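(* Let $m>0$. For each bounded interval $I\subset\mathbb R$ there exists a von Neumann algebra isomorphism $\phi$ between $\mathcal C^{(m)}(O_I)$ and $\mathcal C^{(0)}(O_I)$ such that $\phi(\pi^{(m)}(W(f)))=\pi^{(0)}(W(f))$ for all $f\in\mathcal D(\mathbb R)$ with $\mathrm{supp}f\subset I$ and $\int_If=0$.
   Context: $\mathcal D(\mathbb R)$ is the space of complex-valued compactly supported smooth functions on $\mathbb R$ (as a real vector space); $\hat f(p)=(2\pi)^{-1/2}\int_{\mathbb R}e^{-ipx}f(x)\,dx$. $\mathfrak W$ is the Weyl C*-algebra generated by unitaries $W(f)$, $f\in\mathcal D(\mathbb R)$, with $W(f)W(g)=e^{-\frac i2\sigma(f,g)}W(f+g)$, $\sigma(f,g)=\mathrm{Im}\int_{\mathbb R}\overline fg$. For $m\ge0$ let $\omega_m(p)=\sqrt{p^2+m^2}$ and $\|f\|_m^2=\frac12\int_{\mathbb R}dp\,|\omega_m(p)^{-1/2}\widehat{\mathrm{Re}f}(p)+i\omega_m(p)^{1/2}\widehat{\mathrm{Im}f}(p)|^2$. The vacuum states on $\mathfrak W$ are $\omega^{(m)}(W(f))=e^{-\frac12\|f\|_m^2}$ for $m>0$, and $\omega^{(0)}(W(f))=e^{-\frac12\|f\|_0^2}$ if $\int_{\mathbb R}\mathrm{Re}f=0$, $\omega^{(0)}(W(f))=0$ otherwise; $\pi^{(m)}$, $m\ge0$, denotes the GNS representation of $\omega^{(m)}$. For $m\ge0$, $$\mathcal C^{(m)}(O_I)=\Big\{\pi^{(m)}(W(f)):\mathrm{supp}f\subset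 I,\ \int_If=0\Big\}'' .$$ ($O_I$ denotes the double cone in $\mathbb R^2$ with base $I$ on the time-zero line.) *)

theory Defs
  imports "HOL-Analysis.Analysis"
begin

section \<open>Complex vector spaces, Hilbert spaces and C*-algebras\<close>

class scaleC =
  fixes scaleC :: "complex \<Rightarrow> 'a \<Rightarrow> 'a"  (infixr \<open>*\<^sub>C\<close> 75)

class complex_vector = scaleC + real_vector +
  assumes scaleC_add_right: "a *\<^sub>C (x + y) = a *\<^sub>C x + a *\<^sub>C y"
    and scaleC_add_left: "(a + b) *\<^sub>C x = a *\<^sub>C x + b *\<^sub>C x"
    and scaleC_scaleC: "a *\<^sub>C b *\<^sub>C x = (a * b) *\<^sub>C x"
    and scaleC_complex_of_real: "complex_of_real r *\<^sub>C x = r *\<^sub>R x"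

text \<open>
  The inner product is antilinear in the first argument. Its real part is the library's real
  inner product, so norm, topology and completeness are those of the underlying real
  Hilbert space.
\<close>

class chilbert_space = complex_vector + real_inner + complete_space +
  fixes cinner :: "'a \<Rightarrow> 'a \<Rightarrow> complex"
  assumes cinner_commute: "cinner x y = cnj (cinner y x)"
    and cinner_add_right: "cinner x (y + z) = cinner x y + cinner x z"
    and cinner_scaleC_right: "cinner x (c *\<^sub>C y) = c * cinner x y"
    and Re_cinner: "Re (cinner x y) = inner x y"

text \<open>All C*-algebras here are unital and nonzero.\<close>

class cstar_algebra = complex_vector + real_normed_algebra_1 + banach +
  fixes cstar :: "'a \<Rightarrow> 'a"
  assumes norm_scaleC: "norm (c *\<^sub>C x) = cmod c * norm x"
    and mult_scaleC_left: "(c *\<^sub>C x) * y = c *\<^sub>C (x * y)"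
    and mult_scaleC_right: "x * (c *\<^sub>C y) = c *\<^sub>C (x * y)"
    and cstar_cstar: "cstar (cstar x) = x"
    and cstar_add: "cstar (x + y) = cstar x + cstar y"
    and cstar_scaleC: "cstar (c *\<^sub>C x) = cnj c *\<^sub>C cstar x"
    and cstar_mult: "cstar (x * y) = cstar y * cstar x"
    and norm_cstar_mult_self: "norm (cstar x * x) = (norm x)\<^sup>2"

definition cstar_subalgebra :: "'a::cstar_algebra set \<Rightarrow> bool" where
  "cstar_subalgebra B \<longleftrightarrow> closed B \<and> 1 \<in> B \<and>
     (\<forall>x\<in>B. \<forall>y\<in>B. x + y \<in> B \<and> x * y \<in> B) \<and>
     (\<forall>c. \<forall>x\<in>B. c *\<^sub>C x \<in> B) \<and> (\<forall>x\<in>B. cstar x \<in> B)"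

definition cstar_generated_by :: "'a::cstar_algebra set \<Rightarrow> 'a set" where
  "cstar_generated_by S = \<Inter>{B. cstar_subalgebra B \<and> S \<subseteq> B}"

definition unitary :: "'a::cstar_algebra \<Rightarrow> bool" where
  "unitary u \<longleftrightarrow> cstar u * u = 1 \<and> u * cstar u = 1"

definition state :: "('a::cstar_algebra \<Rightarrow> complex) \<Rightarrow> bool" where
  "state \<omega> \<longleftrightarrow>
     (\<forall>x y. \<omega> (x + y) = \<omega> x + \<omega> y) \<and> (\<forall>c x. \<omega> (c *\<^sub>C x) = c * \<omega> x) \<and>
     (\<forall>x. \<omega> (cstar x * x) \<in> \<real>\<^sub>\<ge>\<^sub>0) \<and> \<omega> 1 = 1"


section \<open>Operators, representations and von Neumann algebras\<close>

definition bounded_operators :: "('h::chilbert_space \<Rightarrow> 'h) set" where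
  "bounded_operators = {T. bounded_linear T \<and> (\<forall>c x. T (c *\<^sub>C x) = c *\<^sub>C T x)}"

definition op_adj :: "('h::chilbert_space \<Rightarrow> 'h) \<Rightarrow> 'h \<Rightarrow> 'h" where
  "op_adj T = (THE S. S \<in> bounded_operators \<and> (\<forall>x y. cinner (S x) y = cinner x (T y)))"

definition commutant :: "('h::chilbert_space \<Rightarrow> 'h) set \<Rightarrow> ('h \<Rightarrow> 'h) set" where
  "commutant M = {S \<in> bounded_operators. \<forall>T\<in>M. S \<circ> T = T \<circ> S}"

definition representation :: "('a::cstar_algebra \<Rightarrow> 'h::chilbert_space \<Rightarrow> 'h) \<Rightarrow> bool" where
  "representation \<pi> \<longleftrightarrow>
     (\<forall>a. \<pi> a \<in> bounded_operators) \<and>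
     (\<forall>a b. \<pi> (a + b) = (\<lambda>x. \<pi> a x + \<pi> b x)) \<and>
     (\<forall>c a. \<pi> (c *\<^sub>C a) = (\<lambda>x. c *\<^sub>C \<pi> a x)) \<and>
     (\<forall>a b. \<pi> (a * b) = \<pi> a \<circ> \<pi> b) \<and>
     (\<forall>a. \<pi> (cstar a) = op_adj (\<pi> a))"

text \<open>The defining property of the GNS triple, which fixes it up to unitary equivalence.\<close>

definition GNS_triple ::
  "('a::cstar_algebra \<Rightarrow> complex) \<Rightarrow> ('a \<Rightarrow> 'h::chilbert_space \<Rightarrow> 'h) \<Rightarrow> 'h \<Rightarrow> bool" where
  "GNS_triple \<omega> \<pi> \<Omega> \<longleftrightarrow> representation \<pi> \<and>
     closure (range (\<lambda>a. \<pi> a \<Omega>)) = UNIV \<and> (\<forall>a. \<omega> a = cinner \<Omega> (\<pi> a \<Omega>))"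

text \<open>
  Isomorphisms of von Neumann algebras are *-isomorphisms; these are automatically unital,
  isometric and normal.
\<close>

definition vN_isomorphism ::
  "(('h::chilbert_space \<Rightarrow> 'h) \<Rightarrow> 'k::chilbert_space \<Rightarrow> 'k) \<Rightarrow>
   ('h \<Rightarrow> 'h) set \<Rightarrow> ('k \<Rightarrow> 'k) set \<Rightarrow> bool" where
  "vN_isomorphism \<phi> M N \<longleftrightarrow> bij_betw \<phi> M N \<and>
     (\<forall>S\<in>M. \<forall>T\<in>M. \<phi> (\<lambda>x. S x + T x) = (\<lambda>x. \<phi> S x + \<phi> T x)) \<and>
     (\<forall>c. \<forall>S\<in>M. \<phi> (\<lambda>x. c *\<^sub>C S x) = (\<lambda>x. c *\<^sub>C \<phi> S x)) \<and>
     (\<forall>S\<in>M. \<forall>T\<in>M. \<phi> (S \<circ> T) = \<phi> S \<circ> \<phi> T) \<and>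
     (\<forall>S\<in>M. \<phi> (op_adj S) = op_adj (\<phi> S))"


section \<open>Test functions and the Weyl algebra\<close>

definition supp :: "(real \<Rightarrow> complex) \<Rightarrow> real set" where
  "supp f = closure {x. f x \<noteq> 0}"

definition smooth :: "(real \<Rightarrow> complex) \<Rightarrow> bool" where
  "smooth f \<longleftrightarrow>
     (\<forall>n x. ((\<lambda>g t. vector_derivative g (at t)) ^^ n) f differentiable (at x))"

definition test_functions :: "(real \<Rightarrow> complex) set"  (\<open>\<D>\<close>) where
  "\<D> = {f. smooth f \<and> compact (supp f)}"

definition fourier :: "(real \<Rightarrow> complex) \<Rightarrow> real \<Rightarrow> complex" where
  "fourier f p = complex_of_real (1 / sqrt (2 * pi)) *
     (LINT x|lborel. exp (- \<i> * complex_of_real (p * x)) * f x)"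

definition symp :: "(real \<Rightarrow> complex) \<Rightarrow> (real \<Rightarrow> complex) \<Rightarrow> real" where
  "symp f g = Im (LINT x|lborel. cnj (f x) * g x)"

text \<open>
  Since the form \<open>symp\<close> is nondegenerate, these conditions determine the pair of the
  C*-algebra and \<open>W\<close> up to isomorphism. Only the values of \<open>W\<close> on \<open>\<D>\<close> matter.
\<close>

definition weyl_algebra :: "((real \<Rightarrow> complex) \<Rightarrow> 'a::cstar_algebra) \<Rightarrow> bool" where
  "weyl_algebra W \<longleftrightarrow>
     (\<forall>f\<in>\<D>. unitary (W f)) \<and>
     (\<forall>f\<in>\<D>. \<forall>g\<in>\<D>. W f * W g =
        exp (- (\<i> / 2) * complex_of_real (symp f g)) *\<^sub>C W (\<lambda>x. f x + g x)) \<and>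
     cstar_generated_by (W ` \<D>) = UNIV"


section \<open>Vacuum states and local algebras\<close>

definition disp :: "real \<Rightarrow> real \<Rightarrow> real" where
  "disp m p = sqrt (p\<^sup>2 + m\<^sup>2)"

text \<open>
  For \<open>m = 0\<close> the integral converges if and only if the integral of \<open>Re f\<close> vanishes; otherwise
  the value (0 by convention) is not used in \<open>vacuum_function\<close>. The convention for the
  power at \<open>m = p = 0\<close> only affects a null set.
\<close>

definition sq_norm :: "real \<Rightarrow> (real \<Rightarrow> complex) \<Rightarrow> real" where
  "sq_norm m f = 1/2 * (LINT p|lborel.
     (cmod (complex_of_real (disp m p powr (-1/2)) * fourier (\<lambda>x. complex_of_real (Re (f x))) p +
       \<i> * complex_of_real (disp m p powr (1/2)) * fourier (\<lambda>x. complex_of_real (Im (f x))) p))\<^sup>2)"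

definition vacuum_function :: "real \<Rightarrow> (real \<Rightarrow> complex) \<Rightarrow> real" where
  "vacuum_function m f =
     (if m = 0 \<and> (LINT x|lborel. Re (f x)) \<noteq> 0 then 0 else exp (- (1/2) * sq_norm m f))"

definition vacuum_state ::
  "((real \<Rightarrow> complex) \<Rightarrow> 'a::cstar_algebra) \<Rightarrow> real \<Rightarrow> ('a \<Rightarrow> complex) \<Rightarrow> bool" where
  "vacuum_state W m \<omega> \<longleftrightarrow>
     state \<omega> \<and> (\<forall>f\<in>\<D>. \<omega> (W f) = complex_of_real (vacuum_function m f))"

text \<open>With \<open>\<pi>\<close> the GNS representation of the vacuum of mass \<open>m\<close>, this is the algebra
  of the double cone with base \<open>I\<close>.\<close>

definition local_algebra ::
  "('a::cstar_algebra \<Rightarrow> 'h::chilbert_space \<Rightarrow> 'h) \<Rightarrow>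
   ((real \<Rightarrow> complex) \<Rightarrow> 'a) \<Rightarrow> real set \<Rightarrow> ('h \<Rightarrow> 'h) set" where
  "local_algebra \<pi> W I = commutant (commutant
     {\<pi> (W f) | f. f \<in> \<D> \<and> supp f \<subseteq> I \<and> (LINT x:I|lborel. f x) = 0})"

end

theory Submission
  imports Defs "HOL-Probability.Probability"
begin

text \<open>
  The two local algebras are compared through intertwiners. Let \<open>V\<close> be the set of test functions that
  generate them, and consider the bounded operators \<open>R\<close> with \<open>R \<circ> \<pi>\<^sub>m (W f) = \<pi>\<^sub>0 (W f) \<circ> R\<close> for
  \<open>f \<in> V\<close>. If their ranges are total, and likewise with the representations exchanged, then
  \<open>S \<circ> R = R \<circ> T\<close> for all such \<open>R\<close> determines an operator \<open>S\<close> for every \<open>T\<close> in the first algebra, and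
  \<open>T \<mapsto> S\<close> is the isomorphism (\<open>vN_isomorphism_of_intertwiners\<close>; the bound of \<open>S\<close> is
  \<open>amplification_bound\<close>).

  Intertwiners are obtained from a positive functional \<open>s\<close> on the Weyl algebra. A vector \<open>x\<close> of a
  representation \<open>\<pi>\<close> is dominated if \<open>\<parallel>\<pi> b x\<parallel>\<^sup>2 \<le> C\<^sup>2 * s (b\<^sup>* b)\<close> for some constant \<open>C\<close> and all \<open>b\<close> in
  the *-algebra generated by the local Weyl operators. Two dominated vectors \<open>x\<close> and \<open>y\<close>, one in each
  representation, give an intertwiner that factors through the GNS space of \<open>s\<close>
  (\<open>dominated_intertwiner\<close>). The ranges of these are total if the dominated vectors of the first
  representation suffice to approximate \<open>s\<close> (\<open>approximable\<close>) and the vacuum of the second is a limit of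
  combinations of dominated vectors, because conjugation with any Weyl operator preserves the set of
  intertwiners (\<open>intertwiners_total\<close>).

  Such functionals are Gaussian mixtures of vector states. Let \<open>h j\<close> be test functions with summable
  energies, and shift the vacuum by \<open>W (\<Sum> \<xi> j h j)\<close> with independent standard normal variables \<open>\<xi> j\<close>. The
  average of the resulting vector states takes the value
  \<open>exp (- (\<parallel>f\<parallel>\<^sup>2 + \<Sum> (symp f (h j))\<^sup>2) / 2)\<close> on \<open>W f\<close> (\<open>mixture_value\<close>), the integrals of the shifted
  vacuum over events are dominated vectors, and there are enough of them
  (\<open>mixture_approximable\<close>, \<open>Omega_in_dominated\<close>).

  It remains to choose shifts for the massless and for the massive vacuum such that the two mixtures
  agree on the local Weyl operators. For this, \<open>sq_norm m f - sq_norm 0 f\<close> is expanded into a series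
  \<open>\<Sum> d j * (symp f (h j))\<^sup>2\<close> with \<open>\<Sum> \<bar>d j\<bar> * sq_norm M (h j) < \<infinity>\<close> for both masses \<open>M\<close>
  (\<open>energy_difference\<close>); the positive weights add noise to the massless vacuum, the negative ones to
  the massive vacuum. Since \<open>Re f\<close> has mean zero, it is the derivative of a test function \<open>U\<close>, and with
  \<open>v = Im f\<close> and \<open>\<omega> = disp m p\<close> the difference is half of the integral of
  \<open>(\<omega> - \<bar>p\<bar>) * \<bar>fourier v p\<bar>\<^sup>2 - (\<bar>p\<bar> - p\<^sup>2 / \<omega>) * \<bar>fourier U p\<bar>\<^sup>2\<close>, where both weights are \<open>O(1/\<bar>p\<bar>)\<close>. As \<open>U\<close> and \<open>v\<close>
  have compact support, Poisson summation turns this into a sum over nodes \<open>q\<close> in an arithmetic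
  progression, with weights \<open>O(1/q)\<close> (\<open>sampled_integral\<close>, \<open>sample_weight_bound\<close>). At a node,
  \<open>\<bar>fourier v q\<bar>\<^sup>2\<close> and \<open>\<bar>fourier U q\<bar>\<^sup>2\<close> are, up to a constant, sums of two
  squares of the symplectic form with shifts formed from localised waves of frequency \<open>q\<close> and amplitude
  \<open>1/q\<close> (\<open>symp_shift\<close>). These shifts have energy \<open>O(1/q)\<close>, so the weighted energies are summable.
\<close>

section \<open>Complex inner products and the Riesz representation\<close>

lemma scaleC_zero_left [simp]: "0 *\<^sub>C (x::'a::complex_vector) = 0"
  using scaleC_complex_of_real[of 0 x] by simp

lemma scaleC_one [simp]: "1 *\<^sub>C (x::'a::complex_vector) = x"
  using scaleC_complex_of_real[of 1 x] by simp

lemma scaleC_zero_right [simp]: "c *\<^sub>C (0::'a::complex_vector) = 0"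
  using scaleC_add_right[of c 0 "0::'a"] by simp

lemma scaleC_minus_left [simp]: "(- c) *\<^sub>C (x::'a::complex_vector) = - (c *\<^sub>C x)"
  using scaleC_add_left[of c "-c" x] by (simp add: eq_neg_iff_add_eq_0 add.commute)

lemma scaleC_minus_right [simp]: "c *\<^sub>C (- x::'a::complex_vector) = - (c *\<^sub>C x)"
  using scaleC_add_right[of c x "-x"] by (simp add: eq_neg_iff_add_eq_0 add.commute)

lemma scaleC_diff_right: "c *\<^sub>C (x - y::'a::complex_vector) = c *\<^sub>C x - c *\<^sub>C y"
  using scaleC_add_right[of c x "-y"] by simp

lemma scaleC_diff_left: "(c - d) *\<^sub>C (x::'a::complex_vector) = c *\<^sub>C x - d *\<^sub>C x"
  using scaleC_add_left[of c "-d" x] by simp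

lemma scaleR_eq_scaleC: "r *\<^sub>R (x::'a::complex_vector) = complex_of_real r *\<^sub>C x"
  by (simp add: scaleC_complex_of_real)

lemma scaleC_commute: "c *\<^sub>C d *\<^sub>C (x::'a::complex_vector) = d *\<^sub>C c *\<^sub>C x"
  by (simp add: scaleC_scaleC mult.commute)

text \<open>
  A positive semidefinite sesquilinear form on a complex vector space, antilinear in the first
  argument. The inner product of a Hilbert space is one; another is \<open>(a, b) \<mapsto> s (a\<^sup>* b)\<close>
  for a positive functional \<open>s\<close> on a *-algebra, where completeness fails.
\<close>

locale semi_cinner =
  fixes H :: "'v::complex_vector \<Rightarrow> 'v \<Rightarrow> complex"
  assumes H_commute: "H x y = cnj (H y x)"
    and H_add_right: "H x (y + z) = H x y + H x z"
    and H_scaleC_right: "H x (c *\<^sub>C y) = c * H x y"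
    and H_nonneg: "0 \<le> Re (H x x)"
begin

lemma H_add_left: "H (x + y) z = H x z + H y z"
  by (metis H_commute H_add_right complex_cnj_add)

lemma H_scaleC_left: "H (c *\<^sub>C x) y = cnj c * H x y"
  by (metis H_commute H_scaleC_right complex_cnj_mult)

lemma H_minus_right: "H x (- y) = - H x y"
  using H_scaleC_right[of x "-1" y] by simp

lemma H_minus_left: "H (- x) y = - H x y"
  using H_scaleC_left[of "-1" x y] by simp

lemma H_diff_right: "H x (y - z) = H x y - H x z"
  using H_add_right[of x y "-z"] by (simp add: H_minus_right)

lemma H_diff_left: "H (x - y) z = H x z - H y z"
  using H_add_left[of x "-y" z] by (simp add: H_minus_left)

lemma H_zero_left [simp]: "H 0 x = 0"
  using H_scaleC_left[of 0 x x] by simp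

lemma H_zero_right [simp]: "H x 0 = 0"
  using H_scaleC_right[of x 0 x] by simp

lemma H_sum_right: "H x (\<Sum>i\<in>A. f i) = (\<Sum>i\<in>A. H x (f i))"
  by (induction A rule: infinite_finite_induct) (auto simp: H_add_right)

lemma H_sum_left: "H (\<Sum>i\<in>A. f i) x = (\<Sum>i\<in>A. H (f i) x)"
  by (induction A rule: infinite_finite_induct) (auto simp: H_add_left)

lemma H_self: "H x x = complex_of_real (Re (H x x))"
proof -
  have "Im (H x x) = - Im (H x x)" using arg_cong[OF H_commute[of x x], of Im] by simp
  thus ?thesis by (simp add: complex_eq_iff)
qed

text \<open>The seminorm of the form.\<close>

definition sn :: "'v \<Rightarrow> real" where "sn x = sqrt (Re (H x x))"

lemma sn_nonneg [simp]: "0 \<le> sn x"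
  by (simp add: sn_def H_nonneg)

lemma sn_sq: "(sn x)\<^sup>2 = Re (H x x)"
  by (simp add: sn_def H_nonneg)

lemma H_self_sn: "H x x = complex_of_real ((sn x)\<^sup>2)"
  using H_self sn_sq by simp

lemma H_cauchy_schwarz: "cmod (H x y) \<le> sn x * sn y"
proof -
  define h where "h = H x y"
  have yx: "H y x = cnj h" using H_commute[of y x] by (simp add: h_def)
  have ineq: "0 \<le> (sn x)\<^sup>2 - 2 * t * (cmod h)\<^sup>2 + t\<^sup>2 * (cmod h)\<^sup>2 * (sn y)\<^sup>2" for t :: real
  proof -
    let ?c = "complex_of_real t * cnj h"
    have "H (x - ?c *\<^sub>C y) (x - ?c *\<^sub>C y) =
        H x x - ?c * h - cnj ?c * cnj h + cnj ?c * ?c * H y y"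
      by (simp add: H_diff_left H_diff_right H_scaleC_left H_scaleC_right yx h_def[symmetric] algebra_simps)
    also have "?c * h = complex_of_real (t * (cmod h)\<^sup>2)"
      using complex_norm_square[of h] by (simp add: mult_ac)
    also have "cnj ?c * cnj h = complex_of_real (t * (cmod h)\<^sup>2)"
      using complex_norm_square[of h] by (simp add: mult.assoc)
    also have "cnj ?c * ?c = complex_of_real (t\<^sup>2 * (cmod h)\<^sup>2)"
      using complex_norm_square[of h] by (simp add: power2_eq_square mult_ac)
    finally have "Re (H (x - ?c *\<^sub>C y) (x - ?c *\<^sub>C y)) =
        (sn x)\<^sup>2 - 2 * t * (cmod h)\<^sup>2 + t\<^sup>2 * (cmod h)\<^sup>2 * (sn y)\<^sup>2"
      unfolding H_self_sn by (simp add: power_mult_distrib)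
    thus ?thesis using H_nonneg by metis
  qed
  show ?thesis
  proof (cases "cmod h = 0")
    case True thus ?thesis by (simp add: h_def[symmetric])
  next
    case False
    hence hp: "(cmod h)\<^sup>2 > 0" by simp
    show ?thesis
    proof (cases "sn y = 0")
      case True
      from ineq[of "((sn x)\<^sup>2 + 1) / (cmod h)\<^sup>2"] True False have "0 \<le> (sn x)\<^sup>2 - 2 * ((sn x)\<^sup>2 + 1)"
        by simp
      then have False using zero_le_power2[of "sn x"] by (smt (verit))
      thus ?thesis ..
    next
      case F: False
      have pos: "(sn y)\<^sup>2 > 0" using F by simp
      have "(1 / (sn y)\<^sup>2)\<^sup>2 * (cmod h)\<^sup>2 * (sn y)\<^sup>2 = (cmod h)\<^sup>2 / (sn y)\<^sup>2"
        using F by (simp add: power2_eq_square)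
      with ineq[of "1 / (sn y)\<^sup>2"] have "(cmod h)\<^sup>2 / (sn y)\<^sup>2 \<le> (sn x)\<^sup>2"
        by simp
      hence "(cmod h)\<^sup>2 \<le> (sn x * sn y)\<^sup>2"
        using pos by (simp add: power_mult_distrib pos_divide_le_eq)
      thus ?thesis using power2_le_imp_le[of "cmod h" "sn x * sn y"] unfolding h_def by simp
    qed
  qed
qed

lemma sn_triangle: "sn (x + y) \<le> sn x + sn y"
proof -
  have "(sn (x + y))\<^sup>2 = (sn x)\<^sup>2 + (sn y)\<^sup>2 + 2 * Re (H x y)"
    using H_commute[of y x] by (simp add: sn_sq H_add_left H_add_right)
  also have "\<dots> \<le> (sn x)\<^sup>2 + (sn y)\<^sup>2 + 2 * (sn x * sn y)"
    using H_cauchy_schwarz[of x y] complex_Re_le_cmod[of "H x y"] by linarith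
  also have "\<dots> = (sn x + sn y)\<^sup>2" by (simp add: power2_eq_square algebra_simps)
  finally show ?thesis by (rule power2_le_imp_le) simp
qed

lemma sn_scaleC: "sn (c *\<^sub>C x) = cmod c * sn x"
proof -
  have "H (c *\<^sub>C x) (c *\<^sub>C x) = complex_of_real ((cmod c)\<^sup>2 * (sn x)\<^sup>2)"
    unfolding of_real_mult complex_norm_square H_self_sn[symmetric]
    by (simp add: H_scaleC_left H_scaleC_right mult_ac)
  hence "(sn (c *\<^sub>C x))\<^sup>2 = (cmod c * sn x)\<^sup>2" by (simp add: sn_sq power_mult_distrib)
  thus ?thesis by (simp add: power2_eq_iff_nonneg)
qed

text \<open>Cauchy sequences for the seminorm; they stand for the elements of the completion.\<close>

definition Hcauchy :: "(nat \<Rightarrow> 'v) \<Rightarrow> bool" where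
  "Hcauchy a \<longleftrightarrow> (\<forall>e>0. \<exists>N. \<forall>m\<ge>N. \<forall>n\<ge>N. sn (a m - a n) < e)"

text \<open>
  The Riesz representation without completeness: a functional that is bounded on a subspace is
  represented by a Cauchy sequence, namely a minimising sequence for
  \<open>H a a / 2 - Re (l a)\<close>.
\<close>

lemma riesz_cauchy:
  assumes V: "\<And>x y. x \<in> V \<Longrightarrow> y \<in> V \<Longrightarrow> x + y \<in> V" "\<And>c x. x \<in> V \<Longrightarrow> c *\<^sub>C x \<in> V" "0 \<in> V"
    and l: "\<And>x y. l (x + y) = l x + l y" "\<And>c x. l (c *\<^sub>C x) = c * l x"
    and bdd: "\<And>x. x \<in> V \<Longrightarrow> cmod (l x) \<le> C * sn x"
  obtains a where "\<And>n. a n \<in> V" "Hcauchy a" "\<And>b. b \<in> V \<Longrightarrow> (\<lambda>n. H (a n) b) \<longlonglongrightarrow> l b"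
proof -
  define J where "J x = (sn x)\<^sup>2 / 2 - Re (l x)" for x
  have J_lower: "J x \<ge> - C\<^sup>2 / 2" if "x \<in> V" for x
  proof -
    have "Re (l x) \<le> C * sn x"
      using bdd[OF that] complex_Re_le_cmod[of "l x"] by linarith
    moreover have "0 \<le> (sn x - C)\<^sup>2" by simp
    ultimately show ?thesis unfolding J_def by (simp add: power2_eq_square algebra_simps)
  qed
  define d where "d = Inf (J ` V)"
  have bddb: "bdd_below (J ` V)" using J_lower by (intro bdd_belowI2[of _ "- C\<^sup>2/2"]) auto
  have dle: "d \<le> J x" if "x \<in> V" for x
    unfolding d_def using that bddb by (intro cInf_lower) auto
  have "\<exists>x\<in>V. J x < d + 1 / real (Suc n)" for n
  proof -
    have "Inf (J ` V) < d + 1 / real (Suc n)" by (simp add: d_def)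
    thus ?thesis using cInf_lessD[of "J ` V"] V(3) by (metis (no_types, lifting) empty_iff imageE image_eqI)
  qed
  then obtain a where aV: "\<And>n. a n \<in> V" and aJ: "\<And>n. J (a n) < d + 1 / real (Suc n)" by metis
  have lR: "l (r *\<^sub>R x) = r * l x" for r x by (simp add: scaleR_eq_scaleC l)
  have ld: "l (x - y) = l x - l y" for x y using l(1)[of x "-y"] l(2)[of "-1" y] by simp
  \<comment> \<open>Parallelogram law: near-minimisers of \<open>J\<close> are close to each other.\<close>
  have par: "(sn (x - y))\<^sup>2 \<le> 4 * (J x - d) + 4 * (J y - d)" if "x \<in> V" "y \<in> V" for x y
  proof -
    let ?z = "complex_of_real (1/2) *\<^sub>C (x + y)"
    have z: "?z \<in> V" using that V by blast
    have 1: "(sn (x + y))\<^sup>2 + (sn (x - y))\<^sup>2 = 2 * (sn x)\<^sup>2 + 2 * (sn y)\<^sup>2"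
      by (simp add: sn_sq H_add_left H_add_right H_diff_left H_diff_right)
    have 2: "(sn ?z)\<^sup>2 = (sn (x + y))\<^sup>2 / 4" unfolding sn_scaleC by (simp add: power_mult_distrib power2_eq_square)
    have "Re (l ?z) = (Re (l x) + Re (l y)) / 2" by (simp add: l)
    hence "8 * J ?z = (sn (x + y))\<^sup>2 - 4 * (Re (l x) + Re (l y))" unfolding J_def 2 by (simp add: field_simps)
    moreover have "8 * d \<le> 8 * J ?z" using dle[OF z] by simp
    ultimately show ?thesis using 1 unfolding J_def by (simp add: field_simps)
  qed
  have C: "Hcauchy a" unfolding Hcauchy_def
  proof (intro allI impI)
    fix e :: real assume e: "e > 0"
    obtain N where N: "8 / e\<^sup>2 < real N" using reals_Archimedean2 by blast
    have "sn (a m - a n) < e" if "m \<ge> N" "n \<ge> N" for m n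
    proof -
      have h: "1 / real (Suc k) < e\<^sup>2 / 8" if "k \<ge> N" for k
      proof -
        have "8 / e\<^sup>2 < real (Suc k)" using N that by linarith
        thus ?thesis using e by (simp add: field_simps)
      qed
      have "(sn (a m - a n))\<^sup>2 \<le> 4 * (J (a m) - d) + 4 * (J (a n) - d)" using par aV by blast
      also have "\<dots> < 4 * (e\<^sup>2/8) + 4 * (e\<^sup>2/8)"
        using aJ[of m] aJ[of n] h[OF that(1)] h[OF that(2)] by (intro add_strict_mono mult_strict_left_mono) linarith+
      finally show ?thesis using e by (simp add: power2_less_imp_less)
    qed
    thus "\<exists>N. \<forall>m\<ge>N. \<forall>n\<ge>N. sn (a m - a n) < e" by blast
  qed
  \<comment> \<open>The real part suffices: replace \<open>b\<close> by \<open>\<i> b\<close> for the imaginary part.\<close>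
  have re: "(\<lambda>n. Re (H (a n) b - l b)) \<longlonglongrightarrow> 0" if b: "b \<in> V" for b
  proof -
    define \<beta> where "\<beta> = (sn b)\<^sup>2 + 1"
    have bp: "\<beta> > 0" "(sn b)\<^sup>2 \<le> \<beta>" unfolding \<beta>_def by (auto simp: add_nonneg_pos)
    have "(Re (H (a n) b - l b))\<^sup>2 \<le> 2 * \<beta> * (1 / real (Suc n))" for n
    proof -
      define \<delta> where "\<delta> = Re (H (a n) b - l b)"
      \<comment> \<open>Vary \<open>a n\<close> in the direction \<open>b\<close>, up to the minimum of the resulting quadratic in \<open>t\<close>.\<close>
      let ?t = "- \<delta> / \<beta>"
      let ?w = "a n + complex_of_real ?t *\<^sub>C b"
      have "?w \<in> V" using V aV b by blast
      hence "d \<le> J ?w" by (rule dle)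
      have *: "(sn (a n + complex_of_real t *\<^sub>C b))\<^sup>2 =
          (sn (a n))\<^sup>2 + 2 * t * Re (H (a n) b) + t\<^sup>2 * (sn b)\<^sup>2" for t
        using H_commute[of b "a n"] unfolding sn_sq
        by (simp add: H_add_left H_add_right H_scaleC_left H_scaleC_right power2_eq_square algebra_simps)
      have "J (a n + complex_of_real t *\<^sub>C b) = J (a n) + t * \<delta> + t\<^sup>2 * (sn b)\<^sup>2 / 2" for t
        unfolding J_def * \<delta>_def by (simp add: l algebra_simps add_divide_distrib diff_divide_distrib)
      from this[of ?t] \<open>d \<le> J ?w\<close> have "d \<le> J (a n) + ?t * \<delta> + ?t\<^sup>2 * (sn b)\<^sup>2 / 2" by simp
      moreover have "?t\<^sup>2 * (sn b)\<^sup>2 / 2 \<le> ?t\<^sup>2 * \<beta> / 2"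
        using bp by (intro divide_right_mono mult_left_mono) auto
      moreover have "?t\<^sup>2 * \<beta> / 2 = \<delta>\<^sup>2 / (2 * \<beta>)" using bp by (simp add: power2_eq_square field_simps)
      moreover have "?t * \<delta> = - 2 * (\<delta>\<^sup>2 / (2 * \<beta>))" using bp by (simp add: power2_eq_square field_simps)
      ultimately have "\<delta>\<^sup>2 / (2 * \<beta>) \<le> 1 / real (Suc n)" using aJ[of n] by linarith
      thus ?thesis using bp unfolding \<delta>_def by (simp add: field_simps)
    qed
    hence "(\<lambda>n. (Re (H (a n) b - l b))\<^sup>2) \<longlonglongrightarrow> 0"
      by (intro tendsto_sandwich[OF _ _ tendsto_const tendsto_mult_right_zero[OF LIMSEQ_Suc[OF lim_1_over_n]]])
         (auto intro!: always_eventually)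
    from tendsto_real_sqrt[OF this] show ?thesis by (simp add: tendsto_rabs_zero_iff)
  qed
  have "(\<lambda>n. H (a n) b) \<longlonglongrightarrow> l b" if b: "b \<in> V" for b
  proof -
    have ib: "\<i> *\<^sub>C b \<in> V" using V b by blast
    have "(\<lambda>n. Im (H (a n) b - l b)) \<longlonglongrightarrow> 0"
      using tendsto_minus[OF re[OF ib]] by (simp add: H_scaleC_right l algebra_simps)
    with re[OF b] have "(\<lambda>n. H (a n) b - l b) \<longlonglongrightarrow> 0"
      by (simp add: tendsto_complex_iff)
    thus ?thesis by (simp add: LIM_zero_iff)
  qed
  with aV C that show ?thesis by blast
qed

end

interpretation cinner: semi_cinner "cinner :: 'h::chilbert_space \<Rightarrow> 'h \<Rightarrow> complex"
  by unfold_locales (auto intro: cinner_commute cinner_add_right cinner_scaleC_right simp: Re_cinner)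

lemma sn_cinner [simp]: "cinner.sn x = norm (x::'h::chilbert_space)"
  by (simp add: cinner.sn_def Re_cinner norm_eq_sqrt_inner)

lemma cinner_self: "cinner x x = complex_of_real ((norm (x::'h::chilbert_space))\<^sup>2)"
  using cinner.H_self_sn[of x] by simp

lemma cmod_cinner_le: "cmod (cinner x y) \<le> norm (x::'h::chilbert_space) * norm y"
  using cinner.H_cauchy_schwarz[of x y] by simp

lemma norm_scaleC_h: "norm (c *\<^sub>C (x::'h::chilbert_space)) = cmod c * norm x"
  using cinner.sn_scaleC[of c x] by simp

lemma cinner_eqI: "(\<And>z. cinner z x = cinner z y) \<Longrightarrow> x = (y::'h::chilbert_space)"
proof -
  assume "\<And>z. cinner z x = cinner z y"
  hence "cinner (x - y) (x - y) = 0" by (simp add: cinner.H_diff_right)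
  thus ?thesis by (simp add: cinner_self)
qed

lemma cinner_eqI': "(\<And>z. cinner x z = cinner y z) \<Longrightarrow> x = (y::'h::chilbert_space)"
  by (rule cinner_eqI) (metis cinner_commute)

lemma bounded_bilinear_cinner: "bounded_bilinear (cinner :: 'h::chilbert_space \<Rightarrow> _)"
  by (rule bounded_bilinear.intro)
     (auto simp: cinner.H_add_left cinner_add_right scaleR_eq_scaleC cinner.H_scaleC_left
        cinner_scaleC_right scaleR_conv_of_real intro!: exI[of _ 1] cmod_cinner_le)

lemmas tendsto_cinner = bounded_bilinear.tendsto[OF bounded_bilinear_cinner]
lemmas continuous_on_cinner = bounded_bilinear.continuous_on[OF bounded_bilinear_cinner]

lemma bounded_linear_scaleC: "bounded_linear ((*\<^sub>C) c :: 'h::chilbert_space \<Rightarrow> 'h)"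
  by (rule bounded_linear_intro[where K="cmod c"])
     (auto simp: scaleC_add_right norm_scaleC_h scaleR_eq_scaleC scaleC_commute mult.commute)

lemmas tendsto_scaleC = bounded_linear.tendsto[OF bounded_linear_scaleC]

lemma Hcauchy_imp_Cauchy:
  "cinner.Hcauchy a \<Longrightarrow> Cauchy (a :: nat \<Rightarrow> 'h::chilbert_space)"
  by (auto simp: cinner.Hcauchy_def Cauchy_def dist_norm)

lemma riesz:
  fixes l :: "'h::chilbert_space \<Rightarrow> complex"
  assumes "\<And>x y. l (x + y) = l x + l y" "\<And>c x. l (c *\<^sub>C x) = c * l x"
    and "\<And>x. cmod (l x) \<le> C * norm x"
  obtains z where "\<And>x. l x = cinner z x"
proof -
  obtain a where "cinner.Hcauchy a" and a: "\<And>b. (\<lambda>n. cinner (a n) b) \<longlonglongrightarrow> l b"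
    using cinner.riesz_cauchy[of UNIV l C] assms by auto
  then obtain z where "a \<longlonglongrightarrow> z"
    using Hcauchy_imp_Cauchy Cauchy_convergent convergent_def by blast
  hence "(\<lambda>n. cinner (a n) b) \<longlonglongrightarrow> cinner z b" for b
    by (intro tendsto_cinner tendsto_const)
  with a that show ?thesis using LIMSEQ_unique by blast
qed


section \<open>Operators between Hilbert spaces\<close>

text \<open>Bounded complex-linear maps between possibly different Hilbert spaces.\<close>

definition cop :: "('h::chilbert_space \<Rightarrow> 'k::chilbert_space) \<Rightarrow> bool" where
  "cop T \<longleftrightarrow> bounded_linear T \<and> (\<forall>c x. T (c *\<^sub>C x) = c *\<^sub>C T x)"

lemma bounded_operators_iff: "T \<in> bounded_operators \<longleftrightarrow> cop T"
  by (simp add: bounded_operators_def cop_def)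

lemma cop_bounded_linear: "cop T \<Longrightarrow> bounded_linear T"
  by (simp add: cop_def)

lemma cop_add: "cop T \<Longrightarrow> T (x + y) = T x + T y"
  by (simp add: cop_def bounded_linear.linear linear_add)

lemma cop_diff: "cop T \<Longrightarrow> T (x - y) = T x - T y"
  by (simp add: cop_def bounded_linear.linear linear_diff)

lemma cop_scaleC: "cop T \<Longrightarrow> T (c *\<^sub>C x) = c *\<^sub>C T x"
  by (simp add: cop_def)

lemma cop_norm: "cop T \<Longrightarrow> norm (T x) \<le> onorm T * norm x"
  by (simp add: cop_def onorm)

lemma cop_onorm_nonneg: "cop T \<Longrightarrow> 0 \<le> onorm T"
  by (simp add: cop_def onorm_pos_le)

lemma cop_tendsto: "cop T \<Longrightarrow> (f \<longlongrightarrow> x) F \<Longrightarrow> ((\<lambda>n. T (f n)) \<longlongrightarrow> T x) F"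
  by (simp add: cop_def bounded_linear.tendsto)

lemma copI:
  assumes "\<And>x y. T (x + y) = T x + T y" "\<And>c x. T (c *\<^sub>C x) = c *\<^sub>C T x"
    and "\<And>x. norm (T x) \<le> K * norm x"
  shows "cop T"
  unfolding cop_def
proof
  show "bounded_linear T"
    by (rule bounded_linear_intro[where K=K]) (use assms in \<open>auto simp: scaleR_eq_scaleC mult.commute\<close>)
qed (use assms in blast)

lemma cop_compose: "cop S \<Longrightarrow> cop T \<Longrightarrow> cop (S \<circ> T)"
  using bounded_linear_compose[of S T] by (auto simp: cop_def o_def)

lemma cop_plus: "cop S \<Longrightarrow> cop T \<Longrightarrow> cop (\<lambda>x. S x + T x)"
  by (auto simp: cop_def bounded_linear_add scaleC_add_right)

lemma cop_cscale: "cop S \<Longrightarrow> cop (\<lambda>x. c *\<^sub>C S x)"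
  using bounded_linear_compose[OF bounded_linear_scaleC, of S c] by (auto simp: cop_def scaleC_commute)

text \<open>The functional \<open>x \<mapsto> cinner y (T x)\<close> is represented by a vector.\<close>

lemma cop_adjoint_ex:
  fixes T :: "'h::chilbert_space \<Rightarrow> 'k::chilbert_space"
  assumes T: "cop T"
  shows "\<exists>S. cop S \<and> (\<forall>y x. cinner (S y) x = cinner y (T x))"
proof -
  have "\<exists>z. \<forall>x. cinner y (T x) = cinner z x" for y
  proof -
    have "cmod (cinner y (T x)) \<le> (norm y * onorm T) * norm x" for x
      using order_trans[OF cmod_cinner_le mult_left_mono[OF cop_norm[OF T] norm_ge_zero]]
      by (simp add: mult.assoc)
    then obtain z where "\<And>x. cinner y (T x) = cinner z x"
      by (rule riesz[rotated 2]) (auto simp: cop_add[OF T] cop_scaleC[OF T] cinner_add_right cinner_scaleC_right)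
    thus ?thesis by blast
  qed
  then obtain S where S: "\<And>y x. cinner y (T x) = cinner (S y) x" by metis
  have "cop S"
  proof (rule copI[where K="onorm T"])
    show "S (x + y) = S x + S y" for x y
      by (rule cinner_eqI') (simp add: cinner.H_add_left S[symmetric])
    show "S (c *\<^sub>C x) = c *\<^sub>C S x" for c x
      by (rule cinner_eqI') (simp add: cinner.H_scaleC_left S[symmetric])
    show "norm (S y) \<le> onorm T * norm y" for y
    proof (cases "S y = 0")
      case False
      have "complex_of_real ((norm (S y))\<^sup>2) = cinner y (T (S y))" by (simp add: S cinner_self)
      hence "(norm (S y))\<^sup>2 = cmod (cinner y (T (S y)))"
        by (metis abs_of_nonneg norm_of_real zero_le_power2)
      also have "\<dots> \<le> norm y * (onorm T * norm (S y))"
        using order_trans[OF cmod_cinner_le mult_left_mono[OF cop_norm[OF T] norm_ge_zero]] .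
      finally show ?thesis using False by (simp add: power2_eq_square mult_ac)
    qed (simp add: cop_onorm_nonneg[OF T])
  qed
  with S show ?thesis by metis
qed

text \<open>The adjoint of an operator between possibly different Hilbert spaces.\<close>

definition adj :: "('h::chilbert_space \<Rightarrow> 'k::chilbert_space) \<Rightarrow> 'k \<Rightarrow> 'h" where
  "adj T = (SOME S. cop S \<and> (\<forall>y x. cinner (S y) x = cinner y (T x)))"

lemma cop_adj: "cop T \<Longrightarrow> cop (adj T)"
  and cinner_adj_left: "cop T \<Longrightarrow> cinner (adj T y) x = cinner y (T x)"
  using someI_ex[OF cop_adjoint_ex[of T]] unfolding adj_def by blast+

lemma cinner_adj_right: "cop T \<Longrightarrow> cinner x (adj T y) = cinner (T x) y"
  by (metis cinner_adj_left cinner_commute)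

lemma adj_unique:
  assumes "cop T" "\<And>y x. cinner (S y) x = cinner y (T x)"
  shows "S = adj T"
  by (rule ext, rule cinner_eqI') (simp add: assms cinner_adj_left)

lemma op_adj_eq_adj: "cop T \<Longrightarrow> op_adj T = adj T"
  unfolding op_adj_def bounded_operators_iff
  by (rule the_equality) (auto simp: cop_adj cinner_adj_left intro: adj_unique)

text \<open>
  A linear relation with dense domain that is bounded is contained in the graph of an operator.
\<close>

lemma operator_of_graph:
  fixes \<Gamma> :: "('h::chilbert_space \<times> 'k::chilbert_space) set"
  assumes add: "\<And>x y x' y'. (x, y) \<in> \<Gamma> \<Longrightarrow> (x', y') \<in> \<Gamma> \<Longrightarrow> (x + x', y + y') \<in> \<Gamma>"
    and scale: "\<And>c x y. (x, y) \<in> \<Gamma> \<Longrightarrow> (c *\<^sub>C x, c *\<^sub>C y) \<in> \<Gamma>"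
    and bound: "\<And>x y. (x, y) \<in> \<Gamma> \<Longrightarrow> norm y \<le> K * norm x"
    and dense: "closure (fst ` \<Gamma>) = UNIV"
  obtains T where "cop T" "\<And>x y. (x, y) \<in> \<Gamma> \<Longrightarrow> T x = y"
proof -
  have K0: "\<exists>K'\<ge>0. \<forall>x y. (x, y) \<in> \<Gamma> \<longrightarrow> norm y \<le> K' * norm x"
    by (intro exI[of _ "max 0 K"]) (auto intro: order_trans[OF bound mult_right_mono])
  then obtain K' where K': "K' \<ge> 0" "\<And>x y. (x, y) \<in> \<Gamma> \<Longrightarrow> norm y \<le> K' * norm x" by blast
  have diff: "(x - x', y - y') \<in> \<Gamma>" if "(x, y) \<in> \<Gamma>" "(x', y') \<in> \<Gamma>" for x y x' y'
    using add[OF that(1) scale[OF that(2), of "-1"]] by simp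
  have ex: "\<exists>xs ys. (\<forall>n. (xs n, ys n) \<in> \<Gamma>) \<and> xs \<longlonglongrightarrow> x" for x
  proof -
    have "x \<in> closure (fst ` \<Gamma>)" using dense by simp
    then obtain xs where xs: "\<And>n. xs n \<in> fst ` \<Gamma>" "xs \<longlonglongrightarrow> x" by (auto simp: closure_sequential)
    from xs(1) have "\<exists>y. (xs n, y) \<in> \<Gamma>" for n by (metis imageE prod.collapse)
    with xs(2) show ?thesis by metis
  qed
  have conv: "\<exists>y. ys \<longlonglongrightarrow> y" if g: "\<And>n. (xs n, ys n) \<in> \<Gamma>" and "xs \<longlonglongrightarrow> x" for xs ys x
  proof -
    have "Cauchy xs" using that(2) by (rule LIMSEQ_imp_Cauchy)
    have "Cauchy ys"
    proof (rule metric_CauchyI)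
      fix e :: real assume e: "0 < e"
      obtain N where N: "\<And>m n. m \<ge> N \<Longrightarrow> n \<ge> N \<Longrightarrow> dist (xs m) (xs n) < e / (K' + 1)"
        using metric_CauchyD[OF \<open>Cauchy xs\<close>, of "e / (K' + 1)"] K'(1) e by auto
      have "dist (ys m) (ys n) < e" if "m \<ge> N" "n \<ge> N" for m n
      proof -
        have "dist (ys m) (ys n) \<le> K' * dist (xs m) (xs n)"
          using K'(2)[OF diff[OF g g]] by (simp add: dist_norm)
        also have "\<dots> \<le> (K' + 1) * dist (xs m) (xs n)" by (intro mult_right_mono) auto
        also have "\<dots> < e" using N[OF that] K'(1) by (simp add: field_simps)
        finally show ?thesis .
      qed
      thus "\<exists>M. \<forall>m\<ge>M. \<forall>n\<ge>M. dist (ys m) (ys n) < e" by blast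
    qed
    thus ?thesis using Cauchy_convergent convergent_def by blast
  qed
  define R where "R x y \<longleftrightarrow> (\<exists>xs ys. (\<forall>n. (xs n, ys n) \<in> \<Gamma>) \<and> xs \<longlonglongrightarrow> x \<and> ys \<longlonglongrightarrow> y)" for x y
  have R_ex: "\<exists>y. R x y" for x unfolding R_def using ex conv by meson
  have R_bound: "norm y \<le> K' * norm x" if "R x y" for x y
  proof -
    obtain xs ys where *: "\<And>n. (xs n, ys n) \<in> \<Gamma>" "xs \<longlonglongrightarrow> x" "ys \<longlonglongrightarrow> y"
      using \<open>R x y\<close> unfolding R_def by blast
    show ?thesis
      by (rule LIMSEQ_le[OF tendsto_norm[OF *(3)] tendsto_mult_left[OF tendsto_norm[OF *(2)]]])
         (use K'(2) *(1) in blast)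
  qed
  have R_add: "R (x + x') (y + y')" if xy: "R x y" "R x' y'" for x y x' y'
  proof -
    obtain xs ys where 1: "\<And>n. (xs n, ys n) \<in> \<Gamma>" "xs \<longlonglongrightarrow> x" "ys \<longlonglongrightarrow> y"
      using \<open>R x y\<close> unfolding R_def by blast
    obtain xs' ys' where 2: "\<And>n. (xs' n, ys' n) \<in> \<Gamma>" "xs' \<longlonglongrightarrow> x'" "ys' \<longlonglongrightarrow> y'"
      using \<open>R x' y'\<close> unfolding R_def by blast
    show ?thesis unfolding R_def
      by (rule exI[of _ "\<lambda>n. xs n + xs' n"], rule exI[of _ "\<lambda>n. ys n + ys' n"])
         (use 1 2 add in \<open>auto intro: tendsto_add\<close>)
  qed
  have R_scale: "R (c *\<^sub>C x) (c *\<^sub>C y)" if xy: "R x y" for c x y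
  proof -
    obtain xs ys where 1: "\<And>n. (xs n, ys n) \<in> \<Gamma>" "xs \<longlonglongrightarrow> x" "ys \<longlonglongrightarrow> y"
      using \<open>R x y\<close> unfolding R_def by blast
    show ?thesis unfolding R_def
      by (rule exI[of _ "\<lambda>n. c *\<^sub>C xs n"], rule exI[of _ "\<lambda>n. c *\<^sub>C ys n"])
         (use 1 scale in \<open>auto intro: tendsto_scaleC\<close>)
  qed
  have R_unique: "y = y'" if "R x y" "R x y'" for x y y'
    using R_bound[OF R_add[OF that(1) R_scale[OF that(2), of "-1"]]] by simp
  obtain T where T: "\<And>x. R x (T x)" using R_ex by metis
  have "cop T"
  proof (rule copI[where K=K'])
    show "T (x + y) = T x + T y" for x y by (rule R_unique[OF T R_add[OF T T]])
    show "T (c *\<^sub>C x) = c *\<^sub>C T x" for c x by (rule R_unique[OF T R_scale[OF T]])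
    show "norm (T x) \<le> K' * norm x" for x by (rule R_bound[OF T])
  qed
  moreover have "T x = y" if "(x, y) \<in> \<Gamma>" for x y
  proof (rule R_unique[OF T])
    show "R x y" unfolding R_def using that by (intro exI[of _ "\<lambda>_. x"] exI[of _ "\<lambda>_. y"]) auto
  qed
  ultimately show ?thesis using that by blast
qed


section \<open>Intertwiners and isomorphisms of von Neumann algebras\<close>

text \<open>The bounded operators that intertwine two families of operators indexed by \<open>V\<close>.\<close>

definition intertwiners ::
  "('i \<Rightarrow> 'h::chilbert_space \<Rightarrow> 'h) \<Rightarrow> ('i \<Rightarrow> 'k::chilbert_space \<Rightarrow> 'k) \<Rightarrow> 'i set \<Rightarrow> ('h \<Rightarrow> 'k) set" where
  "intertwiners U1 U2 V = {R. cop R \<and> (\<forall>f\<in>V. \<forall>x. R (U1 f x) = U2 f (R x))}"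

text \<open>The union of the ranges of a set of operators.\<close>

definition intertwined :: "('h::chilbert_space \<Rightarrow> 'k::chilbert_space) set \<Rightarrow> 'k set" where
  "intertwined E = {R x | R x. R \<in> E}"

lemma cop_eq_on_dense:
  assumes "cop A" "cop B" "\<And>x. x \<in> S \<Longrightarrow> A x = B x" "closure (span S) = UNIV"
  shows "A = B"
proof
  fix x
  have eq: "A x = B x" if "x \<in> span S" for x
    using linear_eq_on[OF _ _ that] assms bounded_linear.linear[OF cop_bounded_linear] by blast
  have "x \<in> closure (span S)" using assms by simp
  then obtain xs where xs: "\<And>n. xs n \<in> span S" "xs \<longlonglongrightarrow> x" by (auto simp: closure_sequential)
  show "A x = B x"
  proof (rule LIMSEQ_unique)
    show "(\<lambda>n. A (xs n)) \<longlonglongrightarrow> A x" using xs(2) assms(1) by (rule cop_tendsto[rotated])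
    show "(\<lambda>n. A (xs n)) \<longlonglongrightarrow> B x" using cop_tendsto[OF assms(2) xs(2)] eq[OF xs(1)] by simp
  qed
qed

text \<open>
  A logarithmically convex sequence that grows at most like \<open>b ^ k\<close> starts with a ratio of at most
  \<open>b\<close>, because its ratios increase.
\<close>

lemma log_convex_growth:
  fixes N :: "nat \<Rightarrow> real"
  assumes nonneg: "\<And>k. 0 \<le> N k" and conv: "\<And>k. (N (Suc k))\<^sup>2 \<le> N k * N (Suc (Suc k))"
    and bound: "\<And>k. N k \<le> K * b ^ k" and b: "0 \<le> b"
  shows "N 1 \<le> b * N 0"
proof (rule ccontr)
  assume "\<not> ?thesis"
  hence gt: "N 1 > b * N 0" by simp
  have N0: "N 0 > 0"
    using conv[of 0] nonneg[of 0] gt by (cases "N 0 = 0") auto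
  define r where "r = N 1 / N 0"
  have r: "r > b" using gt N0 by (simp add: r_def field_simps)
  have step: "N k > 0 \<and> N (Suc k) \<ge> r * N k" for k
  proof (induction k)
    case 0 thus ?case using N0 by (simp add: r_def)
  next
    case (Suc k)
    hence pos: "N (Suc k) > 0" using r b by (meson less_le_trans mult_pos_pos order.strict_trans1)
    have "r * N k * N (Suc k) \<le> N (Suc k) * N (Suc k)" using Suc pos by (intro mult_right_mono) auto
    also have "\<dots> \<le> N k * N (Suc (Suc k))" using conv[of k] by (simp add: power2_eq_square)
    finally have "N k * (r * N (Suc k)) \<le> N k * N (Suc (Suc k))" by (simp add: mult_ac)
    thus ?case using pos Suc by simp
  qed
  have lower: "N k \<ge> r ^ k * N 0" for k
  proof (induction k)
    case (Suc k)
    have "r ^ Suc k * N 0 \<le> r * N k" using Suc r b by (simp add: mult.assoc mult_left_mono)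
    thus ?case using step[of k] by linarith
  qed simp
  have bpos: "b > 0" using bound[of 1] step[of 1] b by (cases "b = 0") auto
  obtain k where k: "(r / b) ^ k > K / N 0"
    using real_arch_pow[of "r/b" "K / N 0"] r bpos by auto
  have "r ^ k * N 0 \<le> K * b ^ k" using lower[of k] bound[of k] by linarith
  hence "(r / b) ^ k \<le> K / N 0" using bpos N0 by (simp add: power_divide field_simps)
  with k show False by simp
qed

text \<open>
  If \<open>T\<close> commutes with all \<open>R\<^sub>i\<^sup>* R\<^sub>j\<close>, then so does its adjoint, since this family is closed under
  adjoints, and \<open>\<Sum> R\<^sub>i x\<^sub>i \<mapsto> \<Sum> R\<^sub>i T x\<^sub>i\<close> increases norms by at most the factor \<open>\<parallel>T\<parallel>\<close>. Indeed
  the norms of \<open>\<Sum> R\<^sub>i (T\<^sup>* T)\<^sup>k x\<^sub>i\<close> are logarithmically convex in \<open>k\<close> and bounded by a multiple of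
  \<open>\<parallel>T\<parallel>\<^sup>2\<^sup>k\<close>, so their first ratio is at most \<open>\<parallel>T\<parallel>\<^sup>2\<close>.
\<close>

lemma amplification_bound:
  fixes R :: "'i \<Rightarrow> 'h::chilbert_space \<Rightarrow> 'k::chilbert_space"
  assumes T: "cop T" and R: "\<And>i. i \<in> A \<Longrightarrow> cop (R i)"
    and comm: "\<And>i j x. i \<in> A \<Longrightarrow> j \<in> A \<Longrightarrow> adj (R i) (R j (T x)) = T (adj (R i) (R j x))"
  shows "norm (\<Sum>i\<in>A. R i (T (x i))) \<le> onorm T * norm (\<Sum>i\<in>A. R i (x i))"
proof -
  define t where "t = onorm T"
  have t0: "t \<ge> 0" using cop_onorm_nonneg[OF T] by (simp add: t_def)
  define B where "B = adj T \<circ> T"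
  have cB: "cop B" unfolding B_def by (intro cop_compose cop_adj T)
  have comm': "adj (R i) (R j (adj T y)) = adj T (adj (R i) (R j y))" if "i \<in> A" "j \<in> A" for i j y
  proof (rule cinner_eqI')
    fix z
    have "cinner (adj (R i) (R j (adj T y))) z = cinner (adj T y) (adj (R j) (R i z))"
      by (simp add: cinner_adj_left cinner_adj_right R that)
    also have "\<dots> = cinner y (adj (R j) (R i (T z)))" by (simp add: cinner_adj_left T comm that)
    also have "\<dots> = cinner (adj (R i) (R j y)) (T z)"
      by (simp add: cinner_adj_left cinner_adj_right R that)
    also have "\<dots> = cinner (adj T (adj (R i) (R j y))) z" by (simp add: cinner_adj_left T)
    finally show "cinner (adj (R i) (R j (adj T y))) z = cinner (adj T (adj (R i) (R j y))) z" .
  qed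
  have Bmove: "cinner (R i x) (R j (B y)) = cinner (R i (B x)) (R j y)" if ij: "i \<in> A" "j \<in> A" for i j x y
  proof -
    have "cinner (R i x) (R j (B y)) = cinner x (adj (R i) (R j (adj T (T y))))"
      by (simp add: B_def cinner_adj_right R ij)
    also have "\<dots> = cinner (T x) (adj (R i) (R j (T y)))"
      by (simp add: comm' ij cinner_adj_right T)
    also have "\<dots> = cinner (B x) (adj (R i) (R j y))"
      by (simp add: comm ij B_def cinner_adj_left T)
    finally show ?thesis by (simp add: cinner_adj_right R ij)
  qed
  define G where "G u w = cinner (\<Sum>i\<in>A. R i (u i)) (\<Sum>j\<in>A. R j (w j))" for u w
  have GB: "G u (\<lambda>j. B (w j)) = G (\<lambda>i. B (u i)) w" for u w
    unfolding G_def cinner.H_sum_left cinner.H_sum_right by (intro sum.cong refl Bmove)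
  define N where "N k = norm (\<Sum>i\<in>A. R i ((B ^^ k) (x i)))" for k
  have GN: "cmod (G (\<lambda>i. (B ^^ k) (x i)) (\<lambda>i. (B ^^ l) (x i))) \<le> N k * N l" for k l
    unfolding G_def N_def by (rule cmod_cinner_le)
  have normB: "norm (B y) \<le> t\<^sup>2 * norm y" for y
  proof (cases "B y = 0")
    case False
    have "(norm (B y))\<^sup>2 = Re (cinner (B y) (B y))" by (simp add: cinner_self)
    also have "\<dots> = Re (cinner (T (B y)) (T y))" by (simp add: B_def cinner_adj_right T)
    also have "\<dots> \<le> norm (T (B y)) * norm (T y)"
      by (rule order_trans[OF complex_Re_le_cmod cmod_cinner_le])
    also have "\<dots> \<le> (t * norm (B y)) * (t * norm y)"
      unfolding t_def by (intro mult_mono cop_norm T) (auto simp: cop_onorm_nonneg T)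
    finally have "norm (B y) * norm (B y) \<le> norm (B y) * (t\<^sup>2 * norm y)"
      by (simp add: power2_eq_square mult_ac)
    thus ?thesis using False by simp
  qed (simp)
  have normBk: "norm ((B ^^ k) y) \<le> (t\<^sup>2) ^ k * norm y" for k y
  proof (induction k)
    case (Suc k)
    have "norm ((B ^^ Suc k) y) \<le> t\<^sup>2 * norm ((B ^^ k) y)" using normB by simp
    also have "\<dots> \<le> t\<^sup>2 * ((t\<^sup>2) ^ k * norm y)" using Suc by (intro mult_left_mono) auto
    finally show ?case by (simp add: mult.assoc)
  qed simp
  have N1: "N 1 \<le> t\<^sup>2 * N 0"
  proof (rule log_convex_growth)
    show "0 \<le> N k" for k by (simp add: N_def)
    show "(N (Suc k))\<^sup>2 \<le> N k * N (Suc (Suc k))" for k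
    proof -
      have "complex_of_real ((N (Suc k))\<^sup>2) = G (\<lambda>i. (B ^^ Suc k) (x i)) (\<lambda>i. (B ^^ Suc k) (x i))"
        by (simp add: G_def N_def cinner_self)
      also have "\<dots> = G (\<lambda>i. (B ^^ k) (x i)) (\<lambda>i. (B ^^ Suc (Suc k)) (x i))"
        using GB[of "\<lambda>i. (B ^^ k) (x i)" "\<lambda>i. (B ^^ Suc k) (x i)"] by simp
      finally have "cmod (complex_of_real ((N (Suc k))\<^sup>2)) \<le> N k * N (Suc (Suc k))"
        using GN[of k "Suc (Suc k)"] by (simp only:)
      thus ?thesis unfolding norm_of_real by simp
    qed
    show "N k \<le> (\<Sum>i\<in>A. onorm (R i) * norm (x i)) * (t\<^sup>2) ^ k" for k
    proof -
      have "N k \<le> (\<Sum>i\<in>A. norm (R i ((B ^^ k) (x i))))" unfolding N_def by (rule norm_sum)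
      also have "\<dots> \<le> (\<Sum>i\<in>A. onorm (R i) * ((t\<^sup>2) ^ k * norm (x i)))"
        by (intro sum_mono order_trans[OF cop_norm[OF R] mult_left_mono[OF normBk]])
           (auto simp: R cop_onorm_nonneg)
      finally show ?thesis by (simp add: sum_distrib_left sum_distrib_right mult_ac)
    qed
  qed simp
  have "complex_of_real ((norm (\<Sum>i\<in>A. R i (T (x i))))\<^sup>2) = G (\<lambda>i. x i) (\<lambda>i. B (x i))"
  proof -
    have "cinner (R i (T u)) (R j (T w)) = cinner (R i u) (R j (B w))" if ij: "i \<in> A" "j \<in> A" for i j u w
      using comm'[OF ij, of "T w"]
      by (simp add: B_def R ij T cinner_adj_right[symmetric] flip: cinner_adj_right[OF R[OF ij(1)]])
    thus ?thesis unfolding G_def cinner_self[symmetric] cinner.H_sum_left cinner.H_sum_right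
      by (intro sum.cong refl)
  qed
  moreover have "cmod (G (\<lambda>i. x i) (\<lambda>i. B (x i))) \<le> N 0 * N 1" using GN[of 0 1] by simp
  ultimately have "cmod (complex_of_real ((norm (\<Sum>i\<in>A. R i (T (x i))))\<^sup>2)) \<le> N 0 * N 1" by (simp only:)
  hence "(norm (\<Sum>i\<in>A. R i (T (x i))))\<^sup>2 \<le> N 0 * N 1" unfolding norm_of_real by simp
  also have "\<dots> \<le> N 0 * (t\<^sup>2 * N 0)" using N1 by (intro mult_left_mono) (auto simp: N_def)
  also have "\<dots> = (t * N 0)\<^sup>2" by (simp add: power2_eq_square)
  finally have "norm (\<Sum>i\<in>A. R i (T (x i))) \<le> t * N 0"
    by (rule power2_le_imp_le) (simp add: t0 N_def)
  thus ?thesis by (simp add: N_def t_def)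
qed

text \<open>
  Two families of operators with a common index set that is closed under adjoints, such that the
  ranges of the intertwiners are total in both directions.
\<close>

locale intertwined_systems =
  fixes U1 :: "'i \<Rightarrow> 'h::chilbert_space \<Rightarrow> 'h" and U2 :: "'i \<Rightarrow> 'k::chilbert_space \<Rightarrow> 'k" and V :: "'i set"
  assumes cop1: "\<And>f. f \<in> V \<Longrightarrow> cop (U1 f)" and cop2: "\<And>f. f \<in> V \<Longrightarrow> cop (U2 f)"
    and star: "\<And>f. f \<in> V \<Longrightarrow> \<exists>g\<in>V. U1 g = adj (U1 f) \<and> U2 g = adj (U2 f)"
    and total12: "closure (span (intertwined (intertwiners U1 U2 V))) = UNIV"
    and total21: "closure (span (intertwined (intertwiners U2 U1 V))) = UNIV"
begin

lemma sym: "intertwined_systems U2 U1 V"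
  using cop1 cop2 star total12 total21 by unfold_locales blast+

abbreviation "vN1 \<equiv> commutant (commutant (U1 ` V))"
abbreviation "vN2 \<equiv> commutant (commutant (U2 ` V))"

lemma adj_intertwiner:
  assumes "R \<in> intertwiners U1 U2 V"
  shows "adj R \<in> intertwiners U2 U1 V"
proof -
  have R: "cop R" and RU: "\<And>f x. f \<in> V \<Longrightarrow> R (U1 f x) = U2 f (R x)"
    using assms by (auto simp: intertwiners_def)
  have "adj R (U2 f x) = U1 f (adj R x)" if f: "f \<in> V" for f x
  proof (rule cinner_eqI)
    fix z
    obtain g where g: "g \<in> V" "U1 g = adj (U1 f)" "U2 g = adj (U2 f)" using star[OF f] by blast
    have "cinner z (adj R (U2 f x)) = cinner (U2 g (R z)) x"
      by (simp add: cinner_adj_right R g cinner_adj_left cop2 f)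
    also have "\<dots> = cinner (R (U1 g z)) x" by (simp add: RU g(1))
    also have "\<dots> = cinner z (U1 f (adj R x))"
      by (simp add: g cinner_adj_left cop1 f cinner_adj_right[symmetric] R)
    finally show "cinner z (adj R (U2 f x)) = cinner z (U1 f (adj R x))" .
  qed
  thus ?thesis using R by (simp add: intertwiners_def cop_adj)
qed

lemma intertwiner_comp_commutant:
  assumes "R \<in> intertwiners U1 U2 V" "R' \<in> intertwiners U2 U1 V"
  shows "R' \<circ> R \<in> commutant (U1 ` V)"
  using assms unfolding intertwiners_def commutant_def bounded_operators_iff
  by (auto intro: cop_compose)

text \<open>\<open>transports T S\<close>: the pair acts consistently on all intertwiners.\<close>

definition transports :: "('h \<Rightarrow> 'h) \<Rightarrow> ('k \<Rightarrow> 'k) \<Rightarrow> bool" where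
  "transports T S \<longleftrightarrow> cop S \<and> (\<forall>R\<in>intertwiners U1 U2 V. \<forall>x. S (R x) = R (T x))"

lemma transports_unique: "transports T S \<Longrightarrow> transports T S' \<Longrightarrow> S = S'"
  by (rule cop_eq_on_dense[OF _ _ _ total12]) (auto simp: transports_def intertwined_def)

text \<open>
  The assignment \<open>R x \<mapsto> R (T x)\<close> extends to an operator by \<open>amplification_bound\<close>, because \<open>T\<close>
  commutes with the elements \<open>R'\<^sup>* R\<close> of the commutant.
\<close>

lemma transports_ex:
  assumes T: "T \<in> vN1"
  shows "\<exists>S\<in>vN2. transports T S"
proof -
  have cT: "cop T" using T by (simp add: commutant_def bounded_operators_iff)
  have Tcomm: "T (Y x) = Y (T x)" if "Y \<in> commutant (U1 ` V)" for Y x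
    using T that by (auto simp: commutant_def fun_eq_iff)
  let ?E = "intertwiners U1 U2 V"
  define S0 where "S0 = {(R x, R (T x)) | R x. R \<in> ?E}"
  have scale: "(c *\<^sub>C x, c *\<^sub>C y) \<in> span S0" if "(x, y) \<in> span S0" for c x y
  proof -
    have lin: "linear (\<lambda>p. (c *\<^sub>C fst p, c *\<^sub>C snd (p :: 'k \<times> 'k)))"
      by (rule linearI) (auto simp: scaleC_add_right scaleR_eq_scaleC scaleC_commute)
    have "(\<lambda>p. (c *\<^sub>C fst p, c *\<^sub>C snd p)) ` S0 \<subseteq> S0"
    proof
      fix q assume "q \<in> (\<lambda>p. (c *\<^sub>C fst p, c *\<^sub>C snd p)) ` S0"
      then obtain R x where R: "R \<in> ?E" and q: "q = (c *\<^sub>C R x, c *\<^sub>C R (T x))" by (auto simp: S0_def)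
      have "cop R" using R by (simp add: intertwiners_def)
      hence "q = (R (c *\<^sub>C x), R (T (c *\<^sub>C x)))" by (simp add: q cop_scaleC cT)
      thus "q \<in> S0" using R unfolding S0_def by blast
    qed
    hence "span ((\<lambda>p. (c *\<^sub>C fst p, c *\<^sub>C snd p)) ` S0) \<subseteq> span S0" by (rule span_mono)
    moreover have "(c *\<^sub>C x, c *\<^sub>C y) \<in> (\<lambda>p. (c *\<^sub>C fst p, c *\<^sub>C snd p)) ` span S0"
      using that by force
    ultimately show ?thesis using linear_span_image[OF lin] by auto
  qed
  have bound: "norm y \<le> onorm T * norm x" if "(x, y) \<in> span S0" for x y
  proof -
    from that obtain t r where t: "finite t" "t \<subseteq> S0" and xy: "(x, y) = (\<Sum>p\<in>t. r p *\<^sub>R p)"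
      unfolding span_explicit by blast
    have "\<forall>p\<in>t. \<exists>R z. R \<in> ?E \<and> p = (R z, R (T z))" using t(2) unfolding S0_def by blast
    then obtain R z where Rz: "\<And>p. p \<in> t \<Longrightarrow> R p \<in> ?E" "\<And>p. p \<in> t \<Longrightarrow> p = (R p (z p), R p (T (z p)))"
      by metis
    have cR: "cop (R p)" if "p \<in> t" for p using Rz(1)[OF that] by (simp add: intertwiners_def)
    have f: "fst p = R p (z p)" "snd p = R p (T (z p))" if "p \<in> t" for p
      using arg_cong[OF Rz(2)[OF that], of fst] arg_cong[OF Rz(2)[OF that], of snd] by simp_all
    have x: "x = (\<Sum>p\<in>t. R p (complex_of_real (r p) *\<^sub>C z p))"
      using arg_cong[OF xy, of fst] by (simp add: fst_sum f scaleR_eq_scaleC cop_scaleC cR)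
    have y: "y = (\<Sum>p\<in>t. R p (T (complex_of_real (r p) *\<^sub>C z p)))"
      using arg_cong[OF xy, of snd] by (simp add: snd_sum f scaleR_eq_scaleC cop_scaleC cR cT)
    show ?thesis unfolding x y
    proof (rule amplification_bound[OF cT cR])
      fix i j u assume ij: "i \<in> t" "j \<in> t"
      show "adj (R i) (R j (T u)) = T (adj (R i) (R j u))"
        using Tcomm[OF intertwiner_comp_commutant[OF Rz(1)[OF ij(2)] adj_intertwiner[OF Rz(1)[OF ij(1)]]]]
        by simp
    qed
  qed
  have dense: "closure (fst ` span S0) = UNIV"
  proof -
    have "fst ` S0 = intertwined ?E" unfolding S0_def intertwined_def by force
    moreover have "fst ` span S0 = span (fst ` S0)"
      by (rule linear_span_image[symmetric]) (auto intro: linearI)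
    ultimately show ?thesis using total12 by simp
  qed
  obtain S where S: "cop S" "\<And>x y. (x, y) \<in> span S0 \<Longrightarrow> S x = y"
    by (rule operator_of_graph[of "span S0" "onorm T"])
       (use scale bound dense in \<open>auto dest: span_add simp del: span_add\<close>)
  have tr: "transports T S" unfolding transports_def
    using S S0_def by (auto intro!: S(2) span_base)
  have "S \<in> vN2"
  proof -
    have "S (Y x) = Y (S x)" if Y: "Y \<in> commutant (U2 ` V)" for Y x
    proof -
      have cY: "cop Y" using Y by (simp add: commutant_def bounded_operators_iff)
      have "S \<circ> Y = Y \<circ> S"
      proof (rule cop_eq_on_dense[OF _ _ _ total12])
        fix x assume "x \<in> intertwined ?E"
        then obtain R z where R: "R \<in> ?E" "x = R z" unfolding intertwined_def by blast
        have "Y \<circ> R \<in> ?E" using R Y cY unfolding intertwiners_def commutant_def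
          by (auto simp: fun_eq_iff intro: cop_compose)
        hence "S ((Y \<circ> R) z) = (Y \<circ> R) (T z)" using tr unfolding transports_def by blast
        thus "(S \<circ> Y) x = (Y \<circ> S) x" using R tr unfolding transports_def by simp
      qed (auto intro: cop_compose S cY)
      thus ?thesis by (simp add: fun_eq_iff)
    qed
    thus ?thesis using S(1) unfolding commutant_def[of "commutant (U2 ` V)"] bounded_operators_iff
      by (auto simp: fun_eq_iff)
  qed
  with tr show ?thesis by blast
qed

lemma transports_inverse:
  assumes T: "T \<in> vN1" and tr: "transports T S" and R': "R' \<in> intertwiners U2 U1 V"
  shows "T (R' x) = R' (S x)"
proof -
  have cT: "cop T" using T by (simp add: commutant_def bounded_operators_iff)
  have "T \<circ> R' = R' \<circ> S"
  proof (rule cop_eq_on_dense[OF _ _ _ total12])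
    fix x assume "x \<in> intertwined (intertwiners U1 U2 V)"
    then obtain R z where R: "R \<in> intertwiners U1 U2 V" "x = R z" unfolding intertwined_def by blast
    have "T ((R' \<circ> R) z) = (R' \<circ> R) (T z)"
      using T intertwiner_comp_commutant[OF R(1) R'] by (auto simp: commutant_def[of "commutant _"] fun_eq_iff)
    thus "(T \<circ> R') x = (R' \<circ> S) x" using tr R by (simp add: transports_def)
  qed (use cT R' tr in \<open>auto intro: cop_compose simp: intertwiners_def transports_def\<close>)
  thus ?thesis by (simp add: fun_eq_iff)
qed

end

text \<open>
  Two *-closed families of operators with enough intertwiners in both directions generate
  isomorphic von Neumann algebras.
\<close>

theorem (in intertwined_systems) vN_isomorphism_of_intertwiners:
  "\<exists>\<phi>. vN_isomorphism \<phi> vN1 vN2 \<and> (\<forall>f\<in>V. \<phi> (U1 f) = U2 f)"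
proof -
  interpret rev: intertwined_systems U2 U1 V by (rule sym)
  define \<phi> where "\<phi> T = (THE S. transports T S)" for T
  have \<phi>_eq: "\<phi> T = S" if "transports T S" for T S
    unfolding \<phi>_def using that transports_unique by blast
  have \<phi>: "transports T (\<phi> T)" "\<phi> T \<in> vN2" if "T \<in> vN1" for T
    using transports_ex[OF that] \<phi>_eq by metis+
  have cop_vN1: "cop T" if "T \<in> vN1" for T using that by (simp add: commutant_def bounded_operators_iff)
  have rev_tr: "rev.transports (\<phi> T) T" if "T \<in> vN1" for T
    using transports_inverse[OF that \<phi>(1)[OF that]] cop_vN1[OF that] by (simp add: rev.transports_def)
  have inj: "inj_on \<phi> vN1"
    by (rule inj_onI) (metis rev_tr rev.transports_unique)
  have surj: "\<phi> ` vN1 = vN2"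
  proof (intro equalityI subsetI)
    fix S assume S: "S \<in> vN2"
    obtain T where T: "T \<in> vN1" "rev.transports S T" using rev.transports_ex[OF S] by blast
    have "cop S" using S by (simp add: commutant_def bounded_operators_iff)
    hence "transports T S" using rev.transports_inverse[OF S T(2)] by (simp add: transports_def)
    thus "S \<in> \<phi> ` vN1" using T(1) \<phi>_eq by blast
  qed (use \<phi> in blast)
  have trD: "cop (\<phi> T)" "\<And>R x. R \<in> intertwiners U1 U2 V \<Longrightarrow> \<phi> T (R x) = R (T x)" if "T \<in> vN1" for T
    using \<phi>(1)[OF that] by (auto simp: transports_def)
  have add: "\<phi> (\<lambda>x. S x + T x) = (\<lambda>x. \<phi> S x + \<phi> T x)" if "S \<in> vN1" "T \<in> vN1" for S T
    by (rule \<phi>_eq) (auto simp: transports_def intro: cop_plus trD that,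
        auto simp: trD that intertwiners_def cop_add)
  have cscale: "\<phi> (\<lambda>x. c *\<^sub>C S x) = (\<lambda>x. c *\<^sub>C \<phi> S x)" if "S \<in> vN1" for c S
    by (rule \<phi>_eq) (auto simp: transports_def intro: cop_cscale trD that,
        auto simp: trD that intertwiners_def cop_scaleC)
  have mult: "\<phi> (S \<circ> T) = \<phi> S \<circ> \<phi> T" if "S \<in> vN1" "T \<in> vN1" for S T
    by (rule \<phi>_eq) (auto simp: transports_def trD that intro: cop_compose trD that)
  have star': "\<phi> (op_adj S) = op_adj (\<phi> S)" if S: "S \<in> vN1" for S
    unfolding op_adj_eq_adj[OF cop_vN1[OF S]] op_adj_eq_adj[OF trD(1)[OF S]]
  proof (rule \<phi>_eq, unfold transports_def, intro conjI ballI allI)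
    show "cop (adj (\<phi> S))" by (intro cop_adj trD S)
    fix R x assume R: "R \<in> intertwiners U1 U2 V"
    hence cR: "cop R" by (simp add: intertwiners_def)
    show "adj (\<phi> S) (R x) = R (adj S x)"
    proof (rule cinner_eqI)
      fix z
      have "cinner z (adj (\<phi> S) (R x)) = cinner (adj R (\<phi> S z)) x"
        by (simp add: cinner_adj_right cinner_adj_left trD S cR)
      also have "\<dots> = cinner (S (adj R z)) x"
        using transports_inverse[OF S \<phi>(1)[OF S] adj_intertwiner[OF R]] by simp
      also have "\<dots> = cinner z (R (adj S x))"
        by (simp add: cinner_adj_right[symmetric] cinner_adj_left cop_vN1 S cR)
      finally show "cinner z (adj (\<phi> S) (R x)) = cinner z (R (adj S x))" .
    qed
  qed
  have "\<phi> (U1 f) = U2 f" if "f \<in> V" for f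
    by (rule \<phi>_eq) (use that cop2 in \<open>auto simp: transports_def intertwiners_def\<close>)
  moreover have "vN_isomorphism \<phi> vN1 vN2"
    unfolding vN_isomorphism_def bij_betw_def using inj surj add cscale mult star' by blast
  ultimately show ?thesis by blast
qed


section \<open>Representations of C*-algebras\<close>

lemma subspace_closure:
  fixes S :: "'v::real_normed_vector set"
  assumes S: "subspace S"
  shows "subspace (closure S)"
proof (rule subspaceI)
  show "0 \<in> closure S" using subspace_0[OF S] closure_subset by blast
  show "x + y \<in> closure S" if xy: "x \<in> closure S" "y \<in> closure S" for x y
  proof -
    obtain f g where "\<And>n. f n \<in> S" "f \<longlonglongrightarrow> x" "\<And>n. g n \<in> S" "g \<longlonglongrightarrow> y"
      using xy by (auto simp: closure_sequential)
    thus ?thesis unfolding closure_sequential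
      by (intro exI[of _ "\<lambda>n. f n + g n"]) (auto intro: tendsto_add subspace_add[OF S])
  qed
  show "c *\<^sub>R x \<in> closure S" if x: "x \<in> closure S" for c x
  proof -
    obtain f where "\<And>n. f n \<in> S" "f \<longlonglongrightarrow> x" using x by (auto simp: closure_sequential)
    thus ?thesis unfolding closure_sequential
      by (intro exI[of _ "\<lambda>n. c *\<^sub>R f n"]) (auto intro: tendsto_scaleR subspace_scale[OF S])
  qed
qed

lemma cstar_zero [simp]: "cstar (0::'a::cstar_algebra) = 0"
  using cstar_scaleC[of 0 0] by simp

lemma cstar_one [simp]: "cstar (1::'a::cstar_algebra) = 1"
  by (metis cstar_cstar cstar_mult mult_1 mult_1_right)

lemma cstar_minus: "cstar (- x::'a::cstar_algebra) = - cstar x"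
  using cstar_scaleC[of "-1" x] by simp

lemma cstar_diff: "cstar (x - y::'a::cstar_algebra) = cstar x - cstar y"
  using cstar_add[of x "-y"] by (simp add: cstar_minus)

lemma norm_cstar: "norm (cstar x) = norm (x::'a::cstar_algebra)"
proof -
  have le: "norm y \<le> norm (cstar y)" for y :: 'a
  proof (cases "y = 0")
    case False
    have "norm y * norm y \<le> norm (cstar y) * norm y"
      using norm_mult_ineq[of "cstar y" y] by (simp add: norm_cstar_mult_self power2_eq_square)
    thus ?thesis using False by simp
  qed simp
  show ?thesis using le[of x] le[of "cstar x"] by (simp add: cstar_cstar)
qed

lemma neumann_left_inverse:
  fixes c :: "'a::{real_normed_algebra_1,banach}"
  assumes "norm c < 1"
  shows "\<exists>b. b * (1 - c) = 1"
proof -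
  have sm: "summable (\<lambda>n. c ^ n)"
  proof (rule summable_comparison_test')
    show "summable (\<lambda>n. norm c ^ n)" using assms by (intro summable_geometric) auto
    show "norm (c ^ n) \<le> norm c ^ n" for n by (rule norm_power_ineq)
  qed
  have "(\<lambda>n. c ^ n * (1 - c)) sums (suminf (\<lambda>n. c ^ n) * (1 - c))"
    by (rule sums_mult2[OF summable_sums[OF sm]])
  moreover have "(\<lambda>n. c ^ n * (1 - c)) = (\<lambda>n. c ^ n - c ^ Suc n)"
    by (simp add: algebra_simps power_commutes)
  moreover have "(\<lambda>n. c ^ n - c ^ Suc n) sums (c ^ 0 - 0)"
    by (rule telescope_sums'[OF summable_LIMSEQ_zero[OF sm]])
  ultimately show ?thesis using sums_unique2 by (metis diff_zero power_0)
qed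

lemma representation_cop: "representation \<pi> \<Longrightarrow> cop (\<pi> a)"
  by (simp add: representation_def flip: bounded_operators_iff)

lemma representation_add: "representation \<pi> \<Longrightarrow> \<pi> (a + b) x = \<pi> a x + \<pi> b x"
  by (simp add: representation_def)

lemma representation_scaleC: "representation \<pi> \<Longrightarrow> \<pi> (c *\<^sub>C a) x = c *\<^sub>C \<pi> a x"
  by (simp add: representation_def)

lemma representation_mult: "representation \<pi> \<Longrightarrow> \<pi> (a * b) x = \<pi> a (\<pi> b x)"
  by (simp add: representation_def)

lemma representation_cstar: "representation \<pi> \<Longrightarrow> \<pi> (cstar a) = adj (\<pi> a)"
  by (metis representation_def op_adj_eq_adj representation_cop)

lemma representation_minus: "representation \<pi> \<Longrightarrow> \<pi> (- a) x = - \<pi> a x"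
  using representation_scaleC[of \<pi> "-1" a x] by simp

lemma representation_diff: "representation \<pi> \<Longrightarrow> \<pi> (a - b) x = \<pi> a x - \<pi> b x"
  using representation_add[of \<pi> a "-b" x] by (simp add: representation_minus)

lemma representation_zero: "representation \<pi> \<Longrightarrow> \<pi> 0 x = 0"
  using representation_diff[of \<pi> 0 0 x] by simp

lemma representation_sum:
  "representation \<pi> \<Longrightarrow> \<pi> (\<Sum>i\<in>A. f i) x = (\<Sum>i\<in>A. \<pi> (f i) x)"
  by (induction A rule: infinite_finite_induct) (auto simp: representation_zero representation_add)

lemma cinner_rep_left: "representation \<pi> \<Longrightarrow> cinner (\<pi> a x) y = cinner x (\<pi> (cstar a) y)"
  by (simp add: representation_cstar cinner_adj_right representation_cop)

lemma cinner_rep_right: "representation \<pi> \<Longrightarrow> cinner x (\<pi> a y) = cinner (\<pi> (cstar a) x) y"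
  by (simp add: representation_cstar cinner_adj_left representation_cop)

text \<open>
  Unital representations are contractive. If the norm of \<open>A = \<pi> a\<close> exceeded that of \<open>a\<close>, then
  \<open>m = \<parallel>A\<parallel>\<^sup>2\<close> would be outside the spectrum of \<open>a\<^sup>* a\<close>, so that \<open>m - A\<^sup>* A\<close> would be bounded
  below; but this contradicts the definition of the norm.
\<close>

lemma representation_contractive:
  assumes rep: "representation \<pi>" and unital: "\<And>x. \<pi> 1 x = x"
  shows "norm (\<pi> a x) \<le> norm a * norm x"
proof -
  define A where "A = \<pi> a"
  have A: "cop A" unfolding A_def by (rule representation_cop[OF rep])
  define t where "t = onorm A"
  have "t \<le> norm a"
  proof (rule ccontr)
    assume "\<not> ?thesis"
    hence gt: "norm a < t" by simp
    hence tp: "t > 0" using norm_ge_zero[of a] by linarith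
    define c where "c = complex_of_real (1 / t\<^sup>2) *\<^sub>C (cstar a * a)"
    have "norm c = (norm a)\<^sup>2 / t\<^sup>2" by (simp add: c_def norm_scaleC norm_cstar_mult_self norm_divide norm_power)
    also have "\<dots> < 1" using gt tp by (simp add: power_strict_mono)
    finally obtain b where b: "b * (1 - c) = 1" using neumann_left_inverse by blast
    \<comment> \<open>\<open>\<pi> b\<close> is a left inverse of \<open>1 - A\<^sup>* A / t\<^sup>2\<close>, which is therefore bounded below.\<close>
    define \<beta> where "\<beta> = onorm (\<pi> b) + 1"
    have \<beta>: "\<beta> > 0" using cop_onorm_nonneg[OF representation_cop[OF rep], of b] by (simp add: \<beta>_def)
    have low: "norm x \<le> \<beta> * norm (x - complex_of_real (1 / t\<^sup>2) *\<^sub>C adj A (A x))" for x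
    proof -
      have "x = \<pi> b (\<pi> (1 - c) x)"
        using b unital representation_mult[OF rep, of b "1 - c" x] by simp
      also have "\<pi> (1 - c) x = x - complex_of_real (1 / t\<^sup>2) *\<^sub>C adj A (A x)"
        unfolding representation_diff[OF rep] c_def representation_scaleC[OF rep]
          representation_mult[OF rep] representation_cstar[OF rep] unital A_def ..
      finally have "norm x \<le> onorm (\<pi> b) * norm (x - complex_of_real (1 / t\<^sup>2) *\<^sub>C adj A (A x))"
        using cop_norm[OF representation_cop[OF rep]] by metis
      also have "\<dots> \<le> \<beta> * norm (x - complex_of_real (1 / t\<^sup>2) *\<^sub>C adj A (A x))"
        unfolding \<beta>_def by (intro mult_right_mono) auto
      finally show ?thesis .
    qed
    have adjle: "norm (adj A y) \<le> t * norm y" for y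
    proof (cases "adj A y = 0")
      case False
      have "(norm (adj A y))\<^sup>2 = Re (cinner y (A (adj A y)))"
        by (simp add: cinner_adj_left[OF A, symmetric] cinner_self)
      also have "\<dots> \<le> norm y * (t * norm (adj A y))"
        unfolding t_def by (intro order_trans[OF complex_Re_le_cmod] order_trans[OF cmod_cinner_le]
            mult_left_mono cop_norm A) auto
      finally show ?thesis using False by (simp add: power2_eq_square mult_ac)
    qed (use tp in simp)
    have up: "(norm (x - complex_of_real (1 / t\<^sup>2) *\<^sub>C adj A (A x)))\<^sup>2 \<le> (norm x)\<^sup>2 - (norm (A x))\<^sup>2 / t\<^sup>2" for x
    proof -
      let ?y = "adj A (A x)"
      have "Re (cinner x ?y) = (norm (A x))\<^sup>2" by (simp add: cinner_adj_right A cinner_self)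
      hence "(norm (x - complex_of_real (1 / t\<^sup>2) *\<^sub>C ?y))\<^sup>2
          = (norm x)\<^sup>2 - 2 / t\<^sup>2 * (norm (A x))\<^sup>2 + (norm ?y)\<^sup>2 / t^4"
        unfolding scaleC_complex_of_real power2_norm_eq_inner inner_diff_left inner_diff_right
        by (simp add: Re_cinner inner_commute[of ?y x] power2_norm_eq_inner power2_eq_square eval_nat_numeral)
      moreover have "(norm ?y)\<^sup>2 / t^4 \<le> (t * norm (A x))\<^sup>2 / t^4"
        using adjle by (intro divide_right_mono power_mono) auto
      moreover have "(t * norm (A x))\<^sup>2 / t^4 = (norm (A x))\<^sup>2 / t\<^sup>2"
        using tp by (simp add: power_mult_distrib eval_nat_numeral)
      ultimately show ?thesis by simp
    qed
    \<comment> \<open>Both estimates together bound \<open>\<parallel>A\<parallel>\<^sup>2\<close> by \<open>q < t\<^sup>2\<close>.\<close>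
    define q where "q = t\<^sup>2 * (1 - 1 / \<beta>\<^sup>2)"
    have main: "(norm (A x))\<^sup>2 \<le> q * (norm x)\<^sup>2" for x
    proof -
      have "(norm x)\<^sup>2 \<le> (\<beta> * norm (x - complex_of_real (1 / t\<^sup>2) *\<^sub>C adj A (A x)))\<^sup>2"
        using low by (intro power_mono) auto
      also have "\<dots> \<le> \<beta>\<^sup>2 * ((norm x)\<^sup>2 - (norm (A x))\<^sup>2 / t\<^sup>2)"
        unfolding power_mult_distrib using up by (intro mult_left_mono) auto
      finally have "(norm x)\<^sup>2 / \<beta>\<^sup>2 \<le> (norm x)\<^sup>2 - (norm (A x))\<^sup>2 / t\<^sup>2"
        using \<beta> by (simp add: pos_divide_le_eq mult.commute)
      hence "(norm (A x))\<^sup>2 / t\<^sup>2 \<le> (norm x)\<^sup>2 - (norm x)\<^sup>2 / \<beta>\<^sup>2" by simp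
      hence "(norm (A x))\<^sup>2 \<le> ((norm x)\<^sup>2 - (norm x)\<^sup>2 / \<beta>\<^sup>2) * t\<^sup>2"
        using tp by (simp add: pos_divide_le_eq)
      thus ?thesis by (simp add: q_def algebra_simps)
    qed
    have "t \<le> sqrt (max q 0)" unfolding t_def
    proof (rule onorm_bound)
      show "0 \<le> sqrt (max q 0)" by simp
      fix x
      have "(norm (A x))\<^sup>2 \<le> (sqrt (max q 0) * norm x)\<^sup>2"
        using order_trans[OF main[of x] mult_right_mono[of q "max q 0"]] by (simp add: power_mult_distrib)
      thus "norm (A x) \<le> sqrt (max q 0) * norm x" by (rule power2_le_imp_le) simp
    qed
    hence "t\<^sup>2 \<le> (sqrt (max q 0))\<^sup>2" using tp by (intro power_mono) auto
    hence "t\<^sup>2 \<le> max q 0" by simp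
    moreover have "q < t\<^sup>2" using tp \<beta> by (simp add: q_def)
    moreover have "t\<^sup>2 > 0" using tp by simp
    ultimately show False by linarith
  qed
  thus ?thesis using order_trans[OF cop_norm[OF A] mult_right_mono[OF _ norm_ge_zero]]
    by (simp add: A_def t_def)
qed


section \<open>Intertwiners from a dominating functional\<close>

locale positive_functional =
  fixes s :: "'a::cstar_algebra \<Rightarrow> complex"
  assumes s_add: "s (a + b) = s a + s b"
    and s_scaleC: "s (c *\<^sub>C a) = c * s a"
    and s_cstar: "s (cstar a) = cnj (s a)"
    and s_nonneg: "0 \<le> Re (s (cstar a * a))"
begin

sublocale form: semi_cinner "\<lambda>a b. s (cstar a * b)"
proof unfold_locales
  show "s (cstar x * y) = cnj (s (cstar y * x))" for x y
    by (metis cstar_cstar cstar_mult s_cstar)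
qed (auto simp: distrib_left s_add mult_scaleC_right s_scaleC s_nonneg)

lemma s_zero [simp]: "s 0 = 0"
  using s_scaleC[of 0 0] by simp

text \<open>
  The vectors \<open>x\<close> for which \<open>b \<mapsto> \<parallel>\<pi> b x\<parallel>\<close> is bounded on \<open>A\<close> by a multiple of the GNS seminorm of
  \<open>s\<close>.
\<close>

definition dominated :: "'a set \<Rightarrow> ('a \<Rightarrow> 'h::chilbert_space \<Rightarrow> 'h) \<Rightarrow> 'h set" where
  "dominated A \<pi> = {x. \<exists>C\<ge>0. \<forall>b\<in>A. norm (\<pi> b x) \<le> C * form.sn b}"

text \<open>
  The functional is approximated, in the norm dual to its own seminorm, by combinations of
  matrix coefficients with dominated vectors. This expresses that its GNS representation is
  contained in a multiple of \<open>\<pi>\<close>.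
\<close>

definition approximable :: "'a set \<Rightarrow> ('a \<Rightarrow> 'h::chilbert_space \<Rightarrow> 'h) \<Rightarrow> bool" where
  "approximable A \<pi> \<longleftrightarrow> (\<forall>e>0. \<exists>(n::nat) \<eta> x. (\<forall>i<n. x i \<in> dominated A \<pi>) \<and>
     (\<forall>b\<in>A. cmod (s b - (\<Sum>i<n. cinner (\<eta> i) (\<pi> b (x i)))) \<le> e * form.sn b))"

end

text \<open>
  Two representations of a C*-algebra, and a subspace \<open>A\<close> that contains 1 and is invariant under
  left multiplication by given unitaries \<open>w f\<close> and their adjoints. Only these unitaries will be
  intertwined.
\<close>

locale dominating = positive_functional s for s :: "'a::cstar_algebra \<Rightarrow> complex" +
  fixes A :: "'a set" and w :: "'i \<Rightarrow> 'a" and V :: "'i set"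
    and \<pi>1 :: "'a \<Rightarrow> 'h::chilbert_space \<Rightarrow> 'h" and \<pi>2 :: "'a \<Rightarrow> 'k::chilbert_space \<Rightarrow> 'k"
  assumes rep1: "representation \<pi>1" and rep2: "representation \<pi>2"
    and unital1: "\<pi>1 1 x = x" and unital2: "\<pi>2 1 y = y"
    and A_add: "a \<in> A \<Longrightarrow> b \<in> A \<Longrightarrow> a + b \<in> A" and A_scaleC: "a \<in> A \<Longrightarrow> c *\<^sub>C a \<in> A"
    and A_one: "1 \<in> A"
    and A_mult: "f \<in> V \<Longrightarrow> a \<in> A \<Longrightarrow> w f * a \<in> A" and A_cmult: "f \<in> V \<Longrightarrow> a \<in> A \<Longrightarrow> cstar (w f) * a \<in> A"
    and w_unitary: "f \<in> V \<Longrightarrow> unitary (w f)"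
begin

lemma A_diff: "a \<in> A \<Longrightarrow> b \<in> A \<Longrightarrow> a - b \<in> A"
  using A_add[of a "(-1) *\<^sub>C b"] A_scaleC[of b "-1"] by simp

lemma A_zero: "0 \<in> A"
  using A_scaleC[OF A_one, of 0] by simp

lemma A_sum: "(\<And>i. i \<in> S \<Longrightarrow> f i \<in> A) \<Longrightarrow> (\<Sum>i\<in>S. f i) \<in> A"
  by (induction S rule: infinite_finite_induct) (auto simp: A_zero A_add)

text \<open>
  Through the GNS space of \<open>s\<close>, two dominated vectors \<open>x\<close> and \<open>y\<close> give the intertwiner
  \<open>R\<^sub>y R\<^sub>x\<^sup>*\<close>, where \<open>R\<^sub>x b = \<pi>1 b x\<close> and \<open>R\<^sub>y b = \<pi>2 b y\<close>.
\<close>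

lemma dominated_intertwiner:
  assumes x: "x \<in> dominated A \<pi>1" and y: "y \<in> dominated A \<pi>2"
  obtains R where "R \<in> intertwiners (\<lambda>f. \<pi>1 (w f)) (\<lambda>f. \<pi>2 (w f)) V"
    and "\<And>\<xi> a. (\<And>n. a n \<in> A) \<Longrightarrow> form.Hcauchy a \<Longrightarrow>
          (\<And>b. b \<in> A \<Longrightarrow> (\<lambda>n. s (cstar (a n) * b)) \<longlonglongrightarrow> cinner \<xi> (\<pi>1 b x)) \<Longrightarrow>
          (\<lambda>n. \<pi>2 (a n) y) \<longlonglongrightarrow> R \<xi>"
proof -
  obtain Cx where Cx: "Cx \<ge> 0" "\<And>b. b \<in> A \<Longrightarrow> norm (\<pi>1 b x) \<le> Cx * form.sn b"
    using x unfolding dominated_def by blast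
  obtain Cy where Cy: "Cy \<ge> 0" "\<And>b. b \<in> A \<Longrightarrow> norm (\<pi>2 b y) \<le> Cy * form.sn b"
    using y unfolding dominated_def by blast
  \<comment> \<open>\<open>P a \<xi>\<close>: the Cauchy sequence \<open>a\<close> represents \<open>R\<^sub>x\<^sup>* \<xi>\<close> in the GNS space.\<close>
  define P where "P a \<xi> \<longleftrightarrow> (\<forall>n. a n \<in> A) \<and> form.Hcauchy a \<and>
      (\<forall>b\<in>A. (\<lambda>n. s (cstar (a n) * b)) \<longlonglongrightarrow> cinner \<xi> (\<pi>1 b x))" for a \<xi>
  have P_ex: "\<exists>a. P a \<xi>" for \<xi>
  proof -
    have bd: "cmod (cinner \<xi> (\<pi>1 b x)) \<le> (norm \<xi> * Cx) * form.sn b" if "b \<in> A" for b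
      using order_trans[OF cmod_cinner_le mult_left_mono[OF Cx(2)[OF that] norm_ge_zero]]
      by (simp add: mult.assoc)
    show ?thesis
      by (rule form.riesz_cauchy[of A "\<lambda>b. cinner \<xi> (\<pi>1 b x)" "norm \<xi> * Cx"])
         (auto simp: P_def A_add A_scaleC A_zero representation_add[OF rep1] representation_scaleC[OF rep1]
            cinner_add_right cinner_scaleC_right bd)
  qed
  have conv: "\<exists>\<eta>. (\<lambda>n. \<pi>2 (a n) y) \<longlonglongrightarrow> \<eta>" if "P a \<xi>" for a \<xi>
  proof -
    have "Cauchy (\<lambda>n. \<pi>2 (a n) y)"
    proof (rule metric_CauchyI)
      fix e :: real assume e: "0 < e"
      have "form.Hcauchy a" using that by (simp add: P_def)
      then obtain N where N: "\<And>m n. m \<ge> N \<Longrightarrow> n \<ge> N \<Longrightarrow> form.sn (a m - a n) < e / (Cy + 1)"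
        unfolding form.Hcauchy_def using Cy(1) e by (metis add_nonneg_pos divide_pos_pos zero_less_one)
      have "dist (\<pi>2 (a m) y) (\<pi>2 (a n) y) < e" if "m \<ge> N" "n \<ge> N" for m n
      proof -
        have "dist (\<pi>2 (a m) y) (\<pi>2 (a n) y) \<le> Cy * form.sn (a m - a n)"
          using Cy(2)[of "a m - a n"] \<open>P a \<xi>\<close> A_diff by (simp add: dist_norm representation_diff[OF rep2] P_def)
        also have "\<dots> \<le> (Cy + 1) * form.sn (a m - a n)" by (intro mult_right_mono) auto
        also have "\<dots> < e" using N[OF that] Cy(1) by (simp add: field_simps)
        finally show ?thesis .
      qed
      thus "\<exists>M. \<forall>m\<ge>M. \<forall>n\<ge>M. dist (\<pi>2 (a m) y) (\<pi>2 (a n) y) < e" by blast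
    qed
    thus ?thesis using Cauchy_convergent convergent_def by blast
  qed
  define \<Gamma> where "\<Gamma> = {(\<xi>, \<eta>). \<exists>a. P a \<xi> \<and> (\<lambda>n. \<pi>2 (a n) y) \<longlonglongrightarrow> \<eta>}"
  have P_add: "P (\<lambda>n. a n + a' n) (\<xi> + \<xi>')" if P: "P a \<xi>" "P a' \<xi>'" for a a' \<xi> \<xi>'
  proof -
    have "form.Hcauchy (\<lambda>n. a n + a' n)" unfolding form.Hcauchy_def
    proof (intro allI impI)
      fix e :: real assume "e > 0"
      hence e2: "e/2 > 0" by simp
      obtain N where N: "\<And>m n. m \<ge> N \<Longrightarrow> n \<ge> N \<Longrightarrow> form.sn (a m - a n) < e/2"
        using P(1) e2 unfolding P_def form.Hcauchy_def by blast
      obtain N' where N': "\<And>m n. m \<ge> N' \<Longrightarrow> n \<ge> N' \<Longrightarrow> form.sn (a' m - a' n) < e/2"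
        using P(2) e2 unfolding P_def form.Hcauchy_def by blast
      have "form.sn (a m + a' m - (a n + a' n)) < e" if "m \<ge> max N N'" "n \<ge> max N N'" for m n
      proof -
        have "form.sn (a m + a' m - (a n + a' n)) \<le> form.sn (a m - a n) + form.sn (a' m - a' n)"
          using form.sn_triangle[of "a m - a n" "a' m - a' n"] by (simp add: algebra_simps)
        thus ?thesis using N[of m n] N'[of m n] that by simp
      qed
      thus "\<exists>N. \<forall>m\<ge>N. \<forall>n\<ge>N. form.sn (a m + a' m - (a n + a' n)) < e" by blast
    qed
    thus ?thesis using P unfolding P_def
      by (auto simp: A_add cstar_add distrib_right s_add cinner.H_add_left intro!: tendsto_add)
  qed
  have P_scale: "P (\<lambda>n. c *\<^sub>C a n) (c *\<^sub>C \<xi>)" if P: "P a \<xi>" for c a \<xi>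
  proof -
    have "form.Hcauchy (\<lambda>n. c *\<^sub>C a n)" unfolding form.Hcauchy_def
    proof (intro allI impI)
      fix e :: real assume e: "e > 0"
      hence "e / (cmod c + 1) > 0" by (simp add: add_nonneg_pos)
      then obtain N where N: "\<And>m n. m \<ge> N \<Longrightarrow> n \<ge> N \<Longrightarrow> form.sn (a m - a n) < e / (cmod c + 1)"
        using P unfolding P_def form.Hcauchy_def by blast
      have "form.sn (c *\<^sub>C a m - c *\<^sub>C a n) < e" if "m \<ge> N" "n \<ge> N" for m n
      proof -
        have "form.sn (c *\<^sub>C a m - c *\<^sub>C a n) \<le> (cmod c + 1) * form.sn (a m - a n)"
          by (simp add: scaleC_diff_right[symmetric] form.sn_scaleC mult_right_mono)
        also have "\<dots> < (cmod c + 1) * (e / (cmod c + 1))"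
          using N[OF that] by (intro mult_strict_left_mono) (auto simp: add_nonneg_pos)
        also have "\<dots> = e" using norm_ge_zero[of c] by (simp add: add_nonneg_eq_0_iff)
        finally show ?thesis .
      qed
      thus "\<exists>N. \<forall>m\<ge>N. \<forall>n\<ge>N. form.sn (c *\<^sub>C a m - c *\<^sub>C a n) < e" by blast
    qed
    thus ?thesis using P unfolding P_def
      by (auto simp: A_scaleC cstar_scaleC mult_scaleC_left s_scaleC cinner.H_scaleC_left intro!: tendsto_mult)
  qed
  have P_w: "P (\<lambda>n. w f * a n) (\<pi>1 (w f) \<xi>)" if "P a \<xi>" and f: "f \<in> V" for a \<xi> f
  proof -
    have "form.sn (w f * b) = form.sn b" for b
      using w_unitary[OF f] unfolding form.sn_def unitary_def
      by (metis (no_types, lifting) cstar_mult mult.assoc mult_1)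
    hence "form.Hcauchy (\<lambda>n. w f * a n)"
      using that(1) unfolding P_def form.Hcauchy_def by (simp add: right_diff_distrib[symmetric])
    moreover have "(\<lambda>n. s (cstar (w f * a n) * b)) \<longlonglongrightarrow> cinner (\<pi>1 (w f) \<xi>) (\<pi>1 b x)" if b: "b \<in> A" for b
    proof -
      have "(\<lambda>n. s (cstar (a n) * (cstar (w f) * b))) \<longlonglongrightarrow> cinner \<xi> (\<pi>1 (cstar (w f) * b) x)"
        using \<open>P a \<xi>\<close> A_cmult[OF f b] unfolding P_def by blast
      thus ?thesis by (simp add: cstar_mult mult.assoc representation_mult[OF rep1] cinner_rep_left[OF rep1])
    qed
    ultimately show ?thesis using that(1) A_mult[OF f] unfolding P_def by blast
  qed
  \<comment> \<open>The norm of \<open>R\<^sub>y R\<^sub>x\<^sup>*\<close> is at most the product of the two domination constants.\<close>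
  have \<Gamma>_bound: "norm \<eta> \<le> Cy * Cx * norm \<xi>" if P: "P a \<xi>" and lim\<eta>: "(\<lambda>n. \<pi>2 (a n) y) \<longlonglongrightarrow> \<eta>" for a \<xi> \<eta>
  proof (rule field_le_epsilon)
    fix e :: real assume e: "e > 0"
    define d where "d = e / (Cy + 1)"
    have d: "d > 0" "Cy * d \<le> e" using e Cy(1) by (auto simp: d_def field_simps)
    obtain N where N: "\<And>m n. m \<ge> N \<Longrightarrow> n \<ge> N \<Longrightarrow> form.sn (a m - a n) < d"
      using P d unfolding P_def form.Hcauchy_def by blast
    have aA: "a n \<in> A" for n using P by (simp add: P_def)
    have sn_le: "form.sn (a m) \<le> Cx * norm \<xi> + d" if m: "m \<ge> N" for m
    proof (cases "form.sn (a m) = 0")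
      case False
      have lim: "(\<lambda>n. cmod (s (cstar (a n) * a m))) \<longlonglongrightarrow> cmod (cinner \<xi> (\<pi>1 (a m) x))"
        using \<open>P a \<xi>\<close> aA[of m] unfolding P_def by (intro tendsto_norm) blast
      have "(form.sn (a m))\<^sup>2 - d * form.sn (a m) \<le> cmod (cinner \<xi> (\<pi>1 (a m) x))"
      proof (rule LIMSEQ_le_const[OF lim])
        have "(form.sn (a m))\<^sup>2 - d * form.sn (a m) \<le> cmod (s (cstar (a n) * a m))" if n: "n \<ge> N" for n
        proof -
          have "complex_of_real ((form.sn (a m))\<^sup>2) = s (cstar (a m - a n) * a m) + s (cstar (a n) * a m)"
            by (simp only: form.H_self_sn[symmetric] form.H_diff_left diff_add_cancel)
          hence "cmod (complex_of_real ((form.sn (a m))\<^sup>2)) \<le> cmod (s (cstar (a m - a n) * a m)) + cmod (s (cstar (a n) * a m))"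
            by (metis norm_triangle_ineq)
          moreover have "cmod (s (cstar (a m - a n) * a m)) \<le> form.sn (a m - a n) * form.sn (a m)"
            by (rule form.H_cauchy_schwarz)
          moreover have "\<dots> \<le> d * form.sn (a m)" using N[OF m n] by (intro mult_right_mono) auto
          ultimately show ?thesis unfolding norm_of_real by simp
        qed
        thus "\<exists>N. \<forall>n\<ge>N. (form.sn (a m))\<^sup>2 - d * form.sn (a m) \<le> cmod (s (cstar (a n) * a m))" by blast
      qed
      also have "\<dots> \<le> norm \<xi> * (Cx * form.sn (a m))"
        by (rule order_trans[OF cmod_cinner_le mult_left_mono[OF Cx(2)[OF aA] norm_ge_zero]])
      finally have "form.sn (a m) * form.sn (a m) \<le> form.sn (a m) * (Cx * norm \<xi> + d)"
        by (simp add: power2_eq_square algebra_simps)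
      moreover have "form.sn (a m) > 0" using False form.sn_nonneg[of "a m"] by linarith
      ultimately show ?thesis by simp
    qed (use Cx(1) d in simp)
    have "norm \<eta> \<le> Cy * (Cx * norm \<xi> + d)"
    proof (rule LIMSEQ_le_const2[OF tendsto_norm[OF lim\<eta>]])
      have "norm (\<pi>2 (a n) y) \<le> Cy * (Cx * norm \<xi> + d)" if "n \<ge> N" for n
        by (rule order_trans[OF Cy(2)[OF aA] mult_left_mono[OF sn_le[OF that] Cy(1)]])
      thus "\<exists>N. \<forall>n\<ge>N. norm (\<pi>2 (a n) y) \<le> Cy * (Cx * norm \<xi> + d)" by blast
    qed
    thus "norm \<eta> \<le> Cy * Cx * norm \<xi> + e" using d by (simp add: algebra_simps)
  qed
  have "fst ` \<Gamma> = UNIV" using P_ex conv unfolding \<Gamma>_def by (auto simp: image_iff) meson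
  hence dense: "closure (fst ` \<Gamma>) = UNIV" by simp
  obtain R where R: "cop R" "\<And>\<xi> \<eta>. (\<xi>, \<eta>) \<in> \<Gamma> \<Longrightarrow> R \<xi> = \<eta>"
  proof (rule operator_of_graph[OF _ _ _ dense])
    show "(\<xi> + \<xi>', \<eta> + \<eta>') \<in> \<Gamma>" if g: "(\<xi>, \<eta>) \<in> \<Gamma>" "(\<xi>', \<eta>') \<in> \<Gamma>" for \<xi> \<eta> \<xi>' \<eta>'
    proof -
      obtain a a' where "P a \<xi>" "(\<lambda>n. \<pi>2 (a n) y) \<longlonglongrightarrow> \<eta>" "P a' \<xi>'" "(\<lambda>n. \<pi>2 (a' n) y) \<longlonglongrightarrow> \<eta>'"
        using g unfolding \<Gamma>_def by blast
      thus ?thesis using P_add[of a \<xi> a' \<xi>'] tendsto_add unfolding \<Gamma>_def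
        by (fastforce simp: representation_add[OF rep2])
    qed
    show "(c *\<^sub>C \<xi>, c *\<^sub>C \<eta>) \<in> \<Gamma>" if g: "(\<xi>, \<eta>) \<in> \<Gamma>" for c \<xi> \<eta>
    proof -
      obtain a where "P a \<xi>" "(\<lambda>n. \<pi>2 (a n) y) \<longlonglongrightarrow> \<eta>" using g unfolding \<Gamma>_def by blast
      thus ?thesis using P_scale[of a \<xi> c] tendsto_scaleC[of _ \<eta> _ c] unfolding \<Gamma>_def
        by (fastforce simp: representation_scaleC[OF rep2])
    qed
    show "norm \<eta> \<le> Cy * Cx * norm \<xi>" if "(\<xi>, \<eta>) \<in> \<Gamma>" for \<xi> \<eta>
      using that \<Gamma>_bound unfolding \<Gamma>_def by blast
  qed blast
  have "R (\<pi>1 (w f) \<xi>) = \<pi>2 (w f) (R \<xi>)" if f: "f \<in> V" for f \<xi>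
  proof -
    obtain a where a: "P a \<xi>" using P_ex by blast
    obtain \<eta> where \<eta>: "(\<lambda>n. \<pi>2 (a n) y) \<longlonglongrightarrow> \<eta>" using conv[OF a] by blast
    have 1: "R \<xi> = \<eta>" using a \<eta> by (intro R) (auto simp: \<Gamma>_def)
    have "(\<lambda>n. \<pi>2 (w f * a n) y) \<longlonglongrightarrow> \<pi>2 (w f) \<eta>"
      unfolding representation_mult[OF rep2] by (rule cop_tendsto[OF representation_cop[OF rep2] \<eta>])
    hence "(\<pi>1 (w f) \<xi>, \<pi>2 (w f) \<eta>) \<in> \<Gamma>" using P_w[OF a f] unfolding \<Gamma>_def by blast
    thus ?thesis using R(2) 1 by simp
  qed
  moreover have "(\<lambda>n. \<pi>2 (a n) y) \<longlonglongrightarrow> R \<xi>" if P: "P a \<xi>" for a \<xi>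
  proof -
    obtain \<eta> where \<eta>: "(\<lambda>n. \<pi>2 (a n) y) \<longlonglongrightarrow> \<eta>" using conv[OF P] by blast
    hence "R \<xi> = \<eta>" using P by (intro R) (auto simp: \<Gamma>_def)
    with \<eta> show ?thesis by simp
  qed
  ultimately show ?thesis
    by (intro that[of R]) (use R(1) in \<open>auto simp: intertwiners_def P_def\<close>)
qed

text \<open>
  Approximate \<open>s\<close> by \<open>\<Sum> cinner (\<eta> i) (\<pi>1 b (x i))\<close>. Then the GNS vector of \<open>s\<close> is approximated by
  \<open>\<Sum> R\<^sub>x\<^sub>i\<^sup>* (\<eta> i)\<close>, and applying \<open>R\<^sub>y\<close> shows that \<open>y\<close> is approximated by a sum of values of
  intertwiners.
\<close>

lemma dominated_subset_intertwined:
  assumes appr: "approximable A \<pi>1" and y: "y \<in> dominated A \<pi>2"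
  shows "y \<in> closure (span (intertwined (intertwiners (\<lambda>f. \<pi>1 (w f)) (\<lambda>f. \<pi>2 (w f)) V)))"
    (is "_ \<in> closure (span (intertwined ?E))")
proof -
  obtain C where C: "C \<ge> 0" "\<And>b. b \<in> A \<Longrightarrow> norm (\<pi>2 b y) \<le> C * form.sn b"
    using y unfolding dominated_def by blast
  show ?thesis unfolding closure_approachable
  proof (intro allI impI)
    fix e :: real assume "e > 0"
    define d where "d = e / (2 * (C + 1))"
    have d: "d > 0" "C * (2 * d) < e" using C(1) \<open>e > 0\<close> by (auto simp: d_def field_simps)
    obtain n :: nat and \<eta> x where x: "\<And>i. i < n \<Longrightarrow> x i \<in> dominated A \<pi>1"
      and ap: "\<And>b. b \<in> A \<Longrightarrow> cmod (s b - (\<Sum>i<n. cinner (\<eta> i) (\<pi>1 b (x i)))) \<le> d * form.sn b"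
    proof -
      from appr d(1) have "\<exists>(n::nat) \<eta> x. (\<forall>i<n. x i \<in> dominated A \<pi>1) \<and>
          (\<forall>b\<in>A. cmod (s b - (\<Sum>i<n. cinner (\<eta> i) (\<pi>1 b (x i)))) \<le> d * form.sn b)"
        unfolding approximable_def by blast
      thus ?thesis using that by blast
    qed
    define Q where "Q i a R \<longleftrightarrow> R \<in> ?E \<and> (\<forall>k. a k \<in> A) \<and> form.Hcauchy a \<and>
        (\<forall>b\<in>A. (\<lambda>k. s (cstar (a k) * b)) \<longlonglongrightarrow> cinner (\<eta> i) (\<pi>1 b (x i))) \<and>
        (\<lambda>k. \<pi>2 (a k) y) \<longlonglongrightarrow> R (\<eta> i)" for i a R
    have "\<exists>a R. Q i a R" if i: "i < n" for i
    proof -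
      obtain Cx where Cx: "Cx \<ge> 0" "\<And>b. b \<in> A \<Longrightarrow> norm (\<pi>1 b (x i)) \<le> Cx * form.sn b"
        using x[OF i] unfolding dominated_def by blast
      have bd: "cmod (cinner (\<eta> i) (\<pi>1 b (x i))) \<le> (norm (\<eta> i) * Cx) * form.sn b" if "b \<in> A" for b
        using order_trans[OF cmod_cinner_le mult_left_mono[OF Cx(2)[OF that] norm_ge_zero]]
        by (simp add: mult.assoc)
      obtain a where a: "\<And>k. a k \<in> A" "form.Hcauchy a"
          "\<And>b. b \<in> A \<Longrightarrow> (\<lambda>k. s (cstar (a k) * b)) \<longlonglongrightarrow> cinner (\<eta> i) (\<pi>1 b (x i))"
        by (rule form.riesz_cauchy[of A "\<lambda>b. cinner (\<eta> i) (\<pi>1 b (x i))" "norm (\<eta> i) * Cx"])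
           (auto simp: A_add A_scaleC A_zero representation_add[OF rep1] representation_scaleC[OF rep1]
            cinner_add_right cinner_scaleC_right bd)
      obtain R where "R \<in> ?E" "(\<lambda>k. \<pi>2 (a k) y) \<longlonglongrightarrow> R (\<eta> i)"
        by (rule dominated_intertwiner[OF x[OF i] y]) (use a in blast)
      with a show ?thesis unfolding Q_def by blast
    qed
    then obtain a R where Q: "\<And>i. i < n \<Longrightarrow> Q i (a i) (R i)" by metis
    have R: "\<And>i. i < n \<Longrightarrow> R i \<in> ?E" and aA: "\<And>i k. i < n \<Longrightarrow> a i k \<in> A"
      and cau: "\<And>i. i < n \<Longrightarrow> form.Hcauchy (a i)"
      and lim: "\<And>i b. i < n \<Longrightarrow> b \<in> A \<Longrightarrow> (\<lambda>k. s (cstar (a i k) * b)) \<longlonglongrightarrow> cinner (\<eta> i) (\<pi>1 b (x i))"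
      and limR: "\<And>i. i < n \<Longrightarrow> (\<lambda>k. \<pi>2 (a i k) y) \<longlonglongrightarrow> R i (\<eta> i)"
      using Q unfolding Q_def by blast+
    define z where "z = (\<Sum>i<n. R i (\<eta> i))"
    have z: "z \<in> span (intertwined ?E)"
      unfolding z_def by (intro span_sum span_base) (use R in \<open>auto simp: intertwined_def\<close>)
    \<comment> \<open>The difference of the two GNS vectors; its seminorm is eventually at most \<open>2 d\<close>.\<close>
    define c where "c k = (\<Sum>i<n. a i k) - 1" for k
    have cA: "c k \<in> A" for k unfolding c_def by (intro A_diff A_sum A_one aA) simp
    have limz: "(\<lambda>k. \<pi>2 (c k) y) \<longlonglongrightarrow> z - y"
      unfolding c_def representation_diff[OF rep2] representation_sum[OF rep2] unital2 z_def
      by (intro tendsto_diff tendsto_sum tendsto_const limR) simp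
    have limc: "(\<lambda>k. s (cstar (c k) * b)) \<longlonglongrightarrow> (\<Sum>i<n. cinner (\<eta> i) (\<pi>1 b (x i))) - s b" if "b \<in> A" for b
    proof -
      have "s (cstar (c k) * b) = (\<Sum>i<n. s (cstar (a i k) * b)) - s b" for k
        unfolding c_def by (simp only: form.H_diff_left form.H_sum_left cstar_one mult_1)
      thus ?thesis using that by (auto intro!: tendsto_diff tendsto_sum lim)
    qed
    have "\<exists>N. \<forall>j k. j \<ge> N \<longrightarrow> k \<ge> N \<longrightarrow> form.sn (c j - c k) < d"
    proof -
      have "\<exists>N. \<forall>j\<ge>N. \<forall>k\<ge>N. form.sn (a i j - a i k) < d / (real n + 1)" if "i < n" for i
        using cau[OF that] d(1) unfolding form.Hcauchy_def by simp
      then obtain N where N: "\<And>i j k. i < n \<Longrightarrow> j \<ge> N i \<Longrightarrow> k \<ge> N i \<Longrightarrow> form.sn (a i j - a i k) < d / (real n + 1)"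
        by metis
      define M where "M = (\<Sum>i<n. N i)"
      have M: "N i \<le> M" if "i < n" for i unfolding M_def using that by (intro member_le_sum) auto
      have tri: "form.sn (\<Sum>i\<in>S. u i) \<le> (\<Sum>i\<in>S. form.sn (u i))" for S :: "nat set" and u
        by (induction S rule: infinite_finite_induct)
           (auto simp: form.sn_def[of 0] intro: order_trans[OF form.sn_triangle])
      have "form.sn (c j - c k) < d" if "j \<ge> M" "k \<ge> M" for j k
      proof -
        have "c j - c k = (\<Sum>i<n. a i j - a i k)" by (simp add: c_def sum_subtractf)
        hence "form.sn (c j - c k) \<le> (\<Sum>i<n. form.sn (a i j - a i k))" using tri by simp
        also have "\<dots> \<le> (\<Sum>i<n. d / (real n + 1))"
        proof (rule sum_mono)
          fix i assume "i \<in> {..<n}"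
          hence "i < n" by simp
          with N[OF this, of j k] M[OF this] that show "form.sn (a i j - a i k) \<le> d / (real n + 1)" by simp
        qed
        also have "\<dots> = d * (real n / (real n + 1))" by simp
        also have "\<dots> < d * 1" using d(1) by (intro mult_strict_left_mono) auto
        finally show ?thesis by simp
      qed
      thus ?thesis by blast
    qed
    then obtain N where N: "\<And>j k. j \<ge> N \<Longrightarrow> k \<ge> N \<Longrightarrow> form.sn (c j - c k) < d" by blast
    have small: "form.sn (c j) \<le> 2 * d" if j: "j \<ge> N" for j
    proof (cases "form.sn (c j) = 0")
      case False
      have "(form.sn (c j))\<^sup>2 - d * form.sn (c j) \<le> cmod ((\<Sum>i<n. cinner (\<eta> i) (\<pi>1 (c j) (x i))) - s (c j))"
      proof (rule LIMSEQ_le_const[OF tendsto_norm[OF limc[OF cA]]])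
        have "(form.sn (c j))\<^sup>2 - d * form.sn (c j) \<le> cmod (s (cstar (c k) * c j))" if k: "k \<ge> N" for k
        proof -
          have "complex_of_real ((form.sn (c j))\<^sup>2) = s (cstar (c j - c k) * c j) + s (cstar (c k) * c j)"
            by (simp only: form.H_self_sn[symmetric] form.H_diff_left diff_add_cancel)
          hence "cmod (complex_of_real ((form.sn (c j))\<^sup>2)) \<le> cmod (s (cstar (c j - c k) * c j)) + cmod (s (cstar (c k) * c j))"
            by (metis norm_triangle_ineq)
          moreover have "cmod (s (cstar (c j - c k) * c j)) \<le> form.sn (c j - c k) * form.sn (c j)"
            by (rule form.H_cauchy_schwarz)
          moreover have "\<dots> \<le> d * form.sn (c j)" using N[OF j k] by (intro mult_right_mono) auto
          ultimately show ?thesis unfolding norm_of_real by simp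
        qed
        thus "\<exists>N. \<forall>k\<ge>N. (form.sn (c j))\<^sup>2 - d * form.sn (c j) \<le> cmod (s (cstar (c k) * c j))" by blast
      qed
      also have "\<dots> \<le> d * form.sn (c j)" using ap[OF cA] by (simp add: norm_minus_commute)
      finally have "form.sn (c j) * form.sn (c j) \<le> form.sn (c j) * (2 * d)"
        by (simp add: power2_eq_square algebra_simps)
      moreover have "form.sn (c j) > 0" using False form.sn_nonneg[of "c j"] by linarith
      ultimately show ?thesis by simp
    qed (use d in simp)
    have "norm (z - y) \<le> C * (2 * d)"
    proof (rule LIMSEQ_le_const2[OF tendsto_norm[OF limz]])
      have "norm (\<pi>2 (c k) y) \<le> C * (2 * d)" if "k \<ge> N" for k
        by (rule order_trans[OF C(2)[OF cA] mult_left_mono[OF small[OF that] C(1)]])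
      thus "\<exists>N. \<forall>k\<ge>N. norm (\<pi>2 (c k) y) \<le> C * (2 * d)" by blast
    qed
    hence "dist z y < e" using d by (simp add: dist_norm)
    with z show "\<exists>z\<in>span (intertwined ?E). dist z y < e" by blast
  qed
qed

text \<open>
  The closed span of the ranges of the intertwiners is invariant under every unitary that
  commutes with the \<open>w f\<close> up to scalars. If such unitaries generate the C*-algebra and a cyclic
  vector is a limit of combinations of dominated ones, then the ranges are total.
\<close>

lemma intertwiners_total:
  assumes appr: "approximable A \<pi>1"
    and \<Omega>: "\<Omega> \<in> closure (span (dominated A \<pi>2))" and cyc: "closure (range (\<lambda>a. \<pi>2 a \<Omega>)) = UNIV"
    and gen: "cstar_generated_by T = UNIV" and Tstar: "\<And>u. u \<in> T \<Longrightarrow> cstar u \<in> T"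
    and Tu: "\<And>u. u \<in> T \<Longrightarrow> unitary u"
    and comm: "\<And>u f. u \<in> T \<Longrightarrow> f \<in> V \<Longrightarrow> \<exists>c. w f * u = c *\<^sub>C (u * w f) \<and> cstar u * w f = c *\<^sub>C (w f * cstar u)"
  shows "closure (span (intertwined (intertwiners (\<lambda>f. \<pi>1 (w f)) (\<lambda>f. \<pi>2 (w f)) V))) = UNIV"
    (is "closure (span (intertwined ?E)) = UNIV")
proof -
  define L where "L = closure (span (intertwined ?E))"
  have L_sub: "subspace L" unfolding L_def by (intro subspace_closure subspace_span)
  have L_closed: "closed L" unfolding L_def by simp
  have L_scaleC: "c *\<^sub>C x \<in> L" if "x \<in> L" for c x
  proof -
    have lin: "linear ((*\<^sub>C) c :: 'k \<Rightarrow> 'k)" by (rule bounded_linear.linear[OF bounded_linear_scaleC])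
    have "(*\<^sub>C) c ` intertwined ?E \<subseteq> intertwined ?E"
      unfolding intertwined_def intertwiners_def
      by safe (use cop_scaleC[symmetric] in blast)
    hence "(*\<^sub>C) c ` span (intertwined ?E) \<subseteq> span (intertwined ?E)"
      by (metis linear_span_image[OF lin] span_mono)
    hence "(*\<^sub>C) c ` closure (span (intertwined ?E)) \<subseteq> closure (span (intertwined ?E))"
      by (intro image_closure_subset continuous_on_subset[OF linear_continuous_on[OF bounded_linear_scaleC]])
         (auto intro: subsetD[OF closure_subset])
    thus ?thesis using that unfolding L_def by blast
  qed
  have inv: "\<pi>2 u x \<in> L" if u: "u \<in> T" and x: "x \<in> L" for u x
  proof -
    have uu: "cstar u * u = 1" "u * cstar u = 1" using Tu[OF u] by (auto simp: unitary_def)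
    have "\<pi>2 u z \<in> intertwined ?E" if z': "z \<in> intertwined ?E" for z
    proof -
      obtain R \<xi> where R: "R \<in> ?E" and z: "z = R \<xi>" using z' unfolding intertwined_def by blast
      have cR: "cop R" and RU: "\<And>f x. f \<in> V \<Longrightarrow> R (\<pi>1 (w f) x) = \<pi>2 (w f) (R x)"
        using R by (auto simp: intertwiners_def)
      \<comment> \<open>The scalars from both commutations cancel in the conjugate of \<open>R\<close> by \<open>u\<close>.\<close>
      define R' where "R' = \<pi>2 u \<circ> (R \<circ> \<pi>1 (cstar u))"
      have "R' \<in> ?E" unfolding intertwiners_def
      proof (intro CollectI conjI ballI allI)
        show "cop R'" unfolding R'_def by (intro cop_compose representation_cop rep1 rep2 cR)
        fix f x assume f: "f \<in> V"
        obtain c where c: "w f * u = c *\<^sub>C (u * w f)" "cstar u * w f = c *\<^sub>C (w f * cstar u)"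
          using comm[OF u f] by blast
        have "R' (\<pi>1 (w f) x) = \<pi>2 u (R (\<pi>1 (cstar u * w f) x))"
          by (simp add: R'_def representation_mult[OF rep1])
        also have "\<dots> = c *\<^sub>C \<pi>2 (u * w f) (R (\<pi>1 (cstar u) x))"
          unfolding c(2) representation_scaleC[OF rep1] representation_mult[OF rep1] cop_scaleC[OF cR]
            RU[OF f] cop_scaleC[OF representation_cop[OF rep2]] representation_mult[OF rep2] ..
        also have "\<dots> = \<pi>2 (w f) (R' x)"
          unfolding representation_scaleC[OF rep2, symmetric] c(1)[symmetric]
          by (simp add: R'_def representation_mult[OF rep2])
        finally show "R' (\<pi>1 (w f) x) = \<pi>2 (w f) (R' x)" .
      qed
      moreover have "\<pi>2 u z = R' (\<pi>1 u \<xi>)"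
        by (simp add: R'_def z representation_mult[OF rep1, symmetric] uu unital1)
      ultimately show ?thesis unfolding intertwined_def by blast
    qed
    hence "\<pi>2 u ` intertwined ?E \<subseteq> intertwined ?E" by blast
    hence "\<pi>2 u ` span (intertwined ?E) \<subseteq> span (intertwined ?E)"
      using linear_span_image[OF bounded_linear.linear[OF cop_bounded_linear[OF representation_cop[OF rep2]]]]
      by (metis span_mono)
    hence "\<pi>2 u ` closure (span (intertwined ?E)) \<subseteq> closure (span (intertwined ?E))"
      by (intro image_closure_subset
            continuous_on_subset[OF linear_continuous_on[OF cop_bounded_linear[OF representation_cop[OF rep2]]]])
         (auto intro: subsetD[OF closure_subset])
    thus ?thesis using x unfolding L_def by blast
  qed
  \<comment> \<open>The elements leaving \<open>L\<close> invariant form a C*-subalgebra, which contains the generators.\<close>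
  define B where "B = {a. \<forall>x\<in>L. \<pi>2 a x \<in> L \<and> \<pi>2 (cstar a) x \<in> L}"
  have "cstar_subalgebra B" unfolding cstar_subalgebra_def
  proof (intro conjI)
    have lim: "\<pi>2 a x \<in> L" if "\<And>n. \<pi>2 (as n) x \<in> L" "as \<longlonglongrightarrow> a" for as a x
    proof -
      have "(\<lambda>n. norm (as n - a) * norm x) \<longlonglongrightarrow> 0"
        using that(2) by (intro tendsto_mult_left_zero) (simp add: LIM_zero tendsto_norm_zero)
      hence "(\<lambda>n. \<pi>2 (as n) x - \<pi>2 a x) \<longlonglongrightarrow> 0"
        by (rule Lim_null_comparison[rotated])
           (auto simp: representation_diff[OF rep2, symmetric] intro!: always_eventually
              representation_contractive rep2 unital2)
      hence "(\<lambda>n. \<pi>2 (as n) x) \<longlonglongrightarrow> \<pi>2 a x" by (simp add: LIM_zero_iff)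
      thus ?thesis by (rule closed_sequentially[OF L_closed that(1)])
    qed
    show "closed B" unfolding closed_sequential_limits
    proof (intro allI impI, elim conjE)
      fix as a assume as: "\<forall>n. as n \<in> B" "as \<longlonglongrightarrow> a"
      have "(\<lambda>n. norm (cstar (as n) - cstar a)) \<longlonglongrightarrow> 0"
        using as(2) by (simp add: cstar_diff[symmetric] norm_cstar LIM_zero tendsto_norm_zero)
      hence cs: "(\<lambda>n. cstar (as n)) \<longlonglongrightarrow> cstar a" by (simp add: tendsto_norm_zero_iff LIM_zero_iff)
      show "a \<in> B" unfolding B_def
      proof (intro CollectI ballI conjI)
        fix x assume x: "x \<in> L"
        show "\<pi>2 a x \<in> L" by (rule lim[OF _ as(2)]) (use as(1) x in \<open>auto simp: B_def\<close>)
        show "\<pi>2 (cstar a) x \<in> L" by (rule lim[OF _ cs]) (use as(1) x in \<open>auto simp: B_def\<close>)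
      qed
    qed
    show "\<forall>x\<in>B. \<forall>y\<in>B. x + y \<in> B \<and> x * y \<in> B"
      by (auto simp: B_def cstar_add cstar_mult representation_add[OF rep2] representation_mult[OF rep2]
          intro: subspace_add[OF L_sub])
  qed (auto simp: B_def unital2 representation_scaleC[OF rep2] cstar_scaleC cstar_cstar intro: L_scaleC)
  moreover have "T \<subseteq> B" using inv Tstar by (auto simp: B_def)
  ultimately have "UNIV \<subseteq> B" using gen unfolding cstar_generated_by_def by blast
  hence inv': "\<pi>2 a x \<in> L" if "x \<in> L" for a x using that unfolding B_def by blast
  have "dominated A \<pi>2 \<subseteq> L" using dominated_subset_intertwined[OF appr] unfolding L_def by blast
  hence "closure (span (dominated A \<pi>2)) \<subseteq> L"
    by (intro closure_minimal span_minimal L_closed L_sub)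
  hence "range (\<lambda>a. \<pi>2 a \<Omega>) \<subseteq> L" using \<Omega> inv' by blast
  hence "closure (range (\<lambda>a. \<pi>2 a \<Omega>)) \<subseteq> L" by (intro closure_minimal L_closed)
  thus ?thesis using cyc unfolding L_def by blast
qed

end


section \<open>Smooth functions and test functions\<close>

text \<open>The derivative, as it is iterated in the definition of \<open>smooth\<close>.\<close>

definition vderiv :: "(real \<Rightarrow> complex) \<Rightarrow> real \<Rightarrow> complex" where
  "vderiv f = (\<lambda>t. vector_derivative f (at t))"

lemma smooth_iff: "smooth f \<longleftrightarrow> (\<forall>n x. (vderiv ^^ n) f differentiable (at x))"
  by (simp add: smooth_def vderiv_def[abs_def])

lemma vderivI: "(\<And>x. (f has_vector_derivative f' x) (at x)) \<Longrightarrow> vderiv f = f'"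
  by (auto simp: vderiv_def vector_derivative_at)

text \<open>Members of a set of functions that is closed under differentiation are smooth.\<close>

lemma smooth_coinduct:
  assumes "f \<in> S" and "\<And>g. g \<in> S \<Longrightarrow> (\<exists>g'\<in>S. \<forall>x. (g has_vector_derivative g' x) (at x))"
  shows "smooth f"
proof -
  have "(vderiv ^^ n) f \<in> S" for n
  proof (induction n)
    case (Suc n)
    then obtain g' where "g' \<in> S" "\<forall>x. ((vderiv ^^ n) f has_vector_derivative g' x) (at x)"
      using assms(2) by blast
    thus ?case using vderivI by (metis comp_apply funpow.simps(2))
  qed (use assms in simp)
  thus ?thesis unfolding smooth_iff using assms(2) differentiableI_vector by blast
qed

lemma smooth_has_vderiv: "smooth f \<Longrightarrow> (f has_vector_derivative vderiv f x) (at x)"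
  unfolding smooth_iff vderiv_def
  by (metis funpow_0 vector_derivative_works)

lemma smooth_vderiv: "smooth f \<Longrightarrow> smooth (vderiv f)"
  unfolding smooth_iff by (metis funpow_Suc_right comp_apply)

lemma smooth_antiderivative:
  assumes "smooth f" "\<And>x. (F has_vector_derivative f x) (at x)"
  shows "smooth F"
  by (rule smooth_coinduct[of _ "insert F {f. smooth f}"])
     (use assms smooth_has_vderiv smooth_vderiv in blast)+

text \<open>
  The closure of the smooth functions under sums, products and inverses of nowhere vanishing functions,
  an auxiliary set for \<open>smooth_coinduct\<close>; in fact it contains nothing new.
\<close>

inductive_set smooth_closure :: "(real \<Rightarrow> complex) set" where
  base: "smooth f \<Longrightarrow> f \<in> smooth_closure"
| add: "f \<in> smooth_closure \<Longrightarrow> g \<in> smooth_closure \<Longrightarrow> (\<lambda>x. f x + g x) \<in> smooth_closure"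
| mult: "f \<in> smooth_closure \<Longrightarrow> g \<in> smooth_closure \<Longrightarrow> (\<lambda>x. f x * g x) \<in> smooth_closure"
| inverse: "f \<in> smooth_closure \<Longrightarrow> (\<And>x. f x \<noteq> 0) \<Longrightarrow> (\<lambda>x. inverse (f x)) \<in> smooth_closure"

lemma smooth_const: "smooth (\<lambda>x. c)"
  by (rule smooth_coinduct[of _ "range (\<lambda>c x. c)"]) (auto intro!: derivative_eq_intros bexI[of _ "\<lambda>_. 0"])

lemma smooth_closure_smooth: "f \<in> smooth_closure \<Longrightarrow> smooth f"
proof (erule smooth_coinduct)
  fix g assume "g \<in> smooth_closure"
  thus "\<exists>g'\<in>smooth_closure. \<forall>x. (g has_vector_derivative g' x) (at x)"
  proof induction
    case (base f)
    thus ?case using smooth_has_vderiv smooth_vderiv smooth_closure.base by blast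
  next
    case (add f g)
    then obtain f' g' where "f' \<in> smooth_closure" "g' \<in> smooth_closure"
      "\<And>x. (f has_vector_derivative f' x) (at x)" "\<And>x. (g has_vector_derivative g' x) (at x)" by blast
    thus ?case
      by (intro bexI[of _ "\<lambda>x. f' x + g' x"]) (auto intro!: derivative_intros smooth_closure.add)
  next
    case (mult f g)
    then obtain f' g' where d: "f' \<in> smooth_closure" "g' \<in> smooth_closure"
      "\<And>x. (f has_vector_derivative f' x) (at x)" "\<And>x. (g has_vector_derivative g' x) (at x)" by blast
    have "((\<lambda>x. f x * g x) has_vector_derivative (f x * g' x + f' x * g x)) (at x)" for x
      by (rule has_vector_derivative_mult) (use d in auto)
    thus ?case
      by (intro bexI[of _ "\<lambda>x. f x * g' x + f' x * g x"] allI smooth_closure.add smooth_closure.mult)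
         (use d mult in auto)
  next
    case (inverse f)
    then obtain f' where d: "f' \<in> smooth_closure" "\<And>x. (f has_vector_derivative f' x) (at x)" by blast
    have "((\<lambda>x. inverse (f x)) has_vector_derivative (f' x * (- 1 * (inverse (f x) * inverse (f x))))) (at x)" for x
    proof -
      have "(inverse has_field_derivative - (inverse (f x) * inverse (f x))) (at (f x))"
        using DERIV_inverse'[OF DERIV_ident, of "f x" UNIV] inverse.hyps(2) by simp
      from field_vector_diff_chain_at[OF d(2) this] show ?thesis by (simp add: o_def)
    qed
    thus ?case
      by (intro bexI[of _ "\<lambda>x. f' x * (- 1 * (inverse (f x) * inverse (f x)))"] allI
            smooth_closure.mult smooth_closure.inverse smooth_closure.base[OF smooth_const])
         (use d inverse in auto)
  qed
qed

lemma smooth_add: "smooth f \<Longrightarrow> smooth g \<Longrightarrow> smooth (\<lambda>x. f x + g x)"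
  by (rule smooth_closure_smooth, rule smooth_closure.add) (auto intro: smooth_closure.base)

lemma smooth_mult: "smooth f \<Longrightarrow> smooth g \<Longrightarrow> smooth (\<lambda>x. f x * g x)"
  by (rule smooth_closure_smooth, rule smooth_closure.mult) (auto intro: smooth_closure.base)

lemma smooth_inverse: "smooth f \<Longrightarrow> (\<And>x. f x \<noteq> 0) \<Longrightarrow> smooth (\<lambda>x. inverse (f x))"
  by (rule smooth_closure_smooth, rule smooth_closure.inverse) (auto intro: smooth_closure.base)

lemma smooth_linear:
  assumes "bounded_linear L" "smooth f"
  shows "smooth (\<lambda>x. L (f x))"
  by (rule smooth_coinduct[of _ "(\<lambda>f x. L (f x)) ` {f. smooth f}"])
     (use assms in \<open>auto intro!: smooth_vderiv bounded_linear.has_vector_derivative[OF assms(1)] smooth_has_vderiv\<close>)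

lemma smooth_affine:
  assumes "smooth f"
  shows "smooth (\<lambda>x. f (a + b * x))"
proof -
  let ?S = "{\<lambda>x. c *\<^sub>R g (a + b * x) | c g. smooth g}"
  have "(\<lambda>x. f (a + b * x)) = (\<lambda>x. 1 *\<^sub>R f (a + b * x))" by simp
  hence f: "(\<lambda>x. f (a + b * x)) \<in> ?S" using assms by blast
  show ?thesis
  proof (rule smooth_coinduct[OF f])
    fix g assume "g \<in> ?S"
    then obtain c k where g: "g = (\<lambda>x. c *\<^sub>R k (a + b * x))" and k: "smooth k" by blast
    have "((\<lambda>x. k (a + b * x)) has_vector_derivative b *\<^sub>R vderiv k (a + b * x)) (at x)" for x
    proof -
      have "((\<lambda>x. a + b * x) has_vector_derivative b) (at x)" by (auto intro!: derivative_eq_intros)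
      from vector_diff_chain_at[OF this smooth_has_vderiv[OF k]] show ?thesis by (simp add: o_def)
    qed
    hence "\<forall>x. (g has_vector_derivative (c * b) *\<^sub>R vderiv k (a + b * x)) (at x)"
      unfolding g by (auto intro!: derivative_eq_intros)
    thus "\<exists>g'\<in>?S. \<forall>x. (g has_vector_derivative g' x) (at x)"
      using smooth_vderiv[OF k] by (intro bexI[of _ "\<lambda>x. (c * b) *\<^sub>R vderiv k (a + b * x)"]) auto
  qed
qed

lemma smooth_cis: "smooth (\<lambda>x. cis (p * x))"
proof -
  let ?S = "range (\<lambda>c x. c * cis (p * x))"
  have f: "(\<lambda>x. cis (p * x)) \<in> ?S" by (rule range_eqI[of _ _ 1]) simp
  show ?thesis
  proof (rule smooth_coinduct[OF f])
    fix g assume "g \<in> ?S"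
    then obtain c where g: "g = (\<lambda>x. c * cis (p * x))" by blast
    have "((\<lambda>x. cis (p * x)) has_vector_derivative p *\<^sub>R (\<i> * cis (p * x))) (at x)" for x
    proof -
      have 1: "((\<lambda>x. p * x) has_vector_derivative p) (at x)" by (auto intro!: derivative_eq_intros)
      have 2: "(cis has_vector_derivative \<i> * cis (p * x)) (at (p * x))"
        using has_derivative_cis[of "\<lambda>x. x" id "p*x" UNIV]
        by (simp add: has_vector_derivative_def scaleR_conv_of_real mult_ac id_def)
      show ?thesis using vector_diff_chain_at[OF 1 2] by (simp add: o_def)
    qed
    hence "\<forall>x. (g has_vector_derivative (c * p * \<i>) * cis (p * x)) (at x)"
      unfolding g by (auto intro!: derivative_eq_intros simp: scaleR_conv_of_real)
    thus "\<exists>g'\<in>?S. \<forall>x. (g has_vector_derivative g' x) (at x)"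
      by (intro bexI[of _ "\<lambda>x. (c * p * \<i>) * cis (p * x)"] rangeI) auto
  qed
qed

lemma smooth_continuous: "smooth f \<Longrightarrow> continuous_on S f"
  by (intro continuous_at_imp_continuous_on ballI has_vector_derivative_continuous[OF smooth_has_vderiv])


subsection \<open>A smooth cutoff\<close>

text \<open>
  The functions \<open>P (1/x) exp (-1/x)\<close>, continued by zero; this family is closed under
  differentiation.
\<close>

definition expinv :: "real poly \<Rightarrow> real \<Rightarrow> complex" where
  "expinv P x = (if x > 0 then complex_of_real (poly P (inverse x) * exp (- inverse x)) else 0)"

lemma poly_exp_tendsto_0: "((\<lambda>y. poly P y * exp (- y)) \<longlongrightarrow> (0::real)) at_top"
proof -
  have "((\<lambda>y. \<Sum>i\<le>degree P. coeff P i * (y ^ i / exp y)) \<longlongrightarrow> (\<Sum>i\<le>degree P. coeff P i * 0)) at_top"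
    by (intro tendsto_sum tendsto_mult tendsto_const tendsto_power_div_exp_0)
  thus ?thesis by (simp add: poly_altdef exp_minus divide_inverse sum_distrib_right mult.assoc)
qed

lemma expinv_derivative:
  "(expinv P has_vector_derivative expinv ((P - pderiv P) * [:0, 0, 1:]) x) (at x)"
proof -
  consider "x > 0" | "x < 0" | "x = 0" by linarith
  thus ?thesis
  proof cases
    case 1
    have "((\<lambda>x. poly P (inverse x) * exp (- inverse x)) has_real_derivative
        poly ((P - pderiv P) * [:0, 0, 1:]) (inverse x) * exp (- inverse x)) (at x)"
      using 1 by (auto intro!: derivative_eq_intros poly_DERIV[THEN DERIV_chain2]
          simp: algebra_simps power2_eq_square)
    hence "((\<lambda>x. complex_of_real (poly P (inverse x) * exp (- inverse x))) has_vector_derivative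
        expinv ((P - pderiv P) * [:0, 0, 1:]) x) (at x)"
      using 1 unfolding expinv_def
      by (auto intro!: has_vector_derivative_of_real simp: has_real_derivative_iff_has_vector_derivative simp del: of_real_mult)
    thus ?thesis
    proof (rule has_vector_derivative_transform_within_open[of _ _ _ "{0<..}"])
      show "\<And>y. y \<in> {0<..} \<Longrightarrow> complex_of_real (poly P (inverse y) * exp (- inverse y)) = expinv P y"
        by (simp add: expinv_def)
    qed (use 1 in auto)
  next
    case 2
    have "((\<lambda>x. 0) has_vector_derivative expinv ((P - pderiv P) * [:0, 0, 1:]) x) (at x)"
      using 2 by (simp add: expinv_def)
    thus ?thesis
      by (rule has_vector_derivative_transform_within_open[of _ _ _ "{..<0}"]) (use 2 in \<open>auto simp: expinv_def\<close>)
  next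
    case 3
    have "((\<lambda>y. (expinv P y - expinv P 0) /\<^sub>R (y - 0)) \<longlongrightarrow> 0) (at 0)"
      unfolding at_within_def[symmetric] filterlim_at_split
    proof
      have "\<forall>\<^sub>F y in at_left 0. (expinv P y - expinv P 0) /\<^sub>R (y - 0) = 0"
        by (simp add: eventually_at_filter expinv_def)
      thus "((\<lambda>y. (expinv P y - expinv P 0) /\<^sub>R (y - 0)) \<longlongrightarrow> 0) (at_left 0)"
        by (rule tendsto_eventually)
      have "((\<lambda>y. poly (P * [:0, 1:]) (inverse y) * exp (- inverse y)) \<longlongrightarrow> 0) (at_right (0::real))"
        by (rule filterlim_compose[OF poly_exp_tendsto_0 filterlim_inverse_at_top_right])
      hence "((\<lambda>y. complex_of_real (poly (P * [:0, 1:]) (inverse y) * exp (- inverse y))) \<longlongrightarrow> 0) (at_right 0)"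
        by (metis of_real_0 tendsto_of_real)
      moreover have "\<forall>\<^sub>F y in at_right 0. complex_of_real (poly (P * [:0, 1:]) (inverse y) * exp (- inverse y))
          = (expinv P y - expinv P 0) /\<^sub>R (y - 0)"
        by (simp add: eventually_at_filter expinv_def scaleR_conv_of_real mult_ac)
      ultimately show "((\<lambda>y. (expinv P y - expinv P 0) /\<^sub>R (y - 0)) \<longlongrightarrow> 0) (at_right 0)"
        by (rule Lim_transform_eventually)
    qed
    from tendsto_norm_zero[OF this] have "(expinv P has_vector_derivative 0) (at 0)"
      unfolding has_vector_derivative_def has_derivative_iff_norm
      by (simp add: divide_inverse mult.commute)
    thus ?thesis using 3 by (simp add: expinv_def)
  qed
qed

lemma smooth_expinv: "smooth (expinv P)"
proof (rule smooth_coinduct[of _ "range expinv"])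
  fix g assume "g \<in> range expinv"
  then obtain P where "g = expinv P" by blast
  thus "\<exists>g'\<in>range expinv. \<forall>x. (g has_vector_derivative g' x) (at x)"
    using expinv_derivative by blast
qed simp

text \<open>A smooth function that is 0 for \<open>x \<le> 0\<close> and 1 for \<open>x \<ge> 1\<close>.\<close>

definition smooth_step :: "real \<Rightarrow> complex" where
  "smooth_step x = expinv 1 x * inverse (expinv 1 x + expinv 1 (1 + (- 1) * x))"

lemma smooth_smooth_step: "smooth smooth_step"
proof -
  have "expinv 1 x + expinv 1 (1 + (- 1) * x) \<noteq> 0" for x
  proof -
    have "expinv 1 x + expinv 1 (1 + (- 1) * x) =
        complex_of_real ((if x > 0 then exp (- inverse x) else 0) + (if x < 1 then exp (- inverse (1 - x)) else 0))"
      by (auto simp: expinv_def)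
    moreover have "(if x > 0 then exp (- inverse x) else 0) + (if x < 1 then exp (- inverse (1 - x)) else 0) > 0"
      by (auto simp: add_pos_pos)
    ultimately show ?thesis by (metis less_irrefl of_real_eq_0_iff)
  qed
  thus ?thesis unfolding smooth_step_def[abs_def]
    by (intro smooth_mult smooth_inverse smooth_add smooth_affine smooth_expinv) auto
qed

lemma smooth_step_0: "x \<le> 0 \<Longrightarrow> smooth_step x = 0"
  and smooth_step_1: "x \<ge> 1 \<Longrightarrow> smooth_step x = 1"
  by (auto simp: smooth_step_def expinv_def)

lemma cnj_smooth_step: "cnj (smooth_step x) = smooth_step x"
  by (auto simp: smooth_step_def expinv_def)

text \<open>A smooth function that is 1 on \<open>[-R, R]\<close> and 0 outside \<open>[-R-1, R+1]\<close>.\<close>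

definition cutoff :: "real \<Rightarrow> real \<Rightarrow> complex" where
  "cutoff R x = smooth_step ((R + 1) + 1 * x) * smooth_step ((R + 1) + (- 1) * x)"

lemma smooth_cutoff: "smooth (cutoff R)"
  unfolding cutoff_def[abs_def] by (intro smooth_mult smooth_affine smooth_smooth_step)

lemma cutoff_1: "\<bar>x\<bar> \<le> R \<Longrightarrow> cutoff R x = 1"
  by (auto simp: cutoff_def intro: smooth_step_1 simp: smooth_step_1)

lemma cutoff_0: "\<bar>x\<bar> \<ge> R + 1 \<Longrightarrow> cutoff R x = 0"
  by (cases "x \<ge> 0") (auto simp: cutoff_def smooth_step_0)

lemma cnj_cutoff: "cnj (cutoff R x) = cutoff R x"
  by (simp add: cutoff_def cnj_smooth_step)


subsection \<open>Test functions\<close>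

lemma supp_zero: "x \<notin> supp f \<Longrightarrow> f x = 0"
  using closure_subset[of "{x. f x \<noteq> 0}"] by (auto simp: supp_def)

lemma test_function_iff:
  "f \<in> \<D> \<longleftrightarrow> smooth f \<and> (\<exists>R. \<forall>x. \<bar>x\<bar> > R \<longrightarrow> f x = 0)"
proof -
  have "compact (supp f) \<longleftrightarrow> bounded {x. f x \<noteq> 0}"
    by (auto simp: supp_def compact_eq_bounded_closed intro: bounded_subset[OF _ closure_subset])
  also have "\<dots> \<longleftrightarrow> (\<exists>R. \<forall>x. \<bar>x\<bar> > R \<longrightarrow> f x = 0)"
    by (auto simp: bounded_iff not_less[symmetric])
  finally show ?thesis by (auto simp: test_functions_def)
qed

lemma test_functionI: "smooth f \<Longrightarrow> (\<And>x. \<bar>x\<bar> > R \<Longrightarrow> f x = 0) \<Longrightarrow> f \<in> \<D>"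
  by (auto simp: test_function_iff)

lemma test_functionE:
  assumes "f \<in> \<D>"
  obtains R where "R > 0" "\<And>x. \<bar>x\<bar> \<ge> R \<Longrightarrow> f x = 0"
proof -
  obtain R where R: "\<And>x. \<bar>x\<bar> > R \<Longrightarrow> f x = 0" using assms by (auto simp: test_function_iff)
  show ?thesis
  proof (rule that[of "\<bar>R\<bar> + 1"])
    fix x assume "\<bar>R\<bar> + 1 \<le> \<bar>x\<bar>"
    thus "f x = 0" by (intro R) linarith
  qed simp
qed

lemma test_function_smooth: "f \<in> \<D> \<Longrightarrow> smooth f"
  by (simp add: test_functions_def)

lemma test_function_add: "f \<in> \<D> \<Longrightarrow> g \<in> \<D> \<Longrightarrow> (\<lambda>x. f x + g x) \<in> \<D>"
proof -
  assume fg: "f \<in> \<D>" "g \<in> \<D>"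
  obtain R where "R > 0" "\<And>x. \<bar>x\<bar> \<ge> R \<Longrightarrow> f x = 0" using test_functionE[OF fg(1)] by blast
  moreover obtain R' where "R' > 0" "\<And>x. \<bar>x\<bar> \<ge> R' \<Longrightarrow> g x = 0" using test_functionE[OF fg(2)] by blast
  ultimately show ?thesis using fg
    by (intro test_functionI[where R="max R R'"]) (auto intro: smooth_add test_function_smooth)
qed

lemma test_function_mult: "smooth f \<Longrightarrow> g \<in> \<D> \<Longrightarrow> (\<lambda>x. f x * g x) \<in> \<D>"
  by (auto simp: test_function_iff intro: smooth_mult)

lemma test_function_linear: "bounded_linear L \<Longrightarrow> f \<in> \<D> \<Longrightarrow> (\<lambda>x. L (f x)) \<in> \<D>"
  unfolding test_function_iff by (metis bounded_linear.linear linear_0 smooth_linear)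

lemma test_function_scaleR: "f \<in> \<D> \<Longrightarrow> (\<lambda>x. r *\<^sub>R f x) \<in> \<D>"
  by (rule test_function_linear[OF bounded_linear_scaleR_right])

lemma test_function_minus: "f \<in> \<D> \<Longrightarrow> (\<lambda>x. - f x) \<in> \<D>"
  using test_function_scaleR[of f "-1"] by simp

lemma test_function_zero: "(\<lambda>x. 0) \<in> \<D>"
  by (rule test_functionI[OF smooth_const, of 0]) simp

lemma test_function_sum:
  "(\<And>i. i \<in> A \<Longrightarrow> f i \<in> \<D>) \<Longrightarrow> (\<lambda>x. \<Sum>i\<in>A. f i x) \<in> \<D>"
  by (induction A rule: infinite_finite_induct) (auto simp: test_function_zero test_function_add)

lemma test_function_Re: "f \<in> \<D> \<Longrightarrow> (\<lambda>x. complex_of_real (Re (f x))) \<in> \<D>"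
  by (rule test_function_linear[OF bounded_linear_compose[OF bounded_linear_of_real bounded_linear_Re]])

lemma test_function_Im: "f \<in> \<D> \<Longrightarrow> (\<lambda>x. complex_of_real (Im (f x))) \<in> \<D>"
  by (rule test_function_linear[OF bounded_linear_compose[OF bounded_linear_of_real bounded_linear_Im]])

lemma test_function_ext_derivative_zero:
  assumes "\<And>x. (f has_vector_derivative f' x) (at x)" "\<And>x. \<bar>x\<bar> > R \<Longrightarrow> f x = 0" "\<bar>x\<bar> > R"
  shows "f' x = 0"
proof -
  have "((\<lambda>x. 0) has_vector_derivative f' x) (at x)"
    by (rule has_vector_derivative_transform_within_open[OF assms(1)[of x], of "{x. \<bar>x\<bar> > R}"])
       (use assms in \<open>auto intro!: open_Collect_less continuous_intros\<close>)
  thus ?thesis by (metis has_vector_derivative_const vector_derivative_at)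
qed

lemma test_function_vderiv: "f \<in> \<D> \<Longrightarrow> vderiv f \<in> \<D>"
  using test_function_ext_derivative_zero[of f "vderiv f"] smooth_has_vderiv[of f] smooth_vderiv[of f]
  by (auto simp: test_function_iff)

lemma cutoff_test_function: "cutoff R \<in> \<D>"
  by (rule test_functionI[OF smooth_cutoff, of "R + 1"]) (simp add: cutoff_0)

lemma test_function_continuous: "f \<in> \<D> \<Longrightarrow> continuous_on S f"
  by (simp add: smooth_continuous test_function_smooth)

lemma test_function_measurable [measurable_dest]: "f \<in> \<D> \<Longrightarrow> f \<in> borel_measurable borel"
  by (intro borel_measurable_continuous_onI test_function_continuous)

lemma integrable_compact_support:
  fixes f :: "real \<Rightarrow> complex"
  assumes f: "continuous_on UNIV f" and R: "\<And>x. \<bar>x\<bar> > R \<Longrightarrow> f x = 0"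
  shows "integrable lborel f"
proof -
  have "integrable lborel (\<lambda>x. indicator {-R..R} x *\<^sub>R f x)"
    by (rule borel_integrable_compact) (auto intro: continuous_on_subset[OF f])
  also have "(\<lambda>x. indicator {-R..R} x *\<^sub>R f x) = f"
  proof
    fix x show "indicator {-R..R} x *\<^sub>R f x = f x"
      using R[of x] by (cases "\<bar>x\<bar> > R") (auto simp: indicator_def)
  qed
  finally show ?thesis .
qed

lemma test_function_integrable: "f \<in> \<D> \<Longrightarrow> integrable lborel f"
  by (auto simp: test_function_iff smooth_continuous intro: integrable_compact_support)

lemma test_function_integrable_mult:
  assumes "continuous_on UNIV g" "f \<in> \<D>"
  shows "integrable lborel (\<lambda>x. g x * f x)"
proof -
  obtain R where "\<And>x. \<bar>x\<bar> > R \<Longrightarrow> f x = 0" using assms(2) by (auto simp: test_function_iff)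
  thus ?thesis
    by (intro integrable_compact_support[of _ R] continuous_on_mult assms test_function_continuous) auto
qed

lemma integral_derivative_zero:
  fixes f :: "real \<Rightarrow> complex"
  assumes f: "\<And>x. (f has_vector_derivative f' x) (at x)" and R: "\<And>x. \<bar>x\<bar> > R \<Longrightarrow> f x = 0"
    and c: "continuous_on UNIV f'"
  shows "(LINT x|lborel. f' x) = 0"
proof -
  define S where "S = \<bar>R\<bar> + 1"
  have z: "f' x = 0" if "\<bar>x\<bar> > S" for x
    by (rule test_function_ext_derivative_zero[OF f R]) (use that in \<open>auto simp: S_def\<close>)
  have "(LINT x|lborel. indicator {-S..S} x *\<^sub>R f' x) = f S - f (-S)"
    by (rule integral_FTC_Icc) (auto simp: S_def intro: has_vector_derivative_at_within[OF f] continuous_on_subset[OF c])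
  also have "\<dots> = 0" using R[of S] R[of "-S"] by (auto simp: S_def)
  also have "(\<lambda>x. indicator {-S..S} x *\<^sub>R f' x) = f'"
  proof
    fix x show "indicator {-S..S} x *\<^sub>R f' x = f' x"
      using z[of x] by (cases "\<bar>x\<bar> > S") (auto simp: indicator_def)
  qed
  finally show ?thesis by simp
qed

lemma symp_add_right:
  assumes "f \<in> \<D>" "g \<in> \<D>" "h \<in> \<D>"
  shows "symp f (\<lambda>x. g x + h x) = symp f g + symp f h"
proof -
  have "continuous_on UNIV (\<lambda>x. cnj (f x))"
    by (intro continuous_intros test_function_continuous assms)
  thus ?thesis using assms unfolding symp_def
    by (simp add: distrib_left Bochner_Integration.integral_add test_function_integrable_mult)
qed

lemma symp_scale_right: "symp f (\<lambda>x. r *\<^sub>R g x) = r * symp f g"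
  by (simp add: symp_def scaleR_conv_of_real mult.left_commute)

lemma symp_commute: "symp f g = - symp g f"
proof -
  have "(LINT x|lborel. cnj (f x) * g x) = cnj (LINT x|lborel. cnj (g x) * f x)"
    unfolding Bochner_Integration.integral_cnj[symmetric] by (simp add: mult.commute)
  thus ?thesis by (simp add: symp_def)
qed

lemma symp_self: "symp f f = 0"
  using symp_commute[of f f] by simp

lemma symp_minus_right: "symp f (\<lambda>x. - g x) = - symp f g"
  using symp_scale_right[of f "-1" g] by simp

lemma symp_sum_right:
  assumes "f \<in> \<D>" "\<And>i. i \<in> A \<Longrightarrow> g i \<in> \<D>"
  shows "symp f (\<lambda>x. \<Sum>i\<in>A. g i x) = (\<Sum>i\<in>A. symp f (g i))"
  using assms(2)
proof (induction A rule: infinite_finite_induct)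
  case (insert a A)
  thus ?case using assms(1) by (simp add: symp_add_right test_function_sum)
qed (simp_all add: symp_def)


section \<open>Weak integrals of Hilbert space valued functions\<close>

lemma discriminant_le:
  fixes A B D :: real
  assumes "\<And>t. 0 \<le> A - 2 * t * D + t\<^sup>2 * B" "0 \<le> B"
  shows "D\<^sup>2 \<le> A * B"
proof (cases "B = 0")
  case True
  have "D = 0"
  proof (rule ccontr)
    assume "D \<noteq> 0"
    with True assms(1)[of "(A + 1) / (2 * D)"] show False by simp
  qed
  thus ?thesis using True by simp
next
  case False
  hence "B > 0" using assms(2) by simp
  have "0 \<le> A - 2 * (D / B) * D + (D / B)\<^sup>2 * B" by (rule assms)
  also have "\<dots> = A - D\<^sup>2 / B" using \<open>B > 0\<close> by (simp add: power2_eq_square field_simps)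
  finally show ?thesis using \<open>B > 0\<close> by (simp add: field_simps)
qed

lemma cauchy_schwarz_integral:
  fixes f g :: "'z \<Rightarrow> real"
  assumes "integrable M (\<lambda>x. (f x)\<^sup>2)" "integrable M (\<lambda>x. (g x)\<^sup>2)" "integrable M (\<lambda>x. f x * g x)"
  shows "(\<integral>x. f x * g x \<partial>M)\<^sup>2 \<le> (\<integral>x. (f x)\<^sup>2 \<partial>M) * (\<integral>x. (g x)\<^sup>2 \<partial>M)"
proof (rule discriminant_le)
  fix t
  have "0 \<le> (\<integral>x. (f x - t * g x)\<^sup>2 \<partial>M)" by simp
  also have "(\<lambda>x. (f x - t * g x)\<^sup>2) = (\<lambda>x. (f x)\<^sup>2 - 2 * t * (f x * g x) + t\<^sup>2 * (g x)\<^sup>2)"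
    by (auto simp: fun_eq_iff power2_eq_square algebra_simps)
  also have "(\<integral>x. (f x)\<^sup>2 - 2 * t * (f x * g x) + t\<^sup>2 * (g x)\<^sup>2 \<partial>M) =
      (\<integral>x. (f x)\<^sup>2 \<partial>M) - 2 * t * (\<integral>x. f x * g x \<partial>M) + t\<^sup>2 * (\<integral>x. (g x)\<^sup>2 \<partial>M)"
    using assms by simp
  finally show "0 \<le> (\<integral>x. (f x)\<^sup>2 \<partial>M) - 2 * t * (\<integral>x. f x * g x \<partial>M) + t\<^sup>2 * (\<integral>x. (g x)\<^sup>2 \<partial>M)" .
qed simp

text \<open>A Borel probability measure on a second countable space.\<close>

locale borel_prob = prob_space M for M :: "'z::second_countable_topology measure" +
  assumes sets_M: "sets M = sets borel"
begin

lemma space_M: "space M = UNIV"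
  using sets_eq_imp_space_eq[OF sets_M] by simp

lemma measurable_continuous: "continuous_on UNIV f \<Longrightarrow> f \<in> borel_measurable M"
  unfolding measurable_cong_sets[OF sets_M refl] by (rule borel_measurable_continuous_onI)

text \<open>Bounded continuous functions.\<close>

definition bcont :: "('z \<Rightarrow> 'h::real_normed_vector) \<Rightarrow> bool" where
  "bcont G \<longleftrightarrow> continuous_on UNIV G \<and> bounded (range G)"

lemma bcont_integrable:
  fixes f :: "'z \<Rightarrow> 'b::{banach,second_countable_topology}"
  assumes "bcont f"
  shows "integrable M f"
proof -
  obtain K where K: "\<And>x. norm (f x) \<le> K" using assms unfolding bcont_def bounded_iff by auto
  show ?thesis
    by (rule integrable_const_bound[of _ K]) (use K assms in \<open>auto simp: bcont_def measurable_continuous\<close>)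
qed

lemma bcont_indicator_integrable:
  fixes f :: "'z \<Rightarrow> 'b::{banach,second_countable_topology}"
  assumes "bcont f" "C \<in> sets M"
  shows "integrable M (\<lambda>x. indicator C x *\<^sub>R f x)"
  using bcont_integrable[OF assms(1)] assms(2) by (rule integrable_mult_indicator[rotated])

lemma bcont_diff: "bcont f \<Longrightarrow> bcont g \<Longrightarrow> bcont (\<lambda>x. f x - g x)"
  unfolding bcont_def by (auto intro!: continuous_intros bounded_minus_comp)

lemma bcont_const: "bcont (\<lambda>x. c)"
  unfolding bcont_def by auto

lemma bcont_linear: "bounded_linear T \<Longrightarrow> bcont f \<Longrightarrow> bcont (\<lambda>x. T (f x))"
  unfolding bcont_def
  using bounded_linear_image[of "range f" T] continuous_on_compose2[OF linear_continuous_on[of T UNIV]]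
  by (auto simp: image_image)

lemma bcont_cop: "cop T \<Longrightarrow> bcont f \<Longrightarrow> bcont (\<lambda>x. T (f x))"
  by (rule bcont_linear[OF cop_bounded_linear])

lemma bcont_cinner:
  fixes f g :: "'z \<Rightarrow> 'h::chilbert_space"
  assumes "bcont f" "bcont g"
  shows "bcont (\<lambda>x. cinner (f x) (g x))"
proof -
  obtain K where K: "\<And>x. norm (f x) \<le> K" using assms unfolding bcont_def bounded_iff by auto
  obtain L where L: "\<And>x. norm (g x) \<le> L" using assms unfolding bcont_def bounded_iff by auto
  have "cmod (cinner (f x) (g x)) \<le> K * L" for x
    by (rule order_trans[OF cmod_cinner_le mult_mono[OF K L]]) (auto intro: order_trans[OF norm_ge_zero K])
  hence "bounded (range (\<lambda>x. cinner (f x) (g x)))" unfolding bounded_iff by blast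
  thus ?thesis using assms unfolding bcont_def by (auto intro: continuous_on_cinner)
qed

lemma bcont_norm_sq:
  fixes f :: "'z \<Rightarrow> 'h::chilbert_space"
  shows "bcont f \<Longrightarrow> bcont (\<lambda>x. (norm (f x))\<^sup>2)"
  using bcont_linear[OF bounded_linear_Re bcont_cinner[of f f]] by (simp add: cinner_self del: of_real_power)

lemma bcont_norm:
  fixes f :: "'z \<Rightarrow> 'h::real_normed_vector"
  shows "bcont f \<Longrightarrow> bcont (\<lambda>x. norm (f x))"
  unfolding bcont_def by (auto intro!: continuous_intros simp: bounded_iff)

text \<open>
  The weak integral over \<open>C\<close>, defined through the Riesz theorem; the Hilbert space need not be
  separable.
\<close>

definition wint :: "'z set \<Rightarrow> ('z \<Rightarrow> 'h::chilbert_space) \<Rightarrow> 'h" where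
  "wint C G = (SOME x. \<forall>\<eta>. cinner \<eta> x = (\<integral>\<xi>. indicator C \<xi> *\<^sub>R cinner \<eta> (G \<xi>) \<partial>M))"

lemma cinner_wint:
  fixes G :: "'z \<Rightarrow> 'h::chilbert_space"
  assumes G: "bcont G" and C: "C \<in> sets M"
  shows "cinner \<eta> (wint C G) = (\<integral>\<xi>. indicator C \<xi> *\<^sub>R cinner \<eta> (G \<xi>) \<partial>M)"
proof -
  obtain K where K: "\<And>x. norm (G x) \<le> K" using G unfolding bcont_def bounded_iff by auto
  have int: "integrable M (\<lambda>\<xi>. indicator C \<xi> *\<^sub>R cinner (G \<xi>) \<eta>)" for \<eta>
    by (intro bcont_indicator_integrable bcont_cinner bcont_const G C)
  have bd: "cmod (\<integral>\<xi>. indicator C \<xi> *\<^sub>R cinner (G \<xi>) \<eta> \<partial>M) \<le> K * norm \<eta>" for \<eta>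
  proof -
    have "cmod (\<integral>\<xi>. indicator C \<xi> *\<^sub>R cinner (G \<xi>) \<eta> \<partial>M) \<le> (\<integral>\<xi>. K * norm \<eta> \<partial>M)"
    proof (rule order_trans[OF integral_norm_bound], rule integral_mono[OF integrable_norm[OF int]])
      fix \<xi>
      have "norm (indicator C \<xi> *\<^sub>R cinner (G \<xi>) \<eta>) \<le> cmod (cinner (G \<xi>) \<eta>)" by (simp add: indicator_def)
      also have "\<dots> \<le> K * norm \<eta>" by (rule order_trans[OF cmod_cinner_le mult_right_mono[OF K]]) simp
      finally show "norm (indicator C \<xi> *\<^sub>R cinner (G \<xi>) \<eta>) \<le> K * norm \<eta>" .
    qed simp
    thus ?thesis by (simp add: prob_space)
  qed
  obtain z where z: "\<And>\<eta>. (\<integral>\<xi>. indicator C \<xi> *\<^sub>R cinner (G \<xi>) \<eta> \<partial>M) = cinner z \<eta>"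
  proof (rule riesz[OF _ _ bd])
    show "(\<integral>\<xi>. indicator C \<xi> *\<^sub>R cinner (G \<xi>) (x + y) \<partial>M) =
        (\<integral>\<xi>. indicator C \<xi> *\<^sub>R cinner (G \<xi>) x \<partial>M) + (\<integral>\<xi>. indicator C \<xi> *\<^sub>R cinner (G \<xi>) y \<partial>M)" for x y
      by (simp only: cinner_add_right scaleR_add_right Bochner_Integration.integral_add[OF int int])
    show "(\<integral>\<xi>. indicator C \<xi> *\<^sub>R cinner (G \<xi>) (c *\<^sub>C x) \<partial>M) = c * (\<integral>\<xi>. indicator C \<xi> *\<^sub>R cinner (G \<xi>) x \<partial>M)" for c x
      by (simp add: cinner_scaleC_right mult_scaleR_right[symmetric] del: mult_scaleR_right)
  qed blast
  have "\<forall>\<eta>. cinner \<eta> z = (\<integral>\<xi>. indicator C \<xi> *\<^sub>R cinner \<eta> (G \<xi>) \<partial>M)"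
  proof
    fix \<eta>
    have "cinner \<eta> z = cnj (\<integral>\<xi>. indicator C \<xi> *\<^sub>R cinner (G \<xi>) \<eta> \<partial>M)"
      using z by (metis cinner_commute)
    also have "\<dots> = (\<integral>\<xi>. cnj (indicator C \<xi> *\<^sub>R cinner (G \<xi>) \<eta>) \<partial>M)"
      unfolding Bochner_Integration.integral_cnj ..
    also have "\<dots> = (\<integral>\<xi>. indicator C \<xi> *\<^sub>R cinner \<eta> (G \<xi>) \<partial>M)"
      by (intro Bochner_Integration.integral_cong refl) (simp add: cinner_commute[of _ \<eta>])
    finally show "cinner \<eta> z = (\<integral>\<xi>. indicator C \<xi> *\<^sub>R cinner \<eta> (G \<xi>) \<partial>M)" .
  qed
  from someI[of "\<lambda>x. \<forall>\<eta>. cinner \<eta> x = (\<integral>\<xi>. indicator C \<xi> *\<^sub>R cinner \<eta> (G \<xi>) \<partial>M)", OF this]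
  show ?thesis unfolding wint_def by blast
qed

lemma wint_diff:
  assumes "bcont G" "bcont G'" "C \<in> sets M"
  shows "wint C (\<lambda>\<xi>. G \<xi> - G' \<xi>) = wint C G - wint C G'"
proof (rule cinner_eqI)
  fix z
  have int: "integrable M (\<lambda>\<xi>. indicator C \<xi> *\<^sub>R cinner z (G \<xi>))" "integrable M (\<lambda>\<xi>. indicator C \<xi> *\<^sub>R cinner z (G' \<xi>))"
    by (intro bcont_indicator_integrable bcont_cinner bcont_const assms)+
  show "cinner z (wint C (\<lambda>\<xi>. G \<xi> - G' \<xi>)) = cinner z (wint C G - wint C G')"
    unfolding cinner.H_diff_right cinner_wint[OF assms(1,3)] cinner_wint[OF assms(2,3)]
      cinner_wint[OF bcont_diff[OF assms(1,2)] assms(3)] scaleR_diff_right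
    by (rule Bochner_Integration.integral_diff[OF int])
qed

lemma wint_const: "C \<in> sets M \<Longrightarrow> wint C (\<lambda>\<xi>. x) = prob C *\<^sub>R x"
  by (rule cinner_eqI)
     (simp add: cinner_wint bcont_const scaleR_eq_scaleC cinner_scaleC_right scaleR_conv_of_real mult.commute)

lemma cop_wint:
  assumes "cop T" "bcont G" "C \<in> sets M"
  shows "T (wint C G) = wint C (\<lambda>\<xi>. T (G \<xi>))"
  by (rule cinner_eqI)
     (simp add: cinner_wint assms bcont_cop flip: cinner_adj_left[OF assms(1)])

lemma norm_wint_le:
  fixes G :: "'z \<Rightarrow> 'h::chilbert_space"
  assumes G: "bcont G" and C: "C \<in> sets M"
  shows "(norm (wint C G))\<^sup>2 \<le> prob C * (\<integral>\<xi>. indicator C \<xi> * (norm (G \<xi>))\<^sup>2 \<partial>M)"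
proof -
  let ?x = "wint C G"
  have int1: "integrable M (\<lambda>\<xi>. indicator C \<xi> * norm (G \<xi>))"
    using bcont_indicator_integrable[OF bcont_norm[OF G] C] by simp
  have int2: "integrable M (\<lambda>\<xi>. indicator C \<xi> * (norm (G \<xi>))\<^sup>2)"
    using bcont_indicator_integrable[OF bcont_norm_sq[OF G] C] by simp
  have ind: "(indicator C \<xi> * a)\<^sup>2 = indicator C \<xi> * a\<^sup>2" "(indicator C \<xi>)\<^sup>2 = (indicator C \<xi> :: real)"
    "indicator C \<xi> * (indicator C \<xi> * a) = indicator C \<xi> * a" for a :: real and \<xi>
    by (auto simp: indicator_def)
  have "(norm ?x)\<^sup>2 = cmod (cinner ?x ?x)" unfolding cinner_self norm_of_real by simp
  also have "\<dots> \<le> (\<integral>\<xi>. norm ?x * (indicator C \<xi> * norm (G \<xi>)) \<partial>M)"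
    unfolding cinner_wint[OF G C]
  proof (rule order_trans[OF integral_norm_bound], rule integral_mono)
    show "integrable M (\<lambda>\<xi>. norm (indicator C \<xi> *\<^sub>R cinner ?x (G \<xi>)))"
      by (intro integrable_norm bcont_indicator_integrable bcont_cinner bcont_const G C)
    show "norm (indicator C \<xi> *\<^sub>R cinner ?x (G \<xi>)) \<le> norm ?x * (indicator C \<xi> * norm (G \<xi>))" for \<xi>
      using cmod_cinner_le[of ?x "G \<xi>"] by (simp add: indicator_def)
  qed (use int1 in simp)
  also have "\<dots> = norm ?x * (\<integral>\<xi>. indicator C \<xi> * norm (G \<xi>) \<partial>M)" by simp
  finally have *: "norm ?x * norm ?x \<le> norm ?x * (\<integral>\<xi>. indicator C \<xi> * norm (G \<xi>) \<partial>M)"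
    by (simp add: power2_eq_square)
  have "norm ?x \<le> (\<integral>\<xi>. indicator C \<xi> * norm (G \<xi>) \<partial>M)"
  proof (cases "?x = 0")
    case True
    thus ?thesis by (simp add: Bochner_Integration.integral_nonneg)
  next
    case False
    thus ?thesis using * by simp
  qed
  hence "(norm ?x)\<^sup>2 \<le> (\<integral>\<xi>. indicator C \<xi> * (indicator C \<xi> * norm (G \<xi>)) \<partial>M)\<^sup>2"
    by (simp add: ind)
  also have "\<dots> \<le> (\<integral>\<xi>. (indicator C \<xi>)\<^sup>2 \<partial>M) * (\<integral>\<xi>. (indicator C \<xi> * norm (G \<xi>))\<^sup>2 \<partial>M)"
    by (rule cauchy_schwarz_integral) (use int1 int2 bcont_indicator_integrable[OF bcont_const[of "1::real"] C] in \<open>simp_all add: ind\<close>)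
  also have "\<dots> = prob C * (\<integral>\<xi>. indicator C \<xi> * (norm (G \<xi>))\<^sup>2 \<partial>M)"
    using C by (simp add: ind)
  finally show ?thesis .
qed

lemma cinner_integral_cauchy_schwarz:
  fixes G G' :: "'z \<Rightarrow> 'h::chilbert_space"
  assumes "bcont G'" and "(\<lambda>\<xi>. cinner (G \<xi>) (G' \<xi>)) \<in> borel_measurable M"
    and "integrable M (\<lambda>\<xi>. (norm (G \<xi>))\<^sup>2)" "(\<lambda>\<xi>. norm (G \<xi>)) \<in> borel_measurable M" "bounded (range G)"
  shows "cmod (\<integral>\<xi>. cinner (G \<xi>) (G' \<xi>) \<partial>M) \<le>
     sqrt (\<integral>\<xi>. (norm (G \<xi>))\<^sup>2 \<partial>M) * sqrt (\<integral>\<xi>. (norm (G' \<xi>))\<^sup>2 \<partial>M)"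
proof -
  obtain K where K: "\<And>x. norm (G x) \<le> K" using assms(5) unfolding bounded_iff by auto
  obtain L where L: "\<And>x. norm (G' x) \<le> L" using assms(1) unfolding bcont_def bounded_iff by auto
  have m: "(\<lambda>\<xi>. norm (G' \<xi>)) \<in> borel_measurable M"
    using bcont_norm[OF assms(1)] by (simp add: bcont_def measurable_continuous)
  have le: "norm (G x) * norm (G' x) \<le> K * L" for x
    by (rule mult_mono[OF K L]) (auto intro: order_trans[OF norm_ge_zero K])
  have int: "integrable M (\<lambda>\<xi>. norm (G \<xi>) * norm (G' \<xi>))"
    by (rule integrable_const_bound[of _ "K * L"]) (use le m assms(4) in auto)
  have int': "integrable M (\<lambda>\<xi>. cinner (G \<xi>) (G' \<xi>))"
    by (rule integrable_const_bound[of _ "K * L"])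
       (use assms(2) in \<open>auto intro!: order_trans[OF cmod_cinner_le le]\<close>)
  have "cmod (\<integral>\<xi>. cinner (G \<xi>) (G' \<xi>) \<partial>M) \<le> (\<integral>\<xi>. norm (G \<xi>) * norm (G' \<xi>) \<partial>M)"
    by (rule order_trans[OF integral_norm_bound], rule integral_mono[OF integrable_norm[OF int'] int])
       (rule cmod_cinner_le)
  also have "\<dots> \<le> sqrt ((\<integral>\<xi>. (norm (G \<xi>))\<^sup>2 \<partial>M) * (\<integral>\<xi>. (norm (G' \<xi>))\<^sup>2 \<partial>M))"
    by (rule real_le_rsqrt, rule cauchy_schwarz_integral[OF assms(3) bcont_integrable[OF bcont_norm_sq[OF assms(1)]] int])
  finally show ?thesis by (simp add: real_sqrt_mult)
qed

text \<open>A continuous function is close to a finite-valued one outside a set of small measure.\<close>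

lemma simple_approximation:
  fixes F :: "'z \<Rightarrow> 'h::real_normed_vector"
  assumes F: "continuous_on UNIV F" and e: "e > 0"
  obtains n :: nat and C \<eta> where "\<And>i. C i \<in> sets M" "disjoint_family C"
    "\<And>i \<xi>. \<xi> \<in> C i \<Longrightarrow> norm (F \<xi> - \<eta> i) < e" "prob (UNIV - (\<Union>i<n. C i)) < e"
proof -
  define \<F> where "\<F> = range (\<lambda>\<xi>. F -` ball (F \<xi>) e)"
  have op: "open S" if "S \<in> \<F>" for S
    using that F unfolding \<F>_def by (auto intro: open_vimage)
  \<comment> \<open>Countably many preimages of balls cover the space, so finitely many have large probability.\<close>
  obtain \<G> where \<G>: "\<G> \<subseteq> \<F>" "countable \<G>" "\<Union>\<G> = \<Union>\<F>" using Lindelof[of \<F>] op by metis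
  have U: "\<Union>\<F> = UNIV" unfolding \<F>_def using e by force
  hence ne: "\<G> \<noteq> {}" using \<G>(3) by auto
  define O' where "O' = from_nat_into \<G>"
  have rO: "range O' = \<G>" unfolding O'_def using ne \<G>(2) by (rule range_from_nat_into)
  have "\<exists>\<xi>. O' k = F -` ball (F \<xi>) e" for k
  proof -
    have "O' k \<in> \<F>" using rO \<G>(1) by blast
    thus ?thesis unfolding \<F>_def by blast
  qed
  then obtain c where c: "\<And>k. O' k = F -` ball (F (c k)) e" by metis
  have om: "O' k \<in> sets M" for k
    unfolding sets_M using op rO \<G>(1) by (metis borel_open rangeI subsetD)
  define A where "A n = (\<Union>k<n. O' k)" for n
  have "(\<lambda>n. prob (A n)) \<longlonglongrightarrow> prob (\<Union>n. A n)"
    by (rule finite_Lim_measure_incseq) (use om in \<open>auto simp: A_def incseq_def intro: less_le_trans\<close>)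
  moreover have "(\<Union>n. A n) = UNIV"
  proof -
    have "(\<Union>n. A n) = \<Union>(range O')" unfolding A_def by auto
    thus ?thesis using rO \<G>(3) U by simp
  qed
  ultimately have "(\<lambda>n. prob (A n)) \<longlonglongrightarrow> 1" using prob_space space_M by simp
  hence "eventually (\<lambda>n. prob (A n) > 1 - e) sequentially" using e by (intro order_tendstoD(1)) auto
  then obtain n where n: "prob (A n) > 1 - e" by (auto simp: eventually_sequentially)
  show ?thesis
  proof (rule that[of "disjointed O'" "\<lambda>i. F (c i)" n])
    show "disjointed O' i \<in> sets M" for i using sets.range_disjointed_sets[of O' M] om by blast
    show "norm (F \<xi> - F (c i)) < e" if "\<xi> \<in> disjointed O' i" for i \<xi>
      using that disjointed_subset[of O' i] c[of i] by (auto simp: dist_norm norm_minus_commute)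
    have "(\<Union>i<n. disjointed O' i) = A n"
      unfolding A_def using finite_UN_disjointed_eq[of O' n] by (simp add: atLeast0LessThan)
    moreover have "prob (UNIV - A n) = 1 - prob (A n)"
      using prob_compl[of "A n"] om space_M unfolding A_def by auto
    ultimately show "prob (UNIV - (\<Union>i<n. disjointed O' i)) < e" using n by simp
  qed (rule disjoint_family_disjointed)
qed

end


section \<open>Independent Gaussian variables\<close>

text \<open>The law of a sequence of independent standard normal variables.\<close>

definition gauss :: "(nat \<Rightarrow> real) measure" where
  "gauss = Pi\<^sub>M UNIV (\<lambda>_. std_normal_distribution)"

lemma sets_gauss: "sets gauss = sets borel"
proof -
  have "sets gauss = sets (Pi\<^sub>M UNIV (\<lambda>_::nat. borel :: real measure))"
    unfolding gauss_def by (rule sets_PiM_cong) auto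
  thus ?thesis using sets_PiM_equal_borel by blast
qed

interpretation std_normal: prob_space std_normal_distribution
  by (rule prob_space_normal_density) simp

interpretation std_normals: product_prob_space "\<lambda>_::nat. std_normal_distribution" UNIV
  by unfold_locales

interpretation gauss: borel_prob gauss
proof (intro borel_prob.intro borel_prob_axioms.intro)
  show "prob_space gauss" unfolding gauss_def by (rule std_normals.prob_space_axioms)
qed (rule sets_gauss)

lemma gauss_prod:
  fixes f :: "nat \<Rightarrow> real \<Rightarrow> 'b::{real_normed_field,banach,second_countable_topology}"
  assumes A: "finite A" and f: "\<And>i. i \<in> A \<Longrightarrow> integrable std_normal_distribution (f i)"
  shows "(\<integral>\<xi>. (\<Prod>i\<in>A. f i (\<xi> i)) \<partial>gauss) = (\<Prod>i\<in>A. integral\<^sup>L std_normal_distribution (f i))"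
    and "integrable gauss (\<lambda>\<xi>. \<Prod>i\<in>A. f i (\<xi> i))"
proof -
  let ?P = "Pi\<^sub>M A (\<lambda>_. std_normal_distribution)"
  have d: "distr gauss ?P (\<lambda>x. restrict x A) = ?P"
    unfolding gauss_def by (rule std_normals.distr_PiM_restrict_finite[OF A]) simp
  have m: "(\<lambda>x. restrict x A) \<in> measurable gauss ?P"
    unfolding gauss_def by (rule measurable_restrict_subset) simp
  have int: "integrable ?P (\<lambda>x. \<Prod>i\<in>A. f i (x i))"
    by (rule std_normals.product_integrable_prod[OF A f])
  have meas: "(\<lambda>x. \<Prod>i\<in>A. f i (x i)) \<in> borel_measurable ?P" using int by simp
  have r: "(\<Prod>i\<in>A. f i (restrict \<xi> A i)) = (\<Prod>i\<in>A. f i (\<xi> i))" for \<xi> by (intro prod.cong) auto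
  have "integral\<^sup>L ?P (\<lambda>x. \<Prod>i\<in>A. f i (x i)) = integral\<^sup>L (distr gauss ?P (\<lambda>x. restrict x A)) (\<lambda>x. \<Prod>i\<in>A. f i (x i))"
    by (simp only: d)
  also have "\<dots> = (\<integral>\<xi>. (\<Prod>i\<in>A. f i (restrict \<xi> A i)) \<partial>gauss)" by (rule integral_distr[OF m meas])
  finally show "(\<integral>\<xi>. (\<Prod>i\<in>A. f i (\<xi> i)) \<partial>gauss) = (\<Prod>i\<in>A. integral\<^sup>L std_normal_distribution (f i))"
    using std_normals.product_integral_prod[OF A f] by (simp only: r)
  have "integrable (distr gauss ?P (\<lambda>x. restrict x A)) (\<lambda>x. \<Prod>i\<in>A. f i (x i))" using int by (simp only: d)
  thus "integrable gauss (\<lambda>\<xi>. \<Prod>i\<in>A. f i (\<xi> i))"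
    unfolding integrable_distr_eq[OF m meas] by (simp only: r)
qed

lemma gauss_char:
  "(\<integral>\<xi>. exp (\<i> * complex_of_real (\<Sum>j<n. \<xi> j * t j)) \<partial>gauss) = complex_of_real (exp (- (\<Sum>j<n. (t j)\<^sup>2) / 2))"
proof -
  have "exp (\<i> * complex_of_real (\<Sum>j<n. \<xi> j * t j)) = (\<Prod>j<n. iexp (t j * \<xi> j))" for \<xi> :: "nat \<Rightarrow> real"
    by (simp add: sum_distrib_left exp_sum mult.commute)
  hence "(\<integral>\<xi>. exp (\<i> * complex_of_real (\<Sum>j<n. \<xi> j * t j)) \<partial>gauss) =
      (\<integral>\<xi>. (\<Prod>j<n. iexp (t j * \<xi> j)) \<partial>gauss)" by simp
  also have "\<dots> = (\<Prod>j<n. \<integral>x. iexp (t j * x) \<partial>std_normal_distribution)"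
    by (rule gauss_prod) (auto intro!: std_normal.integrable_const_bound[of _ 1])
  also have "\<dots> = (\<Prod>j<n. complex_of_real (exp (- (t j)\<^sup>2 / 2)))"
    using char_std_normal_distribution by (simp add: char_def fun_eq_iff)
  also have "\<dots> = complex_of_real (exp (- (\<Sum>j<n. (t j)\<^sup>2) / 2))"
    by (simp add: exp_sum[symmetric] sum_negf sum_divide_distrib flip: of_real_prod)
  finally show ?thesis .
qed

lemma std_normal_odd:
  assumes "\<And>x. f (- x) = - f x" "f \<in> borel_measurable borel"
  shows "integral\<^sup>L std_normal_distribution f = (0::real)"
proof -
  have "integral\<^sup>L std_normal_distribution f = (\<integral>x. std_normal_density x * f x \<partial>lborel)"
    using assms(2) by (subst integral_density) (auto simp: normal_density_nonneg)
  also have "\<dots> = (\<integral>x. std_normal_density (- x) * f (- x) \<partial>lborel)"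
    using lborel_integral_real_affine[of "-1" "\<lambda>x. std_normal_density x * f x" 0] by simp
  also have "\<dots> = - (\<integral>x. std_normal_density x * f x \<partial>lborel)"
    by (simp add: assms(1) std_normal_density_def)
  also have "(\<integral>x. std_normal_density x * f x \<partial>lborel) = integral\<^sup>L std_normal_distribution f"
    using assms(2) by (subst integral_density) (auto simp: normal_density_nonneg)
  finally show ?thesis by simp
qed

text \<open>Restricting finitely many coordinates to a symmetric interval keeps them uncorrelated.\<close>

definition box :: "nat \<Rightarrow> real \<Rightarrow> (nat \<Rightarrow> real) set" where
  "box J d = {\<xi>. \<forall>j<J. \<bar>\<xi> j\<bar> \<le> d}"

lemma box_0: "box 0 d = UNIV"
  by (auto simp: box_def)

lemma box_sets: "box J d \<in> sets gauss"
proof -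
  have "box J d = (\<Inter>j\<in>{..<J}. {\<xi>. \<bar>\<xi> j\<bar> \<le> d}) \<inter> UNIV" by (auto simp: box_def)
  moreover have "closed {\<xi>::nat\<Rightarrow>real. \<bar>\<xi> j\<bar> \<le> d}" for j
    by (intro closed_Collect_le continuous_intros continuous_on_product_coordinates)
  hence "closed ((\<Inter>j\<in>{..<J}. {\<xi>::nat\<Rightarrow>real. \<bar>\<xi> j\<bar> \<le> d}) \<inter> UNIV)" by (intro closed_Int closed_INT) auto
  ultimately show ?thesis unfolding sets_gauss by simp
qed

lemma std_normal_interval_pos:
  assumes "d > 0"
  shows "0 < measure std_normal_distribution {-d..d}"
  proof (rule ccontr)
    assume "\<not> ?thesis"
    hence "measure std_normal_distribution {-d..d} = 0" using measure_nonneg[of std_normal_distribution "{-d..d}"] by linarith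
    hence "emeasure std_normal_distribution {-d..d} = 0" by (simp add: std_normal.emeasure_eq_measure)
    hence "(\<integral>\<^sup>+x. ennreal (std_normal_density x) * indicator {-d..d} x \<partial>lborel) = 0"
      by (simp add: emeasure_density)
    hence "AE x in lborel. ennreal (std_normal_density x) * indicator {-d..d} x = 0"
      by (subst (asm) nn_integral_0_iff_AE) auto
    hence "AE x in lborel. x \<notin> {-d..d}"
    proof (rule eventually_mono)
      fix x assume *: "ennreal (std_normal_density x) * indicator {-d..d} x = 0"
      show "x \<notin> {-d..d}"
      proof
        assume "x \<in> {-d..d}"
        with * normal_density_pos[of 1 0 x] show False by simp
      qed
    qed
    hence "emeasure lborel {-d..d} = 0"
      by (subst (asm) AE_iff_measurable[of "{-d..d}"]) auto
    thus False using assms by simp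
  qed

lemma gauss_box_moments:
  assumes d: "d > 0"
  shows "integrable gauss (\<lambda>\<xi>. indicator (box J d) \<xi> * (\<xi> i * \<xi> j))"
    and "i \<noteq> j \<Longrightarrow> (\<integral>\<xi>. indicator (box J d) \<xi> * (\<xi> i * \<xi> j) \<partial>gauss) = 0"
    and "(\<integral>\<xi>. indicator (box J d) \<xi> * (\<xi> i * \<xi> i) \<partial>gauss) \<le> (if i < J then d\<^sup>2 else 1) * measure gauss (box J d)"
    and "0 < measure gauss (box J d)"
proof -
  define g where "g l x = (if l < J then indicator {-d..d} x else (1::real))" for l :: nat and x :: real
  define N where "N = Suc (max J (max i j))"
  have lt: "i < N" "j < N" "J < N" by (auto simp: N_def)
  define f where "f i j l x = g l x * (if l = i then x else 1) * (if l = j then x else 1)" for i j l :: nat and x :: real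
  have gm [measurable]: "g l \<in> borel_measurable borel" for l unfolding g_def[abs_def] by measurable
  have g01: "0 \<le> g l x" "g l x \<le> 1" for l x by (auto simp: g_def indicator_def)
  have mom: "integrable std_normal_distribution (\<lambda>x. x ^ k)" for k :: nat
    by (rule integrable_std_normal_distribution_moment)
  have gk: "integrable std_normal_distribution (\<lambda>x. g l x * x ^ k)" for l k
  proof (rule Bochner_Integration.integrable_bound[OF mom[of k]])
    show "AE x in std_normal_distribution. norm (g l x * x ^ k) \<le> norm (x ^ k)"
      using g01 by (auto simp: abs_mult intro!: AE_I2 mult_left_le_one_le)
  qed measurable
  have fint: "integrable std_normal_distribution (f i j l)" for i j l
    unfolding f_def[abs_def] using gk[of l 0] gk[of l 1] gk[of l 2]
    by (cases "l = i"; cases "l = j") (auto simp: power2_eq_square mult.assoc)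
  have ind: "indicator (box J d) \<xi> = (\<Prod>l<N. g l (\<xi> l))" for \<xi>
  proof (cases "\<xi> \<in> box J d")
    case True
    hence "g l (\<xi> l) = 1" for l by (auto simp: g_def box_def indicator_def abs_le_iff)
    thus ?thesis using True by simp
  next
    case False
    then obtain l where "l < J" "\<bar>\<xi> l\<bar> > d" by (auto simp: box_def)
    hence "g l (\<xi> l) = 0" "l < N" using lt by (auto simp: g_def indicator_def)
    thus ?thesis using False by (auto intro!: prod_zero[symmetric])
  qed
  have prodf: "indicator (box J d) \<xi> * (\<xi> i' * \<xi> j') = (\<Prod>l<N. f i' j' l (\<xi> l))" if "i' < N" "j' < N" for \<xi> i' j'
    unfolding ind f_def prod.distrib using that by (simp add: prod.delta mult.assoc)
  show "integrable gauss (\<lambda>\<xi>. indicator (box J d) \<xi> * (\<xi> i * \<xi> j))"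
    unfolding prodf[OF lt(1,2)] by (rule gauss_prod) (auto intro: fint)
  have g_int: "integrable std_normal_distribution (g l)" for l using gk[of l 0] by simp
  have m: "measure gauss (box J d) = (\<Prod>l<N. integral\<^sup>L std_normal_distribution (g l))"
  proof -
    have "measure gauss (box J d) = (\<integral>\<xi>. indicator (box J d) \<xi> \<partial>gauss)" using box_sets by simp
    thus ?thesis unfolding ind using gauss_prod(1)[of "{..<N}" g] g_int by simp
  qed
  have gpos: "integral\<^sup>L std_normal_distribution (g l) > 0" for l
    using std_normal_interval_pos[OF d] std_normal.prob_space by (cases "l < J") (auto simp: g_def[abs_def])
  show "0 < measure gauss (box J d)" unfolding m by (intro prod_pos) (use gpos in auto)
  show "(\<integral>\<xi>. indicator (box J d) \<xi> * (\<xi> i * \<xi> j) \<partial>gauss) = 0" if "i \<noteq> j"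
  proof -
    have "(\<integral>\<xi>. indicator (box J d) \<xi> * (\<xi> i * \<xi> j) \<partial>gauss) = (\<Prod>l<N. integral\<^sup>L std_normal_distribution (f i j l))"
      unfolding prodf[OF lt(1,2)] by (rule gauss_prod) (auto intro: fint)
    moreover have "integral\<^sup>L std_normal_distribution (f i j i) = 0"
    proof (rule std_normal_odd)
      show "f i j i (- x) = - f i j i x" for x using that by (auto simp: f_def g_def indicator_def)
      show "f i j i \<in> borel_measurable borel" unfolding f_def[abs_def] by measurable
    qed
    ultimately show ?thesis using lt by (auto intro!: prod_zero)
  qed
  show "(\<integral>\<xi>. indicator (box J d) \<xi> * (\<xi> i * \<xi> i) \<partial>gauss) \<le> (if i < J then d\<^sup>2 else 1) * measure gauss (box J d)"
  proof -
    let ?c = "if i < J then d\<^sup>2 else 1"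
    have fi: "integral\<^sup>L std_normal_distribution (f i i i) \<le> ?c * integral\<^sup>L std_normal_distribution (g i)"
    proof (cases "i < J")
      case True
      have "integral\<^sup>L std_normal_distribution (f i i i) \<le> (\<integral>x. d\<^sup>2 * g i x \<partial>std_normal_distribution)"
      proof (rule integral_mono[OF fint])
        fix x show "f i i i x \<le> d\<^sup>2 * g i x"
          using True abs_le_square_iff[of x d] d by (auto simp: f_def g_def indicator_def power2_eq_square abs_le_iff)
      qed (use g_int in simp)
      thus ?thesis using True by simp
    next
      case False
      have "f i i i = (\<lambda>x. x ^ 2)" using False by (auto simp: f_def g_def power2_eq_square)
      moreover have "g i = (\<lambda>x. 1)" using False by (auto simp: g_def)
      ultimately show ?thesis using False std_normal_distribution_even_moments[of 1] std_normal.prob_space by simp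
    qed
    have "(\<integral>\<xi>. indicator (box J d) \<xi> * (\<xi> i * \<xi> i) \<partial>gauss) = (\<Prod>l<N. integral\<^sup>L std_normal_distribution (f i i l))"
      unfolding prodf[OF lt(1,1)] by (rule gauss_prod) (auto intro: fint)
    also have "\<dots> = integral\<^sup>L std_normal_distribution (f i i i) * (\<Prod>l\<in>{..<N} - {i}. integral\<^sup>L std_normal_distribution (f i i l))"
      using lt by (intro prod.remove) auto
    also have "(\<Prod>l\<in>{..<N} - {i}. integral\<^sup>L std_normal_distribution (f i i l)) = (\<Prod>l\<in>{..<N} - {i}. integral\<^sup>L std_normal_distribution (g l))"
      by (intro prod.cong refl arg_cong[of _ _ "integral\<^sup>L _"]) (auto simp: f_def)
    also have "integral\<^sup>L std_normal_distribution (f i i i) * (\<Prod>l\<in>{..<N} - {i}. integral\<^sup>L std_normal_distribution (g l)) \<le>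
        (?c * integral\<^sup>L std_normal_distribution (g i)) * (\<Prod>l\<in>{..<N} - {i}. integral\<^sup>L std_normal_distribution (g l))"
      by (intro mult_right_mono fi prod_nonneg) (use gpos in \<open>auto intro: less_imp_le\<close>)
    also have "\<dots> = ?c * measure gauss (box J d)"
      unfolding m using lt prod.remove[of "{..<N}" i "\<lambda>l. integral\<^sup>L std_normal_distribution (g l)"] by simp
    finally show ?thesis .
  qed
qed


section \<open>Weyl operators and Gaussian mixtures of coherent vectors\<close>

text \<open>
  A representation of the Weyl algebra with a vector \<open>\<Omega>\<close> that is Gaussian on a subspace \<open>E\<close> of the
  test functions, with covariance form \<open>B\<close>. Outside \<open>E\<close> nothing is assumed about \<open>\<Omega>\<close>; this covers
  the massless vacuum.
\<close>

locale weyl_vacuum =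
  fixes W :: "(real \<Rightarrow> complex) \<Rightarrow> 'a::cstar_algebra" and \<pi> :: "'a \<Rightarrow> 'h::chilbert_space \<Rightarrow> 'h"
    and \<Omega> :: 'h and E :: "(real \<Rightarrow> complex) set"
    and B :: "(real \<Rightarrow> complex) \<Rightarrow> (real \<Rightarrow> complex) \<Rightarrow> real"
  assumes weyl: "weyl_algebra W" and rep: "representation \<pi>" and unital: "\<pi> 1 x = x"
    and E_test: "f \<in> E \<Longrightarrow> f \<in> \<D>" and E_zero: "(\<lambda>x. 0) \<in> E"
    and E_add: "f \<in> E \<Longrightarrow> g \<in> E \<Longrightarrow> (\<lambda>x. f x + g x) \<in> E" and E_scale: "f \<in> E \<Longrightarrow> (\<lambda>x. r *\<^sub>R f x) \<in> E"
    and B_add: "f \<in> E \<Longrightarrow> g \<in> E \<Longrightarrow> k \<in> E \<Longrightarrow> B f (\<lambda>x. g x + k x) = B f g + B f k"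
    and B_scale: "f \<in> E \<Longrightarrow> g \<in> E \<Longrightarrow> B f (\<lambda>x. r *\<^sub>R g x) = r * B f g"
    and B_sym: "f \<in> E \<Longrightarrow> g \<in> E \<Longrightarrow> B f g = B g f"
    and B_nonneg: "f \<in> E \<Longrightarrow> 0 \<le> B f f"
    and vac: "f \<in> E \<Longrightarrow> cinner \<Omega> (\<pi> (W f) \<Omega>) = complex_of_real (exp (- B f f / 2))"

lemma weyl_mult:
  "weyl_algebra W \<Longrightarrow> f \<in> \<D> \<Longrightarrow> g \<in> \<D> \<Longrightarrow>
    W f * W g = exp (- (\<i> / 2) * complex_of_real (symp f g)) *\<^sub>C W (\<lambda>x. f x + g x)"
  and weyl_unitary: "weyl_algebra W \<Longrightarrow> f \<in> \<D> \<Longrightarrow> unitary (W f)"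
  by (auto simp: weyl_algebra_def)

lemma weyl_zero:
  assumes "weyl_algebra W"
  shows "W (\<lambda>x. 0) = 1"
proof -
  have "symp (\<lambda>x. 0) (\<lambda>x. 0) = 0" by (simp add: symp_def)
  hence "W (\<lambda>x. 0) * W (\<lambda>x. 0) = W (\<lambda>x. 0)"
    using weyl_mult[OF assms test_function_zero test_function_zero] by simp
  hence "cstar (W (\<lambda>x. 0)) * W (\<lambda>x. 0) * W (\<lambda>x. 0) = cstar (W (\<lambda>x. 0)) * W (\<lambda>x. 0)"
    by (simp add: mult.assoc)
  thus ?thesis using weyl_unitary[OF assms test_function_zero] by (simp add: unitary_def)
qed

lemma weyl_cstar:
  assumes "weyl_algebra W" "f \<in> \<D>"
  shows "cstar (W f) = W (\<lambda>x. - f x)"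
proof -
  have "symp f (\<lambda>x. - f x) = 0" by (simp add: symp_minus_right symp_self)
  hence "W f * W (\<lambda>x. - f x) = 1"
    using weyl_mult[OF assms test_function_minus[OF assms(2)]] weyl_zero[OF assms(1)] by simp
  hence "cstar (W f) * W f * W (\<lambda>x. - f x) = cstar (W f)" by (simp add: mult.assoc)
  thus ?thesis using weyl_unitary[OF assms] by (simp add: unitary_def)
qed

lemma weyl_commute:
  assumes "weyl_algebra W" "f \<in> \<D>" "g \<in> \<D>"
  shows "W f * W g = exp (- \<i> * complex_of_real (symp f g)) *\<^sub>C (W g * W f)"
proof -
  have "W f * W g = exp (- (\<i> / 2) * complex_of_real (symp f g)) *\<^sub>C W (\<lambda>x. f x + g x)"
    by (rule weyl_mult[OF assms])
  moreover have "W g * W f = exp ((\<i> / 2) * complex_of_real (symp f g)) *\<^sub>C W (\<lambda>x. f x + g x)"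
    using weyl_mult[OF assms(1,3,2)] by (simp add: symp_commute[of g f] add.commute)
  ultimately show ?thesis by (simp add: scaleC_scaleC flip: exp_add)
qed

lemma unitary_norm:
  assumes "representation \<pi>" "\<And>x. \<pi> 1 x = x" "unitary u"
  shows "norm (\<pi> u x) = norm x"
proof -
  have "cinner (\<pi> u x) (\<pi> u x) = cinner x x"
    using assms by (simp add: cinner_rep_left representation_mult[symmetric] unitary_def)
  hence "(norm (\<pi> u x))\<^sup>2 = (norm x)\<^sup>2" unfolding cinner_self of_real_eq_iff .
  thus ?thesis by (simp add: power2_eq_iff_nonneg)
qed

context weyl_vacuum
begin

abbreviation U :: "(real \<Rightarrow> complex) \<Rightarrow> 'h \<Rightarrow> 'h" where "U f \<equiv> \<pi> (W f)"

lemma U_norm: "f \<in> \<D> \<Longrightarrow> norm (U f x) = norm x"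
  by (rule unitary_norm[OF rep unital weyl_unitary[OF weyl]])

lemma U_cop: "cop (U f)"
  by (rule representation_cop[OF rep])

lemma norm_Omega: "norm \<Omega> = 1"
proof -
  have "B (\<lambda>x. 0) (\<lambda>x. 0) = 0" using B_scale[OF E_zero E_zero, of 0] by simp
  hence "cinner \<Omega> \<Omega> = 1" using vac[OF E_zero] weyl_zero[OF weyl] unital by simp
  hence "(norm \<Omega>)\<^sup>2 = 1" unfolding cinner_self by (metis of_real_eq_1_iff)
  thus ?thesis by (simp add: power2_eq_1_iff) (metis norm_ge_zero neg_0_le_iff_le not_one_le_zero)
qed

lemma U_add:
  assumes "f \<in> \<D>" "g \<in> \<D>"
  shows "U (\<lambda>x. f x + g x) x = exp ((\<i> / 2) * complex_of_real (symp f g)) *\<^sub>C U f (U g x)"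
  unfolding representation_mult[OF rep, symmetric] weyl_mult[OF weyl assms] representation_scaleC[OF rep]
  by (simp add: scaleC_scaleC flip: exp_add)

lemma shift_small:
  assumes D: "D \<in> E"
  shows "norm (U D \<Omega> - \<Omega>) \<le> sqrt (B D D)"
proof (rule real_le_rsqrt)
  have "(norm (U D \<Omega> - \<Omega>))\<^sup>2 = Re (cinner (U D \<Omega> - \<Omega>) (U D \<Omega> - \<Omega>))" by (simp add: cinner_self)
  also have "\<dots> = Re (cinner (U D \<Omega>) (U D \<Omega>)) + Re (cinner \<Omega> \<Omega>) - 2 * Re (cinner \<Omega> (U D \<Omega>))"
    using cinner_commute[of "U D \<Omega>" \<Omega>] by (simp only: cinner.H_diff_left cinner.H_diff_right) simp
  also have "\<dots> = 2 - 2 * exp (- B D D / 2)"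
    by (simp add: vac D U_norm E_test norm_Omega cinner_self)
  also have "\<dots> \<le> B D D" using exp_ge_add_one_self[of "- B D D / 2"] by simp
  finally show "(norm (U D \<Omega> - \<Omega>))\<^sup>2 \<le> B D D" .
qed

text \<open>
  Shifts by elements that are small in the vacuum norm nearly commute with a fixed \<open>U k\<close>: they
  nearly fix \<open>\<Omega>\<close>, on both sides of the nonzero matrix element of \<open>U k\<close>. This replaces the
  bound of the symplectic form by the vacuum form.
\<close>

lemma symp_small:
  assumes D: "D \<in> E" and k: "k \<in> E"
  shows "cmod (exp (\<i> * complex_of_real (symp D k)) - 1) \<le> 2 * exp (B k k / 2) * sqrt (B D D)"
proof -
  note DD = E_test[OF D] note kD = E_test[OF k]
  let ?q = "complex_of_real (exp (- B k k / 2))" and ?e = "exp (\<i> * complex_of_real (symp D k))"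
  let ?A = "cinner \<Omega> (U D (U k \<Omega>))" and ?Bb = "cinner \<Omega> (U k (U D \<Omega>))"
  have kk: "cinner \<Omega> (U k \<Omega>) = ?q" by (rule vac[OF k])
  have mD: "(\<lambda>x. - D x) \<in> E" using E_scale[OF D, of "-1"] by simp
  have BmD: "B (\<lambda>x. - D x) (\<lambda>x. - D x) = B D D"
    using B_scale[OF mD D, of "-1"] B_scale[OF D D, of "-1"] B_sym[OF mD D] by simp
  have A: "cmod (?A - ?q) \<le> sqrt (B D D)"
  proof -
    have "?A - ?q = cinner (U (\<lambda>x. - D x) \<Omega> - \<Omega>) (U k \<Omega>)"
      by (simp add: cinner.H_diff_left kk cinner_rep_right[OF rep, of _ "W D"] weyl_cstar[OF weyl DD])
    also have "cmod \<dots> \<le> norm (U (\<lambda>x. - D x) \<Omega> - \<Omega>) * norm (U k \<Omega>)" by (rule cmod_cinner_le)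
    also have "\<dots> \<le> sqrt (B D D)" using shift_small[OF mD] by (simp add: BmD U_norm kD norm_Omega)
    finally show ?thesis .
  qed
  have Bb: "cmod (?Bb - ?q) \<le> sqrt (B D D)"
  proof -
    have "?Bb - ?q = cinner (U (\<lambda>x. - k x) \<Omega>) (U D \<Omega> - \<Omega>)"
    proof -
      have "cinner (U (\<lambda>x. - k x) \<Omega>) y = cinner \<Omega> (U k y)" for y
        by (simp add: weyl_cstar[OF weyl kD, symmetric] cinner_rep_left[OF rep] cstar_cstar)
      thus ?thesis by (simp add: cinner.H_diff_right kk)
    qed
    also have "cmod \<dots> \<le> norm (U (\<lambda>x. - k x) \<Omega>) * norm (U D \<Omega> - \<Omega>)" by (rule cmod_cinner_le)
    also have "\<dots> \<le> sqrt (B D D)"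
      using shift_small[OF D] by (simp add: U_norm test_function_minus kD norm_Omega)
    finally show ?thesis .
  qed
  have BA: "?Bb = ?e * ?A"
    unfolding representation_mult[OF rep, symmetric] weyl_commute[OF weyl DD kD] representation_scaleC[OF rep]
    by (simp add: cinner_scaleC_right flip: exp_add mult.assoc)
  have "cmod ((?e - 1) * ?q) = cmod (?e * (?q - ?A) + (?Bb - ?q))"
    by (rule arg_cong[of _ _ cmod]) (simp add: BA algebra_simps)
  also have "\<dots> \<le> cmod (?q - ?A) + cmod (?Bb - ?q)"
    by (rule order_trans[OF norm_triangle_ineq]) (simp add: norm_mult)
  also have "\<dots> \<le> 2 * sqrt (B D D)" using A Bb by (simp add: norm_minus_commute)
  finally have "cmod (?e - 1) * exp (- B k k / 2) \<le> 2 * sqrt (B D D)" by (simp add: norm_mult)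
  hence "cmod (?e - 1) * exp (- B k k / 2) * exp (B k k / 2) \<le> 2 * sqrt (B D D) * exp (B k k / 2)"
    by (rule mult_right_mono) simp
  moreover have "exp (- B k k / 2) * exp (B k k / 2) = 1" by (simp flip: exp_add)
  ultimately show ?thesis by (simp only: mult.assoc mult_1_right mult.commute[of "exp (B k k / 2)"])
qed

text \<open>Apply \<open>symp_small\<close> to \<open>h / 2\<close>.\<close>

lemma shift_continuous:
  assumes h: "h \<in> E" and D: "D \<in> E"
  shows "norm (U (\<lambda>x. h x + D x) \<Omega> - U h \<Omega>) \<le> (2 * exp (B h h / 8) + 1) * sqrt (B D D)"
proof -
  note DD = E_test[OF D] note hD = E_test[OF h]
  let ?k = "\<lambda>x. (1/2) *\<^sub>R h x"
  let ?c = "exp ((\<i> / 2) * complex_of_real (symp h D))"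
  have k: "?k \<in> E" by (rule E_scale[OF h])
  have Bk: "B ?k ?k = B h h / 4"
    using B_scale[OF k h, of "1/2"] B_scale[OF h h, of "1/2"] B_sym[OF k h] by simp
  have "symp D ?k = symp D h / 2" using symp_scale_right[of D "1/2" h] by simp
  hence sy: "symp h D = - 2 * symp D ?k" using symp_commute[of h D] by simp
  have c1: "cmod (?c - 1) \<le> 2 * exp (B h h / 8) * sqrt (B D D)"
  proof -
    have "?c = cnj (exp (\<i> * complex_of_real (symp D ?k)))"
      by (simp add: sy exp_cnj)
    hence "cmod (?c - 1) = cmod (exp (\<i> * complex_of_real (symp D ?k)) - 1)"
      by (metis complex_cnj_diff complex_cnj_one complex_mod_cnj)
    thus ?thesis using symp_small[OF D k] by (simp add: Bk)
  qed
  have "U (\<lambda>x. h x + D x) \<Omega> - U h \<Omega> = U h (?c *\<^sub>C U D \<Omega> - \<Omega>)"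
    by (simp add: U_add hD DD cop_diff[OF U_cop] cop_scaleC[OF U_cop])
  hence "norm (U (\<lambda>x. h x + D x) \<Omega> - U h \<Omega>) = norm (?c *\<^sub>C U D \<Omega> - \<Omega>)" by (simp add: U_norm hD)
  also have "?c *\<^sub>C U D \<Omega> - \<Omega> = ?c *\<^sub>C (U D \<Omega> - \<Omega>) + (?c - 1) *\<^sub>C \<Omega>"
    by (simp add: scaleC_diff_right scaleC_diff_left)
  also have "norm \<dots> \<le> norm (U D \<Omega> - \<Omega>) + cmod (?c - 1)"
    by (rule order_trans[OF norm_triangle_ineq]) (simp add: norm_scaleC_h norm_Omega)
  also have "\<dots> \<le> sqrt (B D D) + 2 * exp (B h h / 8) * sqrt (B D D)"
    by (intro add_mono shift_small D c1)
  finally show ?thesis by (simp add: algebra_simps)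
qed

end

text \<open>
  A sequence of shifts \<open>h j\<close> with summable vacuum norms, to be weighted by independent Gaussian
  variables.
\<close>

locale gaussian_mixture = weyl_vacuum +
  fixes h :: "nat \<Rightarrow> real \<Rightarrow> complex"
  assumes h_E: "h j \<in> E" and h_sum: "summable (\<lambda>j. B (h j) (h j))"
begin

text \<open>The random shift formed from the indices in \<open>S\<close>, and the shifted vacuum.\<close>

definition hs :: "nat set \<Rightarrow> (nat \<Rightarrow> real) \<Rightarrow> real \<Rightarrow> complex" where
  "hs S \<xi> = (\<lambda>x. \<Sum>j\<in>S. \<xi> j *\<^sub>R h j x)"

definition F :: "nat \<Rightarrow> (nat \<Rightarrow> real) \<Rightarrow> _" where
  "F J \<xi> = U (hs {..<J} \<xi>) \<Omega>"

lemma hs_E: "hs S \<xi> \<in> E"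
  unfolding hs_def
  by (induction S rule: infinite_finite_induct) (auto simp: E_zero E_add E_scale h_E)

lemma hs_D: "hs S \<xi> \<in> \<D>"
  by (rule E_test[OF hs_E])

lemma B_sum_right:
  assumes "f \<in> E"
  shows "B f (hs S \<xi>) = (\<Sum>j\<in>S. \<xi> j * B f (h j))"
proof (induction S rule: infinite_finite_induct)
  case (insert j S)
  have "hs (insert j S) \<xi> = (\<lambda>x. \<xi> j *\<^sub>R h j x + hs S \<xi> x)" using insert by (simp add: hs_def)
  thus ?case using insert B_add[OF assms E_scale[OF h_E[of j], of "\<xi> j"] hs_E[of S \<xi>]] B_scale[OF assms h_E] by simp
next
  case empty
  show ?case using B_scale[OF assms assms, of 0] by (simp add: hs_def)
next
  case (infinite S)
  thus ?case using B_scale[OF assms assms, of 0] by (simp add: hs_def)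
qed

lemma B_hs: "B (hs S \<xi>) (hs S \<xi>) = (\<Sum>i\<in>S. \<Sum>j\<in>S. \<xi> i * \<xi> j * B (h i) (h j))"
proof -
  have "B (hs S \<xi>) (hs S \<xi>) = (\<Sum>j\<in>S. \<xi> j * B (h j) (hs S \<xi>))"
    unfolding B_sum_right[OF hs_E] by (simp add: B_sym[OF hs_E h_E])
  also have "\<dots> = (\<Sum>j\<in>S. \<Sum>i\<in>S. \<xi> j * \<xi> i * B (h j) (h i))"
    by (simp add: B_sum_right h_E sum_distrib_left mult.assoc)
  finally show ?thesis .
qed

lemma F_norm: "norm (F J \<xi>) = 1"
  by (simp add: F_def U_norm hs_D norm_Omega)

lemma F_continuous: "continuous_on UNIV (F J)"
  unfolding continuous_on_eq_continuous_at[OF open_UNIV]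
proof (intro ballI)
  fix \<xi> :: "nat \<Rightarrow> real"
  have bound: "norm (F J \<xi>' - F J \<xi>) \<le> (2 * exp (B (hs {..<J} \<xi>) (hs {..<J} \<xi>) / 8) + 1) *
      sqrt (\<Sum>i<J. \<Sum>j<J. (\<xi>' i - \<xi> i) * (\<xi>' j - \<xi> j) * B (h i) (h j))" for \<xi>'
  proof -
    have "hs {..<J} \<xi>' = (\<lambda>x. hs {..<J} \<xi> x + hs {..<J} (\<lambda>j. \<xi>' j - \<xi> j) x)"
      by (simp add: hs_def scaleR_diff_left sum_subtractf)
    thus ?thesis unfolding F_def
      using shift_continuous[OF hs_E[of "{..<J}" \<xi>] hs_E[of "{..<J}" "\<lambda>j. \<xi>' j - \<xi> j"]]
      by (simp add: B_hs[of "{..<J}" "\<lambda>j. \<xi>' j - \<xi> j"])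
  qed
  have coord: "((\<lambda>\<xi>'. \<xi>' i) \<longlongrightarrow> \<xi> i) (at \<xi>)" for i
  proof -
    have "continuous_on UNIV (\<lambda>\<xi>'::nat \<Rightarrow> real. \<xi>' i)" by (rule continuous_on_product_coordinates)
    thus ?thesis unfolding continuous_on_def by simp
  qed
  have "((\<lambda>\<xi>'. (2 * exp (B (hs {..<J} \<xi>) (hs {..<J} \<xi>) / 8) + 1) *
      sqrt (\<Sum>i<J. \<Sum>j<J. (\<xi>' i - \<xi> i) * (\<xi>' j - \<xi> j) * B (h i) (h j))) \<longlongrightarrow>
      (2 * exp (B (hs {..<J} \<xi>) (hs {..<J} \<xi>) / 8) + 1) *
      sqrt (\<Sum>i<J. \<Sum>j<J. (\<xi> i - \<xi> i) * (\<xi> j - \<xi> j) * B (h i) (h j))) (at \<xi>)"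
    by (intro tendsto_intros coord)
  hence "((\<lambda>\<xi>'. (2 * exp (B (hs {..<J} \<xi>) (hs {..<J} \<xi>) / 8) + 1) *
      sqrt (\<Sum>i<J. \<Sum>j<J. (\<xi>' i - \<xi> i) * (\<xi>' j - \<xi> j) * B (h i) (h j))) \<longlongrightarrow> 0) (at \<xi>)" by simp
  hence "((\<lambda>\<xi>'. F J \<xi>' - F J \<xi>) \<longlongrightarrow> 0) (at \<xi>)"
    by (rule Lim_null_comparison[rotated]) (use bound in \<open>auto intro: always_eventually\<close>)
  thus "isCont (F J) \<xi>" by (simp add: isCont_def LIM_zero_iff)
qed

lemma F_bcont: "gauss.bcont (F J)"
  unfolding gauss.bcont_def using F_continuous by (auto simp: bounded_iff F_norm)

text \<open>The energies of the shifts.\<close>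

definition b :: "nat \<Rightarrow> real" where "b j = B (h j) (h j)"

lemma b_nonneg: "0 \<le> b j"
  by (simp add: b_def B_nonneg h_E)

lemma b_summable: "summable b"
  using h_sum by (simp add: b_def[abs_def])

lemma B_hs_box:
  assumes "d > 0" "finite S"
  shows "(\<integral>\<xi>. indicator (box J d) \<xi> * B (hs S \<xi>) (hs S \<xi>) \<partial>gauss) \<le>
      measure gauss (box J d) * (\<Sum>j\<in>S. (if j < J then d\<^sup>2 else 1) * b j)"
    and "integrable gauss (\<lambda>\<xi>. indicator (box J d) \<xi> * B (hs S \<xi>) (hs S \<xi>))"
proof -
  note int = gauss_box_moments(1)[OF assms(1), of J]
  have eq: "indicator (box J d) \<xi> * B (hs S \<xi>) (hs S \<xi>) =
      (\<Sum>i\<in>S. \<Sum>j\<in>S. indicator (box J d) \<xi> * (\<xi> i * \<xi> j) * B (h i) (h j))" for \<xi>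
    unfolding B_hs by (simp add: sum_distrib_left mult.assoc)
  show "integrable gauss (\<lambda>\<xi>. indicator (box J d) \<xi> * B (hs S \<xi>) (hs S \<xi>))"
    unfolding eq by (intro Bochner_Integration.integrable_sum integrable_mult_left int)
  have "(\<integral>\<xi>. indicator (box J d) \<xi> * B (hs S \<xi>) (hs S \<xi>) \<partial>gauss) =
      (\<Sum>i\<in>S. \<Sum>j\<in>S. (\<integral>\<xi>. indicator (box J d) \<xi> * (\<xi> i * \<xi> j) \<partial>gauss) * B (h i) (h j))"
    unfolding eq
    by (subst Bochner_Integration.integral_sum, intro Bochner_Integration.integrable_sum integrable_mult_left int,
        subst Bochner_Integration.integral_sum, intro integrable_mult_left int, simp)
  also have "\<dots> = (\<Sum>i\<in>S. (\<integral>\<xi>. indicator (box J d) \<xi> * (\<xi> i * \<xi> i) \<partial>gauss) * b i)"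
  proof (rule sum.cong[OF refl])
    fix i assume i: "i \<in> S"
    have "(\<Sum>j\<in>S. (\<integral>\<xi>. indicator (box J d) \<xi> * (\<xi> i * \<xi> j) \<partial>gauss) * B (h i) (h j)) =
        (\<Sum>j\<in>S. if j = i then (\<integral>\<xi>. indicator (box J d) \<xi> * (\<xi> i * \<xi> i) \<partial>gauss) * b i else 0)"
      by (intro sum.cong refl) (auto simp: gauss_box_moments(2)[OF assms(1)] b_def)
    thus "(\<Sum>j\<in>S. (\<integral>\<xi>. indicator (box J d) \<xi> * (\<xi> i * \<xi> j) \<partial>gauss) * B (h i) (h j)) =
        (\<integral>\<xi>. indicator (box J d) \<xi> * (\<xi> i * \<xi> i) \<partial>gauss) * b i"
      using i assms(2) by simp
  qed
  also have "\<dots> \<le> (\<Sum>i\<in>S. (if i < J then d\<^sup>2 else 1) * measure gauss (box J d) * b i)"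
    by (intro sum_mono mult_right_mono gauss_box_moments(3)[OF assms(1)] b_nonneg)
  finally show "(\<integral>\<xi>. indicator (box J d) \<xi> * B (hs S \<xi>) (hs S \<xi>) \<partial>gauss) \<le>
      measure gauss (box J d) * (\<Sum>j\<in>S. (if j < J then d\<^sup>2 else 1) * b j)"
    by (simp add: sum_distrib_left mult_ac)
qed

lemma B_hs_mean:
  assumes "finite S"
  shows "(\<integral>\<xi>. B (hs S \<xi>) (hs S \<xi>) \<partial>gauss) \<le> (\<Sum>j\<in>S. b j)"
    and "integrable gauss (\<lambda>\<xi>. B (hs S \<xi>) (hs S \<xi>))"
  using B_hs_box[of 1 S 0] assms gauss.prob_space gauss.space_M by (simp_all add: box_0)

text \<open>
  The shifted vacua converge in the mean square: where the energy of the first \<open>J\<close> shifts is at most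
  \<open>R\<close>, \<open>shift_continuous\<close> applies; elsewhere the trivial bound 2 is used together with Markov's
  inequality.
\<close>

lemma F_Cauchy:
  assumes e: "e > 0"
  obtains N where "\<And>J K. J \<ge> N \<Longrightarrow> K \<ge> N \<Longrightarrow> (\<integral>\<xi>. (norm (F J \<xi> - F K \<xi>))\<^sup>2 \<partial>gauss) < e"
proof -
  define T where "T = suminf b"
  have T: "(\<Sum>j\<in>S. b j) \<le> T" if "finite S" for S
    unfolding T_def using sum_le_suminf[OF b_summable that] b_nonneg by blast
  have T0: "T \<ge> 0" using T[of "{}"] by simp
  define R where "R = 16 * (T + 1) / e"
  have R: "R > 0" "4 * T / R < e / 2"
    using e T0 by (auto simp: R_def field_simps intro!: add_pos_nonneg)
  define c where "c = (2 * exp (R / 8) + 1)\<^sup>2"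
  have "0 < 2 * exp (R / 8) + 1" by (simp add: add_pos_pos)
  hence c: "c > 0" unfolding c_def by (intro zero_less_power)
  have "\<exists>N. \<forall>m\<ge>N. \<forall>n. norm (sum b {m..<n}) < e / (2 * c)"
    using b_summable e c unfolding summable_Cauchy by simp
  then obtain N where N: "\<And>m n. m \<ge> N \<Longrightarrow> sum b {m..<n} < e / (2 * c)"
    using b_nonneg by (auto simp: sum_nonneg)
  have main: "(\<integral>\<xi>. (norm (F K \<xi> - F J \<xi>))\<^sup>2 \<partial>gauss) < e" if JK: "N \<le> J" "J \<le> K" for J K
  proof -
    have pt: "(norm (F K \<xi> - F J \<xi>))\<^sup>2 \<le> c * B (hs {J..<K} \<xi>) (hs {J..<K} \<xi>) + 4 / R * B (hs {..<J} \<xi>) (hs {..<J} \<xi>)" for \<xi>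
    proof (cases "B (hs {..<J} \<xi>) (hs {..<J} \<xi>) \<le> R")
      case True
      have "hs {..<K} \<xi> = (\<lambda>x. hs {..<J} \<xi> x + hs {J..<K} \<xi> x)"
        using sum.atLeastLessThan_concat[of 0 J K "\<lambda>j. \<xi> j *\<^sub>R h j x" for x] JK
        by (simp add: hs_def lessThan_atLeast0)
      hence "norm (F K \<xi> - F J \<xi>) \<le> (2 * exp (B (hs {..<J} \<xi>) (hs {..<J} \<xi>) / 8) + 1) * sqrt (B (hs {J..<K} \<xi>) (hs {J..<K} \<xi>))"
        unfolding F_def using shift_continuous[OF hs_E hs_E] by simp
      also have "\<dots> \<le> (2 * exp (R / 8) + 1) * sqrt (B (hs {J..<K} \<xi>) (hs {J..<K} \<xi>))"
        using True by (intro mult_right_mono) (auto simp: B_nonneg hs_E)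
      finally have "(norm (F K \<xi> - F J \<xi>))\<^sup>2 \<le> ((2 * exp (R / 8) + 1) * sqrt (B (hs {J..<K} \<xi>) (hs {J..<K} \<xi>)))\<^sup>2"
        by (intro power_mono) auto
      also have "\<dots> = c * B (hs {J..<K} \<xi>) (hs {J..<K} \<xi>)"
        by (simp add: c_def power_mult_distrib B_nonneg hs_E)
      finally show ?thesis using R(1) B_nonneg[OF hs_E, of "{..<J}" \<xi>]
        by (smt (verit) divide_nonneg_pos mult_nonneg_nonneg)
    next
      case False
      have "norm (F K \<xi> - F J \<xi>) \<le> 2"
        using norm_triangle_ineq4[of "F K \<xi>" "F J \<xi>"] by (simp add: F_norm)
      hence "(norm (F K \<xi> - F J \<xi>))\<^sup>2 \<le> 2\<^sup>2" by (intro power_mono) auto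
      also have "\<dots> \<le> 4 / R * B (hs {..<J} \<xi>) (hs {..<J} \<xi>)" using False R(1) by (simp add: field_simps)
      finally show ?thesis using c B_nonneg[OF hs_E, of "{J..<K}" \<xi>]
        by (smt (verit) mult_nonneg_nonneg)
    qed
    have "(\<integral>\<xi>. (norm (F K \<xi> - F J \<xi>))\<^sup>2 \<partial>gauss) \<le>
        (\<integral>\<xi>. c * B (hs {J..<K} \<xi>) (hs {J..<K} \<xi>) + 4 / R * B (hs {..<J} \<xi>) (hs {..<J} \<xi>) \<partial>gauss)"
      by (intro integral_mono gauss.bcont_integrable gauss.bcont_norm_sq gauss.bcont_diff F_bcont
            Bochner_Integration.integrable_add integrable_mult_right B_hs_mean(2) pt) auto
    also have "\<dots> = c * (\<integral>\<xi>. B (hs {J..<K} \<xi>) (hs {J..<K} \<xi>) \<partial>gauss) + 4 / R * (\<integral>\<xi>. B (hs {..<J} \<xi>) (hs {..<J} \<xi>) \<partial>gauss)"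
      by (simp add: B_hs_mean(2))
    also have "\<dots> \<le> c * sum b {J..<K} + 4 / R * T"
      using c R(1) by (intro add_mono mult_left_mono B_hs_mean(1) order_trans[OF B_hs_mean(1) T]) auto
    also have "\<dots> < c * (e / (2 * c)) + e / 2"
      using N[OF JK(1), of K] c R(2) by (intro add_strict_mono mult_strict_left_mono) auto
    also have "\<dots> = e" using c by simp
    finally show ?thesis .
  qed
  show ?thesis
  proof (rule that[of N])
    fix J K assume "N \<le> J" "N \<le> K"
    thus "(\<integral>\<xi>. (norm (F J \<xi> - F K \<xi>))\<^sup>2 \<partial>gauss) < e"
      using main[of J K] main[of K J] by (cases "J \<le> K") (auto simp: norm_minus_commute)
  qed
qed

subsection \<open>The averaged functional\<close>

text \<open>The expectation of the vector state of the shifted vacuum, and its limit.\<close>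

definition mean :: "nat \<Rightarrow> 'a \<Rightarrow> complex" where
  "mean J c = (\<integral>\<xi>. cinner (F J \<xi>) (\<pi> c (F J \<xi>)) \<partial>gauss)"

definition s :: "'a \<Rightarrow> complex" where
  "s c = lim (\<lambda>J. mean J c)"

lemma piF_bcont: "gauss.bcont (\<lambda>\<xi>. \<pi> c (F J \<xi>))"
  by (rule gauss.bcont_cop[OF representation_cop[OF rep] F_bcont])

lemma mean_int: "integrable gauss (\<lambda>\<xi>. cinner (F J \<xi>) (\<pi> c (F J \<xi>)))"
  by (intro gauss.bcont_integrable gauss.bcont_cinner F_bcont piF_bcont)

lemma mean_add: "mean J (c + d) = mean J c + mean J d"
  unfolding mean_def representation_add[OF rep] cinner_add_right
  by (rule Bochner_Integration.integral_add[OF mean_int mean_int])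

lemma mean_scaleC: "mean J (k *\<^sub>C c) = k * mean J c"
  unfolding mean_def representation_scaleC[OF rep] cinner_scaleC_right by simp

lemma mean_cstar: "mean J (cstar c) = cnj (mean J c)"
  unfolding mean_def Bochner_Integration.integral_cnj[symmetric]
  by (intro Bochner_Integration.integral_cong refl) (metis cinner_commute cinner_rep_left[OF rep])

lemma mean_positive: "mean J (cstar c * c) = complex_of_real (\<integral>\<xi>. (norm (\<pi> c (F J \<xi>)))\<^sup>2 \<partial>gauss)"
proof -
  have "cinner (F J \<xi>) (\<pi> (cstar c * c) (F J \<xi>)) = complex_of_real ((norm (\<pi> c (F J \<xi>)))\<^sup>2)" for \<xi>
    by (simp add: representation_mult[OF rep] cinner_rep_left[OF rep, symmetric] cinner_self)
  thus ?thesis unfolding mean_def by (simp only: integral_complex_of_real)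
qed

lemma L2_bcont:
  assumes "gauss.bcont (G :: _ \<Rightarrow> 'k::chilbert_space)" "gauss.bcont G'"
  shows "cmod (\<integral>\<xi>. cinner (G \<xi>) (G' \<xi>) \<partial>gauss) \<le>
     sqrt (\<integral>\<xi>. (norm (G \<xi>))\<^sup>2 \<partial>gauss) * sqrt (\<integral>\<xi>. (norm (G' \<xi>))\<^sup>2 \<partial>gauss)"
proof (rule gauss.cinner_integral_cauchy_schwarz[OF assms(2)])
  show "(\<lambda>\<xi>. cinner (G \<xi>) (G' \<xi>)) \<in> borel_measurable gauss"
    using gauss.bcont_cinner[OF assms] by (simp add: gauss.bcont_def gauss.measurable_continuous)
  show "(\<lambda>\<xi>. norm (G \<xi>)) \<in> borel_measurable gauss"
    using gauss.bcont_norm[OF assms(1)] by (simp add: gauss.bcont_def gauss.measurable_continuous)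
  show "integrable gauss (\<lambda>\<xi>. (norm (G \<xi>))\<^sup>2)"
    by (intro gauss.bcont_integrable gauss.bcont_norm_sq assms)
  show "bounded (range G)" using assms(1) by (simp add: gauss.bcont_def)
qed

lemma mean_convergent: "(\<lambda>J. mean J c) \<longlonglongrightarrow> s c"
proof -
  define t where "t = onorm (\<pi> c) + 1"
  have cc: "cop (\<pi> c)" by (rule representation_cop[OF rep])
  have t: "t > 0" using cop_onorm_nonneg[OF cc] by (simp add: t_def)
  have nt: "norm (\<pi> c x) \<le> t * norm x" for x
    by (rule order_trans[OF cop_norm[OF cc]]) (simp add: t_def mult_right_mono)
  have sq: "sqrt (\<integral>\<xi>. (norm (\<pi> c (G \<xi>)))\<^sup>2 \<partial>gauss) \<le> t * sqrt (\<integral>\<xi>. (norm (G \<xi>))\<^sup>2 \<partial>gauss)"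
    if G: "gauss.bcont G" for G
  proof -
    have "(\<integral>\<xi>. (norm (\<pi> c (G \<xi>)))\<^sup>2 \<partial>gauss) \<le> (\<integral>\<xi>. t\<^sup>2 * (norm (G \<xi>))\<^sup>2 \<partial>gauss)"
    proof (rule integral_mono)
      show "(norm (\<pi> c (G \<xi>)))\<^sup>2 \<le> t\<^sup>2 * (norm (G \<xi>))\<^sup>2" for \<xi>
        using power_mono[OF nt norm_ge_zero, of _ 2] by (simp add: power_mult_distrib)
      show "integrable gauss (\<lambda>\<xi>. (norm (\<pi> c (G \<xi>)))\<^sup>2)"
        by (rule gauss.bcont_integrable[OF gauss.bcont_norm_sq[OF gauss.bcont_cop[OF cc G]]])
      show "integrable gauss (\<lambda>\<xi>. t\<^sup>2 * (norm (G \<xi>))\<^sup>2)"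
        by (rule integrable_mult_right[OF gauss.bcont_integrable[OF gauss.bcont_norm_sq[OF G]]])
    qed
    hence "sqrt (\<integral>\<xi>. (norm (\<pi> c (G \<xi>)))\<^sup>2 \<partial>gauss) \<le> sqrt (t\<^sup>2 * (\<integral>\<xi>. (norm (G \<xi>))\<^sup>2 \<partial>gauss))" by simp
    thus ?thesis using t by (simp add: real_sqrt_mult)
  qed
  have F1: "sqrt (\<integral>\<xi>. (norm (F J \<xi>))\<^sup>2 \<partial>gauss) = 1" for J
    by (simp add: F_norm gauss.prob_space)
  have "Cauchy (\<lambda>J. mean J c)"
  proof (rule metric_CauchyI)
    fix e :: real assume e: "e > 0"
    hence "(e / (2 * t))\<^sup>2 > 0" using t by simp
    from F_Cauchy[OF this] obtain N
      where N: "\<And>J K. J \<ge> N \<Longrightarrow> K \<ge> N \<Longrightarrow> (\<integral>\<xi>. (norm (F J \<xi> - F K \<xi>))\<^sup>2 \<partial>gauss) < (e / (2 * t))\<^sup>2"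
      by blast
    have "dist (mean J c) (mean K c) < e" if "J \<ge> N" "K \<ge> N" for J K
    proof -
      let ?d = "sqrt (\<integral>\<xi>. (norm (F J \<xi> - F K \<xi>))\<^sup>2 \<partial>gauss)"
      have d: "?d < e / (2 * t)" using N[OF that] e t by (intro real_less_lsqrt) auto
      have "mean J c - mean K c = (\<integral>\<xi>. cinner (F J \<xi> - F K \<xi>) (\<pi> c (F J \<xi>)) \<partial>gauss) +
          (\<integral>\<xi>. cinner (F K \<xi>) (\<pi> c (F J \<xi> - F K \<xi>)) \<partial>gauss)"
      proof -
        have "(\<integral>\<xi>. cinner (F J \<xi> - F K \<xi>) (\<pi> c (F J \<xi>)) \<partial>gauss) + (\<integral>\<xi>. cinner (F K \<xi>) (\<pi> c (F J \<xi> - F K \<xi>)) \<partial>gauss) =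
            (\<integral>\<xi>. cinner (F J \<xi> - F K \<xi>) (\<pi> c (F J \<xi>)) + cinner (F K \<xi>) (\<pi> c (F J \<xi> - F K \<xi>)) \<partial>gauss)"
          by (intro Bochner_Integration.integral_add[symmetric] gauss.bcont_integrable gauss.bcont_cinner
                gauss.bcont_diff gauss.bcont_cop[OF cc] F_bcont)
        also have "\<dots> = (\<integral>\<xi>. cinner (F J \<xi>) (\<pi> c (F J \<xi>)) - cinner (F K \<xi>) (\<pi> c (F K \<xi>)) \<partial>gauss)"
          by (simp add: cinner.H_diff_left cinner.H_diff_right cop_diff[OF cc])
        also have "\<dots> = mean J c - mean K c"
          unfolding mean_def by (rule Bochner_Integration.integral_diff[OF mean_int mean_int])
        finally show ?thesis by simp
      qed
      hence "cmod (mean J c - mean K c) \<le> cmod (\<integral>\<xi>. cinner (F J \<xi> - F K \<xi>) (\<pi> c (F J \<xi>)) \<partial>gauss) +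
          cmod (\<integral>\<xi>. cinner (F K \<xi>) (\<pi> c (F J \<xi> - F K \<xi>)) \<partial>gauss)"
        by (simp only: norm_triangle_ineq)
      also have "\<dots> \<le> ?d * sqrt (\<integral>\<xi>. (norm (\<pi> c (F J \<xi>)))\<^sup>2 \<partial>gauss) +
          sqrt (\<integral>\<xi>. (norm (F K \<xi>))\<^sup>2 \<partial>gauss) * sqrt (\<integral>\<xi>. (norm (\<pi> c (F J \<xi> - F K \<xi>)))\<^sup>2 \<partial>gauss)"
        by (intro add_mono L2_bcont gauss.bcont_diff F_bcont piF_bcont gauss.bcont_cop[OF cc])
      also have "\<dots> \<le> ?d * (t * 1) + 1 * (t * ?d)"
        using sq[OF F_bcont[of J]] sq[OF gauss.bcont_diff[OF F_bcont[of J] F_bcont[of K]]]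
        unfolding F1 by (intro add_mono mult_left_mono) auto
      also have "\<dots> = 2 * t * ?d" by simp
      also have "\<dots> < 2 * t * (e / (2 * t))" using d t by (intro mult_strict_left_mono) auto
      also have "\<dots> = e" using t by simp
      finally show ?thesis by (simp add: dist_norm)
    qed
    thus "\<exists>N. \<forall>J\<ge>N. \<forall>K\<ge>N. dist (mean J c) (mean K c) < e" by blast
  qed
  thus ?thesis unfolding s_def using Cauchy_convergent convergent_LIMSEQ_iff by blast
qed

lemma s_eqI: "(\<lambda>J. mean J c) \<longlonglongrightarrow> l \<Longrightarrow> s c = l"
  using mean_convergent LIMSEQ_unique by blast

sublocale positive_functional s
proof
  show "s (c + d) = s c + s d" for c d
    by (rule s_eqI) (simp add: mean_add tendsto_add mean_convergent)
  show "s (k *\<^sub>C c) = k * s c" for k c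
    by (rule s_eqI) (simp add: mean_scaleC tendsto_mult mean_convergent)
  show "s (cstar c) = cnj (s c)" for c
    by (rule s_eqI) (simp add: mean_cstar tendsto_cnj mean_convergent)
  show "0 \<le> Re (s (cstar c * c))" for c
    by (rule LIMSEQ_le_const[OF tendsto_Re[OF mean_convergent]]) (simp add: mean_positive)
qed

lemma sn_limit: "(\<lambda>J. sqrt (\<integral>\<xi>. (norm (\<pi> c (F J \<xi>)))\<^sup>2 \<partial>gauss)) \<longlonglongrightarrow> form.sn c"
proof -
  have "(\<lambda>J. Re (mean J (cstar c * c))) \<longlonglongrightarrow> Re (s (cstar c * c))"
    by (intro tendsto_Re mean_convergent)
  thus ?thesis unfolding form.sn_def mean_positive by (simp add: tendsto_real_sqrt)
qed

text \<open>The integrals of the shifted vacuum over an event converge; their limits are dominated by \<open>s\<close>.\<close>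

lemma wint_limit:
  assumes C: "C \<in> sets gauss"
  obtains x where "(\<lambda>J. gauss.wint C (F J)) \<longlonglongrightarrow> x"
proof -
  have "Cauchy (\<lambda>J. gauss.wint C (F J))"
  proof (rule metric_CauchyI)
    fix e :: real assume e: "e > 0"
    hence "e\<^sup>2 > 0" by simp
    from F_Cauchy[OF this] obtain N
      where N: "\<And>J K. J \<ge> N \<Longrightarrow> K \<ge> N \<Longrightarrow> (\<integral>\<xi>. (norm (F J \<xi> - F K \<xi>))\<^sup>2 \<partial>gauss) < e\<^sup>2" by blast
    have "dist (gauss.wint C (F J)) (gauss.wint C (F K)) < e" if "J \<ge> N" "K \<ge> N" for J K
    proof -
      let ?D = "\<lambda>\<xi>. F J \<xi> - F K \<xi>"
      have D: "gauss.bcont ?D" by (intro gauss.bcont_diff F_bcont)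
      have "(dist (gauss.wint C (F J)) (gauss.wint C (F K)))\<^sup>2 = (norm (gauss.wint C ?D))\<^sup>2"
        by (simp add: dist_norm gauss.wint_diff F_bcont C)
      also have "\<dots> \<le> measure gauss C * (\<integral>\<xi>. indicator C \<xi> * (norm (?D \<xi>))\<^sup>2 \<partial>gauss)"
        by (rule gauss.norm_wint_le[OF D C])
      also have "\<dots> \<le> 1 * (\<integral>\<xi>. (norm (?D \<xi>))\<^sup>2 \<partial>gauss)"
        using gauss.bcont_indicator_integrable[OF gauss.bcont_norm_sq[OF D] C]
          gauss.bcont_integrable[OF gauss.bcont_norm_sq[OF D]]
        by (intro mult_mono integral_mono gauss.prob_le_1) (auto simp: indicator_def)
      also have "\<dots> < e\<^sup>2" using N[OF that] by simp
      finally show ?thesis using e by (simp add: power2_less_imp_less)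
    qed
    thus "\<exists>N. \<forall>J\<ge>N. \<forall>K\<ge>N. dist (gauss.wint C (F J)) (gauss.wint C (F K)) < e" by blast
  qed
  thus ?thesis using that Cauchy_convergent convergent_def by blast
qed

lemma wint_dominated:
  assumes C: "C \<in> sets gauss" and x: "(\<lambda>J. gauss.wint C (F J)) \<longlonglongrightarrow> x"
  shows "x \<in> dominated A \<pi>"
proof -
  have "norm (\<pi> c x) \<le> form.sn c" for c
  proof (rule LIMSEQ_le[OF tendsto_norm[OF cop_tendsto[OF representation_cop[OF rep] x]] sn_limit])
    have "norm (\<pi> c (gauss.wint C (F J))) \<le> sqrt (\<integral>\<xi>. (norm (\<pi> c (F J \<xi>)))\<^sup>2 \<partial>gauss)" for J
    proof (rule real_le_rsqrt)
      have "(norm (\<pi> c (gauss.wint C (F J))))\<^sup>2 = (norm (gauss.wint C (\<lambda>\<xi>. \<pi> c (F J \<xi>))))\<^sup>2"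
        by (simp add: gauss.cop_wint[OF representation_cop[OF rep] F_bcont C])
      also have "\<dots> \<le> measure gauss C * (\<integral>\<xi>. indicator C \<xi> * (norm (\<pi> c (F J \<xi>)))\<^sup>2 \<partial>gauss)"
        by (rule gauss.norm_wint_le[OF piF_bcont C])
      also have "\<dots> \<le> 1 * (\<integral>\<xi>. (norm (\<pi> c (F J \<xi>)))\<^sup>2 \<partial>gauss)"
        using gauss.bcont_indicator_integrable[OF gauss.bcont_norm_sq[OF piF_bcont] C]
          gauss.bcont_integrable[OF gauss.bcont_norm_sq[OF piF_bcont]]
        by (intro mult_mono integral_mono gauss.prob_le_1) (auto simp: indicator_def)
      finally show "(norm (\<pi> c (gauss.wint C (F J))))\<^sup>2 \<le> (\<integral>\<xi>. (norm (\<pi> c (F J \<xi>)))\<^sup>2 \<partial>gauss)" by simp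
    qed
    thus "\<exists>N. \<forall>J\<ge>N. norm (\<pi> c (gauss.wint C (F J))) \<le> sqrt (\<integral>\<xi>. (norm (\<pi> c (F J \<xi>)))\<^sup>2 \<partial>gauss)" by blast
  qed
  thus ?thesis unfolding dominated_def by (intro CollectI exI[of _ 1]) auto
qed

text \<open>
  Condition on the event that the first \<open>J0\<close> normal variables are small, and normalise: the integral
  of the shifted vacuum over this event is close to \<open>\<Omega>\<close>, since the conditional expectation of the energy is small.
\<close>

theorem Omega_in_dominated: "\<Omega> \<in> closure (span (dominated A \<pi>))"
  unfolding closure_approachable
proof (intro allI impI)
  fix e :: real assume e: "e > 0"
  define T where "T = suminf b"
  have T: "(\<Sum>j\<in>S. b j) \<le> T" if "finite S" for S
    unfolding T_def using sum_le_suminf[OF b_summable that] b_nonneg by blast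
  have T0: "T \<ge> 0" using T[of "{}"] by simp
  define d where "d = e / sqrt (8 * (T + 1))"
  have d: "d > 0" using e T0 by (simp add: d_def)
  have d2: "d\<^sup>2 * T \<le> e\<^sup>2 / 8"
    using T0 e by (simp add: d_def power_divide field_simps)
  have "e\<^sup>2 / 8 > 0" using e by simp
  hence "\<exists>N. \<forall>m\<ge>N. \<forall>n. norm (sum b {m..<n}) < e\<^sup>2 / 8"
    using b_summable unfolding summable_Cauchy by blast
  then obtain J0 where J0: "\<And>m n. m \<ge> J0 \<Longrightarrow> norm (sum b {m..<n}) < e\<^sup>2 / 8" by blast
  define C where "C = box J0 d"
  define P where "P = measure gauss C"
  have C: "C \<in> sets gauss" unfolding C_def by (rule box_sets)
  have P: "P > 0" unfolding P_def C_def by (rule gauss_box_moments(4)[OF d])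
  obtain x where x: "(\<lambda>J. gauss.wint C (F J)) \<longlonglongrightarrow> x" using wint_limit[OF C] .
  have "norm (gauss.wint C (F J) - P *\<^sub>R \<Omega>) \<le> P * (e / 2)" if J: "J \<ge> J0" for J
  proof -
    let ?D = "\<lambda>\<xi>. F J \<xi> - \<Omega>"
    have D: "gauss.bcont ?D" by (intro gauss.bcont_diff F_bcont gauss.bcont_const)
    have "(norm (gauss.wint C (F J) - P *\<^sub>R \<Omega>))\<^sup>2 = (norm (gauss.wint C ?D))\<^sup>2"
      by (simp add: gauss.wint_diff F_bcont C gauss.bcont_const gauss.wint_const P_def)
    also have "\<dots> \<le> P * (\<integral>\<xi>. indicator C \<xi> * (norm (?D \<xi>))\<^sup>2 \<partial>gauss)"
      unfolding P_def by (rule gauss.norm_wint_le[OF D C])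
    also have "(\<integral>\<xi>. indicator C \<xi> * (norm (?D \<xi>))\<^sup>2 \<partial>gauss) \<le> (\<integral>\<xi>. indicator C \<xi> * B (hs {..<J} \<xi>) (hs {..<J} \<xi>) \<partial>gauss)"
    proof (rule integral_mono)
      show "integrable gauss (\<lambda>\<xi>. indicator C \<xi> * (norm (?D \<xi>))\<^sup>2)"
        using gauss.bcont_indicator_integrable[OF gauss.bcont_norm_sq[OF D] C] by simp
      show "integrable gauss (\<lambda>\<xi>. indicator C \<xi> * B (hs {..<J} \<xi>) (hs {..<J} \<xi>))"
        unfolding C_def by (rule B_hs_box(2)[OF d]) simp
      show "indicator C \<xi> * (norm (?D \<xi>))\<^sup>2 \<le> indicator C \<xi> * B (hs {..<J} \<xi>) (hs {..<J} \<xi>)" for \<xi>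
      proof (rule mult_left_mono)
        show "(norm (?D \<xi>))\<^sup>2 \<le> B (hs {..<J} \<xi>) (hs {..<J} \<xi>)"
          unfolding F_def using power_mono[OF shift_small[OF hs_E] norm_ge_zero, of "{..<J}" \<xi> 2]
          by (simp add: B_nonneg hs_E)
      qed simp
    qed
    also have "\<dots> \<le> P * (\<Sum>j<J. (if j < J0 then d\<^sup>2 else 1) * b j)"
      unfolding P_def C_def by (rule B_hs_box(1)[OF d]) simp
    also have "(\<Sum>j<J. (if j < J0 then d\<^sup>2 else 1) * b j) = d\<^sup>2 * (\<Sum>j<J0. b j) + sum b {J0..<J}"
    proof -
      have "(\<Sum>j<J. (if j < J0 then d\<^sup>2 else 1) * b j) =
          (\<Sum>j<J0. (if j < J0 then d\<^sup>2 else 1) * b j) + (\<Sum>j=J0..<J. (if j < J0 then d\<^sup>2 else 1) * b j)"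
        using sum.atLeastLessThan_concat[of 0 J0 J "\<lambda>j. (if j < J0 then d\<^sup>2 else 1) * b j"] J
        by (simp only: lessThan_atLeast0)
      thus ?thesis by (simp add: sum_distrib_left)
    qed
    also have "\<dots> \<le> e\<^sup>2 / 4"
    proof -
      have "d\<^sup>2 * (\<Sum>j<J0. b j) \<le> d\<^sup>2 * T" by (intro mult_left_mono T) auto
      thus ?thesis using d2 J0[of J0 J] by simp
    qed
    finally have "(norm (gauss.wint C (F J) - P *\<^sub>R \<Omega>))\<^sup>2 \<le> P * (P * (e\<^sup>2 / 4))"
      using P by (simp add: mult_left_mono)
    also have "\<dots> = (P * (e / 2))\<^sup>2" by (simp add: power2_eq_square)
    finally show ?thesis using P e by (auto intro: power2_le_imp_le)
  qed
  hence "norm (x - P *\<^sub>R \<Omega>) \<le> P * (e / 2)"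
    by (intro LIMSEQ_le_const2[OF tendsto_norm[OF tendsto_diff[OF x tendsto_const]]]) blast
  moreover have "x - P *\<^sub>R \<Omega> = P *\<^sub>R ((1 / P) *\<^sub>R x - \<Omega>)" using P by (simp add: scaleR_diff_right)
  ultimately have "norm ((1 / P) *\<^sub>R x - \<Omega>) \<le> e / 2" using P by simp
  hence "dist ((1 / P) *\<^sub>R x) \<Omega> < e" using e by (simp add: dist_norm)
  moreover have "(1 / P) *\<^sub>R x \<in> span (dominated A \<pi>)"
    by (intro span_scale span_base wint_dominated[OF C x])
  ultimately show "\<exists>y\<in>span (dominated A \<pi>). dist y \<Omega> < e" by blast
qed

text \<open>
  Replace the left factor in \<open>\<integral> cinner (F J \<xi>) (\<pi> c (F J \<xi>))\<close> by a step function \<open>\<Phi>\<close> that is close to it in the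
  mean square. The result is a combination of matrix coefficients with the limits of \<open>wint (C i) (F J)\<close>.
\<close>

theorem mixture_approximable: "approximable A \<pi>"
  unfolding approximable_def
proof (intro allI impI)
  fix e :: real assume e: "e > 0"
  define e' where "e' = min (e / 4) (e\<^sup>2 / 16)"
  have e': "e' > 0" "e' \<le> e / 4" "e' \<le> e\<^sup>2 / 16" using e by (auto simp: e'_def)
  have "e\<^sup>2 / 16 > 0" using e by simp
  from F_Cauchy[OF this] obtain J0
    where J0: "\<And>J K. J \<ge> J0 \<Longrightarrow> K \<ge> J0 \<Longrightarrow> (\<integral>\<xi>. (norm (F J \<xi> - F K \<xi>))\<^sup>2 \<partial>gauss) < e\<^sup>2 / 16" by blast
  obtain n :: nat and C \<eta> where C: "\<And>i. C i \<in> sets gauss" and disj: "disjoint_family C"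
    and near: "\<And>i \<xi>. \<xi> \<in> C i \<Longrightarrow> norm (F J0 \<xi> - \<eta> i) < e'" and rest: "measure gauss (UNIV - (\<Union>i<n. C i)) < e'"
    using gauss.simple_approximation[OF F_continuous[of J0] e'(1)] by metis
  define \<Phi> where "\<Phi> \<xi> = (\<Sum>i<n. indicator (C i) \<xi> *\<^sub>R \<eta> i)" for \<xi>
  have \<Phi>_in: "\<Phi> \<xi> = \<eta> i" if "\<xi> \<in> C i" "i < n" for i \<xi>
  proof -
    have "indicator (C k) \<xi> *\<^sub>R \<eta> k = (if k = i then \<eta> i else 0)" for k
      using that disj by (auto simp: indicator_def disjoint_family_on_def)
    thus ?thesis using that unfolding \<Phi>_def by simp
  qed
  have \<Phi>_out: "\<Phi> \<xi> = 0" if "\<xi> \<notin> (\<Union>i<n. C i)" for \<xi>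
    unfolding \<Phi>_def using that by (intro sum.neutral) auto
  define Rs where "Rs = UNIV - (\<Union>i<n. C i)"
  have Rs: "Rs \<in> sets gauss" unfolding Rs_def using C gauss.space_M by (metis sets.finite_UN sets.compl_sets finite_lessThan)
  have diffJ0: "(norm (F J0 \<xi> - \<Phi> \<xi>))\<^sup>2 \<le> e'\<^sup>2 + indicator Rs \<xi>" for \<xi>
  proof (cases "\<xi> \<in> Rs")
    case True
    thus ?thesis using \<Phi>_out[of \<xi>] by (simp add: Rs_def F_norm)
  next
    case False
    then obtain i where i: "i < n" "\<xi> \<in> C i" unfolding Rs_def by auto
    have "(norm (F J0 \<xi> - \<eta> i))\<^sup>2 \<le> e'\<^sup>2" using near[OF i(2)] by (intro power_mono) auto
    thus ?thesis using \<Phi>_in[OF i(2,1)] False by simp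
  qed
  have "\<exists>x. (\<lambda>J. gauss.wint (C i) (F J)) \<longlonglongrightarrow> x" for i using wint_limit[OF C[of i]] by blast
  then obtain x where x: "\<And>i. (\<lambda>J. gauss.wint (C i) (F J)) \<longlonglongrightarrow> x i" by metis
  have "cmod (s c - (\<Sum>i<n. cinner (\<eta> i) (\<pi> c (x i)))) \<le> e * form.sn c" for c
  proof -
    have cc: "cop (\<pi> c)" by (rule representation_cop[OF rep])
    have lim1: "(\<lambda>J. mean J c - (\<Sum>i<n. cinner (\<eta> i) (\<pi> c (gauss.wint (C i) (F J))))) \<longlonglongrightarrow>
        s c - (\<Sum>i<n. cinner (\<eta> i) (\<pi> c (x i)))"
      by (intro tendsto_diff mean_convergent tendsto_sum tendsto_cinner tendsto_const cop_tendsto[OF cc] x)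
    show ?thesis
    proof (rule LIMSEQ_le[OF tendsto_norm[OF lim1] tendsto_mult_left[OF sn_limit, of e]])
      have "cmod (mean J c - (\<Sum>i<n. cinner (\<eta> i) (\<pi> c (gauss.wint (C i) (F J))))) \<le>
          e * sqrt (\<integral>\<xi>. (norm (\<pi> c (F J \<xi>)))\<^sup>2 \<partial>gauss)" if J: "J \<ge> J0" for J
      proof -
        have int: "integrable gauss (\<lambda>\<xi>. indicator (C i) \<xi> *\<^sub>R cinner (\<eta> i) (\<pi> c (F J \<xi>)))" for i
          by (intro gauss.bcont_indicator_integrable gauss.bcont_cinner gauss.bcont_const piF_bcont C)
        have cin: "cinner (\<Phi> \<xi>) (\<pi> c (F J \<xi>)) = (\<Sum>i<n. indicator (C i) \<xi> *\<^sub>R cinner (\<eta> i) (\<pi> c (F J \<xi>)))" for \<xi>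
          unfolding \<Phi>_def cinner.H_sum_left
          by (intro sum.cong refl) (simp add: scaleR_eq_scaleC cinner.H_scaleC_left scaleR_conv_of_real)
        have int\<Phi>: "integrable gauss (\<lambda>\<xi>. cinner (\<Phi> \<xi>) (\<pi> c (F J \<xi>)))"
          unfolding cin by (intro Bochner_Integration.integrable_sum int)
        have "(\<Sum>i<n. cinner (\<eta> i) (\<pi> c (gauss.wint (C i) (F J)))) = (\<integral>\<xi>. cinner (\<Phi> \<xi>) (\<pi> c (F J \<xi>)) \<partial>gauss)"
          unfolding cin gauss.cop_wint[OF cc F_bcont C] gauss.cinner_wint[OF piF_bcont C]
          by (rule Bochner_Integration.integral_sum[symmetric]) (rule int)
        hence "mean J c - (\<Sum>i<n. cinner (\<eta> i) (\<pi> c (gauss.wint (C i) (F J)))) =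
            (\<integral>\<xi>. cinner (F J \<xi> - \<Phi> \<xi>) (\<pi> c (F J \<xi>)) \<partial>gauss)"
          unfolding mean_def cinner.H_diff_left
          by (simp add: Bochner_Integration.integral_diff[OF mean_int int\<Phi>])
        hence "cmod (mean J c - (\<Sum>i<n. cinner (\<eta> i) (\<pi> c (gauss.wint (C i) (F J))))) =
            cmod (\<integral>\<xi>. cinner (F J \<xi> - \<Phi> \<xi>) (\<pi> c (F J \<xi>)) \<partial>gauss)" by (rule arg_cong)
        also have "\<dots> \<le> sqrt (\<integral>\<xi>. (norm (F J \<xi> - \<Phi> \<xi>))\<^sup>2 \<partial>gauss) * sqrt (\<integral>\<xi>. (norm (\<pi> c (F J \<xi>)))\<^sup>2 \<partial>gauss)"
        proof (rule gauss.cinner_integral_cauchy_schwarz[OF piF_bcont])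
          show "(\<lambda>\<xi>. cinner (F J \<xi> - \<Phi> \<xi>) (\<pi> c (F J \<xi>))) \<in> borel_measurable gauss"
            unfolding cinner.H_diff_left using mean_int[of J c] int\<Phi> by simp
          have Fi: "(\<lambda>\<xi>. norm (F J \<xi> - \<eta> i)) \<in> borel_measurable gauss" for i
            by (intro gauss.measurable_continuous continuous_intros F_continuous)
          have "norm (F J \<xi> - \<Phi> \<xi>) = (\<Sum>i<n. indicator (C i) \<xi> * norm (F J \<xi> - \<eta> i)) + indicator Rs \<xi>" for \<xi>
          proof (cases "\<xi> \<in> Rs")
            case True
            hence "indicator (C i) \<xi> * norm (F J \<xi> - \<eta> i) = 0" if "i < n" for i
              using that by (auto simp: Rs_def)
            thus ?thesis using True \<Phi>_out[of \<xi>] by (simp add: F_norm Rs_def)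
          next
            case False
            then obtain i where i: "i < n" "\<xi> \<in> C i" unfolding Rs_def by auto
            have "indicator (C k) \<xi> * norm (F J \<xi> - \<eta> k) = (if k = i then norm (F J \<xi> - \<eta> i) else 0)" for k
              using i disj by (auto simp: indicator_def disjoint_family_on_def)
            thus ?thesis using i False \<Phi>_in[OF i(2,1)] by simp
          qed
          hence eq: "(\<lambda>\<xi>. norm (F J \<xi> - \<Phi> \<xi>)) =
              (\<lambda>\<xi>. (\<Sum>i<n. indicator (C i) \<xi> * norm (F J \<xi> - \<eta> i)) + indicator Rs \<xi>)" by blast
          show m: "(\<lambda>\<xi>. norm (F J \<xi> - \<Phi> \<xi>)) \<in> borel_measurable gauss"
            unfolding eq by (intro borel_measurable_add borel_measurable_sum borel_measurable_times
              borel_measurable_indicator Fi C Rs)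
          obtain K where K: "\<And>i. i < n \<Longrightarrow> norm (\<eta> i) \<le> K" "K \<ge> 0"
            by (rule that[of "\<Sum>i<n. norm (\<eta> i)"]) (auto intro: member_le_sum sum_nonneg)
          have bd: "norm (F J \<xi> - \<Phi> \<xi>) \<le> 1 + K" for \<xi>
          proof -
            have "norm (\<Phi> \<xi>) \<le> K"
              using \<Phi>_in \<Phi>_out[of \<xi>] K by (cases "\<xi> \<in> (\<Union>i<n. C i)") auto
            thus ?thesis using norm_triangle_ineq4[of "F J \<xi>" "\<Phi> \<xi>"] by (simp add: F_norm)
          qed
          thus "bounded (range (\<lambda>\<xi>. F J \<xi> - \<Phi> \<xi>))" unfolding bounded_iff by blast
          show "integrable gauss (\<lambda>\<xi>. (norm (F J \<xi> - \<Phi> \<xi>))\<^sup>2)"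
            by (rule gauss.integrable_const_bound[of _ "(1 + K)\<^sup>2"])
               (use m power_mono[OF bd norm_ge_zero] in auto)
        qed
        also have "\<dots> \<le> e * sqrt (\<integral>\<xi>. (norm (\<pi> c (F J \<xi>)))\<^sup>2 \<partial>gauss)"
        proof (rule mult_right_mono)
          have "(\<integral>\<xi>. (norm (F J \<xi> - \<Phi> \<xi>))\<^sup>2 \<partial>gauss) \<le>
              (\<integral>\<xi>. 2 * (norm (F J \<xi> - F J0 \<xi>))\<^sup>2 + 2 * (e'\<^sup>2 + indicator Rs \<xi>) \<partial>gauss)"
          proof (rule integral_mono')
            show "integrable gauss (\<lambda>\<xi>. 2 * (norm (F J \<xi> - F J0 \<xi>))\<^sup>2 + 2 * (e'\<^sup>2 + indicator Rs \<xi>))"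
              using Rs gauss.bcont_integrable[OF gauss.bcont_norm_sq[OF gauss.bcont_diff[OF F_bcont F_bcont]]]
                gauss.bcont_indicator_integrable[OF gauss.bcont_const[of "1::real"] Rs]
              by (intro Bochner_Integration.integrable_add integrable_mult_right) auto
            fix \<xi>
            have "norm (F J \<xi> - \<Phi> \<xi>) \<le> norm (F J \<xi> - F J0 \<xi>) + norm (F J0 \<xi> - \<Phi> \<xi>)"
              using norm_triangle_ineq[of "F J \<xi> - F J0 \<xi>" "F J0 \<xi> - \<Phi> \<xi>"] by simp
            hence "(norm (F J \<xi> - \<Phi> \<xi>))\<^sup>2 \<le> (norm (F J \<xi> - F J0 \<xi>) + norm (F J0 \<xi> - \<Phi> \<xi>))\<^sup>2"
              by (rule power_mono) simp
            also have "\<dots> \<le> 2 * (norm (F J \<xi> - F J0 \<xi>))\<^sup>2 + 2 * (norm (F J0 \<xi> - \<Phi> \<xi>))\<^sup>2"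
              using sum_squares_bound[of "norm (F J \<xi> - F J0 \<xi>)" "norm (F J0 \<xi> - \<Phi> \<xi>)"]
              by (simp add: power2_sum)
            also have "\<dots> \<le> 2 * (norm (F J \<xi> - F J0 \<xi>))\<^sup>2 + 2 * (e'\<^sup>2 + indicator Rs \<xi>)"
              using diffJ0[of \<xi>] by simp
            finally show "(norm (F J \<xi> - \<Phi> \<xi>))\<^sup>2 \<le> 2 * (norm (F J \<xi> - F J0 \<xi>))\<^sup>2 + 2 * (e'\<^sup>2 + indicator Rs \<xi>)" .
          qed simp
          also have "\<dots> = 2 * (\<integral>\<xi>. (norm (F J \<xi> - F J0 \<xi>))\<^sup>2 \<partial>gauss) + 2 * (e'\<^sup>2 + measure gauss Rs)"
          proof -
            have i1: "integrable gauss (\<lambda>\<xi>. (norm (F J \<xi> - F J0 \<xi>))\<^sup>2)"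
              by (intro gauss.bcont_integrable gauss.bcont_norm_sq gauss.bcont_diff F_bcont)
            have i2: "integrable gauss (\<lambda>\<xi>. indicator Rs \<xi> :: real)"
              using gauss.bcont_indicator_integrable[OF gauss.bcont_const[of "1::real"] Rs] by simp
            show ?thesis using i1 i2 Rs gauss.prob_space by simp
          qed
          also have "\<dots> \<le> 2 * (e\<^sup>2 / 16) + 2 * (e\<^sup>2 / 16 + e\<^sup>2 / 16)"
          proof -
            have "e'\<^sup>2 \<le> (e / 4)\<^sup>2" using e' by (intro power_mono) auto
            moreover have "measure gauss Rs \<le> e\<^sup>2 / 16" using rest e' by (simp add: Rs_def)
            ultimately show ?thesis using J0[OF J order_refl] by (simp add: power_divide)
          qed
          also have "\<dots> \<le> e\<^sup>2" by simp
          finally show "sqrt (\<integral>\<xi>. (norm (F J \<xi> - \<Phi> \<xi>))\<^sup>2 \<partial>gauss) \<le> e"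
            using e by (intro real_le_lsqrt) auto
        qed simp
        finally show ?thesis .
      qed
      thus "\<exists>N. \<forall>J\<ge>N. cmod (mean J c - (\<Sum>i<n. cinner (\<eta> i) (\<pi> c (gauss.wint (C i) (F J))))) \<le>
          e * sqrt (\<integral>\<xi>. (norm (\<pi> c (F J \<xi>)))\<^sup>2 \<partial>gauss)" by blast
    qed
  qed
  moreover have "x i \<in> dominated A \<pi>" for i by (rule wint_dominated[OF C x])
  ultimately show "\<exists>(n::nat) \<eta> x. (\<forall>i<n. x i \<in> dominated A \<pi>) \<and>
     (\<forall>b\<in>A. cmod (s b - (\<Sum>i<n. cinner (\<eta> i) (\<pi> b (x i)))) \<le> e * form.sn b)" by blast
qed

text \<open>
  A shift by \<open>h\<close> multiplies the expectation of \<open>W f\<close> by a phase, whose average is the characteristic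
  function of a normal variable.
\<close>

theorem mixture_value:
  assumes f: "f \<in> E" and sums: "(\<lambda>j. (symp f (h j))\<^sup>2) sums q"
  shows "s (W f) = complex_of_real (exp (- (B f f + q) / 2))"
proof (rule s_eqI)
  have fD: "f \<in> \<D>" by (rule E_test[OF f])
  have val: "cinner (F J \<xi>) (U f (F J \<xi>)) =
      exp (\<i> * complex_of_real (\<Sum>j<J. \<xi> j * - symp f (h j))) * complex_of_real (exp (- B f f / 2))" for J \<xi>
  proof -
    let ?h = "hs {..<J} \<xi>"
    have uu: "cstar (W ?h) * W ?h = 1" using weyl_unitary[OF weyl hs_D] by (simp add: unitary_def)
    have sy: "symp f ?h = (\<Sum>j<J. \<xi> j * symp f (h j))"
      unfolding hs_def using fD
      by (subst symp_sum_right) (auto simp: symp_scale_right intro: test_function_scaleR E_test h_E)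
    have "cstar (W ?h) * (W f * W ?h) = exp (- \<i> * complex_of_real (symp f ?h)) *\<^sub>C (cstar (W ?h) * W ?h * W f)"
      unfolding weyl_commute[OF weyl fD hs_D] by (simp add: mult_scaleC_right mult.assoc)
    hence eq: "cstar (W ?h) * (W f * W ?h) = exp (- \<i> * complex_of_real (symp f ?h)) *\<^sub>C W f" by (simp add: uu)
    have "cinner (F J \<xi>) (U f (F J \<xi>)) = cinner \<Omega> (\<pi> (cstar (W ?h) * (W f * W ?h)) \<Omega>)"
      unfolding F_def by (simp add: cinner_rep_left[OF rep] representation_mult[OF rep])
    also have "\<dots> = exp (- \<i> * complex_of_real (symp f ?h)) * complex_of_real (exp (- B f f / 2))"
      unfolding eq representation_scaleC[OF rep] cinner_scaleC_right vac[OF f] ..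
    finally show ?thesis by (simp add: sy sum_negf)
  qed
  have mean: "mean J (W f) = complex_of_real (exp (- (B f f + (\<Sum>j<J. (symp f (h j))\<^sup>2)) / 2))" for J
    unfolding mean_def val using gauss_char[where n = J and t = "\<lambda>j. - symp f (h j)"]
    by (simp add: exp_add[symmetric] add_divide_distrib flip: of_real_mult)
  show "(\<lambda>J. mean J (W f)) \<longlonglongrightarrow> complex_of_real (exp (- (B f f + q) / 2))"
    unfolding mean using sums[unfolded sums_def] by (intro tendsto_intros) auto
qed

end


section \<open>The Fourier transform of test functions\<close>

lemma fourier_cis: "fourier f p = complex_of_real (1 / sqrt (2 * pi)) * (LINT x|lborel. cis (- (p * x)) * f x)"
  by (simp add: fourier_def cis_conv_exp)

lemma continuous_on_cis [continuous_intros]: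
  "continuous_on S f \<Longrightarrow> continuous_on S (\<lambda>x. cis (f x))"
  unfolding cis_conv_exp by (intro continuous_intros)

lemma integrable_cis_mult: "f \<in> \<D> \<Longrightarrow> integrable lborel (\<lambda>x. cis (c * x) * f x)"
  by (rule test_function_integrable_mult) (auto intro!: continuous_intros)

lemma integrable_cis_mult': "f \<in> \<D> \<Longrightarrow> integrable lborel (\<lambda>x. cis (- (c * x)) * f x)"
  using integrable_cis_mult[of f "- c"] by simp

lemma fourier_add:
  assumes "f \<in> \<D>" "g \<in> \<D>"
  shows "fourier (\<lambda>x. f x + g x) p = fourier f p + fourier g p"
  unfolding fourier_cis distrib_left
  using integrable_cis_mult'[OF assms(1), of p] integrable_cis_mult'[OF assms(2), of p]
  by (simp add: distrib_left)

lemma fourier_mult_left: "fourier (\<lambda>x. c * f x) p = c * fourier f p"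
  unfolding fourier_cis by (simp add: mult.left_commute)

lemma fourier_measurable [measurable]:
  assumes "f \<in> \<D>"
  shows "fourier f \<in> borel_measurable borel"
proof -
  have [measurable]: "f \<in> borel_measurable borel" by (rule test_function_measurable[OF assms])
  have "continuous_on UNIV cis" by (intro continuous_intros)
  hence [measurable]: "cis \<in> borel_measurable borel" by (rule borel_measurable_continuous_onI)
  show ?thesis unfolding fourier_cis[abs_def] by measurable
qed

lemma fourier_bound: "\<exists>C. \<forall>p. cmod (fourier f p) \<le> C"
proof (intro exI allI)
  fix p
  have "cmod (LINT x|lborel. cis (- (p * x)) * f x) \<le> (LINT x|lborel. cmod (cis (- (p * x)) * f x))"
    by (rule integral_norm_bound)
  thus "cmod (fourier f p) \<le> 1 / sqrt (2 * pi) * (LINT x|lborel. cmod (f x))"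
    by (simp add: fourier_cis norm_mult norm_divide divide_right_mono)
qed

lemma cis_has_vderiv:
  "((\<lambda>x. cis (q * x)) has_vector_derivative \<i> * complex_of_real q * cis (q * x)) (at x within S)"
proof -
  have "((\<lambda>x. exp (\<i> * complex_of_real (q * x))) has_vector_derivative
      (\<i> * complex_of_real q) * exp (\<i> * complex_of_real (q * x))) (at x)"
  proof -
    have 1: "((\<lambda>x. \<i> * complex_of_real (q * x)) has_vector_derivative \<i> * complex_of_real q) (at x)"
      by (auto intro!: derivative_eq_intros simp: scaleR_conv_of_real)
    from field_vector_diff_chain_at[OF 1 DERIV_exp] show ?thesis by (simp add: o_def)
  qed
  thus ?thesis unfolding cis_conv_exp by (rule has_vector_derivative_at_within)
qed

lemma fourier_vderiv:
  assumes f: "f \<in> \<D>"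
  shows "fourier (vderiv f) p = \<i> * complex_of_real p * fourier f p"
proof -
  have d: "((\<lambda>x. cis (- p * x) * f x) has_vector_derivative
      (cis (- p * x) * vderiv f x + (\<i> * complex_of_real (- p) * cis (- p * x)) * f x)) (at x)" for x
    by (rule has_vector_derivative_mult[OF cis_has_vderiv smooth_has_vderiv[OF test_function_smooth[OF f]]])
  obtain R where R: "\<And>x. \<bar>x\<bar> > R \<Longrightarrow> f x = 0" using f by (auto simp: test_function_iff)
  have "(LINT x|lborel. cis (- p * x) * vderiv f x + (\<i> * complex_of_real (- p) * cis (- p * x)) * f x) = 0"
  proof (rule integral_derivative_zero[OF d, of R])
    have "continuous_on UNIV f" "continuous_on UNIV (vderiv f)"
      by (auto intro: test_function_continuous test_function_vderiv f)
    thus "continuous_on UNIV (\<lambda>x. cis (- p * x) * vderiv f x + \<i> * complex_of_real (- p) * cis (- p * x) * f x)"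
      by (intro continuous_intros)
  qed (simp add: R)
  moreover have "(LINT x|lborel. cis (- p * x) * vderiv f x + (\<i> * complex_of_real (- p) * cis (- p * x)) * f x) =
      (LINT x|lborel. cis (- (p * x)) * vderiv f x) - \<i> * complex_of_real p * (LINT x|lborel. cis (- (p * x)) * f x)"
    using integrable_cis_mult'[OF f, of p] integrable_cis_mult'[OF test_function_vderiv[OF f], of p]
    by (simp add: mult.assoc)
  ultimately show ?thesis unfolding fourier_cis by simp
qed

lemma fourier_decay:
  assumes f: "f \<in> \<D>"
  obtains C where "C > 0" "\<And>p. cmod (fourier f p) \<le> C / (1 + p\<^sup>2)\<^sup>2"
proof -
  define L where "L g = (\<lambda>x. g x + - vderiv (vderiv g) x)" for g :: "real \<Rightarrow> complex"
  have L: "L g \<in> \<D>" "fourier (L g) p = complex_of_real (1 + p\<^sup>2) * fourier g p" if g: "g \<in> \<D>" for g p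
  proof -
    have g'': "(\<lambda>x. - vderiv (vderiv g) x) \<in> \<D>" by (intro test_function_minus test_function_vderiv g)
    show "L g \<in> \<D>" unfolding L_def by (rule test_function_add[OF g g''])
    show "fourier (L g) p = complex_of_real (1 + p\<^sup>2) * fourier g p"
      unfolding L_def fourier_add[OF g g''] using fourier_mult_left[of "-1" "vderiv (vderiv g)" p]
      by (simp add: fourier_vderiv g test_function_vderiv algebra_simps power2_eq_square)
  qed
  obtain C where C: "\<And>p. cmod (fourier (L (L f)) p) \<le> C" using fourier_bound by blast
  have "fourier (L (L f)) p = complex_of_real ((1 + p\<^sup>2)\<^sup>2) * fourier f p" for p
    by (simp add: L f power2_eq_square mult.assoc)
  hence "cmod (fourier (L (L f)) p) = (1 + p\<^sup>2)\<^sup>2 * cmod (fourier f p)" for p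
    by (simp only: norm_mult norm_of_real) simp
  hence "(1 + p\<^sup>2)\<^sup>2 * cmod (fourier f p) \<le> C" for p
    using C[of p] by simp
  hence le: "cmod (fourier f p) \<le> C / (1 + p\<^sup>2)\<^sup>2" for p
  proof -
    have "(1 + p\<^sup>2)\<^sup>2 > 0" by (intro zero_less_power add_pos_nonneg) auto
    thus ?thesis using \<open>\<And>p. (1 + p\<^sup>2)\<^sup>2 * cmod (fourier f p) \<le> C\<close>[of p]
      by (simp add: pos_le_divide_eq mult.commute)
  qed
  show ?thesis
  proof (rule that[of "\<bar>C\<bar> + 1"])
    show "cmod (fourier f p) \<le> (\<bar>C\<bar> + 1) / (1 + p\<^sup>2)\<^sup>2" for p
      by (rule order_trans[OF le divide_right_mono]) auto
  qed simp
qed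

lemma fourier_uminus:
  assumes "\<And>x. cnj (f x) = f x"
  shows "fourier f (- p) = cnj (fourier f p)"
proof -
  have "cnj (LINT x|lborel. cis (- (p * x)) * f x) = (LINT x|lborel. cnj (cis (- (p * x)) * f x))"
    by (rule Bochner_Integration.integral_cnj[symmetric])
  also have "\<dots> = (LINT x|lborel. cis (- (- p * x)) * f x)"
    by (rule Bochner_Integration.integral_cong[OF refl]) (simp add: assms cis_cnj)
  finally show ?thesis unfolding fourier_cis complex_cnj_mult by simp
qed

lemma fourier_cis_mult: "fourier (\<lambda>x. cis (q * x) * f x) p = fourier f (p - q)"
proof -
  have "cis (- (p * x)) * cis (q * x) = cis (- ((p - q) * x))" for x
    by (simp add: cis_mult left_diff_distrib)
  hence "cis (- (p * x)) * (cis (q * x) * f x) = cis (- ((p - q) * x)) * f x" for x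
    by (simp only: mult.assoc[symmetric])
  thus ?thesis unfolding fourier_cis by (simp only:)
qed


section \<open>Bessel's inequality and Poisson summation\<close>

text \<open>Integral over the period interval.\<close>

definition pint :: "real \<Rightarrow> (real \<Rightarrow> complex) \<Rightarrow> complex" where
  "pint a g = (LINT t|lborel. indicator {-a..a} t *\<^sub>R g t)"

lemma pint_integrable:
  fixes g :: "real \<Rightarrow> 'b::euclidean_space"
  shows "continuous_on {-a..a} g \<Longrightarrow> integrable lborel (\<lambda>t. indicator {-a..a} t *\<^sub>R g t)"
  by (rule borel_integrable_compact) auto

lemma pint_add:
  "continuous_on {-a..a} f \<Longrightarrow> continuous_on {-a..a} g \<Longrightarrow> pint a (\<lambda>t. f t + g t) = pint a f + pint a g"
  unfolding pint_def scaleR_add_right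
  by (rule Bochner_Integration.integral_add) (auto intro: pint_integrable)

lemma pint_diff:
  "continuous_on {-a..a} f \<Longrightarrow> continuous_on {-a..a} g \<Longrightarrow> pint a (\<lambda>t. f t - g t) = pint a f - pint a g"
  unfolding pint_def scaleR_diff_right
  by (rule Bochner_Integration.integral_diff) (auto intro: pint_integrable)

lemma pint_sum:
  "(\<And>i. i \<in> S \<Longrightarrow> continuous_on {-a..a} (f i)) \<Longrightarrow> pint a (\<lambda>t. \<Sum>i\<in>S. f i t) = (\<Sum>i\<in>S. pint a (f i))"
  unfolding pint_def scaleR_sum_right
  by (rule Bochner_Integration.integral_sum) (auto intro: pint_integrable)

lemma pint_mult_left: "pint a (\<lambda>t. c * f t) = c * pint a f"
  unfolding pint_def by (simp flip: mult_scaleR_right)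

lemma pint_cnj: "pint a (\<lambda>t. cnj (f t)) = cnj (pint a f)"
  unfolding pint_def Bochner_Integration.integral_cnj[symmetric] by simp

lemma pint_cong: "(\<And>t. \<bar>t\<bar> \<le> a \<Longrightarrow> f t = g t) \<Longrightarrow> pint a f = pint a g"
  unfolding pint_def by (rule Bochner_Integration.integral_cong) (auto simp: indicator_def abs_le_iff)

lemma pint_one: "a \<ge> 0 \<Longrightarrow> pint a (\<lambda>t. 1) = complex_of_real (2 * a)"
  by (simp add: pint_def scaleR_conv_of_real)

lemma pint_cis:
  fixes j :: int
  assumes \<Delta>: "\<Delta> > 0" and a: "a = pi / \<Delta>"
  shows "pint a (\<lambda>t. cis (of_int j * \<Delta> * t)) = (if j = 0 then complex_of_real (2 * a) else 0)"
proof (cases "j = 0")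
  case True
  thus ?thesis using pint_one[of a] \<Delta> a by simp
next
  case False
  define q where "q = of_int j * \<Delta>"
  have q: "q \<noteq> 0" using False \<Delta> by (simp add: q_def)
  have "pint a (\<lambda>t. cis (q * t)) = cis (q * a) / (\<i> * complex_of_real q) - cis (q * (- a)) / (\<i> * complex_of_real q)"
    unfolding pint_def
  proof (rule integral_FTC_Icc)
    show "- a \<le> a" using \<Delta> a by simp
    show "((\<lambda>t. cis (q * t) / (\<i> * complex_of_real q)) has_vector_derivative cis (q * x)) (at x within {- a..a})" for x
      using has_vector_derivative_divide[OF cis_has_vderiv[of q x "{-a..a}"], of "\<i> * complex_of_real q"] q by simp
  qed (intro continuous_intros)
  also have "\<dots> = 0"
  proof -
    have "q * a = of_int j * pi" using \<Delta> by (simp add: q_def a)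
    hence "sin (q * a) = 0" by (simp add: mult.commute)
    hence "cis (q * a) = cis (q * (- a))" by (simp add: complex_eq_iff)
    thus ?thesis by simp
  qed
  finally show ?thesis using False by (simp add: q_def)
qed

lemma bessel_inequality:
  assumes \<Delta>: "\<Delta> > 0" and a: "a = pi / \<Delta>" and g: "continuous_on {-a..a} g" and J: "finite (J :: int set)"
  shows "(\<Sum>j\<in>J. (cmod (pint a (\<lambda>t. g t * cis (- (of_int j * \<Delta> * t)))))\<^sup>2) \<le>
      2 * a * Re (pint a (\<lambda>t. g t * cnj (g t)))"
proof -
  have ap: "a > 0" using \<Delta> a by simp
  define G where "G j = pint a (\<lambda>t. g t * cis (- (of_int j * \<Delta> * t)))" for j :: int
  define e where "e j t = cis (of_int j * \<Delta> * t)" for j :: int and t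
  define S where "S t = (\<Sum>j\<in>J. G j * e j t)" for t
  have ce: "continuous_on {-a..a} (e j)" for j unfolding e_def by (intro continuous_intros)
  have cS: "continuous_on {-a..a} S" unfolding S_def by (intro continuous_intros ce)
  have ee: "e j t * cnj (e k t) = cis (of_int (j - k) * \<Delta> * t)" for j k t
    by (simp add: e_def cis_cnj cis_mult algebra_simps)
  have G_cnj: "pint a (\<lambda>t. cnj (g t) * e j t) = cnj (G j)" for j
    unfolding G_def pint_cnj[symmetric] by (simp add: e_def cis_cnj)
  have 1: "pint a (\<lambda>t. S t * cnj (g t)) = complex_of_real (\<Sum>j\<in>J. (cmod (G j))\<^sup>2)"
  proof -
    have "pint a (\<lambda>t. S t * cnj (g t)) = pint a (\<lambda>t. \<Sum>j\<in>J. G j * (cnj (g t) * e j t))"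
      by (simp add: S_def sum_distrib_left sum_distrib_right mult_ac)
    also have "\<dots> = (\<Sum>j\<in>J. G j * cnj (G j))"
      by (subst pint_sum) (auto simp: pint_mult_left G_cnj intro!: continuous_intros ce g)
    finally show ?thesis by (simp add: complex_norm_square del: of_real_power)
  qed
  have 2: "pint a (\<lambda>t. g t * cnj (S t)) = complex_of_real (\<Sum>j\<in>J. (cmod (G j))\<^sup>2)"
  proof -
    have "pint a (\<lambda>t. g t * cnj (S t)) = cnj (pint a (\<lambda>t. S t * cnj (g t)))"
      unfolding pint_cnj[symmetric] by (simp add: mult.commute)
    thus ?thesis unfolding 1 by simp
  qed
  have 3: "pint a (\<lambda>t. S t * cnj (S t)) = complex_of_real (2 * a * (\<Sum>j\<in>J. (cmod (G j))\<^sup>2))"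
  proof -
    have "S t * cnj (S t) = (\<Sum>j\<in>J. \<Sum>k\<in>J. (G j * cnj (G k)) * cis (of_int (j - k) * \<Delta> * t))" for t
      unfolding ee[symmetric] by (simp add: S_def sum_product mult_ac)
    hence "pint a (\<lambda>t. S t * cnj (S t)) =
        pint a (\<lambda>t. \<Sum>j\<in>J. \<Sum>k\<in>J. (G j * cnj (G k)) * cis (of_int (j - k) * \<Delta> * t))" by simp
    also have "\<dots> = (\<Sum>j\<in>J. \<Sum>k\<in>J. (G j * cnj (G k)) * (if j - k = 0 then complex_of_real (2 * a) else 0))"
      by (subst pint_sum, intro continuous_intros, intro sum.cong refl,
          subst pint_sum, intro continuous_intros, simp only: pint_mult_left pint_cis[OF \<Delta> a])
    also have "\<dots> = (\<Sum>j\<in>J. (G j * cnj (G j)) * complex_of_real (2 * a))"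
      using J by (intro sum.cong refl) (simp add: if_distrib cong: if_cong)
    finally show ?thesis by (simp add: sum_distrib_left complex_norm_square mult_ac del: of_real_power)
  qed
  let ?s = "\<Sum>j\<in>J. (cmod (G j))\<^sup>2" and ?c = "complex_of_real (2 * a)"
  have "pint a (\<lambda>t. (?c * g t - S t) * cnj (?c * g t - S t)) =
      pint a (\<lambda>t. (?c * ?c) * (g t * cnj (g t)) - ?c * (g t * cnj (S t)) - ?c * (S t * cnj (g t)) + S t * cnj (S t))"
    by (rule pint_cong) (simp add: algebra_simps)
  also have "\<dots> = ?c * ?c * pint a (\<lambda>t. g t * cnj (g t)) - ?c * pint a (\<lambda>t. g t * cnj (S t))
      - ?c * pint a (\<lambda>t. S t * cnj (g t)) + pint a (\<lambda>t. S t * cnj (S t))"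
  proof -
    note c = continuous_intros g cS
    have A: "continuous_on {-a..a} (\<lambda>t. (?c * ?c) * (g t * cnj (g t)))" by (intro c)
    have B: "continuous_on {-a..a} (\<lambda>t. ?c * (g t * cnj (S t)))" by (intro c)
    have C: "continuous_on {-a..a} (\<lambda>t. ?c * (S t * cnj (g t)))" by (intro c)
    have D: "continuous_on {-a..a} (\<lambda>t. S t * cnj (S t))" by (intro c)
    show ?thesis
      unfolding pint_add[OF continuous_on_diff[OF continuous_on_diff[OF A B] C] D]
        pint_diff[OF continuous_on_diff[OF A B] C] pint_diff[OF A B] pint_mult_left ..
  qed
  also have "\<dots> = complex_of_real ((2 * a)\<^sup>2) * pint a (\<lambda>t. g t * cnj (g t)) - complex_of_real (2 * a * ?s)"
    unfolding 1 2 3 by (simp add: power2_eq_square algebra_simps)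
  finally have eq: "Re (pint a (\<lambda>t. (?c * g t - S t) * cnj (?c * g t - S t))) =
      (2 * a)\<^sup>2 * Re (pint a (\<lambda>t. g t * cnj (g t))) - 2 * a * ?s" by simp
  have "0 \<le> Re (pint a (\<lambda>t. (?c * g t - S t) * cnj (?c * g t - S t)))"
  proof -
    have "pint a (\<lambda>t. (?c * g t - S t) * cnj (?c * g t - S t)) =
        complex_of_real (LINT t|lborel. indicator {-a..a} t * (cmod (?c * g t - S t))\<^sup>2)"
      unfolding pint_def integral_complex_of_real[symmetric]
      by (simp add: scaleR_conv_of_real complex_norm_square del: complex_cnj_diff of_real_power)
    moreover have "0 \<le> (LINT t|lborel. indicator {-a..a} t * (cmod (?c * g t - S t))\<^sup>2)"
      by (rule Bochner_Integration.integral_nonneg) simp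
    ultimately show ?thesis by simp
  qed
  hence "2 * a * ?s \<le> 2 * a * (2 * a * Re (pint a (\<lambda>t. g t * cnj (g t))))"
    unfolding eq by (simp add: power2_eq_square algebra_simps)
  hence "?s \<le> 2 * a * Re (pint a (\<lambda>t. g t * cnj (g t)))"
    using ap by (simp only: mult_le_cancel_left_pos mult_pos_pos zero_less_numeral)
  thus ?thesis unfolding G_def .
qed

lemma riemann_lebesgue:
  assumes \<Delta>: "\<Delta> > 0" and a: "a = pi / \<Delta>" and g: "continuous_on {-a..a} g" and \<kappa>: "inj (\<kappa> :: nat \<Rightarrow> int)"
  shows "(\<lambda>n. pint a (\<lambda>t. g t * cis (- (of_int (\<kappa> n) * \<Delta> * t)))) \<longlonglongrightarrow> 0"
proof -
  define G where "G j = pint a (\<lambda>t. g t * cis (- (of_int j * \<Delta> * t)))" for j :: int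
  have "summable (\<lambda>n. (cmod (G (\<kappa> n)))\<^sup>2)"
  proof (rule summableI_nonneg_bounded)
    fix n
    have "(\<Sum>i<n. (cmod (G (\<kappa> i)))\<^sup>2) = (\<Sum>j\<in>\<kappa> ` {..<n}. (cmod (G j))\<^sup>2)"
      using \<kappa> by (subst sum.reindex) (auto intro: inj_on_subset)
    thus "(\<Sum>i<n. (cmod (G (\<kappa> i)))\<^sup>2) \<le> 2 * a * Re (pint a (\<lambda>t. g t * cnj (g t)))"
      using bessel_inequality[OF \<Delta> a g, of "\<kappa> ` {..<n}"] by (simp add: G_def)
  qed simp
  hence "(\<lambda>n. (cmod (G (\<kappa> n)))\<^sup>2) \<longlonglongrightarrow> 0" by (rule summable_LIMSEQ_zero)
  from tendsto_real_sqrt[OF this] have "(\<lambda>n. G (\<kappa> n)) \<longlonglongrightarrow> 0" by (simp add: tendsto_norm_zero_iff)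
  thus ?thesis by (simp add: G_def)
qed

lemma has_vector_derivative_quotient:
  assumes "(f has_vector_derivative f') (at x)"
  shows "((\<lambda>t. (f t - f x) /\<^sub>R (t - x)) \<longlongrightarrow> f') (at x)"
proof (rule LIM_zero_cancel, rule tendsto_norm_zero_cancel)
  have "((\<lambda>t. norm (f t - f x - (t - x) *\<^sub>R f') / norm (t - x)) \<longlongrightarrow> 0) (at x)"
    using assms unfolding has_vector_derivative_def has_derivative_iff_norm by blast
  moreover have "norm (f t - f x - (t - x) *\<^sub>R f') / norm (t - x) = norm ((f t - f x) /\<^sub>R (t - x) - f')" if "t \<noteq> x" for t
  proof -
    have "(f t - f x) /\<^sub>R (t - x) - f' = (f t - f x - (t - x) *\<^sub>R f') /\<^sub>R (t - x)"
      using that by (simp add: scaleR_diff_right)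
    thus ?thesis by (simp only: norm_scaleR) (simp add: divide_inverse mult.commute)
  qed
  hence "\<forall>\<^sub>F t in at x. norm (f t - f x - (t - x) *\<^sub>R f') / norm (t - x) = norm ((f t - f x) /\<^sub>R (t - x) - f')"
    by (simp add: eventually_at_filter)
  ultimately show "((\<lambda>t. norm ((f t - f x) /\<^sub>R (t - x) - f')) \<longlongrightarrow> 0) (at x)"
    by (rule Lim_transform_eventually)
qed

text \<open>
  Poisson summation for a function supported in one period, with an offset. Dividing
  \<open>f t - f x\<close> by \<open>cis (\<Delta> (t - x)) - 1\<close> makes the Fourier sum at \<open>x\<close> telescope; the
  quotient is continuous because \<open>f\<close> is differentiable.
\<close>

lemma poisson_summation:
  assumes \<Delta>: "\<Delta> > 0" and a: "a = pi / \<Delta>" and \<psi>: "\<psi> \<in> \<D>" and supp: "\<And>t. \<bar>t\<bar> \<ge> a \<Longrightarrow> \<psi> t = 0"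
    and x: "\<bar>x\<bar> < a"
  shows "(\<lambda>k. fourier \<psi> (real k * \<Delta> + \<theta>) * cis ((real k * \<Delta> + \<theta>) * x) +
      fourier \<psi> (- (real k + 1) * \<Delta> + \<theta>) * cis ((- (real k + 1) * \<Delta> + \<theta>) * x)) sums
      (complex_of_real (sqrt (2 * pi) / \<Delta>) * \<psi> x)"
proof -
  have ap: "a > 0" using \<Delta> a by simp
  define f where "f t = cis (- \<theta> * (t - x)) * \<psi> t" for t
  define E where "E t = cis (\<Delta> * (t - x))" for t
  have fx: "f x = \<psi> x" by (simp add: f_def)
  have E1: "E t \<noteq> 1" if t: "\<bar>t\<bar> \<le> a" "t \<noteq> x" for t
  proof
    assume "E t = 1"
    hence "sin (\<Delta> * (t - x) / 2) = 0"
    proof -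
      have "cos (2 * (\<Delta> * (t - x) / 2)) = 1" using \<open>E t = 1\<close> by (simp add: E_def complex_eq_iff)
      thus ?thesis unfolding cos_double_sin by simp
    qed
    moreover have "\<bar>\<Delta> * (t - x) / 2\<bar> < pi"
    proof -
      have "\<bar>t - x\<bar> < 2 * a" using t x by linarith
      hence "\<Delta> * \<bar>t - x\<bar> < \<Delta> * (2 * a)" using \<Delta> by simp
      thus ?thesis using \<Delta> by (simp add: abs_mult a)
    qed
    moreover have "\<Delta> * (t - x) / 2 \<noteq> 0" using t \<Delta> by simp
    moreover have False if y: "sin y = 0" "\<bar>y\<bar> < pi" "y \<noteq> 0" for y :: real
    proof -
      have "sin \<bar>y\<bar> > 0" using y by (intro sin_gt_zero) auto
      moreover have "sin \<bar>y\<bar> = 0" using y(1) by (simp add: abs_if)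
      ultimately show False by simp
    qed
    ultimately show False by blast
  qed
  have df: "(f has_vector_derivative vderiv f x) (at x)"
  proof (rule smooth_has_vderiv)
    have "f = (\<lambda>t. (cis (\<theta> * x) * cis (- \<theta> * t)) * \<psi> t)"
      by (simp add: f_def fun_eq_iff cis_mult algebra_simps)
    thus "smooth f" by (simp add: smooth_mult smooth_const smooth_cis[of "- \<theta>", simplified] test_function_smooth[OF \<psi>])
  qed
  have cf: "continuous_on S f" for S unfolding f_def by (intro continuous_intros test_function_continuous \<psi>)
  have cE: "continuous_on S E" for S unfolding E_def by (intro continuous_intros)
  define g where "g t = (if t = x then vderiv f x / (\<i> * complex_of_real \<Delta>) else (f t - f x) / (E t - 1))" for t
  have gx: "isCont g x"
  proof -
    have q1: "((\<lambda>t. (f t - f x) /\<^sub>R (t - x)) \<longlongrightarrow> vderiv f x) (at x)"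
      by (rule has_vector_derivative_quotient[OF df])
    have dE: "(E has_vector_derivative \<i> * complex_of_real \<Delta>) (at x)"
    proof -
      have "((\<lambda>t. cis (- \<Delta> * x) * cis (\<Delta> * t)) has_vector_derivative
          cis (- \<Delta> * x) * (\<i> * complex_of_real \<Delta> * cis (\<Delta> * x))) (at x)"
        by (intro has_vector_derivative_mult_right cis_has_vderiv)
      moreover have "(\<lambda>t. cis (- \<Delta> * x) * cis (\<Delta> * t)) = E"
        by (simp add: E_def fun_eq_iff cis_mult algebra_simps)
      moreover have "cis (- \<Delta> * x) * (\<i> * complex_of_real \<Delta> * cis (\<Delta> * x)) = \<i> * complex_of_real \<Delta>"
        using cis_mult[of "- \<Delta> * x" "\<Delta> * x"] by (simp add: mult_ac)
      ultimately show ?thesis by (simp only:)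
    qed
    have q2: "((\<lambda>t. (E t - E x) /\<^sub>R (t - x)) \<longlongrightarrow> \<i> * complex_of_real \<Delta>) (at x)"
      by (rule has_vector_derivative_quotient[OF dE])
    have "((\<lambda>t. ((f t - f x) /\<^sub>R (t - x)) / ((E t - E x) /\<^sub>R (t - x))) \<longlongrightarrow> g x) (at x)"
      using tendsto_divide[OF q1 q2] \<Delta> by (simp add: g_def)
    moreover have "\<forall>\<^sub>F t in at x. ((f t - f x) /\<^sub>R (t - x)) / ((E t - E x) /\<^sub>R (t - x)) = g t"
      by (simp add: eventually_at_filter g_def E_def scaleR_conv_of_real)
    ultimately show ?thesis unfolding isCont_def by (rule Lim_transform_eventually)
  qed
  have cg: "continuous_on {-a..a} g"
  proof (rule continuous_on_eq_continuous_within[THEN iffD2], intro ballI)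
    fix t assume t: "t \<in> {-a..a}"
    show "continuous (at t within {-a..a}) g"
    proof (cases "t = x")
      case True
      thus ?thesis using gx by (simp add: continuous_at_imp_continuous_within)
    next
      case False
      have "continuous_on ({-a..a} - {x}) (\<lambda>t. (f t - f x) / (E t - 1))"
        by (intro continuous_intros cf cE) (use E1 in auto)
      hence "continuous_on ({-a..a} - {x}) g"
        by (rule continuous_on_cong[THEN iffD1, rotated 2]) (auto simp: g_def)
      hence "continuous (at t within ({-a..a} - {x})) g"
        using t False by (auto simp: continuous_on_eq_continuous_within)
      moreover have "at t within {-a..a} = at t within ({-a..a} - {x})"
        by (rule at_within_nhd[of t "- {x}"]) (use False in auto)
      ultimately show ?thesis by (simp only:)
    qed
  qed
  \<comment> \<open>Since \<open>f t = f x + (E t - 1) * g t\<close>, the \<open>j\<close>th term of the Fourier sum is \<open>G (j - 1) - G j\<close>, except for \<open>j = 0\<close>.\<close>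
  define G where "G j = cis (of_int j * \<Delta> * x) * pint a (\<lambda>t. g t * cis (- (of_int j * \<Delta> * t)))" for j :: int
  have Ej: "cis (of_int j * \<Delta> * x) * cis (- (of_int j * \<Delta> * t)) = cis (- (of_int j * \<Delta> * (t - x)))" for j t
    by (simp add: cis_mult algebra_simps)
  have G_alt: "G j = pint a (\<lambda>t. g t * cis (- (of_int j * \<Delta> * (t - x))))" for j
    unfolding G_def pint_mult_left[symmetric] Ej[symmetric] by (simp add: mult_ac)
  have G0: "(\<lambda>n. G (\<kappa> n)) \<longlonglongrightarrow> 0" if "inj \<kappa>" for \<kappa> :: "nat \<Rightarrow> int"
  proof -
    have "(\<lambda>n. pint a (\<lambda>t. g t * cis (- (of_int (\<kappa> n) * \<Delta> * t)))) \<longlonglongrightarrow> 0"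
      by (rule riemann_lebesgue[OF \<Delta> a cg that])
    from tendsto_norm_zero[OF this] have "(\<lambda>n. norm (G (\<kappa> n))) \<longlonglongrightarrow> 0"
      unfolding G_def by (simp add: norm_mult)
    thus ?thesis by (rule tendsto_norm_zero_cancel)
  qed
  define c where "c j = fourier \<psi> (of_int j * \<Delta> + \<theta>) * cis ((of_int j * \<Delta> + \<theta>) * x)" for j :: int
  have c_eq: "complex_of_real (sqrt (2 * pi)) * c j = (if j = 0 then complex_of_real (2 * a) * \<psi> x else 0) + G (j - 1) - G j" for j
  proof -
    have "complex_of_real (sqrt (2 * pi)) * c j =
        (LINT t|lborel. cis (- ((of_int j * \<Delta> + \<theta>) * t)) * \<psi> t) * cis ((of_int j * \<Delta> + \<theta>) * x)"
      by (simp add: c_def fourier_cis flip: of_real_mult mult.assoc)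
    also have "\<dots> = (LINT t|lborel. f t * cis (- (of_int j * \<Delta> * (t - x))))"
    proof -
      have "cis ((of_int j * \<Delta> + \<theta>) * x) * (cis (- ((of_int j * \<Delta> + \<theta>) * t)) * \<psi> t) =
          f t * cis (- (of_int j * \<Delta> * (t - x)))" for t
      proof -
        have "cis ((of_int j * \<Delta> + \<theta>) * x) * cis (- ((of_int j * \<Delta> + \<theta>) * t)) =
            cis (- \<theta> * (t - x)) * cis (- (of_int j * \<Delta> * (t - x)))"
          by (simp add: cis_mult algebra_simps)
        thus ?thesis by (simp add: f_def mult_ac)
      qed
      thus ?thesis by (simp flip: mult.commute[of "cis ((of_int j * \<Delta> + \<theta>) * x)"] integral_mult_right_zero)
    qed
    also have "\<dots> = pint a (\<lambda>t. f t * cis (- (of_int j * \<Delta> * (t - x))))"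
      unfolding pint_def using supp
      by (intro Bochner_Integration.integral_cong refl) (auto simp: f_def indicator_def abs_if not_le)
    also have "\<dots> = pint a (\<lambda>t. f x * cis (- (of_int j * \<Delta> * (t - x))) +
        (g t * cis (- (of_int (j - 1) * \<Delta> * (t - x))) - g t * cis (- (of_int j * \<Delta> * (t - x)))))"
    proof (rule pint_cong)
      fix t :: real assume t: "\<bar>t\<bar> \<le> a"
      have "f t = f x + (E t - 1) * g t" using E1[OF t] by (cases "t = x") (auto simp: g_def E_def)
      hence "f t * A = (f x + (E t - 1) * g t) * A" for A by (rule arg_cong)
      moreover have "(f x + (E t - 1) * g t) * A = f x * A + (g t * (E t * A) - g t * A)" for A
        by (simp add: algebra_simps)
      ultimately have "f t * A = f x * A + (g t * (E t * A) - g t * A)" for A by (simp only:)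
      moreover have "E t * cis (- (of_int j * \<Delta> * (t - x))) = cis (- (of_int (j - 1) * \<Delta> * (t - x)))"
        by (simp add: E_def cis_mult algebra_simps)
      ultimately show "f t * cis (- (of_int j * \<Delta> * (t - x))) = f x * cis (- (of_int j * \<Delta> * (t - x))) +
        (g t * cis (- (of_int (j - 1) * \<Delta> * (t - x))) - g t * cis (- (of_int j * \<Delta> * (t - x))))"
        by (simp only:)
    qed
    also have "\<dots> = f x * pint a (\<lambda>t. cis (- (of_int j * \<Delta> * (t - x)))) + (G (j - 1) - G j)"
    proof -
      note ci = continuous_intros cg
      have A: "continuous_on {-a..a} (\<lambda>t. f x * cis (- (of_int j * \<Delta> * (t - x))))" by (intro ci)
      have B: "continuous_on {-a..a} (\<lambda>t. g t * cis (- (of_int (j - 1) * \<Delta> * (t - x))))" by (intro ci)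
      have C: "continuous_on {-a..a} (\<lambda>t. g t * cis (- (of_int j * \<Delta> * (t - x))))" by (intro ci)
      show ?thesis unfolding pint_add[OF A continuous_on_diff[OF B C]] pint_diff[OF B C] pint_mult_left G_alt ..
    qed
    also have "pint a (\<lambda>t. cis (- (of_int j * \<Delta> * (t - x)))) = (if j = 0 then complex_of_real (2 * a) else 0)"
    proof -
      have "pint a (\<lambda>t. cis (- (of_int j * \<Delta> * (t - x)))) =
          cis (of_int j * \<Delta> * x) * pint a (\<lambda>t. cis (of_int (- j) * \<Delta> * t))"
        unfolding pint_mult_left[symmetric] Ej[symmetric] by simp
      thus ?thesis unfolding pint_cis[OF \<Delta> a] by simp
    qed
    finally show ?thesis by (auto simp: fx)
  qed
  have tele: "complex_of_real (sqrt (2 * pi)) * (\<Sum>k<n. c (int k) + c (- int k - 1)) =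
      (if n = 0 then 0 else complex_of_real (2 * a) * \<psi> x) + G (- int n - 1) - G (int n - 1)" for n
  proof (induction n)
    case 0 show ?case by simp
  next
    case (Suc n)
    have "complex_of_real (sqrt (2 * pi)) * (\<Sum>k<Suc n. c (int k) + c (- int k - 1)) =
        complex_of_real (sqrt (2 * pi)) * (\<Sum>k<n. c (int k) + c (- int k - 1)) +
        (complex_of_real (sqrt (2 * pi)) * c (int n) + complex_of_real (sqrt (2 * pi)) * c (- int n - 1))"
      by (simp add: distrib_left)
    also have "\<dots> = (if Suc n = 0 then 0 else complex_of_real (2 * a) * \<psi> x) + G (- int (Suc n) - 1) - G (int (Suc n) - 1)"
      unfolding Suc c_eq by (auto simp: algebra_simps)
    finally show ?case .
  qed
  have "(\<lambda>n. complex_of_real (sqrt (2 * pi)) * (\<Sum>k<Suc n. c (int k) + c (- int k - 1))) \<longlonglongrightarrow>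
      complex_of_real (2 * a) * \<psi> x + 0 - 0"
  proof -
    have "(\<lambda>n. G (- int (Suc n) - 1)) \<longlonglongrightarrow> 0" "(\<lambda>n. G (int (Suc n) - 1)) \<longlonglongrightarrow> 0"
      by (rule G0; simp add: inj_def)+
    thus ?thesis unfolding tele if_not_P[OF Suc_not_Zero] by (intro tendsto_intros)
  qed
  hence "(\<lambda>n. complex_of_real (sqrt (2 * pi)) * (\<Sum>k<n. c (int k) + c (- int k - 1))) \<longlonglongrightarrow> complex_of_real (2 * a) * \<psi> x"
    by (intro LIMSEQ_imp_Suc[where f="\<lambda>n. complex_of_real (sqrt (2 * pi)) * (\<Sum>k<n. c (int k) + c (- int k - 1))"]) simp
  hence "(\<lambda>n. complex_of_real (1 / sqrt (2 * pi)) * (complex_of_real (sqrt (2 * pi)) * (\<Sum>k<n. c (int k) + c (- int k - 1))))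
      \<longlonglongrightarrow> complex_of_real (1 / sqrt (2 * pi)) * (complex_of_real (2 * a) * \<psi> x)"
    by (rule tendsto_mult_left)
  moreover have "complex_of_real (1 / sqrt (2 * pi)) * (complex_of_real (sqrt (2 * pi)) * z) = z" for z
    by (simp flip: of_real_mult mult.assoc)
  moreover have "1 / sqrt (2 * pi) * (2 * a) = sqrt (2 * pi) / \<Delta>"
    using \<Delta> by (simp add: a field_simps flip: power2_eq_square)
  hence "complex_of_real (1 / sqrt (2 * pi)) * (complex_of_real (2 * a) * \<psi> x) = complex_of_real (sqrt (2 * pi) / \<Delta>) * \<psi> x"
    by (metis mult.assoc of_real_mult)
  ultimately have "(\<lambda>n. \<Sum>k<n. c (int k) + c (- int k - 1)) \<longlonglongrightarrow> complex_of_real (sqrt (2 * pi) / \<Delta>) * \<psi> x"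
    by simp
  moreover have "c (- int k - 1) = fourier \<psi> (- (real k + 1) * \<Delta> + \<theta>) * cis ((- (real k + 1) * \<Delta> + \<theta>) * x)" for k
    by (simp add: c_def algebra_simps)
  ultimately show ?thesis unfolding sums_def by (simp add: c_def)
qed


section \<open>Sampling the energy density\<close>

lemma integrable_quad: "integrable lborel (\<lambda>x::real. 1 / (1 + x\<^sup>2))"
proof -
  let ?f = "\<lambda>x::real. 1 / (1 + x\<^sup>2)"
  have pos: "integrable lborel (\<lambda>x. indicator {0<..} x * ?f x)"
    using integrable_I0i_1_div_plus_square
    by (simp add: interval_lebesgue_integrable_def set_integrable_def einterval_eq zero_ereal_def)
  have neg: "integrable lborel (\<lambda>x. indicator {..<0} x * ?f x)"
  proof -
    have "integrable lborel (\<lambda>x. indicator {0<..} (0 + (- 1) * x) * ?f (0 + (- 1) * x))"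
      by (rule lborel_integrable_real_affine[OF pos]) simp
    also have "(\<lambda>x. indicator {0<..} (0 + (- 1) * x) * ?f (0 + (- 1) * x)) = (\<lambda>x. indicator {..<0} x * ?f x)"
      by (auto simp: indicator_def fun_eq_iff)
    finally show ?thesis .
  qed
  have "integrable lborel (\<lambda>x. indicator {0} x :: real)" by (simp add: integrable_indicator_iff)
  from Bochner_Integration.integrable_add[OF Bochner_Integration.integrable_add[OF pos neg] this]
  show ?thesis
    by (rule Bochner_Integration.integrable_cong[THEN iffD1, rotated 2]) (auto simp: indicator_def)
qed

lemma integral_quad_shift:
  shows "integrable lborel (\<lambda>x::real. 1 / (1 + (c - x)\<^sup>2))"
    and "(LINT x|lborel. 1 / (1 + (c - x)\<^sup>2)) = (LINT x|lborel. 1 / (1 + x\<^sup>2))"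
proof -
  show "integrable lborel (\<lambda>x::real. 1 / (1 + (c - x)\<^sup>2))"
    using lborel_integrable_real_affine[OF integrable_quad, of "-1" c] by simp
  show "(LINT x|lborel. 1 / (1 + (c - x)\<^sup>2)) = (LINT x|lborel. 1 / (1 + x\<^sup>2))"
    using lborel_integral_real_affine[of "-1" "\<lambda>x. 1 / (1 + x\<^sup>2)" c] by simp
qed

text \<open>
  The sampling frequencies. The offset by half a step keeps them away from 0, where the amplitudes
  \<open>1/q\<close> of the shifts would be infinite; together with their negatives they form a full translated lattice.
\<close>

definition node :: "real \<Rightarrow> nat \<Rightarrow> real" where
  "node \<Delta> k = (real k + 1/2) * \<Delta>"

lemma node_pos: "\<Delta> > 0 \<Longrightarrow> node \<Delta> k > 0"
  by (simp add: node_def add_nonneg_pos)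

lemma summable_node_sq:
  assumes \<Delta>: "\<Delta> > 0"
  shows "summable (\<lambda>k. 1 / (node \<Delta> k)\<^sup>2)"
proof -
  have "summable (\<lambda>k. (4 / \<Delta>\<^sup>2) * inverse (real (Suc k) ^ 2))"
    by (intro summable_mult, subst summable_Suc_iff, rule inverse_power_summable) simp
  thus ?thesis
  proof (rule summable_comparison_test'[where N=0])
    fix k
    have "real (Suc k) * \<Delta> / 2 \<le> node \<Delta> k" using \<Delta> by (simp add: node_def field_simps)
    hence "(real (Suc k) * \<Delta> / 2)\<^sup>2 \<le> (node \<Delta> k)\<^sup>2" using \<Delta> by (intro power_mono) auto
    hence "1 / (node \<Delta> k)\<^sup>2 \<le> 1 / (real (Suc k) * \<Delta> / 2)\<^sup>2"
      using \<Delta> by (intro divide_left_mono mult_pos_pos zero_less_power) (auto simp: node_pos)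
    moreover have "1 / (x * \<Delta> / 2)\<^sup>2 = (4 / \<Delta>\<^sup>2) * inverse (x\<^sup>2)" for x :: real
      by (simp add: power2_eq_square field_simps)
    ultimately show "norm (1 / (node \<Delta> k)\<^sup>2) \<le> (4 / \<Delta>\<^sup>2) * inverse (real (Suc k) ^ 2)"
      by (simp only: real_norm_def abs_of_nonneg zero_le_divide_1_iff zero_le_power2)
  qed
qed

lemma quad_shift_le: "1 / (1 + (u - p)\<^sup>2) \<le> 2 * (1 + p\<^sup>2) / (1 + (u::real)\<^sup>2)"
proof -
  have "1 + u\<^sup>2 \<le> 2 * (1 + p\<^sup>2) * (1 + (u - p)\<^sup>2)"
  proof -
    have "u\<^sup>2 \<le> 2 * p\<^sup>2 + 2 * (u - p)\<^sup>2"
      using zero_le_power2[of "u - 2 * p"] by (simp add: power2_eq_square algebra_simps)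
    moreover have "2 * (1 + A) * (1 + B) = 2 + 2 * A + 2 * B + 2 * (A * B)" for A B :: real
      by (simp add: algebra_simps)
    ultimately show ?thesis using mult_nonneg_nonneg[OF zero_le_power2[of p] zero_le_power2[of "u - p"]]
      by (smt (verit))
  qed
  moreover have "1 + u\<^sup>2 > 0" "1 + (u - p)\<^sup>2 > 0" by (simp_all add: add_pos_nonneg)
  ultimately show ?thesis by (simp add: divide_simps)
qed

lemma summable_quad_node:
  assumes \<Delta>: "\<Delta> > 0"
  shows "summable (\<lambda>k. 1 / (1 + (node \<Delta> k - p)\<^sup>2))"
proof (rule summable_comparison_test'[where N=0])
  show "summable (\<lambda>k. 2 * (1 + p\<^sup>2) * (1 / (node \<Delta> k)\<^sup>2))"
    by (intro summable_mult summable_node_sq \<Delta>)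
  fix k
  have "2 * (1 + p\<^sup>2) / (1 + (node \<Delta> k)\<^sup>2) \<le> 2 * (1 + p\<^sup>2) / (node \<Delta> k)\<^sup>2"
    using node_pos[OF \<Delta>, of k] by (intro divide_left_mono mult_pos_pos) (auto simp: add_pos_nonneg)
  hence "1 / (1 + (node \<Delta> k - p)\<^sup>2) \<le> 2 * (1 + p\<^sup>2) * (1 / (node \<Delta> k)\<^sup>2)"
    using quad_shift_le[of "node \<Delta> k" p] by simp
  moreover have "0 \<le> 1 / (1 + (node \<Delta> k - p)\<^sup>2)" by (simp add: add_nonneg_nonneg)
  ultimately show "norm (1 / (1 + (node \<Delta> k - p)\<^sup>2)) \<le> 2 * (1 + p\<^sup>2) * (1 / (node \<Delta> k)\<^sup>2)"
    unfolding real_norm_def by linarith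
qed

lemma quad_sq_le: "1 / (1 + q\<^sup>2)\<^sup>2 \<le> 1 / (1 + (q::real)\<^sup>2)"
proof -
  have "1 + q\<^sup>2 \<le> (1 + q\<^sup>2)\<^sup>2" by (rule self_le_power) auto
  thus ?thesis by (intro divide_left_mono mult_pos_pos zero_less_power) (auto simp: add_pos_nonneg)
qed

lemma fourier_decay_quad:
  assumes f: "f \<in> \<D>"
  shows "\<exists>C>0. \<forall>p. cmod (fourier f p) \<le> C / (1 + p\<^sup>2)\<^sup>2 \<and> cmod (fourier f p) \<le> C / (1 + p\<^sup>2) \<and> cmod (fourier f p) \<le> C"
proof -
  obtain C where C: "C > 0" "\<And>p. cmod (fourier f p) \<le> C / (1 + p\<^sup>2)\<^sup>2" using fourier_decay[OF f] by blast
  have C1: "cmod (fourier f p) \<le> C / (1 + p\<^sup>2)" for p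
    using order_trans[OF C(2)[of p]] mult_left_mono[OF quad_sq_le[of p], of C] C(1) by simp
  have "C / (1 + p\<^sup>2) \<le> C / 1" for p
    using C(1) by (intro divide_left_mono) (auto simp: add_pos_nonneg)
  hence "cmod (fourier f p) \<le> C" for p using order_trans[OF C1[of p]] by simp
  thus ?thesis using C C1 by blast
qed

text \<open>
  The squared modulus of the Fourier transform of a function supported in \<open>[-R, R]\<close> is
  determined by its values at the nodes: on differences of points of the support, plane waves
  of frequency \<open>p\<close> are sums of those with frequencies \<open>\<plusminus> node \<Delta> k\<close>.
\<close>

lemma sampling:
  assumes \<Delta>: "\<Delta> > 0" and a: "a = pi / \<Delta>" and \<psi>: "\<psi> \<in> \<D>" and \<psi>0: "\<And>t. \<bar>t\<bar> \<ge> a \<Longrightarrow> \<psi> t = 0"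
    and \<psi>1: "\<And>t. \<bar>t\<bar> \<le> 2 * R \<Longrightarrow> \<psi> t = 1" and Ra: "2 * R < a"
    and v: "v \<in> \<D>" and vreal: "\<And>x. cnj (v x) = v x" and vR: "\<And>x. \<bar>x\<bar> > R \<Longrightarrow> v x = 0"
  shows "(\<lambda>k. (fourier \<psi> (node \<Delta> k - p) + fourier \<psi> (- node \<Delta> k - p)) *
        complex_of_real ((cmod (fourier v (node \<Delta> k)))\<^sup>2)) sums
      complex_of_real (sqrt (2 * pi) / \<Delta> * (cmod (fourier v p))\<^sup>2)"
proof -
  obtain C where C4: "C > 0" "\<And>q. cmod (fourier \<psi> q) \<le> C / (1 + q\<^sup>2)\<^sup>2"
    "\<And>q. cmod (fourier \<psi> q) \<le> C / (1 + q\<^sup>2)" "\<And>q. cmod (fourier \<psi> q) \<le> C"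
    using fourier_decay_quad[OF \<psi>] by blast
  note C = C4(1,3)
  define \<alpha> where "\<alpha> k = fourier \<psi> (node \<Delta> k - p)" for k
  define \<beta> where "\<beta> k = fourier \<psi> (- node \<Delta> k - p)" for k
  define V where "V q = (LINT x|lborel. cis (- (q * x)) * v x)" for q
  have V_F: "V q = complex_of_real (sqrt (2 * pi)) * fourier v q" for q
    by (simp add: V_def fourier_cis flip: of_real_mult mult.assoc)
  have V_cnj: "V (- q) = cnj (V q)" for q
    unfolding V_F fourier_uminus[OF vreal] by simp
  have ab: "summable (\<lambda>k. cmod (\<alpha> k) + cmod (\<beta> k))"
  proof (rule summable_comparison_test'[where N=0])
    show "summable (\<lambda>k. C * (1 / (1 + (node \<Delta> k - p)\<^sup>2)) + C * (1 / (1 + (node \<Delta> k - (- p))\<^sup>2)))"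
      by (intro summable_add summable_mult summable_quad_node \<Delta>)
    fix k
    have "(- node \<Delta> k - p)\<^sup>2 = (node \<Delta> k - (- p))\<^sup>2" by (simp add: power2_eq_square algebra_simps)
    hence "cmod (\<beta> k) \<le> C * (1 / (1 + (node \<Delta> k - (- p))\<^sup>2))" using C(2)[of "- node \<Delta> k - p"] by (simp add: \<beta>_def)
    moreover have "cmod (\<alpha> k) \<le> C * (1 / (1 + (node \<Delta> k - p)\<^sup>2))" using C(2)[of "node \<Delta> k - p"] by (simp add: \<alpha>_def)
    ultimately show "norm (cmod (\<alpha> k) + cmod (\<beta> k)) \<le>
        C * (1 / (1 + (node \<Delta> k - p)\<^sup>2)) + C * (1 / (1 + (node \<Delta> k - (- p))\<^sup>2))" by simp
  qed
  have wave: "(\<lambda>k. \<alpha> k * cis (node \<Delta> k * y) + \<beta> k * cis (- node \<Delta> k * y)) sums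
      (complex_of_real (sqrt (2 * pi) / \<Delta>) * cis (p * y))" if y: "\<bar>y\<bar> \<le> 2 * R" for y
  proof -
    have e1: "real k * \<Delta> + (\<Delta> / 2 - p) = node \<Delta> k - p" for k by (simp add: node_def algebra_simps)
    have e2: "- (real k + 1) * \<Delta> + (\<Delta> / 2 - p) = - node \<Delta> k - p" for k by (simp add: node_def algebra_simps)
    have "(\<lambda>k. \<alpha> k * cis ((node \<Delta> k - p) * y) + \<beta> k * cis ((- node \<Delta> k - p) * y)) sums
        (complex_of_real (sqrt (2 * pi) / \<Delta>) * \<psi> y)"
      using poisson_summation[OF \<Delta> a \<psi> \<psi>0, of y "\<Delta> / 2 - p"] y Ra unfolding e1 e2 \<alpha>_def \<beta>_def by simp
    from sums_mult[OF this, of "cis (p * y)"]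
    have "(\<lambda>k. cis (p * y) * (\<alpha> k * cis ((node \<Delta> k - p) * y) + \<beta> k * cis ((- node \<Delta> k - p) * y))) sums
        (cis (p * y) * (complex_of_real (sqrt (2 * pi) / \<Delta>) * \<psi> y))" .
    moreover have "cis (p * y) * (\<alpha> k * cis ((node \<Delta> k - p) * y) + \<beta> k * cis ((- node \<Delta> k - p) * y)) =
        \<alpha> k * cis (node \<Delta> k * y) + \<beta> k * cis (- node \<Delta> k * y)" for k
    proof -
      have "cis (p * y) * cis ((node \<Delta> k - p) * y) = cis (node \<Delta> k * y)"
        "cis (p * y) * cis ((- node \<Delta> k - p) * y) = cis (- node \<Delta> k * y)"
        by (simp_all add: cis_mult algebra_simps)
      thus ?thesis by (simp only: distrib_left mult.left_commute[of "cis (p * y)"])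
    qed
    ultimately show ?thesis using \<psi>1[OF y] by (simp add: mult.commute)
  qed
  have vint: "integrable lborel (\<lambda>x. cmod (v x))" by (intro integrable_norm test_function_integrable v)
  \<comment> \<open>Integrate the expansion of the plane wave against \<open>v\<close> in both variables.\<close>
  have stepA: "(\<lambda>k. \<alpha> k * (V (- node \<Delta> k) * cis (- (node \<Delta> k * x))) + \<beta> k * (V (node \<Delta> k) * cis (node \<Delta> k * x))) sums
      (complex_of_real (sqrt (2 * pi) / \<Delta>) * (V (- p) * cis (- (p * x))))" if x: "\<bar>x\<bar> \<le> R" for x
  proof -
    define f where "f k y = (\<alpha> k * cis (node \<Delta> k * (y - x)) + \<beta> k * cis (- node \<Delta> k * (y - x))) * v y" for k y
    have fi: "integrable lborel (f k)" for k
      unfolding f_def by (rule test_function_integrable_mult[OF _ v]) (intro continuous_intros)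
    have fn: "cmod (f k y) \<le> (cmod (\<alpha> k) + cmod (\<beta> k)) * cmod (v y)" for k y
      unfolding f_def norm_mult
      by (intro mult_right_mono order_trans[OF norm_triangle_ineq]) (auto simp: norm_mult)
    have sf: "(\<lambda>k. f k y) sums (complex_of_real (sqrt (2 * pi) / \<Delta>) * (cis (p * (y - x)) * v y))" for y
    proof (cases "\<bar>y\<bar> \<le> R")
      case True
      hence "\<bar>y - x\<bar> \<le> 2 * R" using x by linarith
      from sums_mult2[OF wave[OF this], of "v y"] show ?thesis by (simp add: f_def mult.assoc)
    next
      case False
      thus ?thesis using vR[of y] by (simp add: f_def)
    qed
    have "(\<lambda>k. integral\<^sup>L lborel (f k)) sums (LINT y|lborel. (\<Sum>k. f k y))"
    proof (rule sums_integral)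
      show "AE y in lborel. summable (\<lambda>k. norm (f k y))"
      proof (rule AE_I2, rule summable_comparison_test'[where N=0])
        show "summable (\<lambda>k. (cmod (\<alpha> k) + cmod (\<beta> k)) * cmod (v y))" for y by (rule summable_mult2[OF ab])
      qed (use fn in simp)
      show "summable (\<lambda>k. LINT y|lborel. norm (f k y))"
      proof (rule summable_comparison_test'[where N=0])
        show "summable (\<lambda>k. (cmod (\<alpha> k) + cmod (\<beta> k)) * (LINT y|lborel. cmod (v y)))" by (rule summable_mult2[OF ab])
        fix k
        have "(LINT y|lborel. norm (f k y)) \<le> (LINT y|lborel. (cmod (\<alpha> k) + cmod (\<beta> k)) * cmod (v y))"
          by (intro integral_mono integrable_norm fi integrable_mult_right vint fn)
        moreover have "0 \<le> (LINT y|lborel. norm (f k y))" by (intro Bochner_Integration.integral_nonneg) simp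
        ultimately show "norm (LINT y|lborel. norm (f k y)) \<le> (cmod (\<alpha> k) + cmod (\<beta> k)) * (LINT y|lborel. cmod (v y))"
          by simp
      qed
    qed (rule fi)
    also have "(\<lambda>y. \<Sum>k. f k y) = (\<lambda>y. complex_of_real (sqrt (2 * pi) / \<Delta>) * (cis (p * (y - x)) * v y))"
      by (intro ext sums_unique[symmetric] sf)
    also have "(LINT y|lborel. complex_of_real (sqrt (2 * pi) / \<Delta>) * (cis (p * (y - x)) * v y)) =
        complex_of_real (sqrt (2 * pi) / \<Delta>) * (V (- p) * cis (- (p * x)))"
    proof -
      have "cis (p * (y - x)) * v y = cis (- (p * x)) * (cis (- (- p * y)) * v y)" for y
        by (simp add: cis_mult algebra_simps flip: mult.assoc)
      hence "(LINT y|lborel. complex_of_real (sqrt (2 * pi) / \<Delta>) * (cis (p * (y - x)) * v y)) =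
          (LINT y|lborel. (complex_of_real (sqrt (2 * pi) / \<Delta>) * cis (- (p * x))) * (cis (- (- p * y)) * v y))"
        by (simp only: mult.assoc)
      also have "\<dots> = (complex_of_real (sqrt (2 * pi) / \<Delta>) * cis (- (p * x))) * V (- p)"
        unfolding V_def by (rule integral_mult_right_zero)
      finally show ?thesis by (simp only: mult_ac)
    qed
    also have "(\<lambda>k. integral\<^sup>L lborel (f k)) = (\<lambda>k. \<alpha> k * (V (- node \<Delta> k) * cis (- (node \<Delta> k * x))) + \<beta> k * (V (node \<Delta> k) * cis (node \<Delta> k * x)))"
    proof
      fix k
      have "f k y = (\<alpha> k * cis (- (node \<Delta> k * x))) * (cis (- (- node \<Delta> k * y)) * v y) +
          (\<beta> k * cis (node \<Delta> k * x)) * (cis (- (node \<Delta> k * y)) * v y)" for y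
      proof -
        have c: "cis (node \<Delta> k * (y - x)) = cis (- (node \<Delta> k * x)) * cis (- (- node \<Delta> k * y))"
          "cis (- node \<Delta> k * (y - x)) = cis (node \<Delta> k * x) * cis (- (node \<Delta> k * y))"
          by (simp_all add: cis_mult algebra_simps)
        show ?thesis unfolding f_def c by (simp add: algebra_simps)
      qed
      hence "integral\<^sup>L lborel (f k) = (LINT y|lborel. (\<alpha> k * cis (- (node \<Delta> k * x))) * (cis (- (- node \<Delta> k * y)) * v y) +
          (\<beta> k * cis (node \<Delta> k * x)) * (cis (- (node \<Delta> k * y)) * v y))"
        by (intro Bochner_Integration.integral_cong refl)
      also have "\<dots> = (\<alpha> k * cis (- (node \<Delta> k * x))) * V (- node \<Delta> k) + (\<beta> k * cis (node \<Delta> k * x)) * V (node \<Delta> k)"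
        unfolding V_def
        by (subst Bochner_Integration.integral_add, intro integrable_mult_right integrable_cis_mult' v,
            intro integrable_mult_right integrable_cis_mult' v, simp only: integral_mult_right_zero)
      finally show "integral\<^sup>L lborel (f k) = \<alpha> k * (V (- node \<Delta> k) * cis (- (node \<Delta> k * x))) + \<beta> k * (V (node \<Delta> k) * cis (node \<Delta> k * x))"
        by (simp only: mult_ac)
    qed
    finally show ?thesis .
  qed
  define g where "g k x = (\<alpha> k * (V (- node \<Delta> k) * cis (- (node \<Delta> k * x))) + \<beta> k * (V (node \<Delta> k) * cis (node \<Delta> k * x))) * v x" for k x
  obtain K where K: "\<And>q. cmod (V q) \<le> K"
  proof -
    obtain K where "\<And>q. cmod (fourier v q) \<le> K" using fourier_bound by blast
    thus ?thesis by (intro that[of "sqrt (2 * pi) * K"]) (simp add: V_F norm_mult)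
  qed
  have gi: "integrable lborel (g k)" for k
    unfolding g_def by (rule test_function_integrable_mult[OF _ v]) (intro continuous_intros)
  have gn: "cmod (g k y) \<le> (cmod (\<alpha> k) + cmod (\<beta> k)) * K * cmod (v y)" for k y
  proof -
    have "cmod (\<alpha> k * (V (- node \<Delta> k) * cis (- (node \<Delta> k * y))) + \<beta> k * (V (node \<Delta> k) * cis (node \<Delta> k * y))) \<le>
        cmod (\<alpha> k) * cmod (V (- node \<Delta> k)) + cmod (\<beta> k) * cmod (V (node \<Delta> k))"
      by (rule order_trans[OF norm_triangle_ineq]) (simp add: norm_mult)
    also have "\<dots> \<le> cmod (\<alpha> k) * K + cmod (\<beta> k) * K" by (intro add_mono mult_left_mono K) auto
    finally show ?thesis unfolding g_def norm_mult distrib_right[symmetric] by (intro mult_right_mono) auto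
  qed
  have sg: "(\<lambda>k. g k x) sums (complex_of_real (sqrt (2 * pi) / \<Delta>) * (V (- p) * (cis (- (p * x)) * v x)))" for x
  proof (cases "\<bar>x\<bar> \<le> R")
    case True
    from sums_mult2[OF stepA[OF this], of "v x"] show ?thesis by (simp add: g_def mult.assoc)
  next
    case False
    thus ?thesis using vR[of x] by (simp add: g_def)
  qed
  have "(\<lambda>k. integral\<^sup>L lborel (g k)) sums (LINT x|lborel. (\<Sum>k. g k x))"
  proof (rule sums_integral)
    show "AE y in lborel. summable (\<lambda>k. norm (g k y))"
    proof (rule AE_I2, rule summable_comparison_test'[where N=0])
      show "summable (\<lambda>k. (cmod (\<alpha> k) + cmod (\<beta> k)) * K * cmod (v y))" for y
        by (rule summable_mult2[OF summable_mult2[OF ab]])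
    qed (use gn in simp)
    show "summable (\<lambda>k. LINT y|lborel. norm (g k y))"
    proof (rule summable_comparison_test'[where N=0])
      show "summable (\<lambda>k. (cmod (\<alpha> k) + cmod (\<beta> k)) * K * (LINT y|lborel. cmod (v y)))"
        by (rule summable_mult2[OF summable_mult2[OF ab]])
      fix k
      have "(LINT y|lborel. norm (g k y)) \<le> (LINT y|lborel. (cmod (\<alpha> k) + cmod (\<beta> k)) * K * cmod (v y))"
        by (intro integral_mono integrable_norm gi integrable_mult_right vint gn)
      moreover have "0 \<le> (LINT y|lborel. norm (g k y))" by (intro Bochner_Integration.integral_nonneg) simp
      ultimately show "norm (LINT y|lborel. norm (g k y)) \<le> (cmod (\<alpha> k) + cmod (\<beta> k)) * K * (LINT y|lborel. cmod (v y))"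
        by simp
    qed
  qed (rule gi)
  also have "(\<lambda>x. \<Sum>k. g k x) = (\<lambda>x. complex_of_real (sqrt (2 * pi) / \<Delta>) * (V (- p) * (cis (- (p * x)) * v x)))"
    by (intro ext sums_unique[symmetric] sg)
  also have "(LINT x|lborel. complex_of_real (sqrt (2 * pi) / \<Delta>) * (V (- p) * (cis (- (p * x)) * v x))) =
      complex_of_real (sqrt (2 * pi) / \<Delta>) * (V (- p) * V p)" by (simp add: V_def)
  also have "(\<lambda>k. integral\<^sup>L lborel (g k)) = (\<lambda>k. (\<alpha> k + \<beta> k) * (V (- node \<Delta> k) * V (node \<Delta> k)))"
  proof
    fix k
    have "g k x = (\<alpha> k * V (- node \<Delta> k)) * (cis (- (node \<Delta> k * x)) * v x) +
        (\<beta> k * V (node \<Delta> k)) * (cis (- (- node \<Delta> k * x)) * v x)" for x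
      by (simp add: g_def algebra_simps)
    hence "integral\<^sup>L lborel (g k) = (LINT x|lborel. (\<alpha> k * V (- node \<Delta> k)) * (cis (- (node \<Delta> k * x)) * v x) +
        (\<beta> k * V (node \<Delta> k)) * (cis (- (- node \<Delta> k * x)) * v x))"
      by (intro Bochner_Integration.integral_cong refl)
    also have "\<dots> = (LINT x|lborel. (\<alpha> k * V (- node \<Delta> k)) * (cis (- (node \<Delta> k * x)) * v x)) +
        (LINT x|lborel. (\<beta> k * V (node \<Delta> k)) * (cis (- (- node \<Delta> k * x)) * v x))"
      by (intro Bochner_Integration.integral_add integrable_mult_right integrable_cis_mult' v)
    also have "\<dots> = (\<alpha> k * V (- node \<Delta> k)) * V (node \<Delta> k) + (\<beta> k * V (node \<Delta> k)) * V (- node \<Delta> k)"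
      by (simp only: V_def integral_mult_right_zero)
    finally show "integral\<^sup>L lborel (g k) = (\<alpha> k + \<beta> k) * (V (- node \<Delta> k) * V (node \<Delta> k))"
      by (simp add: distrib_right distrib_left mult_ac)
  qed
  finally have main: "(\<lambda>k. (\<alpha> k + \<beta> k) * (V (- node \<Delta> k) * V (node \<Delta> k))) sums
      (complex_of_real (sqrt (2 * pi) / \<Delta>) * (V (- p) * V p))" .
  have VV: "V (- q) * V q = complex_of_real (2 * pi) * complex_of_real ((cmod (fourier v q))\<^sup>2)" for q
  proof -
    have "V (- q) * V q = complex_of_real ((cmod (V q))\<^sup>2)"
      unfolding V_cnj complex_norm_square by (rule mult.commute)
    also have "(cmod (V q))\<^sup>2 = 2 * pi * (cmod (fourier v q))\<^sup>2"
      unfolding V_F by (simp add: norm_mult power_mult_distrib)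
    finally show ?thesis by simp
  qed
  from sums_mult[OF main, of "complex_of_real (1 / (2 * pi))"]
  have "(\<lambda>k. (complex_of_real (1 / (2 * pi)) * complex_of_real (2 * pi)) * ((\<alpha> k + \<beta> k) * complex_of_real ((cmod (fourier v (node \<Delta> k)))\<^sup>2))) sums
      ((complex_of_real (1 / (2 * pi)) * complex_of_real (2 * pi)) * (complex_of_real (sqrt (2 * pi) / \<Delta>) * complex_of_real ((cmod (fourier v p))\<^sup>2)))"
    unfolding VV by (simp only: mult_ac)
  moreover have "complex_of_real (1 / (2 * pi)) * complex_of_real (2 * pi) = 1"
    unfolding of_real_mult[symmetric] by simp
  ultimately show ?thesis unfolding \<alpha>_def \<beta>_def by (simp only: mult_1 of_real_mult)
qed

text \<open>The weight of the node \<open>k\<close> in the integral of \<open>w p * (cmod (fourier v p))\<^sup>2\<close> over \<open>p\<close>.\<close>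

definition sample_weight :: "real \<Rightarrow> (real \<Rightarrow> complex) \<Rightarrow> (real \<Rightarrow> real) \<Rightarrow> nat \<Rightarrow> real" where
  "sample_weight \<Delta> \<psi> w k = (LINT p|lborel. \<Delta> / sqrt (2 * pi) *
     (w p * Re (fourier \<psi> (node \<Delta> k - p) + fourier \<psi> (- node \<Delta> k - p))))"

lemma weight_shift_le:
  fixes a p :: real
  shows "1 / (1 + \<bar>p\<bar>) * (1 / (1 + (a - p)\<^sup>2)\<^sup>2) \<le> 2 / (1 + \<bar>a\<bar>) * (1 / (1 + (a - p)\<^sup>2))"
proof -
  define q where "q = \<bar>a - p\<bar>"
  have qq: "(a - p)\<^sup>2 = q\<^sup>2" by (simp add: q_def)
  have "1 + \<bar>a\<bar> \<le> (1 + \<bar>p\<bar>) * (1 + q)"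
  proof -
    have "\<bar>a\<bar> \<le> \<bar>p\<bar> + q" by (simp add: q_def)
    moreover have "0 \<le> \<bar>p\<bar> * q" by (simp add: q_def)
    ultimately show ?thesis by (simp add: algebra_simps)
  qed
  also have "\<dots> \<le> (1 + \<bar>p\<bar>) * (2 * (1 + q\<^sup>2))"
  proof (rule mult_left_mono)
    have "0 \<le> (q - 1)\<^sup>2" by simp
    hence "2 * q \<le> 1 + q\<^sup>2" by (simp add: power2_eq_square algebra_simps)
    moreover have "0 \<le> q\<^sup>2" by simp
    ultimately show "1 + q \<le> 2 * (1 + q\<^sup>2)" by (smt (verit))
  qed simp
  finally have "1 + \<bar>a\<bar> \<le> 2 * ((1 + \<bar>p\<bar>) * (1 + q\<^sup>2))" by (simp only: mult.left_commute)
  moreover have pos: "1 + \<bar>a\<bar> > 0" "1 + \<bar>p\<bar> > 0" "1 + q\<^sup>2 > 0" by (simp_all add: add_pos_nonneg)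
  ultimately have "1 / ((1 + \<bar>p\<bar>) * (1 + q\<^sup>2)) \<le> 2 / (1 + \<bar>a\<bar>)"
    by (simp add: divide_simps mult_pos_pos)
  hence "1 / ((1 + \<bar>p\<bar>) * (1 + q\<^sup>2)) * (1 / (1 + q\<^sup>2)) \<le> 2 / (1 + \<bar>a\<bar>) * (1 / (1 + q\<^sup>2))"
    using pos by (intro mult_right_mono) auto
  thus ?thesis unfolding qq by (simp add: power2_eq_square mult.assoc)
qed

lemma sampled_integral:
  assumes \<Delta>: "\<Delta> > 0" and a: "a = pi / \<Delta>" and \<psi>: "\<psi> \<in> \<D>" and \<psi>0: "\<And>t. \<bar>t\<bar> \<ge> a \<Longrightarrow> \<psi> t = 0"
    and \<psi>1: "\<And>t. \<bar>t\<bar> \<le> 2 * R \<Longrightarrow> \<psi> t = 1" and Ra: "2 * R < a"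
    and v: "v \<in> \<D>" and vreal: "\<And>x. cnj (v x) = v x" and vR: "\<And>x. \<bar>x\<bar> > R \<Longrightarrow> v x = 0"
    and w [measurable]: "w \<in> borel_measurable borel" and wK: "\<And>p. \<bar>w p\<bar> \<le> K / (1 + \<bar>p\<bar>)"
  shows "(\<lambda>k. sample_weight \<Delta> \<psi> w k * (cmod (fourier v (node \<Delta> k)))\<^sup>2) sums (LINT p|lborel. w p * (cmod (fourier v p))\<^sup>2)"
    and "integrable lborel (\<lambda>p. w p * (cmod (fourier v p))\<^sup>2)"
proof -
  obtain C where C4: "C > 0" "\<And>q. cmod (fourier \<psi> q) \<le> C / (1 + q\<^sup>2)\<^sup>2"
    "\<And>q. cmod (fourier \<psi> q) \<le> C / (1 + q\<^sup>2)" "\<And>q. cmod (fourier \<psi> q) \<le> C"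
    using fourier_decay_quad[OF \<psi>] by blast
  note C = C4(1,3,4)
  obtain Cv where Cv4: "Cv > 0" "\<And>q. cmod (fourier v q) \<le> Cv / (1 + q\<^sup>2)\<^sup>2"
    "\<And>q. cmod (fourier v q) \<le> Cv / (1 + q\<^sup>2)" "\<And>q. cmod (fourier v q) \<le> Cv"
    using fourier_decay_quad[OF v] by blast
  note Cv = Cv4(1,3,4)
  note [measurable] = fourier_measurable[OF \<psi>] fourier_measurable[OF v]
  have K0: "K \<ge> 0" using wK[of 0] by (simp add: abs_le_iff)
  have wK': "\<bar>w p\<bar> \<le> K" for p
  proof -
    have "K / (1 + \<bar>p\<bar>) \<le> K / 1" using K0 by (intro divide_left_mono) auto
    thus ?thesis using wK[of p] by simp
  qed
  define F where "F p = (cmod (fourier v p))\<^sup>2" for p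
  define c where "c = \<Delta> / sqrt (2 * pi)"
  have c: "c > 0" using \<Delta> by (simp add: c_def)
  define S where "S k p = Re (fourier \<psi> (node \<Delta> k - p) + fourier \<psi> (- node \<Delta> k - p))" for k p
  define f where "f k p = c * (w p * S k p) * F (node \<Delta> k)" for k p
  have S_sums: "(\<lambda>k. S k p * F (node \<Delta> k)) sums (sqrt (2 * pi) / \<Delta> * F p)" for p
  proof -
    have "Re ((fourier \<psi> (node \<Delta> k - p) + fourier \<psi> (- node \<Delta> k - p)) * complex_of_real (F (node \<Delta> k))) = S k p * F (node \<Delta> k)" for k
      by (simp add: S_def distrib_right)
    with sums_Re[OF sampling[OF \<Delta> a \<psi> \<psi>0 \<psi>1 Ra v vreal vR, of p]] show ?thesis
      unfolding F_def[symmetric] by (simp only: Re_complex_of_real)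
  qed
  have f_sums: "(\<lambda>k. f k p) sums (w p * F p)" for p
  proof -
    have "c * (sqrt (2 * pi) / \<Delta>) = 1" using \<Delta> by (simp add: c_def)
    moreover have "c * w p * (X * F p) = (c * X) * (w p * F p)" for X by (simp only: mult_ac)
    ultimately have "c * w p * (sqrt (2 * pi) / \<Delta> * F p) = w p * F p" by (simp only: mult_1)
    moreover have "(\<lambda>k. c * w p * (S k p * F (node \<Delta> k))) sums (c * w p * (sqrt (2 * pi) / \<Delta> * F p))"
      by (rule sums_mult[OF S_sums])
    ultimately show ?thesis by (simp add: f_def mult.assoc)
  qed
  have F0: "F p \<ge> 0" for p by (simp add: F_def)
  have sumF: "summable (\<lambda>k. F (node \<Delta> k))"
  proof (rule summable_comparison_test'[where N=0])
    show "summable (\<lambda>k. Cv * Cv * (1 / (1 + (node \<Delta> k - 0)\<^sup>2)))"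
      by (intro summable_mult summable_quad_node \<Delta>)
    fix k
    have "F (node \<Delta> k) \<le> Cv * (Cv / (1 + (node \<Delta> k)\<^sup>2))"
      unfolding F_def power2_eq_square[of "cmod _"] by (intro mult_mono Cv) (use Cv in auto)
    thus "norm (F (node \<Delta> k)) \<le> Cv * Cv * (1 / (1 + (node \<Delta> k - 0)\<^sup>2))" using F0 by simp
  qed
  define D where "D k p = 1 / (1 + (node \<Delta> k - p)\<^sup>2) + 1 / (1 + (- node \<Delta> k - p)\<^sup>2)" for k p
  have S_le: "\<bar>S k p\<bar> \<le> C * D k p" for k p
  proof -
    have "\<bar>S k p\<bar> \<le> cmod (fourier \<psi> (node \<Delta> k - p)) + cmod (fourier \<psi> (- node \<Delta> k - p))"
      unfolding S_def by (rule order_trans[OF abs_Re_le_cmod norm_triangle_ineq])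
    also have "\<dots> \<le> C / (1 + (node \<Delta> k - p)\<^sup>2) + C / (1 + (- node \<Delta> k - p)\<^sup>2)" by (intro add_mono C)
    finally show ?thesis by (simp add: D_def distrib_left)
  qed
  have S_le': "\<bar>S k p\<bar> \<le> 2 * C" for k p
  proof -
    have "\<bar>S k p\<bar> \<le> cmod (fourier \<psi> (node \<Delta> k - p)) + cmod (fourier \<psi> (- node \<Delta> k - p))"
      unfolding S_def by (rule order_trans[OF abs_Re_le_cmod norm_triangle_ineq])
    also have "\<dots> \<le> C + C" by (intro add_mono C)
    finally show ?thesis by simp
  qed
  define I where "I = (LINT x|lborel. 1 / (1 + (x::real)\<^sup>2))"
  have D_int: "integrable lborel (D k)" "integral\<^sup>L lborel (D k) = 2 * I" for k
    unfolding D_def using integral_quad_shift by (simp_all add: I_def)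
  have f_le: "norm (f k p) \<le> (c * (K * C) * F (node \<Delta> k)) * D k p" for k p
  proof -
    have "norm (f k p) = c * (\<bar>w p\<bar> * \<bar>S k p\<bar>) * F (node \<Delta> k)"
      using c F0 by (simp add: f_def abs_mult)
    also have "\<dots> \<le> c * (K * (C * D k p)) * F (node \<Delta> k)"
      using c F0 K0 by (intro mult_right_mono mult_left_mono mult_mono wK' S_le) auto
    finally show ?thesis by (simp add: mult_ac)
  qed
  have fm: "f k \<in> borel_measurable borel" for k unfolding f_def S_def by measurable
  have fi: "integrable lborel (f k)" for k
    by (rule Bochner_Integration.integrable_bound[OF integrable_mult_right[OF D_int(1)]])
       (use fm f_le order_trans[OF f_le abs_ge_self] in \<open>auto intro!: AE_I2\<close>)
  have AEs: "AE p in lborel. summable (\<lambda>k. norm (f k p))"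
  proof (rule AE_I2, rule summable_comparison_test'[where N=0])
    show "summable (\<lambda>k. c * (K * (2 * C)) * F (node \<Delta> k))" for p :: real by (intro summable_mult sumF)
    fix p k
    have "norm (f k p) = c * (\<bar>w p\<bar> * \<bar>S k p\<bar>) * F (node \<Delta> k)"
      using c F0 by (simp add: f_def abs_mult)
    also have "\<dots> \<le> c * (K * (2 * C)) * F (node \<Delta> k)"
      using c F0 K0 by (intro mult_right_mono mult_left_mono mult_mono wK' S_le') auto
    finally show "norm (norm (f k p)) \<le> c * (K * (2 * C)) * F (node \<Delta> k)" by simp
  qed
  have sums: "summable (\<lambda>k. LINT p|lborel. norm (f k p))"
  proof (rule summable_comparison_test'[where N=0])
    show "summable (\<lambda>k. c * (K * C) * (2 * I) * F (node \<Delta> k))" by (intro summable_mult sumF)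
    fix k
    have "(LINT p|lborel. norm (f k p)) \<le> (LINT p|lborel. (c * (K * C) * F (node \<Delta> k)) * D k p)"
      by (intro integral_mono integrable_norm fi integrable_mult_right D_int(1) f_le)
    also have "\<dots> = c * (K * C) * (2 * I) * F (node \<Delta> k)" by (simp add: D_int)
    finally have "(LINT p|lborel. norm (f k p)) \<le> c * (K * C) * (2 * I) * F (node \<Delta> k)" .
    moreover have "0 \<le> (LINT p|lborel. norm (f k p))" by (intro Bochner_Integration.integral_nonneg) simp
    ultimately show "norm (LINT p|lborel. norm (f k p)) \<le> c * (K * C) * (2 * I) * F (node \<Delta> k)" by simp
  qed
  have eq: "(\<lambda>p. \<Sum>k. f k p) = (\<lambda>p. w p * F p)" by (intro ext sums_unique[symmetric] f_sums)
  have ik: "integral\<^sup>L lborel (f k) = sample_weight \<Delta> \<psi> w k * F (node \<Delta> k)" for k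
    unfolding f_def sample_weight_def c_def S_def by simp
  show "(\<lambda>k. sample_weight \<Delta> \<psi> w k * (cmod (fourier v (node \<Delta> k)))\<^sup>2) sums (LINT p|lborel. w p * (cmod (fourier v p))\<^sup>2)"
    using sums_integral[OF fi AEs sums] unfolding eq ik F_def .
  show "integrable lborel (\<lambda>p. w p * (cmod (fourier v p))\<^sup>2)"
    using integrable_suminf[OF fi AEs sums] unfolding eq F_def .
qed

lemma sample_weight_bound:
  assumes \<Delta>: "\<Delta> > 0" and \<psi>: "\<psi> \<in> \<D>"
    and w [measurable]: "w \<in> borel_measurable borel" and wK: "\<And>p. \<bar>w p\<bar> \<le> K / (1 + \<bar>p\<bar>)"
  obtains L where "L > 0" "\<And>k. \<bar>sample_weight \<Delta> \<psi> w k\<bar> \<le> L / node \<Delta> k"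
proof -
  obtain C where C4: "C > 0" "\<And>q. cmod (fourier \<psi> q) \<le> C / (1 + q\<^sup>2)\<^sup>2"
    "\<And>q. cmod (fourier \<psi> q) \<le> C / (1 + q\<^sup>2)" "\<And>q. cmod (fourier \<psi> q) \<le> C"
    using fourier_decay_quad[OF \<psi>] by blast
  note C = C4(1,2)
  have K0: "K \<ge> 0" using wK[of 0] by (simp add: abs_le_iff)
  define I where "I = (LINT x|lborel. 1 / (1 + (x::real)\<^sup>2))"
  have I0: "I \<ge> 0" unfolding I_def by (intro Bochner_Integration.integral_nonneg) (simp add: add_nonneg_nonneg)
  define c where "c = \<Delta> / sqrt (2 * pi)"
  have c: "c > 0" using \<Delta> by (simp add: c_def)
  define D where "D k p = 1 / (1 + (node \<Delta> k - p)\<^sup>2) + 1 / (1 + (- node \<Delta> k - p)\<^sup>2)" for k p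
  have D_int: "integrable lborel (D k)" "integral\<^sup>L lborel (D k) = 2 * I" for k
    unfolding D_def using integral_quad_shift by (simp_all add: I_def)
  have D0: "D k p \<ge> 0" for k p by (simp add: D_def add_nonneg_nonneg)
  define f where "f k p = c * (w p * Re (fourier \<psi> (node \<Delta> k - p) + fourier \<psi> (- node \<Delta> k - p)))" for k p
  have one: "K / (1 + \<bar>p\<bar>) * cmod (fourier \<psi> (b - p)) \<le> K * C * (2 / (1 + \<bar>b\<bar>) * (1 / (1 + (b - p)\<^sup>2)))" for b p
  proof -
    have "K / (1 + \<bar>p\<bar>) * cmod (fourier \<psi> (b - p)) \<le> K / (1 + \<bar>p\<bar>) * (C / (1 + (b - p)\<^sup>2)\<^sup>2)"
      using K0 by (intro mult_left_mono C) auto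
    also have "\<dots> = K * C * (1 / (1 + \<bar>p\<bar>) * (1 / (1 + (b - p)\<^sup>2)\<^sup>2))" by simp
    also have "\<dots> \<le> K * C * (2 / (1 + \<bar>b\<bar>) * (1 / (1 + (b - p)\<^sup>2)))"
      using K0 C by (intro mult_left_mono weight_shift_le) auto
    finally show ?thesis .
  qed
  have f_le: "\<bar>f k p\<bar> \<le> (c * (K * C * (2 / (1 + \<bar>node \<Delta> k\<bar>)))) * D k p" for k p
  proof -
    have "\<bar>f k p\<bar> = c * (\<bar>w p\<bar> * \<bar>Re (fourier \<psi> (node \<Delta> k - p) + fourier \<psi> (- node \<Delta> k - p))\<bar>)"
      using c by (simp add: f_def abs_mult)
    also have "\<dots> \<le> c * (K / (1 + \<bar>p\<bar>) * (cmod (fourier \<psi> (node \<Delta> k - p)) + cmod (fourier \<psi> (- node \<Delta> k - p))))"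
      using c K0 by (intro mult_left_mono mult_mono wK order_trans[OF abs_Re_le_cmod norm_triangle_ineq]) auto
    also have "\<dots> \<le> c * (K * C * (2 / (1 + \<bar>node \<Delta> k\<bar>) * (1 / (1 + (node \<Delta> k - p)\<^sup>2))) +
        K * C * (2 / (1 + \<bar>node \<Delta> k\<bar>) * (1 / (1 + (- node \<Delta> k - p)\<^sup>2))))"
      using c one[of p "node \<Delta> k"] one[of p "- node \<Delta> k"] by (intro mult_left_mono) (simp_all add: distrib_left)
    finally show ?thesis by (simp add: D_def distrib_left mult_ac)
  qed
  define L where "L = c * (K * C * 2) * (2 * I) + 1"
  show ?thesis
  proof (rule that[of L])
    show "L > 0" using c K0 C I0 by (simp add: L_def add_nonneg_pos)
    fix k
    have np: "node \<Delta> k > 0" by (rule node_pos[OF \<Delta>])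
    have "\<bar>sample_weight \<Delta> \<psi> w k\<bar> = \<bar>integral\<^sup>L lborel (f k)\<bar>" unfolding sample_weight_def f_def[abs_def] c_def ..
    also have "\<dots> \<le> (LINT p|lborel. (c * (K * C * (2 / (1 + \<bar>node \<Delta> k\<bar>)))) * D k p)"
      using c K0 C D0
      by (intro order_trans[OF integral_abs_bound integral_mono'] integrable_mult_right D_int(1) f_le) auto
    also have "\<dots> = c * (K * C * 2) * (2 * I) / (1 + node \<Delta> k)" using np by (simp add: D_int)
    also have "\<dots> \<le> c * (K * C * 2) * (2 * I) / node \<Delta> k"
      using np c K0 C I0 by (intro divide_left_mono mult_pos_pos) auto
    also have "\<dots> \<le> L / node \<Delta> k" using np by (intro divide_right_mono) (auto simp: L_def)
    finally show "\<bar>sample_weight \<Delta> \<psi> w k\<bar> \<le> L / node \<Delta> k" .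
  qed
qed


section \<open>The vacuum forms and their difference\<close>

lemma compact_antiderivative:
  assumes u: "u \<in> \<D>" and ureal: "\<And>x. cnj (u x) = u x" and uR: "\<And>x. \<bar>x\<bar> > R \<Longrightarrow> u x = 0"
    and mean: "(LINT x|lborel. u x) = 0"
  obtains U where "U \<in> \<D>" "vderiv U = u" "\<And>x. cnj (U x) = U x" "\<And>x. \<bar>x\<bar> > R \<Longrightarrow> U x = 0"
proof -
  define S where "S = \<bar>R\<bar> + 1"
  have S: "S > 0" "R < S" "- S < R" by (auto simp: S_def)
  have cu: "continuous_on T u" for T by (rule test_function_continuous[OF u])
  obtain g where g: "\<And>x. x \<in> {-S..S} \<Longrightarrow> (g has_vector_derivative u x) (at x within {-S..S})"
    using antiderivative_continuous[OF cu] by blast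
  have FTC: "g x - g (- S) = (LINT t|lborel. indicator {-S..x} t *\<^sub>R u t)" if x: "- S \<le> x" "x \<le> S" for x
  proof -
    have "(LINT t|lborel. indicator {-S..x} t *\<^sub>R u t) = g x - g (- S)"
    proof (rule integral_FTC_Icc[OF x(1) _ cu])
      show "(g has_vector_derivative u t) (at t within {-S..x})" if "- S \<le> t" "t \<le> x" for t
        by (rule has_vector_derivative_within_subset[OF g]) (use that x in auto)
    qed
    thus ?thesis by simp
  qed
  define G where "G x = (if \<bar>x\<bar> < S then g x - g (- S) else 0)" for x
  have G0: "G x = 0" if "\<bar>x\<bar> > R" for x
  proof (cases "\<bar>x\<bar> < S")
    case True
    hence "G x = (LINT t|lborel. indicator {-S..x} t *\<^sub>R u t)" using FTC[of x] by (simp add: G_def)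
    also have "\<dots> = 0"
    proof (cases "x < 0")
      case True
      have "indicator {-S..x} t *\<^sub>R u t = 0" for t
        using uR[of t] that True by (auto simp: indicator_def)
      thus ?thesis by (simp only: Bochner_Integration.integral_zero)
    next
      case False
      have "indicator {-S..x} t *\<^sub>R u t = u t" for t
        using uR[of t] that False True by (auto simp: indicator_def S_def not_le)
      thus ?thesis using mean by (simp only:)
    qed
    finally show ?thesis .
  qed (simp add: G_def)
  have dG: "(G has_vector_derivative u x) (at x)" for x
  proof (cases "\<bar>x\<bar> < S")
    case True
    have "(g has_vector_derivative u x) (at x within {-S..S})" using g[of x] True by (simp add: abs_less_iff)
    moreover have "at x within {-S..S} = at x"
      by (rule at_within_interior) (use True in \<open>auto simp: abs_less_iff\<close>)
    ultimately have "((\<lambda>x. g x - g (- S)) has_vector_derivative u x) (at x)"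
      by (auto intro!: derivative_eq_intros)
    thus ?thesis
      by (rule has_vector_derivative_transform_within_open[of _ _ _ "{-S<..<S}"]) (use True in \<open>auto simp: G_def\<close>)
  next
    case False
    hence "\<bar>x\<bar> > R" using S by linarith
    hence "u x = 0" by (rule uR)
    moreover have "((\<lambda>x. 0) has_vector_derivative 0) (at x)" by simp
    hence "(G has_vector_derivative 0) (at x)"
      by (rule has_vector_derivative_transform_within_open[of _ _ _ "{x. \<bar>x\<bar> > R}"])
         (use \<open>\<bar>x\<bar> > R\<close> G0 in \<open>auto intro!: open_Collect_less continuous_intros\<close>)
    ultimately show ?thesis by simp
  qed
  define U where "U x = complex_of_real (Re (G x))" for x
  have lin: "bounded_linear (\<lambda>z. complex_of_real (Re z))"
    by (rule bounded_linear_compose[OF bounded_linear_of_real bounded_linear_Re])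
  have re: "complex_of_real (Re (u x)) = u x" for x
    using arg_cong[OF ureal[of x], of Im] by (simp add: complex_eq_iff)
  have dU: "(U has_vector_derivative u x) (at x)" for x
    using bounded_linear.has_vector_derivative[OF lin dG[of x]] unfolding U_def re .
  show ?thesis
  proof (rule that[of U])
    show "U \<in> \<D>"
      by (rule test_functionI[of _ R]) (auto intro: smooth_antiderivative[OF test_function_smooth[OF u] dU] simp: U_def G0)
    show "vderiv U = u" by (rule vderivI[OF dU])
  qed (auto simp: U_def G0)
qed

text \<open>Real and imaginary part, as complex-valued functions.\<close>

definition re_part :: "(real \<Rightarrow> complex) \<Rightarrow> real \<Rightarrow> complex" where
  "re_part f = (\<lambda>x. complex_of_real (Re (f x)))"

definition im_part :: "(real \<Rightarrow> complex) \<Rightarrow> real \<Rightarrow> complex" where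
  "im_part f = (\<lambda>x. complex_of_real (Im (f x)))"

lemma parts_test: "f \<in> \<D> \<Longrightarrow> re_part f \<in> \<D>" "f \<in> \<D> \<Longrightarrow> im_part f \<in> \<D>"
  unfolding re_part_def im_part_def by (rule test_function_Re test_function_Im, assumption)+

text \<open>
  Test functions whose real part has mean zero; on these the vacuum functions of all masses,
  including zero, are Gaussian.
\<close>

definition neutral :: "(real \<Rightarrow> complex) set" where
  "neutral = {f \<in> \<D>. (LINT x|lborel. Re (f x)) = 0}"

lemma neutralI:
  assumes "f \<in> \<D>" "U \<in> \<D>" "vderiv U = re_part f"
  shows "f \<in> neutral"
proof -
  obtain R where R: "\<And>x. \<bar>x\<bar> > R \<Longrightarrow> U x = 0" using assms(2) by (auto simp: test_function_iff)
  have "(LINT x|lborel. re_part f x) = 0"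
  proof (rule integral_derivative_zero[of U _ R])
    show "(U has_vector_derivative re_part f x) (at x)" for x
      unfolding assms(3)[symmetric] by (rule smooth_has_vderiv[OF test_function_smooth[OF assms(2)]])
  qed (auto simp: R intro: test_function_continuous parts_test assms)
  thus ?thesis using assms(1) by (simp add: neutral_def re_part_def)
qed

lemma neutral_antiderivative:
  assumes f: "f \<in> neutral" and R: "\<And>x. \<bar>x\<bar> > R \<Longrightarrow> f x = 0"
  obtains U where "U \<in> \<D>" "vderiv U = re_part f" "\<And>x. cnj (U x) = U x" "\<And>x. \<bar>x\<bar> > R \<Longrightarrow> U x = 0"
proof (rule compact_antiderivative[of "re_part f" R])
  show "re_part f \<in> \<D>" using f by (simp add: neutral_def parts_test)
  show "(LINT x|lborel. re_part f x) = 0" using f by (simp add: neutral_def re_part_def)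
qed (use R that in \<open>auto simp: re_part_def\<close>)

text \<open>The integrand of \<open>sq_norm\<close> before taking the squared modulus.\<close>

definition amp :: "real \<Rightarrow> (real \<Rightarrow> complex) \<Rightarrow> real \<Rightarrow> complex" where
  "amp m f p = complex_of_real (disp m p powr (-1/2)) * fourier (re_part f) p +
     \<i> * complex_of_real (disp m p powr (1/2)) * fourier (im_part f) p"

lemma sq_norm_amp: "sq_norm m f = 1/2 * (LINT p|lborel. (cmod (amp m f p))\<^sup>2)"
  by (simp add: sq_norm_def amp_def re_part_def im_part_def)

text \<open>The real bilinear form with quadratic form \<open>sq_norm m\<close>.\<close>

definition vform :: "real \<Rightarrow> (real \<Rightarrow> complex) \<Rightarrow> (real \<Rightarrow> complex) \<Rightarrow> real" where
  "vform m f g = 1/2 * (LINT p|lborel. Re (cnj (amp m f p) * amp m g p))"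

lemma vform_self: "vform m f f = sq_norm m f"
  unfolding vform_def sq_norm_amp
  by (simp add: complex_norm_square[symmetric] mult.commute[of "cnj _"] del: of_real_power)

lemma sq_norm_nonneg: "0 \<le> sq_norm m f"
  unfolding sq_norm_amp by simp

lemma disp_nonneg [simp]: "0 \<le> disp m p"
  by (simp add: disp_def)

lemma disp_le: "m \<ge> 0 \<Longrightarrow> disp m p \<le> m + \<bar>p\<bar>"
  unfolding disp_def using sqrt_add_le_add_sqrt[of "p\<^sup>2" "m\<^sup>2"] by simp

lemma p_le_disp: "\<bar>p\<bar> \<le> disp m p"
  unfolding disp_def by (rule real_le_rsqrt) simp

lemma disp_measurable [measurable]: "disp m \<in> borel_measurable borel"
  unfolding disp_def[abs_def] by measurable

lemma disp_powr_half: "(disp m p powr (1/2))\<^sup>2 = disp m p"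
  by (simp add: powr_half_sqrt)

lemma disp_powr_mhalf: "disp m p > 0 \<Longrightarrow> (disp m p powr (-1/2))\<^sup>2 = 1 / disp m p"
proof -
  assume d: "disp m p > 0"
  have "(disp m p powr (-1/2))\<^sup>2 = disp m p powr (-1/2 + -1/2)" unfolding power2_eq_square powr_add ..
  also have "\<dots> = disp m p powr (- 1)" by simp
  also have "\<dots> = 1 / disp m p" using d by (simp add: powr_minus_divide)
  finally show ?thesis .
qed

lemma disp_powr_mult: "disp m p > 0 \<Longrightarrow> disp m p powr (-1/2) * disp m p powr (1/2) = 1"
  by (simp flip: powr_add)

lemma amp_antiderivative:
  assumes "U \<in> \<D>" "vderiv U = re_part f"
  shows "amp m f p = \<i> * (complex_of_real (disp m p powr (-1/2) * p) * fourier U p +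
     complex_of_real (disp m p powr (1/2)) * fourier (im_part f) p)"
  unfolding amp_def assms(2)[symmetric] fourier_vderiv[OF assms(1)] by (simp add: algebra_simps)

lemma amp_measurable: "f \<in> \<D> \<Longrightarrow> amp m f \<in> borel_measurable borel"
proof -
  assume f: "f \<in> \<D>"
  note [measurable] = fourier_measurable[OF parts_test(1)[OF f]] fourier_measurable[OF parts_test(2)[OF f]]
  show ?thesis unfolding amp_def[abs_def] by measurable
qed

lemma amp_bound:
  assumes U: "U \<in> \<D>" "vderiv U = re_part f"
  shows "(cmod (amp m f p))\<^sup>2 \<le> 2 * (disp m p * ((cmod (fourier U p))\<^sup>2 + (cmod (fourier (im_part f) p))\<^sup>2))"
proof -
  let ?X = "complex_of_real (disp m p powr (-1/2) * p) * fourier U p"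
  let ?Y = "complex_of_real (disp m p powr (1/2)) * fourier (im_part f) p"
  have a: "(disp m p powr (-1/2) * p)\<^sup>2 \<le> disp m p"
  proof (cases "disp m p = 0")
    case False
    hence d: "disp m p > 0" using disp_nonneg[of m p] by linarith
    have "p\<^sup>2 \<le> (disp m p)\<^sup>2" using power_mono[OF p_le_disp[of p m] abs_ge_zero, of 2] by simp
    hence "p\<^sup>2 / disp m p \<le> disp m p" using d by (simp add: pos_divide_le_eq power2_eq_square)
    thus ?thesis unfolding power_mult_distrib disp_powr_mhalf[OF d] by simp
  qed simp
  have "(cmod (amp m f p))\<^sup>2 = (cmod (?X + ?Y))\<^sup>2"
    unfolding amp_antiderivative[OF U] by (simp add: norm_mult)
  also have "\<dots> \<le> (cmod ?X + cmod ?Y)\<^sup>2" by (intro power_mono norm_triangle_ineq) simp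
  also have "\<dots> \<le> 2 * ((cmod ?X)\<^sup>2 + (cmod ?Y)\<^sup>2)"
    using sum_squares_bound[of "cmod ?X" "cmod ?Y"] by (simp add: power2_sum)
  also have "(cmod ?X)\<^sup>2 = (disp m p powr (-1/2) * p)\<^sup>2 * (cmod (fourier U p))\<^sup>2"
    unfolding norm_mult norm_of_real by (simp add: power_mult_distrib)
  also have "(cmod ?Y)\<^sup>2 = disp m p * (cmod (fourier (im_part f) p))\<^sup>2"
    unfolding norm_mult norm_of_real power_mult_distrib by (simp add: disp_powr_half)
  also have "2 * ((disp m p powr (-1/2) * p)\<^sup>2 * (cmod (fourier U p))\<^sup>2 + disp m p * (cmod (fourier (im_part f) p))\<^sup>2) \<le>
      2 * (disp m p * (cmod (fourier U p))\<^sup>2 + disp m p * (cmod (fourier (im_part f) p))\<^sup>2)"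
    by (intro mult_left_mono add_mono mult_right_mono a) auto
  finally show ?thesis by (simp add: distrib_left)
qed

lemma weighted_decay:
  assumes g: "g \<in> \<D>" and m: "m \<ge> 0"
  obtains C where "C \<ge> 0" "\<And>p q. disp m p * (cmod (fourier g (p - q)))\<^sup>2 \<le> C * (1 + \<bar>q\<bar>) * (1 / (1 + (q - p)\<^sup>2))"
proof -
  obtain C where C: "C > 0" "\<And>p. cmod (fourier g p) \<le> C / (1 + p\<^sup>2)\<^sup>2" "\<And>p. cmod (fourier g p) \<le> C"
    using fourier_decay_quad[OF g] by blast
  show ?thesis
  proof (rule that[of "(m + 1) * (2 * C\<^sup>2)"])
    show "0 \<le> (m + 1) * (2 * C\<^sup>2)" using m by simp
    fix p q :: real
    define r where "r = \<bar>q - p\<bar>"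
    have rr: "(q - p)\<^sup>2 = r\<^sup>2" "(p - q)\<^sup>2 = r\<^sup>2" by (simp_all add: r_def power2_eq_square algebra_simps)
    have r0: "r \<ge> 0" by (simp add: r_def)
    have pos: "1 + r\<^sup>2 > 0" by (simp add: add_pos_nonneg)
    have "disp m p \<le> (m + 1) * (1 + \<bar>p\<bar>)"
    proof -
      have "0 \<le> m * \<bar>p\<bar>" using m by simp
      thus ?thesis using disp_le[OF m, of p] by (simp add: algebra_simps)
    qed
    also have "1 + \<bar>p\<bar> \<le> (1 + \<bar>q\<bar>) * (1 + r)"
    proof -
      have "\<bar>p\<bar> \<le> \<bar>q\<bar> + r" by (simp add: r_def)
      moreover have "0 \<le> \<bar>q\<bar> * r" using r0 by simp
      ultimately show ?thesis by (simp add: algebra_simps)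
    qed
    also have "1 + r \<le> 2 * (1 + r\<^sup>2)"
    proof -
      have "0 \<le> (r - 1)\<^sup>2" by simp
      hence "2 * r \<le> 1 + r\<^sup>2" by (simp add: power2_eq_square algebra_simps)
      thus ?thesis using zero_le_power2[of r] by (smt (verit))
    qed
    finally have d: "disp m p \<le> (m + 1) * ((1 + \<bar>q\<bar>) * (2 * (1 + r\<^sup>2)))"
      using m by (simp add: mult_left_mono)
    have f: "(cmod (fourier g (p - q)))\<^sup>2 \<le> C * (C / (1 + r\<^sup>2)\<^sup>2)"
      unfolding power2_eq_square[of "cmod _"] using C(2)[of "p - q"] C(1)
      by (intro mult_mono C(3)) (auto simp: rr)
    have "disp m p * (cmod (fourier g (p - q)))\<^sup>2 \<le> ((m + 1) * ((1 + \<bar>q\<bar>) * (2 * (1 + r\<^sup>2)))) * (C * (C / (1 + r\<^sup>2)\<^sup>2))"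
      using m pos by (intro mult_mono d f) auto
    also have "\<dots> = (m + 1) * (2 * C\<^sup>2) * (1 + \<bar>q\<bar>) * (1 / (1 + r\<^sup>2))"
    proof -
      have "a * (b * (2 * s)) * (c * (c / s\<^sup>2)) = a * (2 * c\<^sup>2) * b * (1 / s)" if "s > 0" for a b c s :: real
        using that by (simp add: power2_eq_square)
      thus ?thesis using pos by this
    qed
    finally show "disp m p * (cmod (fourier g (p - q)))\<^sup>2 \<le> (m + 1) * (2 * C\<^sup>2) * (1 + \<bar>q\<bar>) * (1 / (1 + (q - p)\<^sup>2))"
      by (simp add: rr)
  qed
qed

lemma weighted_integrable:
  assumes g: "g \<in> \<D>" and m: "m \<ge> 0"
  shows "integrable lborel (\<lambda>p. disp m p * (cmod (fourier g p))\<^sup>2)"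
proof -
  note [measurable] = fourier_measurable[OF g]
  obtain C where C: "C \<ge> 0" "\<And>p q. disp m p * (cmod (fourier g (p - q)))\<^sup>2 \<le> C * (1 + \<bar>q\<bar>) * (1 / (1 + (q - p)\<^sup>2))"
    using weighted_decay[OF g m] by metis
  show ?thesis
  proof (rule Bochner_Integration.integrable_bound)
    show "integrable lborel (\<lambda>p. C * (1 + \<bar>0\<bar>) * (1 / (1 + (0 - p)\<^sup>2)))"
      by (intro integrable_mult_right integral_quad_shift(1))
    show "AE p in lborel. norm (disp m p * (cmod (fourier g p))\<^sup>2) \<le> norm (C * (1 + \<bar>0\<bar>) * (1 / (1 + (0 - p)\<^sup>2)))"
    proof (rule AE_I2)
      fix p
      have "disp m p * (cmod (fourier g p))\<^sup>2 \<le> C * (1 + \<bar>0\<bar>) * (1 / (1 + (0 - p)\<^sup>2))"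
        using C(2)[of p 0] by simp
      moreover have "0 \<le> disp m p * (cmod (fourier g p))\<^sup>2" by simp
      ultimately show "norm (disp m p * (cmod (fourier g p))\<^sup>2) \<le> norm (C * (1 + \<bar>0\<bar>) * (1 / (1 + (0 - p)\<^sup>2)))"
        unfolding real_norm_def by linarith
    qed
  qed measurable
qed

lemma amp_sq_integrable:
  assumes f: "f \<in> neutral" and m: "m \<ge> 0"
  shows "integrable lborel (\<lambda>p. (cmod (amp m f p))\<^sup>2)"
proof -
  have fD: "f \<in> \<D>" using f by (simp add: neutral_def)
  obtain R where "\<And>x. \<bar>x\<bar> > R \<Longrightarrow> f x = 0" using fD by (auto simp: test_function_iff)
  then obtain U where U: "U \<in> \<D>" "vderiv U = re_part f" using neutral_antiderivative[OF f] by metis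
  note [measurable] = amp_measurable[OF fD]
  show ?thesis
  proof (rule Bochner_Integration.integrable_bound)
    show "integrable lborel (\<lambda>p. 2 * (disp m p * (cmod (fourier U p))\<^sup>2 + disp m p * (cmod (fourier (im_part f) p))\<^sup>2))"
      by (intro integrable_mult_right Bochner_Integration.integrable_add weighted_integrable U m parts_test fD)
    show "AE p in lborel. norm ((cmod (amp m f p))\<^sup>2) \<le>
        norm (2 * (disp m p * (cmod (fourier U p))\<^sup>2 + disp m p * (cmod (fourier (im_part f) p))\<^sup>2))"
      using amp_bound[OF U, of m] by (auto intro!: AE_I2 order_trans[OF _ abs_ge_self] simp: distrib_left)
  qed measurable
qed

lemma sq_norm_le:
  assumes f: "f \<in> \<D>" "U \<in> \<D>" "vderiv U = re_part f" and m: "m \<ge> 0"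
  shows "sq_norm m f \<le> (LINT p|lborel. disp m p * (cmod (fourier U p))\<^sup>2 + disp m p * (cmod (fourier (im_part f) p))\<^sup>2)"
proof -
  have i: "integrable lborel (\<lambda>p. disp m p * (cmod (fourier U p))\<^sup>2 + disp m p * (cmod (fourier (im_part f) p))\<^sup>2)"
    by (intro Bochner_Integration.integrable_add weighted_integrable f m parts_test)
  have "(LINT p|lborel. (cmod (amp m f p))\<^sup>2) \<le> (LINT p|lborel. 2 * (disp m p * (cmod (fourier U p))\<^sup>2 + disp m p * (cmod (fourier (im_part f) p))\<^sup>2))"
    using amp_bound[OF f(2,3), of m]
    by (intro integral_mono amp_sq_integrable[OF neutralI[OF f] m] integrable_mult_right i) (simp add: distrib_left)
  thus ?thesis unfolding sq_norm_amp integral_mult_right_zero by simp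
qed

lemma neutral_zero: "(\<lambda>x. 0) \<in> neutral"
  by (simp add: neutral_def test_function_zero)

lemma neutral_scale: "f \<in> neutral \<Longrightarrow> (\<lambda>x. r *\<^sub>R f x) \<in> neutral"
  by (simp add: neutral_def test_function_scaleR)

lemma neutral_add: "f \<in> neutral \<Longrightarrow> g \<in> neutral \<Longrightarrow> (\<lambda>x. f x + g x) \<in> neutral"
  by (simp add: neutral_def test_function_add test_function_integrable)

lemma amp_add:
  assumes "f \<in> \<D>" "g \<in> \<D>"
  shows "amp m (\<lambda>x. f x + g x) p = amp m f p + amp m g p"
proof -
  have "re_part (\<lambda>x. f x + g x) = (\<lambda>x. re_part f x + re_part g x)"
    "im_part (\<lambda>x. f x + g x) = (\<lambda>x. im_part f x + im_part g x)" by (auto simp: re_part_def im_part_def)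
  thus ?thesis unfolding amp_def using assms by (simp add: fourier_add parts_test algebra_simps)
qed

lemma amp_scale: "amp m (\<lambda>x. r *\<^sub>R f x) p = complex_of_real r * amp m f p"
proof -
  have "re_part (\<lambda>x. r *\<^sub>R f x) = (\<lambda>x. complex_of_real r * re_part f x)"
    "im_part (\<lambda>x. r *\<^sub>R f x) = (\<lambda>x. complex_of_real r * im_part f x)" by (auto simp: re_part_def im_part_def)
  thus ?thesis unfolding amp_def by (simp add: fourier_mult_left algebra_simps)
qed

lemma amp_mult_integrable:
  assumes f: "f \<in> neutral" and g: "g \<in> neutral" and m: "m \<ge> 0"
  shows "integrable lborel (\<lambda>p. Re (cnj (amp m f p) * amp m g p))"
proof (rule Bochner_Integration.integrable_bound)
  show "integrable lborel (\<lambda>p. (cmod (amp m f p))\<^sup>2 + (cmod (amp m g p))\<^sup>2)"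
    by (intro Bochner_Integration.integrable_add amp_sq_integrable f g m)
  have "\<bar>Re (cnj a * b)\<bar> \<le> (cmod a)\<^sup>2 + (cmod b)\<^sup>2" for a b
  proof -
    have "\<bar>Re (cnj a * b)\<bar> \<le> cmod a * cmod b"
      using abs_Re_le_cmod[of "cnj a * b"] by (simp add: norm_mult)
    also have "\<dots> \<le> (cmod a)\<^sup>2 + (cmod b)\<^sup>2"
    proof -
      have "0 \<le> cmod a * cmod b" by simp
      thus ?thesis using sum_squares_bound[of "cmod a" "cmod b"] unfolding mult.assoc by linarith
    qed
    finally show ?thesis .
  qed
  thus "AE p in lborel. norm (Re (cnj (amp m f p) * amp m g p)) \<le> norm ((cmod (amp m f p))\<^sup>2 + (cmod (amp m g p))\<^sup>2)"
    unfolding real_norm_def by (intro AE_I2 order_trans[OF _ abs_ge_self])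
  have [measurable]: "cnj \<in> borel_measurable borel"
    by (intro borel_measurable_continuous_onI continuous_intros)
  have "f \<in> \<D>" "g \<in> \<D>" using f g by (auto simp: neutral_def)
  note [measurable] = amp_measurable[OF this(1)] amp_measurable[OF this(2)]
  show "(\<lambda>p. Re (cnj (amp m f p) * amp m g p)) \<in> borel_measurable lborel" by measurable
qed

lemma vform_add:
  assumes "f \<in> neutral" "g \<in> neutral" "k \<in> neutral" "m \<ge> 0"
  shows "vform m f (\<lambda>x. g x + k x) = vform m f g + vform m f k"
proof -
  have "g \<in> \<D>" "k \<in> \<D>" using assms by (auto simp: neutral_def)
  thus ?thesis unfolding vform_def amp_add[OF \<open>g \<in> \<D>\<close> \<open>k \<in> \<D>\<close>] distrib_left plus_complex.sel
    by (subst Bochner_Integration.integral_add) (auto intro!: amp_mult_integrable assms simp del: times_complex.sel)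
qed

lemma vform_scale: "vform m f (\<lambda>x. r *\<^sub>R g x) = r * vform m f g"
proof -
  have re: "Re (complex_of_real r * z) = r * Re z" for z by simp
  have "Re (cnj (amp m f p) * amp m (\<lambda>x. r *\<^sub>R g x) p) = r * Re (cnj (amp m f p) * amp m g p)" for p
    unfolding amp_scale mult.left_commute[of _ "complex_of_real r"] re ..
  thus ?thesis unfolding vform_def by simp
qed

lemma vform_sym: "vform m f g = vform m g f"
proof -
  have "Re (cnj a * b) = Re (cnj b * a)" for a b by (simp add: mult.commute)
  thus ?thesis unfolding vform_def by metis
qed


subsection \<open>The difference of the massive and the massless form\<close>

text \<open>
  With \<open>vderiv U = re_part f\<close>, the factor \<open>\<i> p\<close> of the Fourier transform of the derivative turns the
  integrand of \<open>sq_norm\<close> into a form in the transforms of \<open>U\<close> and \<open>im_part f\<close> whose mixed term does not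
  depend on the mass. The difference of the masses \<open>m\<close> and 0 is therefore diagonal, with the
  following weights.
\<close>

definition weight_im :: "real \<Rightarrow> real \<Rightarrow> real" where
  "weight_im m p = disp m p - \<bar>p\<bar>"

definition weight_re :: "real \<Rightarrow> real \<Rightarrow> real" where
  "weight_re m p = \<bar>p\<bar> - p\<^sup>2 / disp m p"

lemma weights_measurable: "weight_im m \<in> borel_measurable borel" "weight_re m \<in> borel_measurable borel"
  unfolding weight_im_def[abs_def] weight_re_def[abs_def] by measurable

lemma weight_im_bound:
  assumes m: "m > 0"
  shows "0 \<le> weight_im m p" "weight_im m p \<le> (m + m\<^sup>2) / (1 + \<bar>p\<bar>)"
proof -
  define d where "d = disp m p"
  have d: "d \<ge> \<bar>p\<bar>" "d \<ge> m" using p_le_disp[of p m] m by (auto simp: d_def disp_def intro: real_le_rsqrt)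
  have sq: "d\<^sup>2 = p\<^sup>2 + m\<^sup>2" by (simp add: d_def disp_def)
  show "0 \<le> weight_im m p" using d by (simp add: weight_im_def d_def)
  have "(d - \<bar>p\<bar>) * (d + \<bar>p\<bar>) = m\<^sup>2" using sq by (simp add: power2_eq_square algebra_simps)
  moreover have "(d - \<bar>p\<bar>) * \<bar>p\<bar> \<le> (d - \<bar>p\<bar>) * (d + \<bar>p\<bar>)" using d m by (intro mult_left_mono) auto
  ultimately have 1: "(d - \<bar>p\<bar>) * \<bar>p\<bar> \<le> m\<^sup>2" by simp
  have 2: "d - \<bar>p\<bar> \<le> m" using disp_le[of m p] m by (simp add: d_def)
  have "(d - \<bar>p\<bar>) * (1 + \<bar>p\<bar>) \<le> m + m\<^sup>2" using 1 2 by (simp add: distrib_left)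
  thus "weight_im m p \<le> (m + m\<^sup>2) / (1 + \<bar>p\<bar>)" by (simp add: weight_im_def d_def pos_le_divide_eq)
qed

lemma weight_re_bound:
  assumes m: "m > 0"
  shows "0 \<le> weight_re m p" "weight_re m p \<le> (m + m\<^sup>2) / (1 + \<bar>p\<bar>)"
proof -
  define d where "d = disp m p"
  have d: "d \<ge> \<bar>p\<bar>" "d > 0" using p_le_disp[of p m] m by (auto simp: d_def disp_def intro: add_nonneg_pos)
  have eq: "weight_re m p = (\<bar>p\<bar> / d) * weight_im m p"
    using d by (simp add: weight_re_def weight_im_def d_def[symmetric] power2_eq_square field_simps)
  have r: "0 \<le> \<bar>p\<bar> / d" "\<bar>p\<bar> / d \<le> 1" using d by auto
  show "0 \<le> weight_re m p" unfolding eq by (rule mult_nonneg_nonneg[OF r(1) weight_im_bound(1)[OF m]])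
  have "weight_re m p \<le> weight_im m p" unfolding eq by (rule mult_left_le_one_le[OF weight_im_bound(1)[OF m] r])
  thus "weight_re m p \<le> (m + m\<^sup>2) / (1 + \<bar>p\<bar>)" using weight_im_bound(2)[OF m, of p] by linarith
qed

lemma amp_sq_difference:
  assumes U: "U \<in> \<D>" "vderiv U = re_part f" and m: "m > 0" and p: "p \<noteq> 0"
  shows "(cmod (amp m f p))\<^sup>2 - (cmod (amp 0 f p))\<^sup>2 =
    weight_im m p * (cmod (fourier (im_part f) p))\<^sup>2 - weight_re m p * (cmod (fourier U p))\<^sup>2"
proof -
  have exp: "(cmod (amp M f p))\<^sup>2 = p\<^sup>2 / disp M p * (cmod (fourier U p))\<^sup>2 +
      disp M p * (cmod (fourier (im_part f) p))\<^sup>2 + 2 * p * Re (fourier U p * cnj (fourier (im_part f) p))"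
    if d: "disp M p > 0" for M
  proof -
    let ?a = "disp M p powr (-1/2)" and ?b = "disp M p powr (1/2)"
    let ?X = "fourier U p" and ?Y = "fourier (im_part f) p"
    have "(cmod (complex_of_real s * X + complex_of_real t * Y))\<^sup>2 =
        s\<^sup>2 * (cmod X)\<^sup>2 + t\<^sup>2 * (cmod Y)\<^sup>2 + 2 * (s * t) * Re (X * cnj Y)" for s t :: real and X Y
      unfolding cmod_power2 by (simp add: power2_eq_square algebra_simps)
    from this[of "?a * p" ?X ?b ?Y]
    have "(cmod (amp M f p))\<^sup>2 = (?a * p)\<^sup>2 * (cmod ?X)\<^sup>2 + ?b\<^sup>2 * (cmod ?Y)\<^sup>2 + 2 * (?a * p * ?b) * Re (?X * cnj ?Y)"
      unfolding amp_antiderivative[OF U] norm_mult by simp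
    moreover have "(?a * p)\<^sup>2 = p\<^sup>2 / disp M p" unfolding power_mult_distrib disp_powr_mhalf[OF d] by simp
    moreover have "?a * p * ?b = p" using disp_powr_mult[OF d] by (simp add: mult.commute mult.left_commute)
    ultimately show ?thesis by (simp only: disp_powr_half)
  qed
  have dm: "disp m p > 0" using m by (simp add: disp_def add_nonneg_pos)
  have d0: "disp 0 p = \<bar>p\<bar>" by (simp add: disp_def)
  have pp: "p\<^sup>2 / \<bar>p\<bar> = \<bar>p\<bar>" using p by (simp add: power2_eq_square abs_if)
  show ?thesis
    using exp[OF dm] exp[of 0] p unfolding d0 pp weight_im_def weight_re_def by (simp add: algebra_simps)
qed

lemma sq_norm_difference:
  assumes f: "f \<in> neutral" and U: "U \<in> \<D>" "vderiv U = re_part f" and m: "m > 0"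
    and i1: "integrable lborel (\<lambda>p. weight_im m p * (cmod (fourier (im_part f) p))\<^sup>2)"
    and i2: "integrable lborel (\<lambda>p. weight_re m p * (cmod (fourier U p))\<^sup>2)"
  shows "sq_norm m f - sq_norm 0 f = 1/2 * (LINT p|lborel. weight_im m p * (cmod (fourier (im_part f) p))\<^sup>2) -
     1/2 * (LINT p|lborel. weight_re m p * (cmod (fourier U p))\<^sup>2)"
proof -
  have fD: "f \<in> \<D>" using f by (simp add: neutral_def)
  note [measurable] = amp_measurable[OF fD]
  have ia: "integrable lborel (\<lambda>p. (cmod (amp M f p))\<^sup>2)" if "M \<ge> 0" for M by (rule amp_sq_integrable[OF f that])
  have "(LINT p|lborel. (cmod (amp m f p))\<^sup>2) - (LINT p|lborel. (cmod (amp 0 f p))\<^sup>2) =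
      (LINT p|lborel. (cmod (amp m f p))\<^sup>2 - (cmod (amp 0 f p))\<^sup>2)"
    by (rule Bochner_Integration.integral_diff[symmetric]) (use ia m in auto)
  also have "\<dots> = (LINT p|lborel. weight_im m p * (cmod (fourier (im_part f) p))\<^sup>2 - weight_re m p * (cmod (fourier U p))\<^sup>2)"
  proof (rule integral_cong_AE)
    have "AE p in lborel. p \<noteq> (0::real)" by (rule AE_lborel_singleton)
    thus "AE p in lborel. (cmod (amp m f p))\<^sup>2 - (cmod (amp 0 f p))\<^sup>2 =
        weight_im m p * (cmod (fourier (im_part f) p))\<^sup>2 - weight_re m p * (cmod (fourier U p))\<^sup>2"
      by eventually_elim (rule amp_sq_difference[OF U m])
  qed (use i1 i2 in auto)
  also have "\<dots> = (LINT p|lborel. weight_im m p * (cmod (fourier (im_part f) p))\<^sup>2) - (LINT p|lborel. weight_re m p * (cmod (fourier U p))\<^sup>2)"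
    by (rule Bochner_Integration.integral_diff[OF i1 i2])
  finally show ?thesis unfolding sq_norm_amp by simp
qed


subsection \<open>Localised waves\<close>

text \<open>
  A wave of frequency \<open>q\<close> and complex amplitude \<open>2 c\<close>, cut off by \<open>\<rho>\<close>; it is real if \<open>\<rho>\<close> is. Its derivative
  and \<open>\<i>\<close> times the wave are the shifts to be used.
\<close>

definition wave :: "(real \<Rightarrow> complex) \<Rightarrow> real \<Rightarrow> complex \<Rightarrow> real \<Rightarrow> complex" where
  "wave \<rho> q c x = c * (cis (q * x) * \<rho> x) + cnj c * (cis (- q * x) * \<rho> x)"

lemma wave_test:
  assumes "\<rho> \<in> \<D>"
  shows "wave \<rho> q c \<in> \<D>"
  unfolding wave_def[abs_def]
  by (intro test_function_add test_function_mult[OF smooth_const] test_function_mult[OF smooth_cis] assms)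

lemma cnj_wave: "(\<And>x. cnj (\<rho> x) = \<rho> x) \<Longrightarrow> cnj (wave \<rho> q c x) = wave \<rho> q c x"
  by (simp add: wave_def cis_cnj add.commute)

lemma fourier_wave:
  assumes "\<rho> \<in> \<D>"
  shows "fourier (wave \<rho> q c) p = c * fourier \<rho> (p - q) + cnj c * fourier \<rho> (p + q)"
proof -
  have d: "(\<lambda>x. c' * (cis (q' * x) * \<rho> x)) \<in> \<D>" for c' q'
    by (intro test_function_mult[OF smooth_const] test_function_mult[OF smooth_cis] assms)
  show ?thesis unfolding wave_def[abs_def] fourier_add[OF d d] fourier_mult_left fourier_cis_mult by simp
qed

lemma wave_energy:
  assumes \<rho>: "\<rho> \<in> \<D>" and m: "m \<ge> 0"
  obtains C where "C \<ge> 0" "\<And>q c. (LINT p|lborel. disp m p * (cmod (fourier (wave \<rho> q c) p))\<^sup>2) \<le> C * (cmod c)\<^sup>2 * (1 + \<bar>q\<bar>)"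
proof -
  obtain C where C: "C \<ge> 0" "\<And>p q. disp m p * (cmod (fourier \<rho> (p - q)))\<^sup>2 \<le> C * (1 + \<bar>q\<bar>) * (1 / (1 + (q - p)\<^sup>2))"
    using weighted_decay[OF \<rho> m] by metis
  define I where "I = (LINT x|lborel. 1 / (1 + (x::real)\<^sup>2))"
  have I0: "I \<ge> 0" unfolding I_def by (intro Bochner_Integration.integral_nonneg) (simp add: add_nonneg_nonneg)
  show ?thesis
  proof (rule that[of "4 * C * I"])
    show "0 \<le> 4 * C * I" using C I0 by simp
    fix q c
    let ?k = "2 * (cmod c)\<^sup>2 * (C * (1 + \<bar>q\<bar>))"
    have le: "disp m p * (cmod (fourier (wave \<rho> q c) p))\<^sup>2 \<le> ?k * (1 / (1 + (q - p)\<^sup>2) + 1 / (1 + (- q - p)\<^sup>2))" for p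
    proof -
      have "cmod (fourier (wave \<rho> q c) p) \<le> cmod c * (cmod (fourier \<rho> (p - q)) + cmod (fourier \<rho> (p - (- q))))"
        unfolding fourier_wave[OF \<rho>]
        by (rule order_trans[OF norm_triangle_ineq]) (simp add: norm_mult distrib_left)
      hence "(cmod (fourier (wave \<rho> q c) p))\<^sup>2 \<le> (cmod c * (cmod (fourier \<rho> (p - q)) + cmod (fourier \<rho> (p - (- q)))))\<^sup>2"
        by (intro power_mono) auto
      also have "\<dots> \<le> (cmod c)\<^sup>2 * (2 * ((cmod (fourier \<rho> (p - q)))\<^sup>2 + (cmod (fourier \<rho> (p - (- q))))\<^sup>2))"
        unfolding power_mult_distrib
        using sum_squares_bound[of "cmod (fourier \<rho> (p - q))" "cmod (fourier \<rho> (p - (- q)))"]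
        by (intro mult_left_mono) (simp_all add: power2_sum)
      finally have "disp m p * (cmod (fourier (wave \<rho> q c) p))\<^sup>2 \<le>
          disp m p * ((cmod c)\<^sup>2 * (2 * ((cmod (fourier \<rho> (p - q)))\<^sup>2 + (cmod (fourier \<rho> (p - (- q))))\<^sup>2)))"
        by (rule mult_left_mono) simp
      also have "\<dots> = 2 * (cmod c)\<^sup>2 * (disp m p * (cmod (fourier \<rho> (p - q)))\<^sup>2 + disp m p * (cmod (fourier \<rho> (p - (- q))))\<^sup>2)"
        by (simp add: algebra_simps)
      also have "\<dots> \<le> 2 * (cmod c)\<^sup>2 * (C * (1 + \<bar>q\<bar>) * (1 / (1 + (q - p)\<^sup>2)) + C * (1 + \<bar>- q\<bar>) * (1 / (1 + (- q - p)\<^sup>2)))"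
        by (intro mult_left_mono add_mono C(2)) simp
      also have "\<dots> = ?k * (1 / (1 + (q - p)\<^sup>2) + 1 / (1 + (- q - p)\<^sup>2))"
        by (simp only: abs_minus_cancel mult.assoc distrib_left[symmetric])
      finally show ?thesis .
    qed
    have D: "integrable lborel (\<lambda>p. 1 / (1 + (q - p)\<^sup>2) + 1 / (1 + (- q - p)\<^sup>2))"
      "(LINT p|lborel. 1 / (1 + (q - p)\<^sup>2) + 1 / (1 + (- q - p)\<^sup>2)) = 2 * I"
      using integral_quad_shift[of q] integral_quad_shift[of "- q"] by (simp_all add: I_def)
    have "(LINT p|lborel. disp m p * (cmod (fourier (wave \<rho> q c) p))\<^sup>2) \<le> (LINT p|lborel. ?k * (1 / (1 + (q - p)\<^sup>2) + 1 / (1 + (- q - p)\<^sup>2)))"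
      by (intro integral_mono weighted_integrable wave_test \<rho> m integrable_mult_right D(1) le)
    also have "\<dots> = ?k * (2 * I)" unfolding integral_mult_right_zero D(2) ..
    also have "\<dots> = 4 * C * I * (cmod c)\<^sup>2 * (1 + \<bar>q\<bar>)" by simp
    finally show "(LINT p|lborel. disp m p * (cmod (fourier (wave \<rho> q c) p))\<^sup>2) \<le> 4 * C * I * (cmod c)\<^sup>2 * (1 + \<bar>q\<bar>)" .
  qed
qed

lemma cnj_vderiv:
  assumes "smooth g" "\<And>x. cnj (g x) = g x"
  shows "cnj (vderiv g x) = vderiv g x"
proof -
  have "((\<lambda>x. cnj (g x)) has_vector_derivative cnj (vderiv g x)) (at x)"
    by (rule bounded_linear.has_vector_derivative[OF bounded_linear_cnj smooth_has_vderiv[OF assms(1)]])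
  thus ?thesis using smooth_has_vderiv[OF assms(1), of x] unfolding assms(2)
    by (rule vector_derivative_unique_at)
qed

lemma real_parts:
  assumes "\<And>x. cnj (g x) = g x"
  shows "re_part g = g" "im_part g = (\<lambda>x. 0)" "re_part (\<lambda>x. \<i> * g x) = (\<lambda>x. 0)" "im_part (\<lambda>x. \<i> * g x) = g"
proof -
  have "Im (g x) = 0" for x using arg_cong[OF assms[of x], of Im] by simp
  thus "re_part g = g" "im_part g = (\<lambda>x. 0)" "re_part (\<lambda>x. \<i> * g x) = (\<lambda>x. 0)" "im_part (\<lambda>x. \<i> * g x) = g"
    by (auto simp: re_part_def im_part_def complex_eq_iff)
qed

lemma shift_vectors:
  assumes g: "g \<in> \<D>" and real: "\<And>x. cnj (g x) = g x"
  shows "vderiv g \<in> neutral" "(\<lambda>x. \<i> * g x) \<in> neutral"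
    and "m \<ge> 0 \<Longrightarrow> sq_norm m (vderiv g) \<le> (LINT p|lborel. disp m p * (cmod (fourier g p))\<^sup>2)"
    and "m \<ge> 0 \<Longrightarrow> sq_norm m (\<lambda>x. \<i> * g x) \<le> (LINT p|lborel. disp m p * (cmod (fourier g p))\<^sup>2)"
proof -
  have d: "\<And>x. cnj (vderiv g x) = vderiv g x" by (rule cnj_vderiv[OF test_function_smooth[OF g] real])
  have gD: "vderiv g \<in> \<D>" "(\<lambda>x. \<i> * g x) \<in> \<D>"
    by (intro test_function_vderiv g, intro test_function_mult[OF smooth_const] g)
  have z: "vderiv (\<lambda>x. 0) = (\<lambda>x. 0)" by (rule vderivI) simp
  have f0: "fourier (\<lambda>x. 0) p = 0" for p by (simp add: fourier_cis)
  have p1: "vderiv g = re_part (vderiv g)" using real_parts(1)[OF d] by simp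
  have p2: "vderiv (\<lambda>x. 0) = re_part (\<lambda>x. \<i> * g x)" using real_parts(3)[OF real] z by simp
  show "vderiv g \<in> neutral" by (rule neutralI[OF gD(1) g p1])
  show "(\<lambda>x. \<i> * g x) \<in> neutral" by (rule neutralI[OF gD(2) test_function_zero p2])
  show "m \<ge> 0 \<Longrightarrow> sq_norm m (vderiv g) \<le> (LINT p|lborel. disp m p * (cmod (fourier g p))\<^sup>2)"
    using sq_norm_le[OF gD(1) g p1, of m] by (simp add: real_parts(2)[OF d] f0)
  show "m \<ge> 0 \<Longrightarrow> sq_norm m (\<lambda>x. \<i> * g x) \<le> (LINT p|lborel. disp m p * (cmod (fourier g p))\<^sup>2)"
    using sq_norm_le[OF gD(2) test_function_zero p2, of m] by (simp add: real_parts(4)[OF real] f0)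
qed

lemma integral_wave:
  assumes u: "u \<in> \<D>" and ureal: "\<And>x. cnj (u x) = u x"
  shows "(LINT x|lborel. u x * complex_of_real (2 * Re (c * cis (q * x)))) =
    complex_of_real (2 * sqrt (2 * pi) * Re (c * cnj (fourier u q)))"
proof -
  have e: "u x * complex_of_real (2 * Re (c * cis (q * x))) = c * (cis (- (- q * x)) * u x) + cnj c * (cis (- (q * x)) * u x)" for x
  proof -
    have "complex_of_real (2 * Re (c * cis (q * x))) = c * cis (q * x) + cnj (c * cis (q * x))"
      by (simp add: complex_eq_iff)
    thus ?thesis by (simp add: cis_cnj algebra_simps)
  qed
  have s: "complex_of_real (sqrt (2 * pi)) * fourier u r = (LINT x|lborel. cis (- (r * x)) * u x)" for r
    by (simp add: fourier_cis flip: of_real_mult mult.assoc)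
  have "(LINT x|lborel. u x * complex_of_real (2 * Re (c * cis (q * x)))) =
      c * (LINT x|lborel. cis (- (- q * x)) * u x) + cnj c * (LINT x|lborel. cis (- (q * x)) * u x)"
    unfolding e
    by (subst Bochner_Integration.integral_add, intro integrable_mult_right integrable_cis_mult' u,
        intro integrable_mult_right integrable_cis_mult' u, simp only: integral_mult_right_zero)
  also have "\<dots> = complex_of_real (sqrt (2 * pi)) * (c * cnj (fourier u q) + cnj (c * cnj (fourier u q)))"
    unfolding s[symmetric] fourier_uminus[OF ureal] by (simp add: algebra_simps)
  also have "\<dots> = complex_of_real (2 * sqrt (2 * pi) * Re (c * cnj (fourier u q)))"
    unfolding complex_add_cnj by (simp add: mult_ac)
  finally show ?thesis .
qed

text \<open>
  On functions supported where \<open>\<rho>\<close> is 1, the symplectic form with the shifts measures the Fourier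
  transforms of the real and of the imaginary part at the frequency \<open>q\<close>.
\<close>

lemma symp_shift:
  assumes f: "f \<in> \<D>" and R: "\<And>x. \<bar>x\<bar> > R \<Longrightarrow> f x = 0"
    and \<rho>: "\<rho> \<in> \<D>" and \<rho>1: "\<And>x. \<bar>x\<bar> < R' \<Longrightarrow> \<rho> x = 1" and \<rho>real: "\<And>x. cnj (\<rho> x) = \<rho> x" and RR: "R < R'"
  shows "symp f (\<lambda>x. \<i> * wave \<rho> q c x) = 2 * sqrt (2 * pi) * Re (c * cnj (fourier (re_part f) q))"
    and "symp f (vderiv (wave \<rho> q c)) = - (2 * sqrt (2 * pi) * Re (\<i> * complex_of_real q * c * cnj (fourier (im_part f) q)))"
proof -
  have wav: "wave \<rho> q c x = complex_of_real (2 * Re (c * cis (q * x)))" if "\<bar>x\<bar> < R'" for x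
    using \<rho>1[OF that] by (simp add: wave_def complex_eq_iff)
  have dw: "vderiv (wave \<rho> q c) x = complex_of_real (2 * Re (\<i> * complex_of_real q * c * cis (q * x)))" if "\<bar>x\<bar> < R'" for x
  proof -
    have "((\<lambda>x. c * cis (q * x) + cnj c * cis (- q * x)) has_vector_derivative
        c * (\<i> * complex_of_real q * cis (q * x)) + cnj c * (\<i> * complex_of_real (- q) * cis (- q * x))) (at x)"
      by (intro derivative_intros has_vector_derivative_mult_right cis_has_vderiv)
    hence "(wave \<rho> q c has_vector_derivative
        c * (\<i> * complex_of_real q * cis (q * x)) + cnj c * (\<i> * complex_of_real (- q) * cis (- q * x))) (at x)"
      by (rule has_vector_derivative_transform_within_open[of _ _ _ "{x. \<bar>x\<bar> < R'}"])
         (use that in \<open>auto simp: wave_def \<rho>1 intro!: open_Collect_less continuous_intros\<close>)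
    hence "vderiv (wave \<rho> q c) x = c * (\<i> * complex_of_real q * cis (q * x)) + cnj c * (\<i> * complex_of_real (- q) * cis (- q * x))"
      by (simp add: vderiv_def vector_derivative_at)
    thus ?thesis by (simp add: complex_eq_iff algebra_simps)
  qed
  note parts = parts_test[OF f]
  show "symp f (\<lambda>x. \<i> * wave \<rho> q c x) = 2 * sqrt (2 * pi) * Re (c * cnj (fourier (re_part f) q))"
  proof -
    have e: "Im (cnj (f x) * (\<i> * wave \<rho> q c x)) = Re (re_part f x * complex_of_real (2 * Re (c * cis (q * x))))" for x
      using R[of x] wav[of x] RR by (cases "\<bar>x\<bar> > R") (auto simp: re_part_def)
    have int: "integrable lborel (\<lambda>x. cnj (f x) * (\<i> * wave \<rho> q c x))"
      by (intro test_function_integrable_mult continuous_on_cnj test_function_continuous f test_function_mult[OF smooth_const] wave_test \<rho>)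
    have int': "integrable lborel (\<lambda>x. re_part f x * complex_of_real (2 * Re (c * cis (q * x))))"
      using test_function_integrable_mult[OF _ parts(1), of "\<lambda>x. complex_of_real (2 * Re (c * cis (q * x)))"]
      by (simp add: mult.commute continuous_intros)
    have "symp f (\<lambda>x. \<i> * wave \<rho> q c x) = (LINT x|lborel. Im (cnj (f x) * (\<i> * wave \<rho> q c x)))"
      unfolding symp_def by (rule integral_Im[OF int, symmetric])
    also have "\<dots> = Re (LINT x|lborel. re_part f x * complex_of_real (2 * Re (c * cis (q * x))))"
      unfolding e by (rule integral_Re[OF int'])
    also have "\<dots> = 2 * sqrt (2 * pi) * Re (c * cnj (fourier (re_part f) q))"
      by (subst integral_wave[OF parts(1)]) (simp add: re_part_def, rule Re_complex_of_real)
    finally show ?thesis .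
  qed
  show "symp f (vderiv (wave \<rho> q c)) = - (2 * sqrt (2 * pi) * Re (\<i> * complex_of_real q * c * cnj (fourier (im_part f) q)))"
  proof -
    have e: "Im (cnj (f x) * vderiv (wave \<rho> q c) x) = - Re (im_part f x * complex_of_real (2 * Re (\<i> * complex_of_real q * c * cis (q * x))))" for x
      using R[of x] dw[of x] RR by (cases "\<bar>x\<bar> > R") (auto simp: im_part_def)
    have int: "integrable lborel (\<lambda>x. cnj (f x) * vderiv (wave \<rho> q c) x)"
      by (intro test_function_integrable_mult continuous_on_cnj test_function_continuous f test_function_vderiv wave_test \<rho>)
    have int': "integrable lborel (\<lambda>x. im_part f x * complex_of_real (2 * Re (\<i> * complex_of_real q * c * cis (q * x))))"
      using test_function_integrable_mult[OF _ parts(2), of "\<lambda>x. complex_of_real (2 * Re (\<i> * complex_of_real q * c * cis (q * x)))"]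
      by (simp add: mult.commute continuous_intros)
    have "symp f (vderiv (wave \<rho> q c)) = (LINT x|lborel. Im (cnj (f x) * vderiv (wave \<rho> q c) x))"
      unfolding symp_def by (rule integral_Im[OF int, symmetric])
    also have "\<dots> = - (LINT x|lborel. Re (im_part f x * complex_of_real (2 * Re (\<i> * complex_of_real q * c * cis (q * x)))))"
      unfolding e by (rule Bochner_Integration.integral_minus)
    also have "(LINT x|lborel. Re (im_part f x * complex_of_real (2 * Re (\<i> * complex_of_real q * c * cis (q * x))))) =
        Re (LINT x|lborel. im_part f x * complex_of_real (2 * Re (\<i> * complex_of_real q * c * cis (q * x))))"
      by (rule integral_Re[OF int'])
    also have "\<dots> = 2 * sqrt (2 * pi) * Re (\<i> * complex_of_real q * c * cnj (fourier (im_part f) q))"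
      by (subst integral_wave[OF parts(2)]) (simp add: im_part_def, rule Re_complex_of_real)
    finally show ?thesis .
  qed
qed


section \<open>Expanding the difference into squares of shifts\<close>

text \<open>
  A sequence of signed weights and test functions that represents the quadratic form \<open>Q\<close> on \<open>V\<close>
  as a weighted sum of squares of the symplectic form, with finite total energy for the masses
  \<open>0\<close> and \<open>m\<close>.
\<close>

definition shift_expansion ::
  "real \<Rightarrow> (real \<Rightarrow> complex) set \<Rightarrow> ((real \<Rightarrow> complex) \<Rightarrow> real) \<Rightarrow> (nat \<Rightarrow> real \<times> (real \<Rightarrow> complex)) \<Rightarrow> bool" where
  "shift_expansion m V Q e \<longleftrightarrow> (\<forall>j. snd (e j) \<in> neutral) \<and>
     (\<forall>M\<in>{0, m}. summable (\<lambda>j. \<bar>fst (e j)\<bar> * sq_norm M (snd (e j)))) \<and>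
     (\<forall>f\<in>V. (\<lambda>j. fst (e j) * (symp f (snd (e j)))\<^sup>2) sums Q f \<and>
        summable (\<lambda>j. \<bar>fst (e j)\<bar> * (symp f (snd (e j)))\<^sup>2))"

lemma interleave_sums:
  fixes F :: "'a \<Rightarrow> real"
  assumes "(\<lambda>j. F (a j)) sums x" "(\<lambda>j. F (b j)) sums y"
  shows "(\<lambda>j. F (if even j then a (j div 2) else b ((j - 1) div 2))) sums (x + y)"
proof -
  have "(\<lambda>j. if even j then F (a (j div 2)) else F (b ((j - 1) div 2))) sums (y + x)"
    by (rule sums_if[OF assms(2,1)])
  moreover have "(\<lambda>j. if even j then F (a (j div 2)) else F (b ((j - 1) div 2))) =
      (\<lambda>j. F (if even j then a (j div 2) else b ((j - 1) div 2)))" by auto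
  ultimately show ?thesis by (simp only: add.commute)
qed

lemma interleave_summable:
  fixes F :: "'a \<Rightarrow> real"
  assumes "summable (\<lambda>j. F (a j))" "summable (\<lambda>j. F (b j))"
  shows "summable (\<lambda>j. F (if even j then a (j div 2) else b ((j - 1) div 2)))"
  by (rule sums_summable[OF interleave_sums[where F = F and a = a and b = b, OF summable_sums summable_sums]])
     (use assms in auto)

lemma shift_expansion_add:
  assumes "shift_expansion m V Q e" "shift_expansion m V Q' e'"
  obtains e'' where "shift_expansion m V (\<lambda>f. Q f + Q' f) e''"
proof
  note e = assms[unfolded shift_expansion_def]
  show "shift_expansion m V (\<lambda>f. Q f + Q' f) (\<lambda>j. if even j then e (j div 2) else e' ((j - 1) div 2))"
    unfolding shift_expansion_def
  proof (intro conjI ballI allI)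
    fix j show "snd (if even j then e (j div 2) else e' ((j - 1) div 2)) \<in> neutral" using e by auto
  next
    fix M assume "M \<in> {0, m}"
    thus "summable (\<lambda>j. \<bar>fst (if even j then e (j div 2) else e' ((j - 1) div 2))\<bar> *
        sq_norm M (snd (if even j then e (j div 2) else e' ((j - 1) div 2))))"
      using e by (intro interleave_summable[of "\<lambda>p. \<bar>fst p\<bar> * sq_norm M (snd p)"]) auto
  next
    fix f assume f: "f \<in> V"
    show "(\<lambda>j. fst (if even j then e (j div 2) else e' ((j - 1) div 2)) *
        (symp f (snd (if even j then e (j div 2) else e' ((j - 1) div 2))))\<^sup>2) sums (Q f + Q' f)"
      using e f by (intro interleave_sums[of "\<lambda>p. fst p * (symp f (snd p))\<^sup>2"]) auto
    show "summable (\<lambda>j. \<bar>fst (if even j then e (j div 2) else e' ((j - 1) div 2))\<bar> *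
        (symp f (snd (if even j then e (j div 2) else e' ((j - 1) div 2))))\<^sup>2)"
      using e f by (intro interleave_summable[of "\<lambda>p. \<bar>fst p\<bar> * (symp f (snd p))\<^sup>2"]) auto
  qed
qed

lemma shift_expansion_cong:
  assumes "shift_expansion m V Q e" "\<And>f. f \<in> V \<Longrightarrow> Q f = Q' f"
  shows "shift_expansion m V Q' e"
  using assms(1) unfolding shift_expansion_def by (simp add: assms(2))

text \<open>
  The waves at the nodes, with amplitude inversely proportional to the frequency, have energy
  \<open>O(1/q)\<close>, and the weights are \<open>O(1/q)\<close> as well.
\<close>

lemma summable_energy:
  assumes \<Delta>: "\<Delta> > 0" and \<rho>: "\<rho> \<in> \<D>" and M: "M \<ge> 0"
    and d: "\<And>k. \<bar>d k\<bar> \<le> L / node \<Delta> k" and c: "\<And>k. cmod (c k) = 1 / (2 * node \<Delta> k)"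
    and N: "\<And>k. 0 \<le> N k" "\<And>k. N k \<le> (LINT p|lborel. disp M p * (cmod (fourier (wave \<rho> (node \<Delta> k) (c k)) p))\<^sup>2)"
  shows "summable (\<lambda>k. \<bar>d k\<bar> * N k)"
proof -
  obtain C where C: "C \<ge> 0"
    "\<And>q c. (LINT p|lborel. disp M p * (cmod (fourier (wave \<rho> q c) p))\<^sup>2) \<le> C * (cmod c)\<^sup>2 * (1 + \<bar>q\<bar>)"
    using wave_energy[OF \<rho> M] by metis
  have L: "L \<ge> 0" using order_trans[OF abs_ge_zero d[of 0]] node_pos[OF \<Delta>, of 0] by (simp add: zero_le_divide_iff)
  have "norm (\<bar>d k\<bar> * N k) \<le> L * C / 4 * (2 / \<Delta> + 1) * (1 / (node \<Delta> k)\<^sup>2)" for k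
  proof -
    let ?q = "node \<Delta> k"
    have q: "?q > 0" "?q \<ge> \<Delta> / 2" using node_pos[OF \<Delta>] \<Delta> by (auto simp: node_def distrib_right)
    have iq: "1 / ?q \<le> 2 / \<Delta>" using q \<Delta> by (simp add: field_simps)
    have "N k \<le> C * (1 / (2 * ?q))\<^sup>2 * (1 + ?q)"
      using order_trans[OF N(2)[of k] C(2)] q(1) by (simp add: c)
    hence "\<bar>d k\<bar> * N k \<le> L / ?q * (C * (1 / (2 * ?q))\<^sup>2 * (1 + ?q))"
      by (intro mult_mono d) (use N(1) L q in auto)
    also have "\<dots> = L * C / 4 * (1 / ?q + 1) * (1 / ?q\<^sup>2)"
      using q(1) by (simp add: power2_eq_square field_simps)
    also have "\<dots> \<le> L * C / 4 * (2 / \<Delta> + 1) * (1 / ?q\<^sup>2)"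
      using L C(1) iq by (intro mult_right_mono mult_left_mono) auto
    finally show ?thesis using N(1)[of k] by simp
  qed
  thus ?thesis
    by (rule summable_comparison_test'[OF summable_mult[OF summable_node_sq[OF \<Delta>]]])
qed

lemma summable_samples:
  assumes \<Delta>: "\<Delta> > 0" and v: "v \<in> \<D>" and d: "\<And>k. \<bar>d k\<bar> \<le> L / node \<Delta> k"
  shows "summable (\<lambda>k. \<bar>d k\<bar> * (cmod (fourier v (node \<Delta> k)))\<^sup>2)"
proof -
  obtain C where C: "C > 0" "\<And>p. cmod (fourier v p) \<le> C / (1 + p\<^sup>2)" "\<And>p. cmod (fourier v p) \<le> C"
    using fourier_decay_quad[OF v] by blast
  have L: "L \<ge> 0" using order_trans[OF abs_ge_zero d[of 0]] node_pos[OF \<Delta>, of 0] by (simp add: zero_le_divide_iff)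
  have "norm (\<bar>d k\<bar> * (cmod (fourier v (node \<Delta> k)))\<^sup>2) \<le> L * (2 / \<Delta>) * C\<^sup>2 * (1 / (node \<Delta> k)\<^sup>2)" for k
  proof -
    let ?q = "node \<Delta> k"
    have q: "?q > 0" "?q \<ge> \<Delta> / 2" using node_pos[OF \<Delta>] \<Delta> by (auto simp: node_def distrib_right)
    have "L / ?q \<le> L * (2 / \<Delta>)"
      using q \<Delta> L mult_left_mono[of "1 / ?q" "2 / \<Delta>" L] by (simp add: field_simps)
    hence dk: "\<bar>d k\<bar> \<le> L * (2 / \<Delta>)" using d[of k] by linarith
    have "C / (1 + ?q\<^sup>2) \<le> C / ?q\<^sup>2" using q C(1) by (intro divide_left_mono mult_pos_pos) (auto simp: add_pos_nonneg)
    hence "cmod (fourier v ?q) \<le> C / ?q\<^sup>2" using C(2)[of ?q] by linarith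
    hence "(cmod (fourier v ?q))\<^sup>2 \<le> C * (C / ?q\<^sup>2)"
      unfolding power2_eq_square[of "cmod _"] using C(1) by (intro mult_mono C(3)) auto
    hence "\<bar>d k\<bar> * (cmod (fourier v ?q))\<^sup>2 \<le> L * (2 / \<Delta>) * (C * (C / ?q\<^sup>2))"
      using dk L \<Delta> by (intro mult_mono) auto
    also have "\<dots> = L * (2 / \<Delta>) * C\<^sup>2 * (1 / ?q\<^sup>2)" by (simp add: power2_eq_square)
    finally show ?thesis by simp
  qed
  thus ?thesis
    by (rule summable_comparison_test'[OF summable_mult[OF summable_node_sq[OF \<Delta>]]])
qed

lemma normalised_square:
  assumes "q > 0"
  shows "8 * pi * (Re (\<i> * complex_of_real q * (complex_of_real (1 / (2 * q)) * c) * z))\<^sup>2 = 2 * pi * (Re (\<i> * c * z))\<^sup>2"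
proof -
  have "\<i> * complex_of_real q * (complex_of_real (1 / (2 * q)) * c) * z = complex_of_real (q * (1 / (2 * q))) * (\<i> * c * z)"
    unfolding of_real_mult by (simp only: mult_ac)
  also have "q * (1 / (2 * q)) = 1/2" using assms by simp
  finally have e: "\<i> * complex_of_real q * (complex_of_real (1 / (2 * q)) * c) * z = complex_of_real (1/2) * (\<i> * c * z)" .
  have re: "Re (complex_of_real r * z) = r * Re z" for r z by simp
  show ?thesis unfolding e re power_mult_distrib by (simp add: power2_eq_square)
qed

text \<open>
  One family of shifts, with a fixed phase \<open>c\<close>. Here \<open>G q c\<close> is either the derivative of the wave or
  \<open>\<i>\<close> times the wave, and \<open>X f\<close> is the function whose Fourier transform it measures.
\<close>

lemma wave_expansion:
  assumes \<Delta>: "\<Delta> > 0" and \<rho>: "\<rho> \<in> \<D>" and m: "m \<ge> 0" and d: "\<And>k. \<bar>d k\<bar> \<le> L / node \<Delta> k"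
    and c: "cmod c = 1"
    and G: "\<And>q c. G q c \<in> neutral"
    and GN: "\<And>M q c. M \<ge> 0 \<Longrightarrow> sq_norm M (G q c) \<le> (LINT p|lborel. disp M p * (cmod (fourier (wave \<rho> q c) p))\<^sup>2)"
    and X: "\<And>f. f \<in> V \<Longrightarrow> X f \<in> \<D>"
    and GX: "\<And>f q c. f \<in> V \<Longrightarrow> (symp f (G q c))\<^sup>2 = 8 * pi * (Re (\<i> * complex_of_real q * c * cnj (fourier (X f) q)))\<^sup>2"
  shows "shift_expansion m V (\<lambda>f. \<Sum>k. d k / (4 * pi) * (2 * pi * (Re (\<i> * c * cnj (fourier (X f) (node \<Delta> k))))\<^sup>2))
    (\<lambda>k. (d k / (4 * pi), G (node \<Delta> k) (complex_of_real (1 / (2 * node \<Delta> k)) * c)))"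
proof -
  have cn: "cmod (complex_of_real (1 / (2 * node \<Delta> k)) * c) = 1 / (2 * node \<Delta> k)" for k
    unfolding norm_mult c norm_of_real using node_pos[OF \<Delta>, of k] by simp
  have d': "\<bar>d k / (4 * pi)\<bar> \<le> (L / (4 * pi)) / node \<Delta> k" for k
    using divide_right_mono[OF d[of k], of "4 * pi"] by (simp add: abs_divide mult.commute)
  have s: "(symp f (G (node \<Delta> k) (complex_of_real (1 / (2 * node \<Delta> k)) * c)))\<^sup>2 =
      2 * pi * (Re (\<i> * c * cnj (fourier (X f) (node \<Delta> k))))\<^sup>2" if "f \<in> V" for f k
    unfolding GX[OF that] by (rule normalised_square[OF node_pos[OF \<Delta>]])
  have sm: "summable (\<lambda>k. \<bar>d k / (4 * pi)\<bar> * (2 * pi * (Re (\<i> * c * cnj (fourier (X f) (node \<Delta> k))))\<^sup>2))"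
    if f: "f \<in> V" for f
  proof (rule summable_comparison_test'[OF summable_mult[OF summable_samples[OF \<Delta> X[OF f] d']], where c1 = "2 * pi"])
    fix k
    let ?z = "\<i> * c * cnj (fourier (X f) (node \<Delta> k))"
    have "(Re ?z)\<^sup>2 \<le> (cmod ?z)\<^sup>2" using power_mono[OF abs_Re_le_cmod[of ?z] abs_ge_zero, of 2] by (simp only: power2_abs)
    also have "cmod ?z = cmod (fourier (X f) (node \<Delta> k))" by (simp add: norm_mult c)
    finally have le: "(Re ?z)\<^sup>2 \<le> (cmod (fourier (X f) (node \<Delta> k)))\<^sup>2" .
    have "\<bar>d k / (4 * pi)\<bar> * (2 * pi * (Re ?z)\<^sup>2) \<le> \<bar>d k / (4 * pi)\<bar> * (2 * pi * (cmod (fourier (X f) (node \<Delta> k)))\<^sup>2)"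
      by (intro mult_left_mono le) auto
    moreover have "0 \<le> \<bar>d k / (4 * pi)\<bar> * (2 * pi * (Re ?z)\<^sup>2)" by simp
    ultimately show "norm (\<bar>d k / (4 * pi)\<bar> * (2 * pi * (Re ?z)\<^sup>2)) \<le> 2 * pi * (\<bar>d k / (4 * pi)\<bar> * (cmod (fourier (X f) (node \<Delta> k)))\<^sup>2)"
      unfolding real_norm_def by (simp only: abs_of_nonneg mult.left_commute)
  qed
  show ?thesis unfolding shift_expansion_def fst_conv snd_conv
  proof (intro conjI allI ballI G)
    fix M assume "M \<in> {0, m}"
    hence "M \<ge> 0" using m by auto
    thus "summable (\<lambda>k. \<bar>d k / (4 * pi)\<bar> * sq_norm M (G (node \<Delta> k) (complex_of_real (1 / (2 * node \<Delta> k)) * c)))"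
      by (intro summable_energy[OF \<Delta> \<rho> _ d' cn sq_norm_nonneg GN])
  next
    fix f assume f: "f \<in> V"
    show "summable (\<lambda>k. \<bar>d k / (4 * pi)\<bar> * (symp f (G (node \<Delta> k) (complex_of_real (1 / (2 * node \<Delta> k)) * c)))\<^sup>2)"
      unfolding s[OF f] by (rule sm[OF f])
    have "summable (\<lambda>k. d k / (4 * pi) * (2 * pi * (Re (\<i> * c * cnj (fourier (X f) (node \<Delta> k))))\<^sup>2))"
      by (rule summable_norm_cancel) (use sm[OF f] in \<open>simp only: real_norm_def abs_mult abs_numeral abs_of_pos[OF pi_gt_zero] abs_power2\<close>)
    thus "(\<lambda>k. d k / (4 * pi) * (symp f (G (node \<Delta> k) (complex_of_real (1 / (2 * node \<Delta> k)) * c)))\<^sup>2) sums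
        (\<Sum>k. d k / (4 * pi) * (2 * pi * (Re (\<i> * c * cnj (fourier (X f) (node \<Delta> k))))\<^sup>2))"
      unfolding s[OF f] by (rule summable_sums)
  qed
qed

text \<open>The phases \<open>1\<close> and \<open>-\<i>\<close> together give the squared modulus of the Fourier transform.\<close>

lemma wave_pair_expansion:
  assumes \<Delta>: "\<Delta> > 0" and \<rho>: "\<rho> \<in> \<D>" and m: "m \<ge> 0" and d: "\<And>k. \<bar>d k\<bar> \<le> L / node \<Delta> k"
    and G: "\<And>q c. G q c \<in> neutral"
    and GN: "\<And>M q c. M \<ge> 0 \<Longrightarrow> sq_norm M (G q c) \<le> (LINT p|lborel. disp M p * (cmod (fourier (wave \<rho> q c) p))\<^sup>2)"
    and X: "\<And>f. f \<in> V \<Longrightarrow> X f \<in> \<D>"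
    and GX: "\<And>f q c. f \<in> V \<Longrightarrow> (symp f (G q c))\<^sup>2 = 8 * pi * (Re (\<i> * complex_of_real q * c * cnj (fourier (X f) q)))\<^sup>2"
    and Q: "\<And>f. f \<in> V \<Longrightarrow> (\<lambda>k. d k * (cmod (fourier (X f) (node \<Delta> k)))\<^sup>2) sums Q f"
  obtains e where "shift_expansion m V (\<lambda>f. 1/2 * Q f) e"
proof -
  define S where "S c f = (\<Sum>k. d k / (4 * pi) * (2 * pi * (Re (\<i> * c * cnj (fourier (X f) (node \<Delta> k))))\<^sup>2))" for c f
  have ex: "shift_expansion m V (S c) (\<lambda>k. (d k / (4 * pi), G (node \<Delta> k) (complex_of_real (1 / (2 * node \<Delta> k)) * c)))"
    if "cmod c = 1" for c
    unfolding S_def by (rule wave_expansion[OF \<Delta> \<rho> m d that G GN X GX])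
  obtain e where e: "shift_expansion m V (\<lambda>f. S 1 f + S (- \<i>) f) e"
    using shift_expansion_add[OF ex[of 1] ex[of "- \<i>"]] by auto
  have "S 1 f + S (- \<i>) f = 1/2 * Q f" if f: "f \<in> V" for f
  proof -
    have s: "(\<lambda>k. d k / (4 * pi) * (2 * pi * (Re (\<i> * c * cnj (fourier (X f) (node \<Delta> k))))\<^sup>2)) sums S c f"
      if "cmod c = 1" for c
    proof -
      have "summable (\<lambda>k. d k / (4 * pi) * (symp f (G (node \<Delta> k) (complex_of_real (1 / (2 * node \<Delta> k)) * c)))\<^sup>2)"
        using ex[OF that] f by (auto simp: shift_expansion_def sums_iff)
      moreover have "(symp f (G (node \<Delta> k) (complex_of_real (1 / (2 * node \<Delta> k)) * c)))\<^sup>2 =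
        2 * pi * (Re (\<i> * c * cnj (fourier (X f) (node \<Delta> k))))\<^sup>2" for k
        unfolding GX[OF f] by (rule normalised_square[OF node_pos[OF \<Delta>]])
      ultimately show ?thesis unfolding S_def by (simp only: summable_sums)
    qed
    have "(\<lambda>k. d k / (4 * pi) * (2 * pi * (Re (\<i> * 1 * cnj (fourier (X f) (node \<Delta> k))))\<^sup>2) +
        d k / (4 * pi) * (2 * pi * (Re (\<i> * (- \<i>) * cnj (fourier (X f) (node \<Delta> k))))\<^sup>2)) sums (S 1 f + S (- \<i>) f)"
      by (intro sums_add s) simp_all
    moreover have "d k / (4 * pi) * (2 * pi * (Re (\<i> * 1 * cnj (fourier (X f) (node \<Delta> k))))\<^sup>2) +
        d k / (4 * pi) * (2 * pi * (Re (\<i> * (- \<i>) * cnj (fourier (X f) (node \<Delta> k))))\<^sup>2) =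
        1/2 * (d k * (cmod (fourier (X f) (node \<Delta> k)))\<^sup>2)" for k
      unfolding cmod_power2 by (simp add: field_simps)
    ultimately have "(\<lambda>k. 1/2 * (d k * (cmod (fourier (X f) (node \<Delta> k)))\<^sup>2)) sums (S 1 f + S (- \<i>) f)" by (simp only:)
    thus ?thesis using sums_mult[OF Q[OF f], of "1/2"] by (rule sums_unique2)
  qed
  thus ?thesis by (rule that[OF shift_expansion_cong[OF e]])
qed

text \<open>
  The difference of the two vacuum forms, on functions supported in \<open>[-R, R]\<close>, is a weighted sum of
  squares of the symplectic form with shifts of finite total energy.
\<close>

theorem energy_difference:
  assumes m: "m > 0" and R: "R > 0"
  obtains e where "shift_expansion m {f \<in> neutral. \<forall>x. \<bar>x\<bar> > R \<longrightarrow> f x = 0} (\<lambda>f. sq_norm m f - sq_norm 0 f) e"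
proof -
  define V where "V = {f \<in> neutral. \<forall>x. \<bar>x\<bar> > R \<longrightarrow> f x = 0}"
  \<comment> \<open>All differences of points of the support lie in the interior of the period interval \<open>[-a, a]\<close>.\<close>
  define a where "a = 2 * R + 2"
  define \<Delta> where "\<Delta> = pi / a"
  define \<psi> where "\<psi> = cutoff (2 * R)"
  define \<rho> where "\<rho> = cutoff (R + 1)"
  have a: "a > 0" "2 * R < a" using R by (auto simp: a_def)
  have \<Delta>: "\<Delta> > 0" "a = pi / \<Delta>" using a by (auto simp: \<Delta>_def)
  have \<psi>: "\<psi> \<in> \<D>" "\<And>t. \<bar>t\<bar> \<ge> a \<Longrightarrow> \<psi> t = 0" "\<And>t. \<bar>t\<bar> \<le> 2 * R \<Longrightarrow> \<psi> t = 1"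
    by (auto simp: \<psi>_def a_def cutoff_test_function cutoff_0 cutoff_1)
  have \<rho>: "\<rho> \<in> \<D>" "\<And>x. \<bar>x\<bar> < R + 1 \<Longrightarrow> \<rho> x = 1" "\<And>x. cnj (\<rho> x) = \<rho> x"
    by (auto simp: \<rho>_def cutoff_test_function cutoff_1 cnj_cutoff)
  note wt = wave_test[OF \<rho>(1)] and wr = cnj_wave[OF \<rho>(3)]
  have "\<exists>U. U \<in> \<D> \<and> vderiv U = re_part f \<and> (\<forall>x. cnj (U x) = U x) \<and> (\<forall>x. \<bar>x\<bar> > R \<longrightarrow> U x = 0)" if "f \<in> V" for f
    using neutral_antiderivative[of f R] that unfolding V_def by (metis (mono_tags, lifting) mem_Collect_eq)
  then obtain U where U: "\<And>f. f \<in> V \<Longrightarrow> U f \<in> \<D>" "\<And>f. f \<in> V \<Longrightarrow> vderiv (U f) = re_part f"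
    "\<And>f x. f \<in> V \<Longrightarrow> cnj (U f x) = U f x" "\<And>f x. f \<in> V \<Longrightarrow> \<bar>x\<bar> > R \<Longrightarrow> U f x = 0" by metis
  have V: "f \<in> neutral" "f \<in> \<D>" "\<And>x. \<bar>x\<bar> > R \<Longrightarrow> f x = 0" if "f \<in> V" for f
    using that by (auto simp: V_def neutral_def)
  have im: "im_part f \<in> \<D>" "cnj (im_part f x) = im_part f x" "\<bar>x\<bar> > R \<Longrightarrow> im_part f x = 0" if "f \<in> V" for f x
    using V[OF that] by (auto simp: parts_test) (auto simp: im_part_def)
  define wr' where "wr' p = - weight_re m p" for p
  have w1: "\<bar>weight_im m p\<bar> \<le> (m + m\<^sup>2) / (1 + \<bar>p\<bar>)" for p using weight_im_bound[OF m, of p] by simp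
  have w2: "\<bar>wr' p\<bar> \<le> (m + m\<^sup>2) / (1 + \<bar>p\<bar>)" for p using weight_re_bound[OF m, of p] by (simp add: wr'_def)
  have wm: "weight_im m \<in> borel_measurable borel" "wr' \<in> borel_measurable borel"
    using weights_measurable unfolding wr'_def[abs_def] by (auto intro: borel_measurable_uminus)
  obtain L1 where L1: "\<And>k. \<bar>sample_weight \<Delta> \<psi> (weight_im m) k\<bar> \<le> L1 / node \<Delta> k"
    using sample_weight_bound[OF \<Delta>(1) \<psi>(1) wm(1) w1] by metis
  obtain L2 where L2: "\<And>k. \<bar>sample_weight \<Delta> \<psi> wr' k\<bar> \<le> L2 / node \<Delta> k"
    using sample_weight_bound[OF \<Delta>(1) \<psi>(1) wm(2) w2] by metis
  have sam1: "(\<lambda>k. sample_weight \<Delta> \<psi> (weight_im m) k * (cmod (fourier (im_part f) (node \<Delta> k)))\<^sup>2) sums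
      (LINT p|lborel. weight_im m p * (cmod (fourier (im_part f) p))\<^sup>2)"
    "integrable lborel (\<lambda>p. weight_im m p * (cmod (fourier (im_part f) p))\<^sup>2)" if "f \<in> V" for f
    subgoal
      by (rule sampled_integral(1)[where \<psi> = \<psi> and a = a and R = R and K = "m + m\<^sup>2"];
          intro \<Delta> \<psi> a(2) im[OF that] wm(1) w1; assumption)
    subgoal
      by (rule sampled_integral(2)[where \<Delta> = \<Delta> and \<psi> = \<psi> and a = a and R = R and K = "m + m\<^sup>2"];
          intro \<Delta> \<psi> a(2) im[OF that] wm(1) w1; assumption)
    done
  have sam2: "(\<lambda>k. sample_weight \<Delta> \<psi> wr' k * (cmod (fourier (U f) (node \<Delta> k)))\<^sup>2) sums
      (LINT p|lborel. wr' p * (cmod (fourier (U f) p))\<^sup>2)"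
    "integrable lborel (\<lambda>p. wr' p * (cmod (fourier (U f) p))\<^sup>2)" if "f \<in> V" for f
    subgoal
      by (rule sampled_integral(1)[where \<psi> = \<psi> and a = a and R = R and K = "m + m\<^sup>2"];
          intro \<Delta> \<psi> a(2) U(1,3,4)[OF that] wm(2) w2; assumption)
    subgoal
      by (rule sampled_integral(2)[where \<Delta> = \<Delta> and \<psi> = \<psi> and a = a and R = R and K = "m + m\<^sup>2"];
          intro \<Delta> \<psi> a(2) U(1,3,4)[OF that] wm(2) w2; assumption)
    done
  have RR: "R < R + 1" by simp
  have sq: "(2 * sqrt (2 * pi) * x)\<^sup>2 = 8 * pi * x\<^sup>2" for x by (simp add: power_mult_distrib)
  obtain e1 where e1: "shift_expansion m V (\<lambda>f. 1/2 * (LINT p|lborel. weight_im m p * (cmod (fourier (im_part f) p))\<^sup>2)) e1"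
  proof (rule wave_pair_expansion[of \<Delta> \<rho> m "sample_weight \<Delta> \<psi> (weight_im m)" L1 "\<lambda>q c. vderiv (wave \<rho> q c)" V im_part])
    fix f q c assume f: "f \<in> V"
    show "(symp f (vderiv (wave \<rho> q c)))\<^sup>2 = 8 * pi * (Re (\<i> * complex_of_real q * c * cnj (fourier (im_part f) q)))\<^sup>2"
      by (subst symp_shift(2)[OF V(2,3)[OF f] \<rho> RR]) (assumption, assumption, simp only: sq power2_minus)
    show "im_part f \<in> \<D>" by (rule im(1)[OF f])
    show "(\<lambda>k. sample_weight \<Delta> \<psi> (weight_im m) k * (cmod (fourier (im_part f) (node \<Delta> k)))\<^sup>2) sums
        (LINT p|lborel. weight_im m p * (cmod (fourier (im_part f) p))\<^sup>2)" by (rule sam1(1)[OF f])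
  next
    fix M q :: real and c assume "M \<ge> 0"
    thus "sq_norm M (vderiv (wave \<rho> q c)) \<le> (LINT p|lborel. disp M p * (cmod (fourier (wave \<rho> q c) p))\<^sup>2)"
      by (rule shift_vectors(3)[OF wt wr])
  qed (rule \<Delta>(1) \<rho>(1) less_imp_le[OF m] L1 shift_vectors(1)[OF wt wr] that, assumption?)+
  obtain e2 where e2: "shift_expansion m V (\<lambda>f. 1/2 * (LINT p|lborel. wr' p * (cmod (fourier (U f) p))\<^sup>2)) e2"
  proof (rule wave_pair_expansion[of \<Delta> \<rho> m "sample_weight \<Delta> \<psi> wr'" L2 "\<lambda>q c x. \<i> * wave \<rho> q c x" V U])
    fix f q c assume f: "f \<in> V"
    have "Re (c * cnj (fourier (re_part f) q)) = - Re (\<i> * complex_of_real q * c * cnj (fourier (U f) q))"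
      unfolding U(2)[OF f, symmetric] fourier_vderiv[OF U(1)[OF f]] by (simp add: algebra_simps)
    thus "(symp f (\<lambda>x. \<i> * wave \<rho> q c x))\<^sup>2 = 8 * pi * (Re (\<i> * complex_of_real q * c * cnj (fourier (U f) q)))\<^sup>2"
      by (subst symp_shift(1)[OF V(2,3)[OF f] \<rho> RR]) (assumption, assumption, simp only: sq power2_minus)
    show "U f \<in> \<D>" by (rule U(1)[OF f])
    show "(\<lambda>k. sample_weight \<Delta> \<psi> wr' k * (cmod (fourier (U f) (node \<Delta> k)))\<^sup>2) sums
        (LINT p|lborel. wr' p * (cmod (fourier (U f) p))\<^sup>2)" by (rule sam2(1)[OF f])
  next
    fix M q :: real and c assume "M \<ge> 0"
    thus "sq_norm M (\<lambda>x. \<i> * wave \<rho> q c x) \<le> (LINT p|lborel. disp M p * (cmod (fourier (wave \<rho> q c) p))\<^sup>2)"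
      by (rule shift_vectors(4)[OF wt wr])
  qed (rule \<Delta>(1) \<rho>(1) less_imp_le[OF m] L2 shift_vectors(2)[OF wt wr] that, assumption?)+
  obtain e where e: "shift_expansion m V (\<lambda>f. 1/2 * (LINT p|lborel. weight_im m p * (cmod (fourier (im_part f) p))\<^sup>2) +
      1/2 * (LINT p|lborel. wr' p * (cmod (fourier (U f) p))\<^sup>2)) e"
    using shift_expansion_add[OF e1 e2] by auto
  have "1/2 * (LINT p|lborel. weight_im m p * (cmod (fourier (im_part f) p))\<^sup>2) +
      1/2 * (LINT p|lborel. wr' p * (cmod (fourier (U f) p))\<^sup>2) = sq_norm m f - sq_norm 0 f" if f: "f \<in> V" for f
  proof -
    have "integrable lborel (\<lambda>p. - (wr' p * (cmod (fourier (U f) p))\<^sup>2))" using sam2(2)[OF f] by simp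
    hence i2: "integrable lborel (\<lambda>p. weight_re m p * (cmod (fourier (U f) p))\<^sup>2)" by (simp add: wr'_def)
    show ?thesis
      unfolding sq_norm_difference[OF V(1)[OF f] U(1,2)[OF f] m sam1(2)[OF f] i2] wr'_def by simp
  qed
  hence "shift_expansion m V (\<lambda>f. sq_norm m f - sq_norm 0 f) e" by (rule shift_expansion_cong[OF e])
  thus ?thesis unfolding V_def by (rule that)
qed


section \<open>The isomorphism of the local algebras\<close>

lemma linear_span_closed:
  assumes T: "linear T" and S: "\<And>x. x \<in> S \<Longrightarrow> T x \<in> span S" and x: "x \<in> span S"
  shows "T x \<in> span S"
proof -
  have "T ` span S = span (T ` S)" by (rule span_linear_image[OF T, symmetric])
  also have "\<dots> \<subseteq> span S" by (rule span_minimal) (use S in auto)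
  finally show ?thesis using x by blast
qed

text \<open>The *-algebra generated algebraically by the Weyl operators of a group of test functions.\<close>

definition weyl_span :: "((real \<Rightarrow> complex) \<Rightarrow> 'a::cstar_algebra) \<Rightarrow> (real \<Rightarrow> complex) set \<Rightarrow> 'a set" where
  "weyl_span W V = span {c *\<^sub>C W f | c f. f \<in> V}"

text \<open>An additive group of test functions, on which the two representations will be intertwined.\<close>

locale weyl_group =
  fixes W :: "(real \<Rightarrow> complex) \<Rightarrow> 'a::cstar_algebra" and V :: "(real \<Rightarrow> complex) set"
  assumes weyl: "weyl_algebra W" and V_test: "V \<subseteq> \<D>" and V_zero: "(\<lambda>x. 0) \<in> V"
    and V_add: "f \<in> V \<Longrightarrow> g \<in> V \<Longrightarrow> (\<lambda>x. f x + g x) \<in> V" and V_minus: "f \<in> V \<Longrightarrow> (\<lambda>x. - f x) \<in> V"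
begin

abbreviation "A \<equiv> weyl_span W V"

lemma A_gen: "f \<in> V \<Longrightarrow> c *\<^sub>C W f \<in> A"
  unfolding weyl_span_def by (rule span_base) blast

lemma A_add: "a \<in> A \<Longrightarrow> b \<in> A \<Longrightarrow> a + b \<in> A"
  unfolding weyl_span_def by (rule span_add)

lemma A_linear:
  assumes "linear T" "\<And>c f. f \<in> V \<Longrightarrow> T (c *\<^sub>C W f) \<in> A" "a \<in> A"
  shows "T a \<in> A"
  unfolding weyl_span_def
proof (rule linear_span_closed[OF assms(1) _ assms(3)[unfolded weyl_span_def]])
  fix x assume "x \<in> {c *\<^sub>C W f | c f. f \<in> V}"
  thus "T x \<in> span {c *\<^sub>C W f | c f. f \<in> V}" using assms(2)[unfolded weyl_span_def] by blast
qed

lemma A_scaleC: "a \<in> A \<Longrightarrow> k *\<^sub>C a \<in> A"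
proof (erule A_linear[rotated 2])
  show "linear ((*\<^sub>C) k :: 'a \<Rightarrow> 'a)"
    by (rule linearI) (simp_all add: scaleC_add_right scaleR_eq_scaleC scaleC_commute)
qed (simp add: scaleC_scaleC A_gen)

lemma A_one: "1 \<in> A"
  using A_gen[OF V_zero, of 1] by (simp add: weyl_zero[OF weyl])

lemma A_mult: "f \<in> V \<Longrightarrow> a \<in> A \<Longrightarrow> W f * a \<in> A"
proof (erule A_linear[rotated 2])
  show "linear ((*) (W f))" by (rule linearI) (simp_all add: distrib_left)
  fix c g assume fg: "f \<in> V" "g \<in> V"
  hence "f \<in> \<D>" "g \<in> \<D>" using V_test by auto
  thus "W f * (c *\<^sub>C W g) \<in> A"
    using A_gen[OF V_add[OF fg]] by (simp add: mult_scaleC_right weyl_mult[OF weyl] scaleC_scaleC)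
qed

lemma A_cstar: "a \<in> A \<Longrightarrow> cstar a \<in> A"
proof (erule A_linear[rotated 2])
  show "linear (cstar :: 'a \<Rightarrow> 'a)"
    by (rule linearI) (simp_all add: cstar_add scaleR_eq_scaleC cstar_scaleC)
  fix c g assume g: "g \<in> V"
  hence "g \<in> \<D>" using V_test by auto
  thus "cstar (c *\<^sub>C W g) \<in> A" using A_gen[OF V_minus[OF g]] by (simp add: cstar_scaleC weyl_cstar[OF weyl])
qed

lemma A_cmult: "f \<in> V \<Longrightarrow> a \<in> A \<Longrightarrow> cstar (W f) * a \<in> A"
  using A_mult[OF V_minus] V_test by (auto simp: weyl_cstar[OF weyl])

lemma A_mult_A: "b \<in> A \<Longrightarrow> a \<in> A \<Longrightarrow> b * a \<in> A"
proof (erule A_linear[rotated 2])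
  show "linear (\<lambda>b. b * a)" by (rule linearI) (simp_all add: distrib_right)
  fix c g assume "g \<in> V" "a \<in> A"
  thus "c *\<^sub>C W g * a \<in> A" by (simp add: mult_scaleC_left A_scaleC A_mult)
qed

lemma functionals_agree:
  assumes "positive_functional s" "positive_functional s'" "\<And>f. f \<in> V \<Longrightarrow> s (W f) = s' (W f)" "a \<in> A"
  shows "s a = s' a"
proof -
  note sc = assms(1,2)[THEN positive_functional.s_scaleC]
  have "linear s" "linear s'"
    by (auto intro!: linearI simp: assms(1,2)[THEN positive_functional.s_add] scaleR_eq_scaleC sc scaleR_conv_of_real)
  thus ?thesis
    by (rule linear_eq_on[OF _ _ assms(4)[unfolded weyl_span_def]]) (auto simp: sc assms(3))
qed

lemma dominated_agree:
  assumes "positive_functional s" "positive_functional s'" "\<And>f. f \<in> V \<Longrightarrow> s (W f) = s' (W f)"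
  shows "positive_functional.dominated s A \<pi> = positive_functional.dominated s' A \<pi>"
proof -
  interpret s: positive_functional s by fact
  interpret s': positive_functional s' by fact
  have "s.form.sn b = s'.form.sn b" if "b \<in> A" for b
    unfolding s.form.sn_def s'.form.sn_def using functionals_agree[OF assms A_mult_A[OF A_cstar[OF that] that]] by simp
  thus ?thesis unfolding s.dominated_def s'.dominated_def by simp
qed

text \<open>
  If Gaussian mixtures in the two representations define the same functional on the Weyl operators
  of \<open>V\<close>, then the ranges of the intertwiners are total. All Weyl operators, also those outside \<open>V\<close>,
  commute with those of \<open>V\<close> up to phases.
\<close>

lemma mixtures_intertwined:
  assumes g1: "gaussian_mixture W \<pi>1 \<Omega>1 E1 B1 h1" and g2: "gaussian_mixture W \<pi>2 \<Omega>2 E2 B2 h2"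
    and cyc: "closure (range (\<lambda>a. \<pi>2 a \<Omega>2)) = UNIV"
    and agree: "\<And>f. f \<in> V \<Longrightarrow> gaussian_mixture.s W \<pi>1 \<Omega>1 h1 (W f) = gaussian_mixture.s W \<pi>2 \<Omega>2 h2 (W f)"
  shows "closure (span (intertwined (intertwiners (\<lambda>f. \<pi>1 (W f)) (\<lambda>f. \<pi>2 (W f)) V))) = UNIV"
proof -
  interpret g1: gaussian_mixture W \<pi>1 \<Omega>1 E1 B1 h1 by fact
  interpret g2: gaussian_mixture W \<pi>2 \<Omega>2 E2 B2 h2 by fact
  have wu: "f \<in> V \<Longrightarrow> unitary (W f)" for f using V_test weyl_unitary[OF weyl] by auto
  interpret d: dominating g1.s A W V \<pi>1 \<pi>2
    by unfold_locales (fact g1.rep g2.rep g1.unital g2.unital A_add A_scaleC A_one A_mult A_cmult wu)+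
  show ?thesis
  proof (rule d.intertwiners_total[OF g1.mixture_approximable _ cyc, of "W ` \<D>"])
    show "\<Omega>2 \<in> closure (span (g1.dominated A \<pi>2))"
      using g2.Omega_in_dominated[of A]
      by (simp only: dominated_agree[OF g1.positive_functional_axioms g2.positive_functional_axioms agree])
    show "cstar_generated_by (W ` \<D>) = UNIV" using weyl by (simp add: weyl_algebra_def)
    show "cstar u \<in> W ` \<D>" if "u \<in> W ` \<D>" for u
      using that by (auto simp: weyl_cstar[OF weyl] intro!: imageI test_function_minus)
    show "unitary u" if "u \<in> W ` \<D>" for u using that by (auto intro: weyl_unitary[OF weyl])
    fix u f assume "u \<in> W ` \<D>" "f \<in> V"
    then obtain g where g: "g \<in> \<D>" "u = W g" and f: "f \<in> \<D>" using V_test by auto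
    have mg: "(\<lambda>x. - g x) \<in> \<D>" by (rule test_function_minus[OF g(1)])
    have "symp (\<lambda>x. - g x) f = symp f g"
      using symp_commute[of "\<lambda>x. - g x" f] by (simp add: symp_minus_right)
    thus "\<exists>c. W f * u = c *\<^sub>C (u * W f) \<and> cstar u * W f = c *\<^sub>C (W f * cstar u)"
      unfolding g(2) weyl_cstar[OF weyl g(1)]
      using weyl_commute[OF weyl f g(1)] weyl_commute[OF weyl mg f] by auto
  qed
qed

end

text \<open>Representations are not required to be unital; those with a cyclic vector are.\<close>

lemma GNS_unital:
  assumes "GNS_triple \<omega> \<pi> \<Omega>"
  shows "\<pi> 1 x = x"
proof -
  have rep: "representation \<pi>" and cyc: "closure (range (\<lambda>a. \<pi> a \<Omega>)) = UNIV"
    using assms by (auto simp: GNS_triple_def)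
  have "bounded_linear (\<pi> 1)" using representation_cop[OF rep] by (simp add: cop_def)
  hence "continuous_on UNIV (\<pi> 1)" by (rule linear_continuous_on)
  hence "closed {x. \<pi> 1 x = x}" by (intro closed_Collect_eq continuous_on_id)
  moreover have "range (\<lambda>a. \<pi> a \<Omega>) \<subseteq> {x. \<pi> 1 x = x}" by (auto simp flip: representation_mult[OF rep])
  ultimately have "closure (range (\<lambda>a. \<pi> a \<Omega>)) \<subseteq> {x. \<pi> 1 x = x}" by (rule closure_minimal[rotated])
  thus ?thesis using cyc by auto
qed

lemma GNS_weyl_vacuum:
  assumes W: "weyl_algebra W" and vs: "vacuum_state W m \<omega>" and gns: "GNS_triple \<omega> \<pi> \<Omega>" and m: "m \<ge> 0"
  shows "weyl_vacuum W \<pi> \<Omega> neutral (vform m)"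
proof
  show "weyl_algebra W" by fact
  show "representation \<pi>" using gns by (simp add: GNS_triple_def)
  show "\<pi> 1 x = x" for x by (rule GNS_unital[OF gns])
  show "f \<in> neutral \<Longrightarrow> f \<in> \<D>" for f by (simp add: neutral_def)
  show "f \<in> neutral \<Longrightarrow> cinner \<Omega> (\<pi> (W f) \<Omega>) = complex_of_real (exp (- vform m f f / 2))" for f
    using vs gns by (auto simp: neutral_def GNS_triple_def vacuum_state_def vacuum_function_def vform_self)
qed (auto intro: neutral_zero neutral_add neutral_scale vform_add m vform_scale vform_sym simp: vform_self sq_norm_nonneg)

text \<open>
  The shifts \<open>h j\<close> with nonnegative weights \<open>d j\<close>: either the positive or the negative part of the
  weights of an expansion, which are dominated by their moduli \<open>c j\<close>.
\<close>

lemma GNS_mixture: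
  assumes W: "weyl_algebra W" and vs: "vacuum_state W m \<omega>" and gns: "GNS_triple \<omega> \<pi> \<Omega>" and m: "m \<ge> 0"
    and h: "\<And>j. h j \<in> neutral" and d: "\<And>j. 0 \<le> d j" "\<And>j. d j \<le> c j"
    and sm: "summable (\<lambda>j. c j * sq_norm m (h j))"
  shows "gaussian_mixture W \<pi> \<Omega> neutral (vform m) (\<lambda>j x. sqrt (d j) *\<^sub>R h j x)"
    and "f \<in> neutral \<Longrightarrow> summable (\<lambda>j. c j * (symp f (h j))\<^sup>2) \<Longrightarrow>
      gaussian_mixture.s W \<pi> \<Omega> (\<lambda>j x. sqrt (d j) *\<^sub>R h j x) (W f) =
      complex_of_real (exp (- (sq_norm m f + (\<Sum>j. d j * (symp f (h j))\<^sup>2)) / 2)) \<and>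
      summable (\<lambda>j. d j * (symp f (h j))\<^sup>2)"
proof -
  have dom: "summable (\<lambda>j. d j * x j)" if "\<And>j. 0 \<le> x j" "summable (\<lambda>j. c j * x j)" for x
    by (rule summable_comparison_test'[OF that(2), of 0]) (use d that(1) in \<open>auto intro: mult_right_mono\<close>)
  have e: "vform m (\<lambda>x. sqrt (d j) *\<^sub>R h j x) (\<lambda>x. sqrt (d j) *\<^sub>R h j x) = d j * sq_norm m (h j)" for j
    unfolding vform_scale vform_sym[of m "\<lambda>x. sqrt (d j) *\<^sub>R h j x"] vform_self using d(1)[of j] by (simp flip: mult.assoc)
  interpret weyl_vacuum W \<pi> \<Omega> neutral "vform m" by (rule GNS_weyl_vacuum[OF W vs gns m])
  show g: "gaussian_mixture W \<pi> \<Omega> neutral (vform m) (\<lambda>j x. sqrt (d j) *\<^sub>R h j x)"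
    by unfold_locales (auto intro: neutral_scale h dom sm simp: e sq_norm_nonneg)
  interpret gaussian_mixture W \<pi> \<Omega> neutral "vform m" "\<lambda>j x. sqrt (d j) *\<^sub>R h j x" by (rule g)
  assume f: "f \<in> neutral" and "summable (\<lambda>j. c j * (symp f (h j))\<^sup>2)"
  hence sd: "summable (\<lambda>j. d j * (symp f (h j))\<^sup>2)" by (intro dom) auto
  moreover have "(symp f (\<lambda>x. sqrt (d j) *\<^sub>R h j x))\<^sup>2 = d j * (symp f (h j))\<^sup>2" for j
    unfolding symp_scale_right power_mult_distrib using d(1) by simp
  ultimately have "(\<lambda>j. (symp f (\<lambda>x. sqrt (d j) *\<^sub>R h j x))\<^sup>2) sums (\<Sum>j. d j * (symp f (h j))\<^sup>2)"
    by (simp add: summable_sums)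
  from mixture_value[OF f this] sd
  show "s (W f) = complex_of_real (exp (- (sq_norm m f + (\<Sum>j. d j * (symp f (h j))\<^sup>2)) / 2)) \<and>
      summable (\<lambda>j. d j * (symp f (h j))\<^sup>2)"
    by (simp only: vform_self simp_thms)
qed

text \<open>The test functions whose Weyl operators generate the local algebra of \<open>I\<close>.\<close>

definition local_test_functions :: "real set \<Rightarrow> (real \<Rightarrow> complex) set" where
  "local_test_functions I = {f \<in> \<D>. supp f \<subseteq> I \<and> (LINT x:I|lborel. f x) = 0}"

lemma local_algebra_image:
  "local_algebra \<pi> W I = commutant (commutant ((\<lambda>f. \<pi> (W f)) ` local_test_functions I))"
  unfolding local_algebra_def local_test_functions_def by (intro arg_cong[where f = "\<lambda>S. commutant (commutant S)"]) auto

lemma local_integral: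
  assumes "supp f \<subseteq> I"
  shows "(LINT x:I|lborel. f x) = (LINT x|lborel. f x)"
proof -
  have "indicator I x *\<^sub>R f x = f x" for x
    using supp_zero[of x f] assms by (auto simp: indicator_def)
  thus ?thesis by (simp only: set_lebesgue_integral_def)
qed

lemma local_test_functions_iff:
  "f \<in> local_test_functions I \<longleftrightarrow> f \<in> \<D> \<and> supp f \<subseteq> I \<and> (LINT x|lborel. f x) = 0"
  by (auto simp: local_test_functions_def local_integral)

lemma local_neutral: "f \<in> local_test_functions I \<Longrightarrow> f \<in> neutral"
  by (auto simp: local_test_functions_iff neutral_def integral_Re[OF test_function_integrable])

lemma local_weyl_group:
  assumes "weyl_algebra W"
  shows "weyl_group W (local_test_functions I)"
proof
  let ?V = "local_test_functions I"
  show "?V \<subseteq> \<D>" "(\<lambda>x. 0) \<in> ?V" by (auto simp: local_test_functions_iff test_function_zero supp_def)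
  fix f g assume f: "f \<in> ?V" and g: "g \<in> ?V"
  have "supp (\<lambda>x. f x + g x) \<subseteq> closure ({x. f x \<noteq> 0} \<union> {x. g x \<noteq> 0})"
    unfolding supp_def by (rule closure_mono) auto
  hence "supp (\<lambda>x. f x + g x) \<subseteq> I" using f g by (auto simp: closure_Un local_test_functions_iff supp_def)
  thus "(\<lambda>x. f x + g x) \<in> ?V"
    using f g by (auto simp: local_test_functions_iff test_function_add test_function_integrable)
next
  fix f assume f: "f \<in> local_test_functions I"
  moreover have "supp (\<lambda>x. - f x) = supp f" by (simp add: supp_def)
  ultimately show "(\<lambda>x. - f x) \<in> local_test_functions I"
    by (simp add: local_test_functions_iff test_function_minus)
qed fact

theorem theoremA1:
  fixes m :: real and I :: "real set"
    and W :: "(real \<Rightarrow> complex) \<Rightarrow> 'a::cstar_algebra"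
    and \<omega>\<^sub>m \<omega>\<^sub>0 :: "'a \<Rightarrow> complex"
    and \<pi>\<^sub>m :: "'a \<Rightarrow> 'h::chilbert_space \<Rightarrow> 'h" and \<Omega>\<^sub>m :: 'h
    and \<pi>\<^sub>0 :: "'a \<Rightarrow> 'k::chilbert_space \<Rightarrow> 'k" and \<Omega>\<^sub>0 :: 'k
  assumes "m > 0"
    and "weyl_algebra W"
    and "vacuum_state W m \<omega>\<^sub>m" and "GNS_triple \<omega>\<^sub>m \<pi>\<^sub>m \<Omega>\<^sub>m"
    and "vacuum_state W 0 \<omega>\<^sub>0" and "GNS_triple \<omega>\<^sub>0 \<pi>\<^sub>0 \<Omega>\<^sub>0"
    and "is_interval I" and "bounded I"
  shows "\<exists>\<phi>. vN_isomorphism \<phi> (local_algebra \<pi>\<^sub>m W I) (local_algebra \<pi>\<^sub>0 W I) \<and>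
    (\<forall>f\<in>\<D>. supp f \<subseteq> I \<longrightarrow> (LINT x:I|lborel. f x) = 0 \<longrightarrow> \<phi> (\<pi>\<^sub>m (W f)) = \<pi>\<^sub>0 (W f))"
proof -
  define V where "V = local_test_functions I"
  interpret weyl_group W V unfolding V_def by (rule local_weyl_group) fact
  obtain R where R: "R > 0" "\<And>x. x \<in> I \<Longrightarrow> \<bar>x\<bar> \<le> R" using \<open>bounded I\<close> by (auto simp: bounded_pos)
  obtain e where e: "shift_expansion m {f \<in> neutral. \<forall>x. \<bar>x\<bar> > R \<longrightarrow> f x = 0} (\<lambda>f. sq_norm m f - sq_norm 0 f) e"
    using energy_difference[OF \<open>m > 0\<close> R(1)] by blast
  define d where "d j = fst (e j)" for j
  define h where "h j = snd (e j)" for j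
  have Vn: "f \<in> neutral" if "f \<in> V" for f using that unfolding V_def by (rule local_neutral)
  have VR: "f x = 0" if "f \<in> V" "\<bar>x\<bar> > R" for f x
    using that R(2)[of x] supp_zero[of x f] by (fastforce simp: V_def local_test_functions_def)
  have h: "h j \<in> neutral" and sums: "f \<in> V \<Longrightarrow> (\<lambda>j. d j * (symp f (h j))\<^sup>2) sums (sq_norm m f - sq_norm 0 f)"
    and abs: "f \<in> V \<Longrightarrow> summable (\<lambda>j. \<bar>d j\<bar> * (symp f (h j))\<^sup>2)"
    and en: "summable (\<lambda>j. \<bar>d j\<bar> * sq_norm 0 (h j))" "summable (\<lambda>j. \<bar>d j\<bar> * sq_norm m (h j))" for j f
    using e Vn VR by (auto simp: shift_expansion_def d_def h_def)
  \<comment> \<open>Positive weights add noise to the massless vacuum, negative weights to the massive one.\<close>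
  define d0 where "d0 j = max (d j) 0" for j
  define dm where "dm j = max (- d j) 0" for j
  have le: "0 \<le> d0 j" "d0 j \<le> \<bar>d j\<bar>" "0 \<le> dm j" "dm j \<le> \<bar>d j\<bar>" "d0 j - dm j = d j" for j
    by (auto simp: d0_def dm_def)
  have "m \<ge> 0" using \<open>m > 0\<close> by simp
  note mix0 = GNS_mixture[OF assms(2,5,6) order_refl h le(1,2) en(1)]
    and mixm = GNS_mixture[OF assms(2,3,4) \<open>m \<ge> 0\<close> h le(3,4) en(2)]
  have agree: "gaussian_mixture.s W \<pi>\<^sub>m \<Omega>\<^sub>m (\<lambda>j x. sqrt (dm j) *\<^sub>R h j x) (W f) =
      gaussian_mixture.s W \<pi>\<^sub>0 \<Omega>\<^sub>0 (\<lambda>j x. sqrt (d0 j) *\<^sub>R h j x) (W f)" if f: "f \<in> V" for f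
  proof -
    note s0 = mix0(2)[OF Vn[OF f] abs[OF f]] and sm = mixm(2)[OF Vn[OF f] abs[OF f]]
    have "(\<Sum>j. d0 j * (symp f (h j))\<^sup>2) - (\<Sum>j. dm j * (symp f (h j))\<^sup>2) = (\<Sum>j. d0 j * (symp f (h j))\<^sup>2 - dm j * (symp f (h j))\<^sup>2)"
      using s0 sm by (intro suminf_diff) auto
    also have "\<dots> = sq_norm m f - sq_norm 0 f"
      using sums_unique[OF sums[OF f]] by (simp only: le(5) left_diff_distrib[symmetric])
    finally have "sq_norm m f + (\<Sum>j. dm j * (symp f (h j))\<^sup>2) = sq_norm 0 f + (\<Sum>j. d0 j * (symp f (h j))\<^sup>2)" by simp
    thus ?thesis using s0 sm by (simp only:)
  qed
  interpret intertwined_systems "\<lambda>f. \<pi>\<^sub>m (W f)" "\<lambda>f. \<pi>\<^sub>0 (W f)" V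
  proof
    have rep: "representation \<pi>\<^sub>m" "representation \<pi>\<^sub>0" using assms by (auto simp: GNS_triple_def)
    have cyc: "closure (range (\<lambda>a. \<pi>\<^sub>m a \<Omega>\<^sub>m)) = UNIV" "closure (range (\<lambda>a. \<pi>\<^sub>0 a \<Omega>\<^sub>0)) = UNIV"
      using assms by (auto simp: GNS_triple_def)
    show "cop (\<pi>\<^sub>m (W f))" "cop (\<pi>\<^sub>0 (W f))" for f by (intro representation_cop rep)+
    show "closure (span (intertwined (intertwiners (\<lambda>f. \<pi>\<^sub>m (W f)) (\<lambda>f. \<pi>\<^sub>0 (W f)) V))) = UNIV"
      by (rule mixtures_intertwined[OF mixm(1) mix0(1) cyc(2) agree])
    show "closure (span (intertwined (intertwiners (\<lambda>f. \<pi>\<^sub>0 (W f)) (\<lambda>f. \<pi>\<^sub>m (W f)) V))) = UNIV"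
      by (rule mixtures_intertwined[OF mix0(1) mixm(1) cyc(1) agree[symmetric]])
    show "\<exists>g\<in>V. \<pi>\<^sub>m (W g) = adj (\<pi>\<^sub>m (W f)) \<and> \<pi>\<^sub>0 (W g) = adj (\<pi>\<^sub>0 (W f))" if f: "f \<in> V" for f
    proof
      have "f \<in> \<D>" using f V_test by auto
      thus "\<pi>\<^sub>m (W (\<lambda>x. - f x)) = adj (\<pi>\<^sub>m (W f)) \<and> \<pi>\<^sub>0 (W (\<lambda>x. - f x)) = adj (\<pi>\<^sub>0 (W f))"
        by (simp flip: weyl_cstar[OF weyl] representation_cstar[OF rep(1)] representation_cstar[OF rep(2)])
    qed (rule V_minus[OF f])
  qed
  show ?thesis
    using vN_isomorphism_of_intertwiners unfolding local_algebra_image V_def by (auto simp: local_test_functions_def)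
qed


end
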